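(* Let $\phi\in\mathcal C^\infty((-\frac12,\frac12),\mathbb R)$ and $G(x',x_3)=e^{2\phi(x_3)}Id_3$, with $G^h=G|_{\Omega^h}$. Suppose $\phi^{(k)}(0)=0$ for $k=1,\dots,n-1$, for some integer $n>2$. Then $\inf\mathcal E^h\le Ch^{2n}$ and $$\liminf_{h\to0}\frac1{h^{2n}}\inf\mathcal E^h\ge c_n\,\phi^{(n)}(0)^2\,|\omega|\,\mathcal Q_2(Id_2)$$ for some constant $c_n>0$ depending only on $n$. In particular, if $\phi^{(n)}(0)\neq0$ then $ch^{2n}\le\inf\mathcal E^h\le Ch^{2n}$ with $c,C>0$.
   Context: $\omega\subset\mathbb R^2$ open, bounded, connected, Lipschitz; $\Omega^h=\omega\times(-h/2,h/2)$. $W:\mathbb R^{3\times3}\to[0,\infty]$ Borel with $W(RF)=W(F)$ for $R\in SO(3)$, $W=0$ on $SO(3)$, $W(F)\ge c\,\mathrm{dist}^2(F,SO(3))$ ($c>0$), $W$ finite and $\mathcal C^2$ near $SO(3)$. $\mathcal E^h(u)=\frac1h\int_{\Omega^h}W(\nabla u\,(G^h)^{-1/2})dx$, infimum over $u\in W^{1,2}(\Omega^h,\mathbb R^3)$. $\mathcal Q_2(F)=\min\{D^2W(Id_3)(\tilde F,\tilde F):\tilde F\in\mathbb R^{3\times3},\tilde F_{2\times2}=F\}$ for $F\in\mathbb R^{2\times2}$, $\tilde F_{2\times2}$ the principal $2\times2$ minor. *)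

theory Defs
  imports "HOL-Analysis.Analysis"
begin

fun Ck_on :: "nat \<Rightarrow> 'a::euclidean_space set \<Rightarrow> ('a \<Rightarrow> real) \<Rightarrow> bool" where
  "Ck_on 0 S f = continuous_on S f"
| "Ck_on (Suc k) S f =
     ((\<forall>x\<in>S. f differentiable (at x)) \<and>
      (\<forall>i\<in>Basis. Ck_on k S (\<lambda>x. frechet_derivative f (at x) i)))"

definition smooth_on :: "'a::euclidean_space set \<Rightarrow> ('a \<Rightarrow> real) \<Rightarrow> bool" where
  "smooth_on S f \<longleftrightarrow> (\<forall>k. Ck_on k S f)"

definition lipschitz_domain :: "(real^2) set \<Rightarrow> bool" where
  "lipschitz_domain \<omega> \<longleftrightarrow> open \<omega> \<and> bounded \<omega> \<and> connected \<omega> \<and> \<omega> \<noteq> {} \<and>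
     (\<forall>p\<in>frontier \<omega>. \<exists>(R::real^2^2) a b L (g::real \<Rightarrow> real).
        orthogonal_matrix R \<and> a > 0 \<and> b > 0 \<and> L-lipschitz_on UNIV g \<and> g 0 = 0 \<and> L * a < b \<and>
        (let cyl = {x. \<bar>(R *v (x - p)) $ 1\<bar> < a \<and> \<bar>(R *v (x - p)) $ 2\<bar> < b} in
           \<omega> \<inter> cyl = {x \<in> cyl. (R *v (x - p)) $ 2 > g ((R *v (x - p)) $ 1)}))"

definition SO3 :: "(real^3^3) set" where
  "SO3 = {R. orthogonal_matrix R \<and> det R = 1}"

definition Wreal :: "(real^3^3 \<Rightarrow> ennreal) \<Rightarrow> real^3^3 \<Rightarrow> real" where
  "Wreal W F = enn2real (W F)"

definition admissible_density :: "(real^3^3 \<Rightarrow> ennreal) \<Rightarrow> bool" where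
  "admissible_density W \<longleftrightarrow>
     W \<in> borel_measurable borel \<and>
     (\<forall>R\<in>SO3. \<forall>F. W (R ** F) = W F) \<and>
     (\<forall>R\<in>SO3. W R = 0) \<and>
     (\<exists>c>0. \<forall>F. W F \<ge> ennreal (c * (infdist F SO3)\<^sup>2)) \<and>
     (\<exists>U. open U \<and> SO3 \<subseteq> U \<and> (\<forall>F\<in>U. W F \<noteq> \<infinity>) \<and> Ck_on 2 U (Wreal W))"

definition D2W :: "(real^3^3 \<Rightarrow> ennreal) \<Rightarrow> real^3^3 \<Rightarrow> real^3^3 \<Rightarrow> real^3^3 \<Rightarrow> real" where
  "D2W W A F1 F2 = frechet_derivative (\<lambda>X. frechet_derivative (Wreal W) (at X) F1) (at A) F2"

definition minor22 :: "real^3^3 \<Rightarrow> real^2^2" where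
  "minor22 F = (\<chi> i j. F $ (if i = 1 then 1 else 2) $ (if j = 1 then 1 else 2))"

definition Q2 :: "(real^3^3 \<Rightarrow> ennreal) \<Rightarrow> real^2^2 \<Rightarrow> real" where
  "Q2 W F = Inf {D2W W (mat 1) Ft Ft | Ft. minor22 Ft = F}"

definition Omega :: "(real^2) set \<Rightarrow> real \<Rightarrow> (real^3) set" where
  "Omega \<omega> h = {x. vector [x $ 1, x $ 2] \<in> \<omega> \<and> \<bar>x $ 3\<bar> < h / 2}"

definition metricG :: "(real \<Rightarrow> real) \<Rightarrow> real^3 \<Rightarrow> real^3^3" where
  "metricG \<phi> x = exp (2 * \<phi> (x $ 3)) *\<^sub>R mat 1"

definition pos_def :: "real^3^3 \<Rightarrow> bool" where
  "pos_def S \<longleftrightarrow> transpose S = S \<and> (\<forall>v. v \<noteq> 0 \<longrightarrow> v \<bullet> (S *v v) > 0)"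

definition inv_sqrt :: "real^3^3 \<Rightarrow> real^3^3" where
  "inv_sqrt G = (THE S. pos_def S \<and> S ** S = matrix_inv G)"

definition test_fn :: "(real^3) set \<Rightarrow> (real^3 \<Rightarrow> real) \<Rightarrow> bool" where
  "test_fn \<Omega> \<psi> \<longleftrightarrow> smooth_on UNIV \<psi> \<and> compact (closure {x. \<psi> x \<noteq> 0}) \<and>
     closure {x. \<psi> x \<noteq> 0} \<subseteq> \<Omega>"

text \<open>u in W^{1,2}(Omega, R^3) with weak gradient Du, (Du x) $ i $ j = d_j u_i.\<close>
definition sobolev12 :: "(real^3) set \<Rightarrow> (real^3 \<Rightarrow> real^3) \<Rightarrow> (real^3 \<Rightarrow> real^3^3) \<Rightarrow> bool" where
  "sobolev12 \<Omega> u Du \<longleftrightarrow>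
     u \<in> borel_measurable (lebesgue_on \<Omega>) \<and> Du \<in> borel_measurable (lebesgue_on \<Omega>) \<and>
     (\<forall>i. integrable (lebesgue_on \<Omega>) (\<lambda>x. (u x $ i)\<^sup>2)) \<and>
     (\<forall>i j. integrable (lebesgue_on \<Omega>) (\<lambda>x. (Du x $ i $ j)\<^sup>2)) \<and>
     (\<forall>\<psi> i j. test_fn \<Omega> \<psi> \<longrightarrow>
        (\<integral>x. u x $ i * frechet_derivative \<psi> (at x) (axis j 1) \<partial>(lebesgue_on \<Omega>))
        = - (\<integral>x. Du x $ i $ j * \<psi> x \<partial>(lebesgue_on \<Omega>)))"

definition energy :: "(real^3^3 \<Rightarrow> ennreal) \<Rightarrow> (real \<Rightarrow> real) \<Rightarrow> (real^2) set \<Rightarrow> real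
    \<Rightarrow> (real^3 \<Rightarrow> real^3^3) \<Rightarrow> ennreal" where
  "energy W \<phi> \<omega> h Du = ennreal (1 / h) *
     (\<integral>\<^sup>+ x\<in>Omega \<omega> h. W (Du x ** inv_sqrt (metricG \<phi> x)) \<partial>lebesgue)"

definition inf_energy :: "(real^3^3 \<Rightarrow> ennreal) \<Rightarrow> (real \<Rightarrow> real) \<Rightarrow> (real^2) set \<Rightarrow> real \<Rightarrow> ennreal" where
  "inf_energy W \<phi> \<omega> h = (INF (u, Du) \<in> {(u, Du). sobolev12 (Omega \<omega> h) u Du}. energy W \<phi> \<omega> h Du)"

end

theory Submission
  imports Defs "HOL-Computational_Algebra.Polynomial"
begin

text \<open>
The upper bound is the energy of the dilation \<open>u x = exp (\<phi> 0) x\<close>.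

For the lower bound, tile a compact part of \<open>\<Omega>\<close> by boxes of width comparable to \<open>h\<close>, rescale each box
to unit height and put \<open>\<epsilon> = h ^ n\<close>. Either the energy of a box already exceeds a multiple of \<open>\<epsilon>\<^sup>2\<close>,
or a quantitative rigidity estimate in the interior of the box gives a rotation \<open>R\<close> with
\<open>\<nabla>u = R + O(\<epsilon>)\<close> in \<open>L\<^sup>2\<close>. In the latter case test the strain against a symmetric divergence free
stress supported in the box: it annihilates gradients, so only the incompatible part
\<open>\<phi>\<^sup>(\<^sup>n\<^sup>)(0) x\<^sub>3 ^ n / n!\<close> of the metric contributes, and by duality with the quadratic form \<open>D\<^sup>2 W(Id)\<close>
this bounds the energy of the box from below. Boxes that are wide compared with their height make the
constant proportional to \<open>Q\<^sub>2(Id)\<close>.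

The rigidity estimate is proved for \<open>C\<^sup>1\<close> maps by hand: cofactors are divergence free, so \<open>F - cof F\<close>, which
is controlled by the distance to the rotations, bounds the oscillation of \<open>F\<close>; maps with unbounded
gradient are first truncated by mollification at a variable scale.
\<close>

text \<open>The constant may depend on \<open>n\<close> alone, so \<open>W\<close> may enter only
  through \<open>Q2\<close>. This dictates the dual stress: if \<open>M\<close> minimizes the form
  among matrices whose in-plane block is the identity, pairing with \<open>M\<close> sees only the
  in-plane block of a strain, has trace \<open>Q2\<close>, and costs \<open>Q2\<close> by
  Cauchy-Schwarz. Cut off to compact support, it forces transverse entries with in-plane
  derivatives, of size \<open>1 / l\<close> on a cell of width \<open>l\<close>. These are paid by
  the coercivity constant of \<open>W\<close>, and \<open>l\<close> is taken so large that the
  payment is negligible. The width then depends on \<open>W\<close>, the energy gained per area does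
  not. The constants of rigidity and Taylor expansion only decide how small \<open>h\<close> has to
  be. Rigidity is needed at the linear rate: the Taylor remainder is a small multiple of the squared
  deviation from one rotation, and it must stay below \<epsilon> squared. The hand-made argument
  reaches this rate in two rounds, first the square root of \<epsilon>, then \<epsilon>. The cutoff
  across the thickness sits on one side of the midplane, since a symmetric one would annihilate the
  moment of an odd power.\<close>

abbreviation nnI :: "('a::euclidean_space => ennreal) => ennreal" where "nnI f \<equiv> integral\<^sup>N lborel f"

section \<open>Mollification of continuously differentiable functions\<close>

text \<open>Carrying the gradient as a second argument turns computations with derivatives into
  computations with continuous vector fields, to which integration over boxes applies
  directly.\<close>

definition grad1 :: "(real^3 => real) => (real^3 => real^3) => bool" where
 "grad1 f g \<longleftrightarrow> continuous_on UNIV g \<and> (\<forall>x. (f has_derivative (%h. g x \<bullet> h)) (at x))"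

lemma grad1_D: "grad1 f g ==> (f has_derivative (%h. g x \<bullet> h)) (at x)"
 and grad1_cont_grad: "grad1 f g ==> continuous_on UNIV g"
 by (auto simp: grad1_def)

lemma grad1_cont: "grad1 f g ==> continuous_on UNIV f"
 unfolding grad1_def
 by (metis continuous_at_imp_continuous_on has_derivative_continuous)

lemma continuous_on_UNIV_comp:
 assumes "continuous_on UNIV f" "continuous_on S g"
 shows "continuous_on S (%x. f (g x))"
 using continuous_on_compose2[OF assms] by auto

lemma grad1_const: "grad1 (%x. c) (%x. 0)"
 by (auto simp: grad1_def)

lemma grad1_add: "grad1 f f' ==> grad1 g g' ==> grad1 (%x. f x + g x) (%x. f' x + g' x)"
 unfolding grad1_def
 by (auto intro!: continuous_intros derivative_eq_intros simp: inner_simps)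

lemma grad1_diff: "grad1 f f' ==> grad1 g g' ==> grad1 (%x. f x - g x) (%x. f' x - g' x)"
 unfolding grad1_def
 by (auto intro!: continuous_intros derivative_eq_intros simp: inner_simps)

lemma grad1_cmult: "grad1 f f' ==> grad1 (%x. c*f x) (%x. c*\<^sub>R f' x)"
 unfolding grad1_def
 by (auto intro!: continuous_intros derivative_eq_intros simp: inner_simps)

lemma grad1_mult:
 assumes "grad1 f f'" "grad1 g g'"
 shows "grad1 (%x. f x*g x) (%x. f x*\<^sub>R g' x + g x*\<^sub>R f' x)"
 using assms grad1_cont[OF assms(1)] grad1_cont[OF assms(2)]
 unfolding grad1_def
 by (auto intro!: continuous_intros derivative_eq_intros simp: inner_simps algebra_simps)

lemma grad1_affine:
 assumes "grad1 f g"
 shows "grad1 (%x. f (c + r*\<^sub>R x)) (%x. r*\<^sub>R g (c + r*\<^sub>R x))"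
 unfolding grad1_def
proof (intro conjI allI)
 show "continuous_on UNIV (%x. r*\<^sub>R g (c + r*\<^sub>R x))"
  by (intro continuous_intros continuous_on_UNIV_comp[OF grad1_cont_grad[OF assms]])
 fix x
 have "((%x. f (c + r*\<^sub>R x)) has_derivative (%h. g (c + r*\<^sub>R x) \<bullet> (r*\<^sub>R h))) (at x)"
  by (rule has_derivative_compose[OF _ grad1_D[OF assms], of "%x. c + r*\<^sub>R x" "%h. r*\<^sub>R h"])
   (auto intro!: derivative_eq_intros)
 then show "((%x. f (c + r*\<^sub>R x)) has_derivative (%h. (r*\<^sub>R g (c + r*\<^sub>R x)) \<bullet> h)) (at x)"
  by simp
qed

lemma grad1_sum:
 assumes "!!i. i \<in> I ==> grad1 (f i) (g i)"
 shows "grad1 (%x. \<Sum>i\<in>I. f i x) (%x. \<Sum>i\<in>I. g i x)"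
 using assms
 by (induction I rule: infinite_finite_induct) (auto intro: grad1_add grad1_const)

lemma grad1_real_comp:
 assumes "grad1 f g" "!!s. (p has_real_derivative p' s) (at s)" "continuous_on UNIV p'"
 shows "grad1 (%x. p (f x)) (%x. p' (f x)*\<^sub>R g x)"
 unfolding grad1_def
proof (intro conjI allI)
 show "continuous_on UNIV (%x. p' (f x)*\<^sub>R g x)"
  by (intro continuous_intros grad1_cont_grad[OF assms(1)]
    continuous_on_UNIV_comp[OF assms(3)] grad1_cont[OF assms(1)])
 fix x
 have "(p has_derivative (%h. p' (f x)*h)) (at (f x))"
  using assms(2) by (simp add: has_field_derivative_def)
 from has_derivative_compose[OF grad1_D[OF assms(1)] this]
 show "((%x. p (f x)) has_derivative (%h. (p' (f x)*\<^sub>R g x) \<bullet> h)) (at x)"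
  by simp
qed

lemma grad1_coord: "grad1 (%x. x $ i) (%x. axis i 1)"
proof -
 have "((%x. axis i 1 \<bullet> x) has_derivative (%h. axis i 1 \<bullet> h)) (at x)" for x :: "real^3"
  by (intro derivative_intros)
 then show ?thesis
  by (auto simp: grad1_def inner_axis')
qed

lemma grad1_cong:
 assumes "grad1 f g" "!!x. f x = f' x" "!!x. g x = g' x"
 shows "grad1 f' g'"
proof -
 have "f' = f" "g' = g" using assms by auto
 with assms(1) show ?thesis by simp
qed

text \<open>Boundary points of the box are limits of points outside it, so vanishing of
  \<open>f\<close>, and then of \<open>g\<close>, extends to them by continuity. Integrals can then
  be moved between closed boxes without boundary terms.\<close>

lemma grad1_zero_outside:
 assumes "grad1 f g" and z: "!!x. x \<notin> cbox a b ==> f x = 0" and x: "x \<notin> box a b"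
 shows "f x = 0" "g x = 0"
proof -
 define U where "U = - cbox a b"
 have fz: "f x = 0" if "x \<notin> box a b" for x
 proof (cases "x \<in> cbox a b")
  case True
  then have fr: "x \<in> frontier (cbox a b)" using that
   by (simp add: frontier_cbox)
  then have "x \<in> closure (- cbox a b)"
   using frontier_closures by blast
  then obtain s where s: "!!n::nat. s n \<in> - cbox a b" "s \<longlonglongrightarrow> x"
   unfolding closure_sequential by blast
  have "isCont f x"
   using grad1_D[OF assms(1)] has_derivative_continuous by blast
  then have "(%n. f (s n)) \<longlonglongrightarrow> f x"
   using s(2) isCont_tendsto_compose by blast
  moreover have "(%n. f (s n)) = (%n. 0)" using s(1) z by auto
  ultimately show ?thesis using LIMSEQ_unique tendsto_const by metis
 qed (use z in auto)
 show "f x = 0" by (rule fz[OF x])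
 have gz: "g y = 0" if "y \<in> - cbox a b" for y
 proof -
  have "((%x. 0) has_derivative (%h. g y \<bullet> h)) (at y)"
   using has_derivative_transform_within_open[OF grad1_D[OF assms(1)], of "- cbox a b" y "%x. 0"]
    that z by (simp add: open_Compl closed_cbox)
  then have "(%h. g y \<bullet> h) = (%h. 0)"
   using has_derivative_unique[of "%x. 0" "(%h. g y \<bullet> h)" y "%h. 0"] by auto
  then have "g y \<bullet> g y = 0" by metis
  then show ?thesis by simp
 qed
 show "g x = 0"
 proof (cases "x \<in> cbox a b")
  case True
  then have "x \<in> closure (- cbox a b)" using x frontier_closures frontier_cbox by blast
  then obtain s where s: "!!n::nat. s n \<in> - cbox a b" "s \<longlonglongrightarrow> x"
   unfolding closure_sequential by blast
  have "isCont g x"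
   using grad1_cont_grad[OF assms(1)] by (simp add: continuous_on_eq_continuous_at)
  then have "(%n. g (s n)) \<longlonglongrightarrow> g x"
   using s(2) isCont_tendsto_compose by blast
  moreover have "(%n. g (s n)) = (%n. 0)" using s(1) gz by auto
  ultimately show ?thesis using LIMSEQ_unique tendsto_const by metis
 qed (use gz in auto)
qed

lemma integral_superset_zero:
 fixes f :: "'a::euclidean_space => 'b::euclidean_space"
 assumes "continuous_on (cbox a b) f" "!!x. x \<notin> cbox a b ==> f x = 0" "cbox a b \<subseteq> T"
 shows "integral T f = integral (cbox a b) f"
 using has_integral_on_superset[OF integrable_integral[OF integrable_continuous[OF assms(1)]]
   assms(2,3)] by (simp add: integral_unique)

lemma integral_shift_support:
 fixes f :: "real^3 => 'b::euclidean_space"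
 assumes "continuous_on UNIV f" "!!x. x \<notin> cbox a b ==> f x = 0"
  "cbox a b \<subseteq> cbox a' b'" "cbox a b \<subseteq> cbox (a' + c) (b' + c)"
 shows "integral (cbox a' b') (%x. f (x + c)) = integral (cbox a' b') f"
proof -
 have c: "continuous_on (cbox a b) f" using assms(1) continuous_on_subset by blast
 have "integral (cbox a' b') (%x. f (x + c)) = integral (cbox (a' + c) (b' + c)) f"
  using integral_shift_cbox_plus[of a' b' f c] by (simp add: o_def add.commute)
 also have "... = integral (cbox a b) f"
  by (rule integral_superset_zero[OF c assms(2,4)])
 also have "... = integral (cbox a' b') f"
  by (rule integral_superset_zero[OF c assms(2,3), symmetric])
 finally show ?thesis .
qed

lemma grad1_integral:
 fixes f :: "real^3 => real^3 => real"
 assumes der: "!!x t. t \<in> cbox a b ==> ((%x. f x t) has_derivative (%h. g x t \<bullet> h)) (at x)"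
  and cf: "!!x. continuous_on (cbox a b) (f x)"
  and cg: "continuous_on (UNIV \<times> cbox a b) (%(x,t). g x t)"
 shows "grad1 (%x. integral (cbox a b) (f x)) (%x. integral (cbox a b) (g x))"
 unfolding grad1_def
proof (intro conjI allI)
 show "continuous_on UNIV (%x. integral (cbox a b) (g x))"
  by (rule integral_continuous_on_param[OF cg])
 fix x
 have cgx: "continuous_on (cbox a b) (g x)"
 proof -
  have "continuous_on (cbox a b) (%t. (%(x,t). g x t) (x,t))"
   by (rule continuous_on_compose2[OF cg]) (auto intro!: continuous_intros)
  then show ?thesis by simp
 qed
 have "((%x. integral (cbox a b) (f x)) has_derivative
   blinfun_apply (integral (cbox a b) (%t. blinfun_inner_right (g x t)))) (at x within UNIV)"
 proof (rule leibniz_rule)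
  show "continuous_on (UNIV \<times> cbox a b) (%(x, t). blinfun_inner_right (g x t))"
   unfolding split_beta
   by (intro bounded_linear.continuous_on[OF bounded_linear_blinfun_inner_right])
    (use cg in \<open>simp add: split_beta\<close>)
 qed (use der cf in \<open>auto intro!: integrable_continuous\<close>)
 moreover have "blinfun_apply (integral (cbox a b) (%t. blinfun_inner_right (g x t))) h
   = integral (cbox a b) (g x) \<bullet> h" for h
 proof -
  have i: "(%t. blinfun_inner_right (g x t)) integrable_on cbox a b"
   by (intro integrable_continuous bounded_linear.continuous_on[OF bounded_linear_blinfun_inner_right] cgx)
  have "blinfun_apply (integral (cbox a b) (%t. blinfun_inner_right (g x t))) h
   = integral (cbox a b) (%t. g x t \<bullet> h)"
   using blinfun_apply_integral[OF i] by simp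
  also have "... = integral (cbox a b) (g x) \<bullet> h"
   using integral_linear[OF integrable_continuous[OF cgx], of "%y. y \<bullet> h"]
   by (simp add: o_def bounded_linear_inner_left)
  finally show ?thesis .
 qed
 then have "blinfun_apply (integral (cbox a b) (%t. blinfun_inner_right (g x t)))
   = (%h. integral (cbox a b) (g x) \<bullet> h)" by (rule ext)
 ultimately show "((%x. integral (cbox a b) (f x)) has_derivative (%h. integral (cbox a b) (g x) \<bullet> h)) (at x)"
  by simp
qed

lemma cbox_mono_cart:
 fixes a b :: "real^3"
 assumes "!!i. c $ i <= a $ i" "!!i. b $ i <= d $ i"
 shows "cbox a b \<subseteq> cbox c d"
 unfolding subset_iff mem_box_cart by (meson assms order_trans)

lemma cbox_cart_nonempty_margin:
 fixes a b :: "real^3"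
 shows "cbox a b \<subseteq> cbox (a - 1) (b + 1)"
 by (rule cbox_mono_cart) auto

text \<open>The divergence theorem for compact support, from translation invariance: the integral of
  \<open>f (x + t)\<close> does not depend on small \<open>t\<close>, so its derivative at
  \<open>t = 0\<close>, which is the integral of the gradient, is zero.\<close>

lemma integral_grad_zero:
 assumes "grad1 f g" and z: "!!x. x \<notin> cbox a b ==> f x = 0"
 shows "integral (cbox a b) (%x. g x $ j) = 0"
proof -
 \<comment> \<open>The margin 1 keeps the support inside for all shifts \<open>t\<close> in the open
   unit box.\<close>
 let ?P = "cbox (a - 1) (b + 1)"
 have cf: "continuous_on UNIV f" by (rule grad1_cont[OF assms(1)])
 have cg: "continuous_on UNIV g" by (rule grad1_cont_grad[OF assms(1)])
 have gr: "grad1 (%t. integral ?P (%x. f (x + t))) (%t. integral ?P (%x. g (x + t)))"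
 proof (rule grad1_integral)
  fix x t :: "real^3"
  have "grad1 (%x. f (t + 1*\<^sub>R x)) (%x. 1*\<^sub>R g (t + 1*\<^sub>R x))"
   by (rule grad1_affine[OF assms(1)])
  from grad1_D[OF this, of x]
  show "((%x. f (t + x)) has_derivative (%h. g (t + x) \<bullet> h)) (at x)" by simp
 qed (auto intro!: continuous_intros continuous_on_UNIV_comp[OF cf] continuous_on_UNIV_comp[OF cg] simp: split_beta)
 have const: "integral ?P (%x. f (x + t)) = integral ?P f" if "t \<in> box (-1) 1" for t
 proof (rule integral_shift_support[OF cf z])
  have t: "-1 < t $ i \<and> t $ i < 1" for i using that by (simp add: mem_box_cart)
  show "cbox a b \<subseteq> cbox (a - 1 + t) (b + 1 + t)"
  proof (rule cbox_mono_cart)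
   fix i show "(a - 1 + t) $ i <= a $ i" "b $ i <= (b + 1 + t) $ i" using t[of i] by auto
  qed
 qed (use cbox_cart_nonempty_margin in auto)
 have "((%t. integral ?P f) has_derivative (%h. integral ?P (%x. g (x + 0)) \<bullet> h)) (at 0)"
  by (rule has_derivative_transform_within_open[OF grad1_D[OF gr], of "box (-1) 1"])
   (use const in \<open>auto simp: mem_box_cart\<close>)
 then have "(%h. integral ?P g \<bullet> h) = (%h. 0)"
  using has_derivative_unique[of "%t. integral ?P f" _ 0 "%h. 0"] by auto
 then have "integral ?P g \<bullet> axis j 1 = 0" by metis
 moreover have "integral ?P g = integral (cbox a b) g"
 proof (rule integral_superset_zero)
  fix x assume "x \<notin> cbox a b"
  then have "x \<notin> box a b" using box_subset_cbox by blast
  with grad1_zero_outside(2)[OF assms(1) z] show "g x = 0" by simp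
 qed (use cg cbox_cart_nonempty_margin in \<open>auto intro: continuous_on_subset\<close>)
 moreover have "integral (cbox a b) g \<bullet> axis j 1 = integral (cbox a b) (%x. g x $ j)"
  using integral_linear[OF integrable_continuous[OF continuous_on_subset[OF cg]], of a b "%y. y \<bullet> axis j 1"]
  by (simp add: o_def bounded_linear_vec_nth inner_axis)
 ultimately show ?thesis by simp
qed

lemma integral_by_parts:
 assumes "grad1 f f'" "grad1 z z'" and z: "!!x. x \<notin> cbox a b ==> z x = 0"
 shows "integral (cbox a b) (%x. f' x $ j*z x) = - integral (cbox a b) (%x. f x*z' x $ j)"
proof -
 have "integral (cbox a b) (%x. (f x*\<^sub>R z' x + z x*\<^sub>R f' x) $ j) = 0"
  by (rule integral_grad_zero[OF grad1_mult[OF assms(1,2)]]) (use z in auto)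
 moreover have "integral (cbox a b) (%x. f x*z' x $ j + f' x $ j*z x)
  = integral (cbox a b) (%x. f x*z' x $ j) + integral (cbox a b) (%x. f' x $ j*z x)"
  using grad1_cont[OF assms(1)] grad1_cont[OF assms(2)] grad1_cont_grad[OF assms(1)] grad1_cont_grad[OF assms(2)]
  by (intro integral_add integrable_continuous continuous_intros)
   (auto intro: continuous_on_subset)
 ultimately show ?thesis by (simp add: mult.commute)
qed

lemma pospow_deriv:
 "((%s::real. max 0 s^Suc (Suc n)) has_real_derivative real (n + 2)*max 0 s^Suc n) (at s)"
proof -
 consider "s < 0" | "s > 0" | "s = 0" by linarith
 then show ?thesis
 proof cases
  case 1
  have "((%s::real. 0) has_real_derivative 0) (at s)" by simp
  then have "((%s::real. max 0 s^Suc (Suc n)) has_real_derivative 0) (at s)"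
   by (rule DERIV_cong_ev[THEN iffD1, rotated -1])
    (use 1 in \<open>auto intro!: eventually_mono[OF eventually_nhds_in_open[of "{..<0}"]]\<close>)
  then show ?thesis using 1 by simp
 next
  case 2
  have "((%s::real. s^Suc (Suc n)) has_real_derivative real (n + 2) * s^Suc n) (at s)"
   using DERIV_pow[of "Suc (Suc n)" s] by simp
  then have "((%s::real. max 0 s^Suc (Suc n)) has_real_derivative real (n + 2) * s^Suc n) (at s)"
   by (rule DERIV_cong_ev[THEN iffD1, rotated -1])
    (use 2 in \<open>auto intro!: eventually_mono[OF eventually_nhds_in_open[of "{0<..}"]]\<close>)
  then show ?thesis using 2 by simp
 next
  case 3
  have l: "((%h::real. \<bar>h\<bar> ^ Suc n) \<longlongrightarrow> 0) (at 0)"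
   by (auto intro!: tendsto_eq_intros)
  have "((%h::real. max 0 h^Suc (Suc n)/h) \<longlongrightarrow> 0) (at 0)"
  proof (rule Lim_null_comparison[OF _ l], rule eventuallyI)
   fix h :: real
   show "norm (max 0 h^Suc (Suc n)/h) <= \<bar>h\<bar> ^ Suc n"
    by (cases "h > 0") (auto simp: max_def mult_nonpos_nonneg)
  qed
  then show ?thesis using 3 by (simp add: DERIV_def)
 qed
qed

lemma grad1_normsq: "grad1 (%y. 1 - y \<bullet> y) (%y. - 2*\<^sub>R y)"
 unfolding grad1_def
 by (auto intro!: continuous_intros derivative_eq_intros simp: inner_commute)

lemma grad1_pospow:
 "grad1 (%y. max 0 (1 - y \<bullet> y)^Suc (Suc n)) (%y. (- 2*real (n + 2)*max 0 (1 - y \<bullet> y)^Suc n)*\<^sub>R y)"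
proof -
 have "continuous_on UNIV (%s. real (n + 2)*max 0 s^Suc n)" by (intro continuous_intros)
 from grad1_real_comp[OF grad1_normsq pospow_deriv this]
 show ?thesis by (rule grad1_cong) (auto simp: algebra_simps)
qed

section \<open>The mollifying kernel and its potential\<close>

abbreviation B1 :: "(real^3) set" where "B1 \<equiv> cbox (-1) 1"

definition kmass :: real where "kmass = integral B1 (%y. max 0 (1 - y \<bullet> y)^3)"

text \<open>The third power gives two continuous derivatives and a gradient whose square is
  dominated by the kernel itself (\<open>dker_sq_le\<close>).\<close>

definition ker :: "real^3 => real" where "ker y = max 0 (1 - y \<bullet> y)^3/kmass"

definition dker :: "real^3 => real^3" where "dker y = (- 6*max 0 (1 - y \<bullet> y)^2/kmass)*\<^sub>R y"

text \<open>A potential for the first moment density: its gradient is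
  \<open>- ker y *\<^sub>R y\<close>. Divergence free fields can therefore be tested against
  \<open>ker y *\<^sub>R y\<close>.\<close>

definition kpot :: "real^3 => real" where "kpot y = max 0 (1 - y \<bullet> y)^4/(8 * kmass)"

lemma outside_B1: "y \<notin> B1 ==> 1 - y \<bullet> y <= 0"
proof -
 assume "y \<notin> B1"
 then obtain i where "\<not> (-1 <= y $ i \<and> y $ i <= 1)" by (auto simp: mem_box_cart)
 then have "\<bar>y $ i\<bar> > 1" by linarith
 then have "1 < norm y" using component_le_norm_cart[of y i] by linarith
 then show ?thesis by (simp add: dot_square_norm)
qed

lemma kmass_pos: "kmass > 0"
proof -
 let ?f = "%y::real^3. max 0 (1 - y \<bullet> y)^3"
 have c: "continuous_on B1 ?f" by (intro continuous_intros)
 have "kmass \<noteq> 0"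
 proof
  assume "kmass = 0"
  then have "(?f has_integral 0) B1"
   using integrable_integral[OF integrable_continuous[OF c]] by (simp add: kmass_def)
  then have "?f 0 = 0"
   by (intro has_integral_0_cbox_imp_0[OF c]) (auto simp: mem_box_cart interval_ne_empty_cart)
  then show False by simp
 qed
 moreover have "kmass \<ge> 0" unfolding kmass_def by (intro integral_nonneg integrable_continuous c) auto
 ultimately show ?thesis by simp
qed

lemma grad1_ker: "grad1 ker dker"
 using grad1_cmult[OF grad1_pospow[of 1], of "1/kmass"]
 by (rule grad1_cong) (auto simp: ker_def dker_def numeral_eq_Suc)

lemma grad1_kpot: "grad1 kpot (%y. - ker y*\<^sub>R y)"
 using grad1_cmult[OF grad1_pospow[of 2], of "1/(8*kmass)"]
 by (rule grad1_cong) (auto simp: ker_def kpot_def numeral_eq_Suc)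

lemma ker_nonneg: "ker y \<ge> 0" using kmass_pos by (simp add: ker_def)

lemma ker_outside: "y \<notin> B1 ==> ker y = 0" "y \<notin> B1 ==> dker y = 0" "y \<notin> B1 ==> kpot y = 0"
 using outside_B1[of y] by (auto simp: ker_def dker_def kpot_def max_absorb1)

lemma ker_le: "ker y <= 1/kmass"
proof -
 have "max 0 (1 - y \<bullet> y) <= 1" by simp
 then have "max 0 (1 - y \<bullet> y)^3 <= 1^3" by (intro power_mono) auto
 then show ?thesis using kmass_pos by (simp add: ker_def divide_right_mono)
qed

text \<open>The gradient keeps a factor \<open>m^2\<close> with
  \<open>m = max 0 (1 - y \<bullet> y)\<close>, so its square has \<open>m^4\<close>, which is below
  the \<open>m^3\<close> of the kernel. It is the reason why squared derivatives of a mollified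
  function are bounded by mollified squares.\<close>

lemma dker_sq_le: "(norm (dker y))^2 <= 36/kmass * ker y"
proof -
 let ?m = "max 0 (1 - y \<bullet> y)"
 have m: "0 <= ?m" "?m <= 1" by auto
 have "?m^4*(norm y)^2 <= ?m^3"
 proof (cases "1 - y \<bullet> y <= 0")
  case False
  then have "(norm y)^2 <= 1" by (simp add: dot_square_norm)
  have "?m^4 <= ?m^3" using m by (intro power_decreasing) auto
  then have "?m^4*(norm y)^2 <= ?m^3*1" using \<open>(norm y)\<^sup>2 <= 1\<close> m
   by (intro mult_mono) auto
  then show ?thesis by simp
 qed simp
 then have "36*(?m^4*(norm y)^2)/kmass^2 <= 36 * ?m^3/kmass^2"
  by (intro divide_right_mono) auto
 moreover have "(norm (dker y))^2 = (- 6 * ?m^2/kmass)^2*(norm y)^2"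
  unfolding dker_def norm_scaleR power_mult_distrib by (simp only: real_norm_def power2_abs)
 moreover have "(- 6 * ?m^2/kmass)^2 = 36 * ?m^4/kmass^2"
  by (simp add: power_divide power_mult_distrib flip: power_mult)
 moreover have "36 * ?m^3/kmass^2 = 36/kmass * ker y"
  by (simp add: ker_def power2_eq_square)
 ultimately show ?thesis by simp
qed

lemma cont_ker: "continuous_on S ker" "continuous_on S dker" "continuous_on S kpot"
 using grad1_cont[OF grad1_ker] grad1_cont_grad[OF grad1_ker] grad1_cont[OF grad1_kpot]
 by (auto intro: continuous_on_subset)

lemma integral_ker: "integral B1 ker = 1"
 using kmass_pos unfolding ker_def
 by (simp add: integral_divide kmass_def[symmetric])

lemma integral_dker: "integral B1 (%y. dker y $ j) = 0"
 by (rule integral_grad_zero[OF grad1_ker]) (simp add: ker_outside)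

lemma integral_ker_first_moment: "integral B1 (%y. ker y*y $ j) = 0"
 using integral_grad_zero[OF grad1_kpot, of "-1" 1 j] by (simp add: ker_outside)

section \<open>Mollification at a fixed scale\<close>

definition mol :: "real => (real^3 => 'b::euclidean_space) => real^3 => 'b" where
 "mol r f x = integral B1 (%y. ker y*\<^sub>R f (x + r*\<^sub>R y))"

lemma cont_param:
 fixes f :: "real^3 => 'b::euclidean_space"
 assumes "continuous_on UNIV f" "continuous_on S p"
 shows "continuous_on S (%x. f (p x))"
 by (rule continuous_on_UNIV_comp[OF assms])

lemma mol_cont:
 fixes f :: "real^3 => 'b::euclidean_space"
 assumes "continuous_on UNIV f"
 shows "continuous_on S (mol r f)"
proof -
 have "continuous_on UNIV (%x. integral B1 (%y. ker y*\<^sub>R f (x + r*\<^sub>R y)))"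
  unfolding split_beta
  by (intro integral_continuous_on_param)
   (auto simp: split_beta intro!: continuous_intros cont_param[OF assms] continuous_on_UNIV_comp[OF cont_ker(1)])
 then show ?thesis unfolding mol_def using continuous_on_subset by blast
qed

lemma mol_integrable:
 fixes f :: "real^3 => 'b::euclidean_space"
 assumes "continuous_on UNIV f"
 shows "(%y. ker y*\<^sub>R f (x + r*\<^sub>R y)) integrable_on B1"
 by (intro integrable_continuous continuous_intros cont_param[OF assms] cont_ker)

lemma mol_linear:
 fixes f :: "real^3 => 'b::euclidean_space" and L :: "'b => 'c::euclidean_space"
 assumes "continuous_on UNIV f" "bounded_linear L"
 shows "L (mol r f x) = mol r (%x. L (f x)) x"
 using integral_linear[OF mol_integrable[OF assms(1)] assms(2), of x r] linear_cmul[OF bounded_linear.linear[OF assms(2)]]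
 by (simp add: mol_def o_def)

lemma mol_diff:
 fixes f :: "real^3 => 'b::euclidean_space"
 assumes "continuous_on UNIV f" "continuous_on UNIV g"
 shows "mol r (%x. f x - g x) x = mol r f x - mol r g x"
 using integral_diff[OF mol_integrable[OF assms(1)] mol_integrable[OF assms(2)]]
 by (simp add: mol_def scaleR_diff_right)

lemma mol_const: "mol r (%x. c) x = c"
proof -
 have "(ker has_integral 1) B1"
  using integral_ker integrable_integral[OF integrable_continuous[OF cont_ker(1), of "-1" 1]] by simp
 from has_integral_scaleR_left[OF this, of c] show ?thesis by (simp add: mol_def integral_unique)
qed

lemma mol_mono:
 fixes f g :: "real^3 => real"
 assumes "continuous_on UNIV f" "continuous_on UNIV g" "!!y. y \<in> B1 ==> f (x + r*\<^sub>R y) <= g (x + r*\<^sub>R y)"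
 shows "mol r f x <= mol r g x"
 unfolding mol_def
 by (rule integral_le[OF mol_integrable[OF assms(1)] mol_integrable[OF assms(2)]])
  (auto intro!: mult_left_mono assms ker_nonneg)

lemma mol_norm_le:
 fixes f :: "real^3 => 'b::euclidean_space"
 assumes "continuous_on UNIV f"
 shows "norm (mol r f x) <= mol r (%x. norm (f x)) x"
 unfolding mol_def
 by (rule integral_norm_bound_integral[OF mol_integrable[OF assms]])
  (use mol_integrable[OF continuous_on_norm[OF assms]] ker_nonneg in auto)

lemma mol_sub_le:
 fixes f :: "real^3 => 'b::euclidean_space"
 assumes "continuous_on UNIV f" "!!y. y \<in> B1 ==> norm (f (x + r*\<^sub>R y) - c) <= e"
 shows "norm (mol r f x - c) <= e"
proof -
 have "mol r f x - c = mol r (%x. f x - c) x"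
  by (simp add: mol_diff[OF assms(1)] mol_const)
 also have "norm ... <= mol r (%x. norm (f x - c)) x"
  by (intro mol_norm_le continuous_intros assms)
 also have "... <= mol r (%x. e) x"
  by (intro mol_mono continuous_intros assms)
 finally show ?thesis by (simp add: mol_const)
qed

lemma mol_grad:
 assumes "grad1 f g"
 shows "grad1 (mol r f) (mol r g)"
proof -
 have cf: "continuous_on UNIV f" and cg: "continuous_on UNIV g"
  using grad1_cont[OF assms] grad1_cont_grad[OF assms] by auto
 have "grad1 (%x. integral B1 (%y. ker y*f (x + r*\<^sub>R y))) (%x. integral B1 (%y. ker y*\<^sub>R g (x + r*\<^sub>R y)))"
 proof (rule grad1_integral)
  fix x t
  show "((%x. ker t*f (x + r*\<^sub>R t)) has_derivative (%h. (ker t*\<^sub>R g (x + r*\<^sub>R t)) \<bullet> h)) (at x)"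
   using grad1_D[OF grad1_cmult[OF grad1_affine[OF assms, of "r*\<^sub>R t" 1]], of "ker t" x]
   by (simp add: add.commute)
 qed (auto simp: split_beta intro!: continuous_intros cont_param[OF cf] cont_param[OF cg]
    continuous_on_UNIV_comp[OF cont_ker(1)])
 then show ?thesis by (rule grad1_cong) (auto simp: mol_def)
qed

definition dmol :: "real => (real^3 => real) => real^3 => real^3" where
 "dmol r f x = (- 1/r)*\<^sub>R integral B1 (%y. f (x + r*\<^sub>R y)*\<^sub>R dker y)"

text \<open>The derivative falls on the kernel, so continuity of \<open>f\<close> is enough. The
  increment \<open>h\<close> is transferred from the argument of \<open>f\<close> to the kernel by
  shifting \<open>y\<close> by \<open>h / r\<close>.\<close>

lemma grad1_mol:
 assumes cf: "continuous_on UNIV f" and r: "r > 0"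
 shows "grad1 (mol r f) (dmol r f)"
 unfolding grad1_def
proof (intro conjI allI)
 have "continuous_on UNIV (%x. integral B1 (%y. f (x + r*\<^sub>R y)*\<^sub>R dker y))"
  by (intro integral_continuous_on_param)
   (auto simp: split_beta intro!: continuous_intros cont_param[OF cf] continuous_on_UNIV_comp[OF cont_ker(2)])
 then show "continuous_on UNIV (dmol r f)" unfolding dmol_def by (intro continuous_intros)
 fix x :: "real^3"
 \<comment> \<open>For \<open>norm h < r\<close> the shifted kernel is still supported in the
   doubled box.\<close>
 let ?B2 = "cbox (-2) (2::real^3)"
 let ?\<Phi> = "%h. integral ?B2 (%y. ker (y - (1/r)*\<^sub>R h)*f (x + r*\<^sub>R y))"
 have B12: "B1 \<subseteq> ?B2" by (rule cbox_mono_cart) auto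
 have gr: "grad1 ?\<Phi> (%h. integral ?B2 (%y. (- 1/r*f (x + r*\<^sub>R y))*\<^sub>R dker (y - (1/r)*\<^sub>R h)))"
 proof (rule grad1_integral)
  fix h y
  show "((%h. ker (y - (1/r)*\<^sub>R h)*f (x + r*\<^sub>R y)) has_derivative
    (%w. ((- 1/r*f (x + r*\<^sub>R y))*\<^sub>R dker (y - (1/r)*\<^sub>R h)) \<bullet> w)) (at h)"
   using grad1_D[OF grad1_cmult[OF grad1_affine[OF grad1_ker, of y "-1/r"], of "f (x + r*\<^sub>R y)"], of h]
   by (simp add: mult_ac)
 qed (auto simp: split_beta intro!: continuous_intros cont_param[OF cf] continuous_on_UNIV_comp[OF cont_ker(1)]
    continuous_on_UNIV_comp[OF cont_ker(2)] simp: r[THEN less_imp_neq, symmetric])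
 have eq: "?\<Phi> h = mol r f (x + h)" if h: "h \<in> ball 0 r" for h
 proof -
  let ?w = "%y. ker y*f (x + h + r*\<^sub>R y)"
  have hr: "\<bar>h $ i/r\<bar> < 1" for i
   using h component_le_norm_cart[of h i] r by (simp add: abs_mult field_simps)
  have cw: "continuous_on UNIV ?w"
   by (intro continuous_intros cont_param[OF cf] cont_ker)
  have "integral ?B2 (%y. ?w (y + (- (1/r)*\<^sub>R h))) = integral ?B2 ?w"
  proof (rule integral_shift_support[OF cw _ B12])
   show "B1 \<subseteq> cbox (- 2 + - (1/r)*\<^sub>R h) (2 + - (1/r)*\<^sub>R h)"
   proof (rule cbox_mono_cart)
    fix i
    show "(- 2 + - (1/r)*\<^sub>R h) $ i <= (-1) $ i" "1 $ i <= (2 + - (1/r)*\<^sub>R h) $ i"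
     using abs_less_iff[THEN iffD1, OF hr[of i]] by auto
   qed
  qed (simp add: ker_outside)
  also have "integral ?B2 ?w = integral B1 ?w"
   by (rule integral_superset_zero[OF continuous_on_subset[OF cw]]) (use B12 ker_outside in auto)
  finally show ?thesis
   using r by (simp add: mol_def algebra_simps)
 qed
 have "((%h. mol r f (x + h)) has_derivative
   (%w. integral ?B2 (%y. (- 1/r*f (x + r*\<^sub>R y))*\<^sub>R dker (y - (1/r)*\<^sub>R 0)) \<bullet> w)) (at 0)"
  by (rule has_derivative_transform_within_open[OF grad1_D[OF gr], of "ball 0 r"])
   (use eq r in auto)
 moreover have "integral ?B2 (%y. (- 1/r*f (x + r*\<^sub>R y))*\<^sub>R dker (y - (1/r)*\<^sub>R 0)) = dmol r f x"
 proof -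
  have "integral ?B2 (%y. (- 1/r*f (x + r*\<^sub>R y))*\<^sub>R dker y) = integral B1 (%y. (- 1/r*f (x + r*\<^sub>R y))*\<^sub>R dker y)"
   by (rule integral_superset_zero)
    (use B12 ker_outside r in \<open>auto intro!: continuous_intros cont_param[OF cf] cont_ker\<close>)
  also have "... = integral B1 (%y. (- 1/r)*\<^sub>R (f (x + r*\<^sub>R y)*\<^sub>R dker y))"
   by (simp only: scaleR_scaleR)
  also have "... = dmol r f x"
   unfolding dmol_def by (rule integral_cmul)
  finally show ?thesis by simp
 qed
 ultimately have "((%h. mol r f (x + h)) has_derivative (%w. dmol r f x \<bullet> w)) (at 0)"
  by (simp only:)
 moreover have "((%z. z - x) has_derivative (%w. w)) (at x)"
  by (auto intro!: derivative_eq_intros)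
 ultimately show "(mol r f has_derivative (%h. dmol r f x \<bullet> h)) (at x)"
  using has_derivative_compose[of "%z. z - x" "%w. w" x UNIV "%h. mol r f (x + h)" "%w. dmol r f x \<bullet> w"]
  by simp
qed

text \<open>Joint continuity includes scale zero, where \<open>mol\<close> is the identity; limits
  of vanishing scale become evaluations of a continuous function.\<close>

lemma mol_joint_cont:
 fixes f :: "real^3 => 'b::euclidean_space"
 assumes "continuous_on UNIV f"
 shows "continuous_on UNIV (%p. mol (fst p) f (snd p))"
 unfolding mol_def
 by (rule integral_continuous_on_param)
  (auto simp: split_beta intro!: continuous_intros cont_param[OF assms] continuous_on_UNIV_comp[OF cont_ker(1)])

lemma mol_joint_cont':
 fixes f :: "real^3 => 'b::euclidean_space"
 assumes "continuous_on UNIV f" "continuous_on S p" "continuous_on S q"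
 shows "continuous_on S (%x. mol (p x) f (q x))"
 using continuous_on_UNIV_comp[OF mol_joint_cont[OF assms(1)], of S "%x. (p x, q x)"]
 by (auto intro!: continuous_intros assms)

lemma mol_0: "mol 0 f x = f x"
 using mol_const[of 0 "f x" x] by (simp add: mol_def)

section \<open>Second derivatives after mollification and the Piola identity\<close>

definition ddker :: "3 => real^3 => real^3" where
 "ddker i y = (-6/kmass)*\<^sub>R ((max 0 (1 - y \<bullet> y)^2)*\<^sub>R axis i 1 - (4*max 0 (1 - y \<bullet> y)*y $ i)*\<^sub>R y)"

lemma grad1_dker: "grad1 (%y. dker y $ i) (ddker i)"
 using grad1_cmult[OF grad1_mult[OF grad1_pospow[of 0] grad1_coord[of i]], of "-6/kmass"]
 by (rule grad1_cong) (auto simp: dker_def ddker_def algebra_simps numeral_2_eq_2)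

lemma ddker_sym: "ddker i y $ j = ddker j y $ i"
 by (auto simp: ddker_def axis_def)

lemma dmol_nth:
 assumes "continuous_on UNIV f"
 shows "dmol r f x $ i = (- 1/r)*integral B1 (%y. f (x + r*\<^sub>R y)*dker y $ i)"
proof -
 have "(%y. f (x + r*\<^sub>R y)*\<^sub>R dker y) integrable_on B1"
  by (intro integrable_continuous continuous_intros cont_param[OF assms] cont_ker)
 from integral_linear[OF this, of "%v. v $ i"]
 show ?thesis by (simp add: dmol_def o_def bounded_linear_vec_nth)
qed

text \<open>One integration by parts turns either side into \<open>f\<close> against a second
  derivative of the kernel, and those commute. So mollified gradients have symmetric derivatives
  although \<open>f\<close> has only one.\<close>

lemma dmol_sym:
 assumes "grad1 f g" "r > 0"
 shows "dmol r (%x. g x $ j) x $ i = dmol r (%x. g x $ i) x $ j"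
proof -
 have c: "continuous_on UNIV (%x. g x $ j)" for j
  by (intro continuous_intros grad1_cont_grad[OF assms(1)])
 have "r*integral B1 (%y. g (x + r*\<^sub>R y) $ j*dker y $ i)
  = - integral B1 (%y. f (x + r*\<^sub>R y)*ddker i y $ j)" for i j
  using integral_by_parts[OF grad1_affine[OF assms(1), of x r] grad1_dker[of i], of "-1" 1 j]
  by (simp add: ker_outside mult.assoc)
 then have "r*integral B1 (%y. g (x + r*\<^sub>R y) $ j*dker y $ i)
  = r*integral B1 (%y. g (x + r*\<^sub>R y) $ i*dker y $ j)"
  by (simp add: ddker_sym[of i _ j])
 then show ?thesis using assms(2) by (simp add: dmol_nth[OF c])
qed

text \<open>The integrand is the divergence of \<open>a\<close> times the cross product of two
  gradients, and that cross product is divergence free. This uses second derivatives of the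
  potentials, which enter as the symmetric first derivatives of \<open>b'\<close> and
  \<open>z'\<close>.\<close>

lemma integral_triple_C2:
 assumes a: "grad1 a a'" and b: "!!j. grad1 (%x. b' x $ j) (b'' j)" and bs: "!!i j x. b'' i x $ j = b'' j x $ i"
  and z: "!!j. grad1 (%x. z' x $ j) (z'' j)" and zs: "!!i j x. z'' i x $ j = z'' j x $ i"
  and z0: "!!x. x \<notin> cbox p q ==> z' x = 0"
 shows "integral (cbox p q) (%x. a' x \<bullet> cross3 (b' x) (z' x)) = 0"
proof -
 define X where "X = (%x. cross3 (b' x) (z' x))"
 define G where "G i j = (%x. (b' x $ i*\<^sub>R z'' j x + z' x $ j*\<^sub>R b'' i x) - (b' x $ j*\<^sub>R z'' i x + z' x $ i*\<^sub>R b'' j x))" for i j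
 have G: "grad1 (%x. b' x $ i*z' x $ j - b' x $ j*z' x $ i) (G i j)" for i j
  unfolding G_def by (intro grad1_diff grad1_mult b z)
 have X: "X x $ 1 = b' x $ 2*z' x $ 3 - b' x $ 3*z' x $ 2"
  "X x $ 2 = b' x $ 3*z' x $ 1 - b' x $ 1*z' x $ 3"
  "X x $ 3 = b' x $ 1*z' x $ 2 - b' x $ 2*z' x $ 1" for x
  by (auto simp: X_def cross3_def)
 have ca': "continuous_on S a'" for S using grad1_cont_grad[OF a] continuous_on_subset by blast
 have ca: "continuous_on S a" for S using grad1_cont[OF a] continuous_on_subset by blast
 have cG: "continuous_on S (G i j)" for S i j using grad1_cont_grad[OF G] continuous_on_subset by blast
 have cX: "continuous_on S (%x. b' x $ i*z' x $ j - b' x $ j*z' x $ i)" for S i j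
  using grad1_cont[OF G] continuous_on_subset by blast
 have ibp: "integral (cbox p q) (%x. a' x $ k*(b' x $ i*z' x $ j - b' x $ j*z' x $ i))
   = - integral (cbox p q) (%x. a x*G i j x $ k)" for i j k
  by (rule integral_by_parts[OF a G]) (simp add: z0)
 have "integral (cbox p q) (%x. a' x \<bullet> X x) = integral (cbox p q) (%x. a' x $ 1*(b' x $ 2*z' x $ 3 - b' x $ 3*z' x $ 2)
   + a' x $ 2*(b' x $ 3*z' x $ 1 - b' x $ 1*z' x $ 3) + a' x $ 3*(b' x $ 1*z' x $ 2 - b' x $ 2*z' x $ 1))"
  by (simp add: inner_vec_def sum_3 X)
 also have "... = integral (cbox p q) (%x. a' x $ 1*(b' x $ 2*z' x $ 3 - b' x $ 3*z' x $ 2))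
   + integral (cbox p q) (%x. a' x $ 2*(b' x $ 3*z' x $ 1 - b' x $ 1*z' x $ 3))
   + integral (cbox p q) (%x. a' x $ 3*(b' x $ 1*z' x $ 2 - b' x $ 2*z' x $ 1))"
  by (subst integral_add integral_add; (intro integrable_add integrable_continuous continuous_intros ca' cX)?)+ simp
 also have "... = - (integral (cbox p q) (%x. a x*G 2 3 x $ 1) + integral (cbox p q) (%x. a x*G 3 1 x $ 2)
   + integral (cbox p q) (%x. a x*G 1 2 x $ 3))"
  unfolding ibp by simp
 also have "integral (cbox p q) (%x. a x*G 2 3 x $ 1) + integral (cbox p q) (%x. a x*G 3 1 x $ 2)
   + integral (cbox p q) (%x. a x*G 1 2 x $ 3)
  = integral (cbox p q) (%x. a x*G 2 3 x $ 1 + a x*G 3 1 x $ 2 + a x*G 1 2 x $ 3)"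
  by (subst integral_add integral_add; (intro integrable_add integrable_continuous continuous_intros ca cG)?)+ simp
 also have "(%x. a x*G 2 3 x $ 1 + a x*G 3 1 x $ 2 + a x*G 1 2 x $ 3) = (%x. 0)"
 proof
  fix x
  have "G 2 3 x $ 1 + G 3 1 x $ 2 + G 1 2 x $ 3 = 0"
   unfolding G_def using bs[of 1 x 2] bs[of 1 x 3] bs[of 2 x 3] zs[of 1 x 2] zs[of 1 x 3] zs[of 2 x 3]
   by simp
  then have "a x*(G 2 3 x $ 1 + G 3 1 x $ 2 + G 1 2 x $ 3) = 0" by simp
  then show "a x*G 2 3 x $ 1 + a x*G 3 1 x $ 2 + a x*G 1 2 x $ 3 = 0" by (simp add: distrib_left)
 qed
 finally show ?thesis by (simp add: X_def)
qed

lemma mol_nth: "continuous_on UNIV f ==> mol r f x $ j = mol r (%x. f x $ j) x" for f :: "real^3 => real^3"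
 by (rule mol_linear[OF _ bounded_linear_vec_nth])

lemma mol_outside:
 fixes f :: "real^3 => 'b::euclidean_space"
 assumes "!!x. x \<notin> cbox p q ==> f x = 0" "x \<notin> cbox (p - 1) (q + 1)" "0 <= r" "r <= 1"
 shows "mol r f x = 0"
proof -
 have "f (x + r*\<^sub>R y) = 0" if y: "y \<in> B1" for y
 proof (rule assms(1))
  obtain i where i: "\<not> (p $ i - 1 <= x $ i \<and> x $ i <= q $ i + 1)"
   using assms(2) by (auto simp: mem_box_cart)
  have "\<bar>y $ i\<bar> <= 1" using y by (auto simp: mem_box_cart abs_le_iff minus_le_iff)
  then have "\<bar>r*y $ i\<bar> <= 1" using assms(3,4) by (simp add: abs_mult mult_le_one)
  then have "\<not> (p $ i <= x $ i + r*y $ i \<and> x $ i + r*y $ i <= q $ i)" using i by linarith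
  then show "x + r*\<^sub>R y \<notin> cbox p q" by (auto simp: mem_box_cart intro!: exI[of _ i])
 qed
 then have "integral B1 (%y. ker y*\<^sub>R f (x + r*\<^sub>R y)) = integral B1 (%y. 0)"
  by (intro integral_cong) auto
 then show ?thesis by (simp add: mol_def)
qed

lemma continuous_on_cross3 [continuous_intros]:
 fixes S :: "'a::t2_space set"
 shows "continuous_on S f ==> continuous_on S g ==> continuous_on S (%x. cross3 (f x) (g x))"
 by (rule continuous_on_cross)

text \<open>Mollifying \<open>b'\<close> and \<open>z'\<close> at scale \<open>s > 0\<close>
  provides the missing second derivatives; the integral \<open>I s\<close> is continuous down to
  \<open>s = 0\<close>, where nothing is mollified.\<close>

lemma integral_triple_zero:
 assumes a: "grad1 a a'" and b: "grad1 b b'" and z: "grad1 z z'"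
  and z0: "!!x. x \<notin> cbox p q ==> z x = 0"
 shows "integral (cbox p q) (%x. a' x \<bullet> cross3 (b' x) (z' x)) = 0"
proof -
 let ?P = "cbox (p - 1) (q + 1)"
 define I where "I s = integral ?P (%x. a' x \<bullet> cross3 (mol s b' x) (mol s z' x))" for s
 have cb: "continuous_on UNIV b'" and cz: "continuous_on UNIV z'" and ca: "continuous_on UNIV a'"
  using a b z grad1_cont_grad by auto
 have z0': "z' x = 0" if "x \<notin> cbox p q" for x
  using grad1_zero_outside(2)[OF z z0] that box_subset_cbox by blast
 have cI: "continuous_on {0..1} I"
  unfolding I_def
  by (rule integral_continuous_on_param)
   (auto simp: split_beta intro!: continuous_intros mol_joint_cont'[OF cb] mol_joint_cont'[OF cz] continuous_on_UNIV_comp[OF ca])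
 have I0: "I s = 0" if s: "s \<in> {0<..1}" for s
  unfolding I_def
 proof (rule integral_triple_C2[OF a])
  have s0: "s > 0" using s by simp
  have ccb: "continuous_on UNIV (%x. b' x $ j)" and ccz: "continuous_on UNIV (%x. z' x $ j)" for j
   by (intro continuous_intros cb cz)+
  show "grad1 (%x. mol s b' x $ j) (dmol s (%x. b' x $ j))" for j
   using grad1_mol[OF ccb s0] by (rule grad1_cong) (simp_all add: mol_nth[OF cb])
  show "grad1 (%x. mol s z' x $ j) (dmol s (%x. z' x $ j))" for j
   using grad1_mol[OF ccz s0] by (rule grad1_cong) (simp_all add: mol_nth[OF cz])
  show "dmol s (%x. b' x $ i) x $ j = dmol s (%x. b' x $ j) x $ i" for i j x
   by (rule dmol_sym[OF b s0])
  show "dmol s (%x. z' x $ i) x $ j = dmol s (%x. z' x $ j) x $ i" for i j x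
   by (rule dmol_sym[OF z s0])
  show "mol s z' x = 0" if "x \<notin> ?P" for x
   by (rule mol_outside[OF z0' that]) (use s in auto)
 qed
 have "I 0 = 0"
 proof -
  have "(%n. I (1/real (Suc n))) \<longlonglongrightarrow> I 0"
   by (rule continuous_on_tendsto_compose[OF cI LIMSEQ_inverse_real_of_nat[unfolded inverse_eq_divide]])
    (auto intro!: eventuallyI)
  moreover have "I (1/real (Suc n)) = 0" for n by (rule I0) simp
  ultimately have "(%n::nat. 0) \<longlonglongrightarrow> I 0" by simp
  then show ?thesis by (simp add: LIMSEQ_const_iff)
 qed
 then have "integral ?P (%x. a' x \<bullet> cross3 (b' x) (z' x)) = 0" by (simp add: I_def mol_0)
 moreover have "integral ?P (%x. a' x \<bullet> cross3 (b' x) (z' x)) = integral (cbox p q) (%x. a' x \<bullet> cross3 (b' x) (z' x))"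
  by (rule integral_superset_zero)
   (use z0' cbox_cart_nonempty_margin in \<open>auto intro!: continuous_intros simp: cross_zero_right
    intro: continuous_on_subset[OF ca] continuous_on_subset[OF cb] continuous_on_subset[OF cz]\<close>)
 ultimately show ?thesis by simp
qed

definition cof :: "real^3^3 => real^3^3" where
 "cof A = vector [cross3 (A $ 2) (A $ 3), cross3 (A $ 3) (A $ 1), cross3 (A $ 1) (A $ 2)]"

definition gradM :: "(real^3 => real^3) => (real^3 => real^3^3) => bool" where
 "gradM v F \<longleftrightarrow> (\<forall>i. grad1 (%x. v x $ i) (%x. F x $ i))"

lemma gradM_nth: "gradM v F ==> grad1 (%x. v x $ i) (%x. F x $ i)"
 by (simp add: gradM_def)

lemma gradM_cont: assumes "gradM v F" shows "continuous_on S F" "continuous_on S v"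
proof -
 have "continuous_on UNIV (%x. \<chi> i. F x $ i)" "continuous_on UNIV (%x. \<chi> i. v x $ i)"
  by (intro continuous_on_vec_lambda grad1_cont_grad[OF gradM_nth[OF assms]] grad1_cont[OF gradM_nth[OF assms]])+
 then show "continuous_on S F" "continuous_on S v"
  by (auto intro: continuous_on_subset)
qed

text \<open>The Piola identity in weak form. Each row of the cofactor matrix is a cross product of
  two gradients, so pairing it with a third one is a triple product.\<close>

lemma integral_cof_zero:
 assumes v: "gradM v F" and z: "grad1 z z'" and z0: "!!x. x \<notin> cbox p q ==> z x = 0"
 shows "integral (cbox p q) (%x. cof (F x) $ i \<bullet> z' x) = 0"
proof -
 have *: "integral (cbox p q) (%x. cross3 (F x $ j) (F x $ k) \<bullet> z' x) = 0" for j k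
 proof -
  have "cross3 (F x $ j) (F x $ k) \<bullet> z' x = F x $ j \<bullet> cross3 (F x $ k) (z' x)" for x
   by (simp add: cross3_def inner_vec_def sum_3 algebra_simps)
  then show ?thesis
   using integral_triple_zero[OF gradM_nth[OF v, of j] gradM_nth[OF v, of k] z z0] by simp
 qed
 have "i = 1 \<or> i = 2 \<or> i = 3" using exhaust_3 by blast
 then show ?thesis using*by (auto simp: cof_def)
qed

section \<open>Rotations and cofactors\<close>

lemma integral_Cauchy_Schwarz_cbox:
 fixes f g :: "'a::euclidean_space => real"
 assumes f: "continuous_on (cbox a b) f" and g: "continuous_on (cbox a b) g"
 shows "(integral (cbox a b) (%x. f x*g x))^2
  <= integral (cbox a b) (%x. (f x)\<^sup>2)*integral (cbox a b) (%x. (g x)\<^sup>2)"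
proof -
 define A B C where "A = integral (cbox a b) (%x. (f x)\<^sup>2)" and "B = integral (cbox a b) (%x. f x*g x)"
  and "C = integral (cbox a b) (%x. (g x)\<^sup>2)"
 have I: "((%x. (f x)\<^sup>2) has_integral A) (cbox a b)" "((%x. f x*g x) has_integral B) (cbox a b)"
  "((%x. (g x)\<^sup>2) has_integral C) (cbox a b)"
  unfolding A_def B_def C_def
  by (intro integrable_integral integrable_continuous continuous_intros f g)+
 have q: "0 <= A - 2*l*B + l^2*C" for l
 proof -
  have "((%x. (f x)\<^sup>2 - (2*l)*(f x*g x) + l^2*(g x)^2) has_integral (A - 2*l*B + l^2*C)) (cbox a b)"
   by (intro has_integral_add has_integral_diff has_integral_mult_right I)
  moreover have "(f x)^2 - (2*l)*(f x*g x) + l^2*(g x)^2 = (f x - l*g x)^2" for x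
   by (simp add: power2_eq_square algebra_simps)
  ultimately show ?thesis using has_integral_nonneg by (metis (no_types, lifting) zero_le_power2)
 qed
 have C: "C \<ge> 0" by (rule has_integral_nonneg[OF I(3)]) simp
 have "B^2 <= A*C"
 proof (cases "C = 0")
  case True
  have "B = 0"
  proof (rule ccontr)
   assume "B \<noteq> 0"
   with q[of "(A + 1)/(2*B)"] True show False by simp
  qed
  then show ?thesis using True by simp
 next
  case False
  with C have "C > 0" by simp
  have "0 <= (A - 2*(B/C)*B + (B/C)^2*C)*C"
   using q[of "B/C"] C by simp
  also have "... = A*C - B^2" using False by (simp add: field_simps power2_eq_square)
  finally show ?thesis by simp
 qed
 then show ?thesis by (simp add: A_def B_def C_def)
qed

lemma integral_sq_le:
 fixes f :: "'a::euclidean_space => real"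
 assumes f: "continuous_on (cbox a b) f"
 shows "(integral (cbox a b) f)^2 <= measure lborel (cbox a b)*integral (cbox a b) (%x. (f x)\<^sup>2)"
 using integral_Cauchy_Schwarz_cbox[OF continuous_on_const f, of 1] by simp

text \<open>Concentric boxes: \<open>l\<close> fixes the half-sides, \<open>t\<close> is a margin on
  every side. Mollification at radius \<open>r\<close> costs exactly \<open>r\<close> of this
  margin, so estimates are passed from larger to smaller \<open>t\<close>.\<close>

definition Qb :: "real^3 => real => (real^3) set" where
 "Qb l t = cbox (- (l + vec t)) (l + vec t)"

lemma mem_Qb: "x \<in> Qb l t \<longleftrightarrow> (\<forall>i. \<bar>x $ i\<bar> <= l $ i + t)"
 by (auto simp: Qb_def mem_box_cart abs_le_iff) (smt (verit))+

lemma Qb_mono: "s <= t ==> Qb l s \<subseteq> Qb l t"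
 unfolding subset_iff mem_Qb by (meson add_left_mono order_trans)

lemma Qb_shift:
 assumes "x \<in> Qb l s" "y \<in> B1" "0 <= r" "s + r <= t"
 shows "x + r*\<^sub>R y \<in> Qb l t"
 unfolding mem_Qb
proof
 fix i
 have "\<bar>y $ i\<bar> <= 1" using assms(2) by (auto simp: mem_box_cart abs_le_iff minus_le_iff)
 then have "\<bar>r*y $ i\<bar> <= r" using assms(3) by (simp add: abs_mult mult_left_le)
 moreover have "\<bar>x $ i\<bar> <= l $ i + s" using assms(1) by (simp add: mem_Qb)
 ultimately show "\<bar>(x + r*\<^sub>R y) $ i\<bar> <= l $ i + t" using assms(4) by simp
qed

lemma integral_Qb_mono:
 fixes f :: "real^3 => real"
 assumes "continuous_on UNIV f" "!!x. 0 <= f x" "s <= t"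
 shows "integral (Qb l s) f <= integral (Qb l t) f"
 using Qb_mono[OF assms(3)] assms(2)
 by (intro integral_subset_le) (auto simp: Qb_def intro!: integrable_continuous continuous_on_subset[OF assms(1)])

lemma integral_Qb_shift_le:
 fixes f :: "real^3 => real"
 assumes "continuous_on UNIV f" "!!x. 0 <= f x" "y \<in> B1" "0 <= r" "s + r <= t"
 shows "integral (Qb l s) (%x. f (x + r*\<^sub>R y)) <= integral (Qb l t) f"
proof -
 have c: "continuous_on S f" for S using assms(1) continuous_on_subset by blast
 have "integral (Qb l s) (%x. f (x + r*\<^sub>R y)) = integral (cbox (- (l + vec s) + r*\<^sub>R y) (l + vec s + r*\<^sub>R y)) f"
  using integral_shift_cbox_plus[of "- (l + vec s)" "l + vec s" f "r*\<^sub>R y"] by (simp add: Qb_def o_def add.commute)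
 also have "... <= integral (Qb l t) f"
 proof (intro integral_subset_le)
  show "cbox (- (l + vec s) + r*\<^sub>R y) (l + vec s + r*\<^sub>R y) \<subseteq> Qb l t"
  proof
   fix x assume "x \<in> cbox (- (l + vec s) + r*\<^sub>R y) (l + vec s + r*\<^sub>R y)"
   then have "x - r*\<^sub>R y \<in> Qb l s"
    by (auto simp: mem_Qb mem_box_cart abs_le_iff) (smt (verit))+
   from Qb_shift[OF this assms(3-5)] show "x \<in> Qb l t" by simp
  qed
 qed (use c assms(2) in \<open>auto simp: Qb_def intro!: integrable_continuous\<close>)
 finally show ?thesis .
qed

lemma integral_mol_le:
 fixes f :: "real^3 => real"
 assumes f: "continuous_on UNIV f" "!!x. 0 <= f x" and r: "0 <= r" "s + r <= t"
 shows "integral (Qb l s) (mol r f) <= integral (Qb l t) f"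
proof -
 have "integral (Qb l s) (mol r f) = integral B1 (%y. integral (Qb l s) (%x. ker y*f (x + r*\<^sub>R y)))"
  unfolding mol_def[abs_def] Qb_def real_scaleR_def
  by (rule integral_swap_continuous)
   (auto simp: split_beta intro!: continuous_intros cont_param[OF f(1)] continuous_on_UNIV_comp[OF cont_ker(1)])
 also have "... = integral B1 (%y. ker y*integral (Qb l s) (%x. f (x + r*\<^sub>R y)))"
  by simp
 also have "... <= integral B1 (%y. ker y*integral (Qb l t) f)"
 proof (rule integral_le)
  have "continuous_on B1 (%y. integral (Qb l s) (%x. f (x + r*\<^sub>R y)))"
   unfolding Qb_def by (rule integral_continuous_on_param)
    (auto simp: split_beta intro!: continuous_intros cont_param[OF f(1)])
  then show "(%y. ker y*integral (Qb l s) (%x. f (x + r*\<^sub>R y))) integrable_on B1"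
   by (intro integrable_continuous continuous_intros cont_ker)
  show "(%y. ker y*integral (Qb l t) f) integrable_on B1"
   by (intro integrable_continuous continuous_intros cont_ker)
 qed (auto intro!: mult_left_mono ker_nonneg integral_Qb_shift_le f r)
 also have "... = integral (Qb l t) f" by (simp add: integral_ker)
 finally show ?thesis .
qed

text \<open>Jensen's inequality, as nonnegativity of the mollified variance of \<open>norm f\<close>
  about its mollified mean \<open>m\<close>.\<close>

lemma mol_sq_le:
 fixes f :: "real^3 => 'b::euclidean_space"
 assumes f: "continuous_on UNIV f"
 shows "(norm (mol r f x))^2 <= mol r (%x. (norm (f x))\<^sup>2) x"
proof -
 define m where "m = mol r (%x. norm (f x)) x"
 have cn: "continuous_on UNIV (%x. norm (f x))" by (intro continuous_intros f)
 have "0 = mol r (%x. 0::real) x" by (simp add: mol_const)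
 also have "... <= mol r (%x. (norm (f x) - m)\<^sup>2) x"
  by (intro mol_mono continuous_intros f) auto
 also have "(%x. (norm (f x) - m)\<^sup>2) = (%x. (norm (f x))\<^sup>2 - ((2*m)*\<^sub>R norm (f x) - m^2))"
  by (auto simp: power2_eq_square algebra_simps)
 also have "mol r ... x = mol r (%x. (norm (f x))\<^sup>2) x - ((2*m)*\<^sub>R mol r (%x. norm (f x)) x - m^2)"
  using mol_linear[OF cn bounded_linear_scaleR_right, of "2*m" r x]
  by (subst mol_diff mol_diff; (intro continuous_intros f)?)+ (simp add: mol_const)
 finally have "m^2 <= mol r (%x. (norm (f x))\<^sup>2) x" by (simp add: m_def power2_eq_square)
 moreover have "(norm (mol r f x))^2 <= m^2"
  unfolding m_def by (intro power_mono mol_norm_le f) auto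
 ultimately show ?thesis by simp
qed

definition n2 :: "real^3 => real => (real^3 => 'b::euclidean_space) => real" where
 "n2 l t f = integral (Qb l t) (%x. (norm (f x))\<^sup>2)"

lemma cont_integrable_Qb:
 fixes f :: "real^3 => 'b::euclidean_space"
 shows "continuous_on UNIV f ==> f integrable_on Qb l t"
 unfolding Qb_def by (intro integrable_continuous) (rule continuous_on_subset, auto)

lemma n2_mono:
 fixes f :: "real^3 => 'b::euclidean_space"
 assumes "continuous_on UNIV f" "s <= t"
 shows "n2 l s f <= n2 l t f"
 unfolding n2_def by (intro integral_Qb_mono continuous_intros assms) auto

lemma n2_le:
 fixes f :: "real^3 => 'b::euclidean_space" and g :: "real^3 => 'c::euclidean_space"
 assumes "continuous_on UNIV f" "continuous_on UNIV g" "!!x. x \<in> Qb l t ==> norm (f x) <= c*norm (g x)"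
 shows "n2 l t f <= c^2*n2 l t g"
proof -
 have "n2 l t f <= integral (Qb l t) (%x. c\<^sup>2*(norm (g x))^2)"
  unfolding n2_def
 proof (intro integral_le cont_integrable_Qb continuous_intros assms)
  fix x assume "x \<in> Qb l t"
  from power_mono[OF assms(3)[OF this] norm_ge_zero, of 2]
  show "(norm (f x))^2 <= c^2*(norm (g x))^2" by (simp add: power_mult_distrib)
 qed
 then show ?thesis by (simp add: n2_def)
qed

lemma sq_add_le: "(a + b)^2 <= 2*a^2 + 2*(b::real)^2"
 using sum_squares_bound[of a b] by (simp add: power2_sum)

lemma n2_le2:
 fixes f :: "real^3 => 'b::euclidean_space" and g :: "real^3 => 'c::euclidean_space" and h :: "real^3 => 'd::euclidean_space"
 assumes "continuous_on UNIV f" "continuous_on UNIV g" "continuous_on UNIV h"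
  "!!x. x \<in> Qb l t ==> norm (f x) <= norm (g x) + norm (h x)"
 shows "n2 l t f <= 2*n2 l t g + 2*n2 l t h"
proof -
 have "n2 l t f <= integral (Qb l t) (%x. 2*(norm (g x))^2 + 2*(norm (h x))^2)"
  unfolding n2_def
 proof (intro integral_le cont_integrable_Qb continuous_intros assms)
  fix x assume "x \<in> Qb l t"
  from power_mono[OF assms(4)[OF this] norm_ge_zero, of 2]
  show "(norm (f x))^2 <= 2*(norm (g x))^2 + 2*(norm (h x))^2"
   using sq_add_le[of "norm (g x)" "norm (h x)"] by linarith
 qed
 also have "... = 2*n2 l t g + 2*n2 l t h"
  unfolding n2_def by (subst integral_add) (auto intro!: cont_integrable_Qb continuous_intros assms)
 finally show ?thesis .
qed

lemma n2_mol_le: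
 fixes f :: "real^3 => 'b::euclidean_space"
 assumes f: "continuous_on UNIV f" and r: "0 <= r" "s + r <= t"
 shows "n2 l s (mol r f) <= n2 l t f"
proof -
 have c: "continuous_on UNIV (%x. (norm (f x))\<^sup>2)" by (intro continuous_intros f)
 have "n2 l s (mol r f) <= integral (Qb l s) (mol r (%x. (norm (f x))\<^sup>2))"
  unfolding n2_def
  by (intro integral_le cont_integrable_Qb continuous_intros mol_cont f mol_sq_le c)
 also have "... <= n2 l t f"
  unfolding n2_def by (intro integral_mol_le c r) auto
 finally show ?thesis .
qed

lemma content_B1: "measure lborel B1 = 8"
 by (subst content_cbox_cart) (auto simp: interval_ne_empty_cart prod_constant)

text \<open>The kernel gradient has mean zero, so any constant \<open>c\<close> may be subtracted
  from \<open>f\<close> first. The factor 288 is the volume 8 of \<open>B1\<close> times the 36 of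
  \<open>dker_sq_le\<close>.\<close>

lemma dmol_sq_le:
 assumes f: "continuous_on UNIV f" and r: "r > 0"
 shows "(norm (dmol r f x))^2 <= 288/(kmass*r^2)*mol r (%z. (f z - c)\<^sup>2) x"
proof -
 let ?w = "%y. f (x + r*\<^sub>R y)"
 have cw: "continuous_on S ?w" for S by (intro cont_param[OF f] continuous_intros)
 have d0: "integral B1 dker = 0"
  using integral_dker integral_linear[OF integrable_continuous[OF cont_ker(2)] bounded_linear_vec_nth, of "-1" 1]
  by (simp add: vec_eq_iff o_def)
 have "integral B1 (%y. (?w y - c)*\<^sub>R dker y) = integral B1 (%y. ?w y*\<^sub>R dker y) - integral B1 (%y. c*\<^sub>R dker y)"
  unfolding scaleR_diff_left
  by (intro integral_diff integrable_continuous continuous_intros cw cont_ker)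
 then have eq: "dmol r f x = (- 1/r)*\<^sub>R integral B1 (%y. (?w y - c)*\<^sub>R dker y)"
  by (simp add: dmol_def d0)
 have "norm (integral B1 (%y. (?w y - c)*\<^sub>R dker y)) <= integral B1 (%y. \<bar>?w y - c\<bar> * norm (dker y))"
  by (rule integral_norm_bound_integral) (auto intro!: integrable_continuous continuous_intros cw cont_ker)
 then have "(norm (integral B1 (%y. (?w y - c)*\<^sub>R dker y)))^2 <= (integral B1 (%y. \<bar>?w y - c\<bar> * norm (dker y)))^2"
  by (intro power_mono) auto
 also have "... <= 8*integral B1 (%y. (\<bar>?w y - c\<bar> * norm (dker y))\<^sup>2)"
  using integral_sq_le[of "-1" 1 "%y. \<bar>?w y - c\<bar> * norm (dker y)"]
  by (simp add: content_B1 continuous_intros cw cont_ker)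
 also have "integral B1 (%y. (\<bar>?w y - c\<bar> * norm (dker y))\<^sup>2) <= integral B1 (%y. (36/kmass)*(ker y*(?w y - c)^2))"
 proof (intro integral_le integrable_continuous continuous_intros cw cont_ker)
  fix y
  have "(\<bar>?w y - c\<bar> * norm (dker y))^2 = (?w y - c)^2*(norm (dker y))^2" by (simp add: power_mult_distrib)
  also have "... <= (?w y - c)^2*(36/kmass * ker y)"
   by (intro mult_left_mono dker_sq_le) auto
  finally show "(\<bar>?w y - c\<bar> * norm (dker y))^2 <= (36/kmass)*(ker y*(?w y - c)^2)" by (simp add: mult_ac)
 qed
 also have "integral B1 (%y. (36/kmass)*(ker y*(?w y - c)^2)) = (36/kmass)*mol r (%z. (f z - c)\<^sup>2) x"
  by (simp add: mol_def)
 finally have "(norm (integral B1 (%y. (?w y - c)*\<^sub>R dker y)))^2 <= 288/kmass*mol r (%z. (f z - c)\<^sup>2) x"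
  by simp
 then have "(1/r^2)*(norm (integral B1 (%y. (?w y - c)*\<^sub>R dker y)))^2 <= (1/r^2)*(288/kmass*mol r (%z. (f z - c)\<^sup>2) x)"
  by (intro mult_left_mono) auto
 moreover have "(norm (dmol r f x))^2 = (1/r^2)*(norm (integral B1 (%y. (?w y - c)*\<^sub>R dker y)))^2"
  unfolding eq using r by (simp add: power_mult_distrib power_divide)
 ultimately show ?thesis by (simp add: mult_ac)
qed

section \<open>Matrix norms, rotations and the distance to \<open>SO3\<close>\<close>

lemma norm_mat_sq: "(norm (A::real^3^3))^2 = (\<Sum>i\<in>UNIV. \<Sum>j\<in>UNIV. (A $ i $ j)\<^sup>2)"
 by (simp add: norm_vec_def L2_set_def sum_nonneg real_sqrt_pow2)

lemma inner_mat: "(A::real^3^3) \<bullet> B = (\<Sum>i\<in>UNIV. \<Sum>j\<in>UNIV. A $ i $ j*B $ i $ j)"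
 by (simp add: inner_vec_def)

lemma SO3_D:
 assumes "S \<in> SO3"
 shows "transpose S ** S = mat 1" "S ** transpose S = mat 1" "det S = 1" "orthogonal_matrix S"
 using assms by (auto simp: SO3_def orthogonal_matrix_def)

lemma mat1_SO3: "mat 1 \<in> SO3" by (simp add: SO3_def orthogonal_matrix_id)

lemma SO3_mult: "R \<in> SO3 ==> S \<in> SO3 ==> R ** S \<in> SO3"
 by (simp add: SO3_def orthogonal_matrix_mul det_mul)

lemma SO3_transpose: "R \<in> SO3 ==> transpose R \<in> SO3"
 by (simp add: SO3_def orthogonal_matrix_transpose)

lemma SO3_rows:
 assumes "S \<in> SO3"
 shows "S $ i \<bullet> S $ j = (if i = j then 1 else 0)"
proof -
 have "(S ** transpose S) $ i $ j = S $ i \<bullet> S $ j"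
  by (simp add: matrix_matrix_mult_def transpose_def inner_vec_def)
 then show ?thesis using SO3_D(2)[OF assms] by (simp add: mat_def)
qed

lemma norm_orthogonal_mult:
 fixes A :: "real^3^3"
 assumes "orthogonal_matrix (R::real^3^3)"
 shows "norm (R ** A) = norm A"
proof -
 have c: "(norm (B::real^3^3))^2 = (\<Sum>j\<in>UNIV. (norm (column j B))\<^sup>2)" for B
  unfolding norm_mat_sq by (subst sum.swap) (simp add: norm_vec_def L2_set_def sum_nonneg column_def)
 have "column j (R ** A) = R *v column j A" for j
  by (simp add: column_def matrix_matrix_mult_def matrix_vector_mult_def vec_eq_iff)
 moreover have "norm (R *v x) = norm x" for x
  by (rule orthogonal_transformation_norm)
   (use assms in \<open>simp add: matrix_of_matrix_vector_mul orthogonal_transformation_matrix\<close>)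
 ultimately have "(norm (R ** A))^2 = (norm A)^2" by (simp only: c)
 then show ?thesis by (simp add: power2_eq_iff_nonneg)
qed

lemma norm_SO3: assumes "S \<in> SO3" shows "(norm S)^2 = 3" "norm S <= 2"
proof -
 have "norm S = norm (S ** mat 1)" by simp
 also have "... = norm (mat 1 :: real^3^3)" by (rule norm_orthogonal_mult[OF SO3_D(4)[OF assms]])
 finally show 1: "(norm S)^2 = 3" by (simp add: norm_mat_sq mat_def sum_3)
 have "(norm S)^2 <= 2^2" using 1 by simp
 then show "norm S <= 2" by (rule power2_le_imp_le) simp
qed

lemma closed_SO3: "closed SO3"
proof -
 have eq: "SO3 = {A. transpose A ** A = mat 1} \<inter> {A. det A = 1}"
  by (auto simp: SO3_def orthogonal_matrix)
 show ?thesis unfolding eq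
 proof (rule closed_Int)
  show "closed {A::real^3^3. transpose A ** A = mat 1}"
   by (intro closed_Collect_eq continuous_intros)
    (auto simp: transpose_def matrix_matrix_mult_def intro!: continuous_on_vec_lambda continuous_intros)
  show "closed {A::real^3^3. det A = 1}"
   by (intro closed_Collect_eq) (auto simp: det_3 intro!: continuous_intros)
 qed
qed

lemma SO3_nearest:
 obtains S where "S \<in> SO3" "infdist F SO3 = norm (F - S)"
 using infdist_attains_inf[OF closed_SO3, of F] mat1_SO3 by (metis dist_norm empty_iff)

lemma infdist_SO3_le: "S \<in> SO3 ==> infdist F SO3 <= norm (F - S)"
 by (metis dist_norm infdist_le)

lemma infdist_SO3_diff: "infdist A SO3 <= infdist B SO3 + norm (A - B)"
 using infdist_triangle[of A SO3 B] by (simp add: dist_norm)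

lemma matrix_diff_mult: "(A - B) ** (C::real^3^3) = A ** C - B ** C" "C ** (A - B) = C ** A - C ** B"
 by (simp_all add: matrix_matrix_mult_def vec_eq_iff sum_subtractf algebra_simps)

lemma matrix_add_mult: "(A + B) ** (C::real^3^3) = A ** C + B ** C" "C ** (A + B) = C ** A + C ** B"
 by (simp_all add: matrix_matrix_mult_def vec_eq_iff sum.distrib algebra_simps)

lemma infdist_SO3_mult:
 assumes "R \<in> SO3"
 shows "infdist (R ** A) SO3 = infdist A SO3"
proof -
 have le: "infdist (R ** A) SO3 <= infdist A SO3" if R: "R \<in> SO3" for R A
 proof -
  obtain S where S: "S \<in> SO3" "infdist A SO3 = norm (A - S)" by (rule SO3_nearest)
  have "infdist (R ** A) SO3 <= norm (R ** A - R ** S)"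
   by (rule infdist_SO3_le[OF SO3_mult[OF R S(1)]])
  also have "... = norm (A - S)"
   using norm_orthogonal_mult[OF SO3_D(4)[OF R], of "A - S"] by (simp add: matrix_diff_mult)
  finally show ?thesis using S by simp
 qed
 have "infdist A SO3 = infdist (transpose R ** (R ** A)) SO3"
  by (simp add: matrix_mul_assoc SO3_D(1)[OF assms])
 also have "... <= infdist (R ** A) SO3" by (rule le[OF SO3_transpose[OF assms]])
 finally show ?thesis using le[OF assms, of A] by simp
qed

lemma norm_cross_le: "norm (cross3 x y) <= norm x*norm y"
proof -
 have "(norm (cross3 x y))^2 <= (norm x*norm y)^2"
  using norm_cross_dot[of x y] by (smt (verit) zero_le_power2)
 then show ?thesis by (rule power2_le_imp_le) simp
qed

lemma cof_nth: "cof A $ 1 = cross3 (A $ 2) (A $ 3)" "cof A $ 2 = cross3 (A $ 3) (A $ 1)" "cof A $ 3 = cross3 (A $ 1) (A $ 2)"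
 by (auto simp: cof_def)

text \<open>Each row and the cross product of the other two are unit vectors whose inner product is
  \<open>det S = 1\<close>; hence they coincide.\<close>

lemma cof_SO3: assumes "S \<in> SO3" shows "cof S = S"
proof -
 have d: "det S = 1" by (rule SO3_D(3)[OF assms])
 have e: "S $ i = cross3 (S $ j) (S $ k)" if "j \<noteq> k" and 1: "S $ i \<bullet> cross3 (S $ j) (S $ k) = 1" for i j k
 proof -
  let ?c = "cross3 (S $ j) (S $ k)"
  have "(norm ?c)^2 = 1"
   using norm_cross_dot[of "S $ j" "S $ k"] SO3_rows[OF assms, of j k] SO3_rows[OF assms, of j j]
    SO3_rows[OF assms, of k k] that(1) by (simp add: power_mult_distrib power2_norm_eq_inner)
  moreover have "(norm (S $ i))^2 = 1" using SO3_rows[OF assms, of i i] by (simp add: power2_norm_eq_inner)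
  ultimately have "(norm (S $ i - ?c))^2 = 0"
   using 1 by (simp add: power2_norm_eq_inner inner_diff_left inner_diff_right inner_commute)
  then show ?thesis by simp
 qed
 have "S $ 1 = cof S $ 1" unfolding cof_nth
  by (rule e) (use d in \<open>auto simp: det_3 cross3_def inner_vec_def sum_3 algebra_simps\<close>)
 moreover have "S $ 2 = cof S $ 2" unfolding cof_nth
  by (rule e) (use d in \<open>auto simp: det_3 cross3_def inner_vec_def sum_3 algebra_simps\<close>)
 moreover have "S $ 3 = cof S $ 3" unfolding cof_nth
  by (rule e) (use d in \<open>auto simp: det_3 cross3_def inner_vec_def sum_3 algebra_simps\<close>)
 ultimately show ?thesis by (simp add: vec_eq_iff[of "cof S"] forall_3)
qed

lemma norm_row_le: "norm ((A::real^3^3) $ i) <= norm A"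
 by (rule Finite_Cartesian_Product.norm_nth_le)

lemma norm_le_rows: "norm (A::real^3^3) <= norm (A $ 1) + norm (A $ 2) + norm (A $ 3)"
proof -
 have "norm A <= (\<Sum>i\<in>UNIV. norm (A $ i))" unfolding norm_vec_def[of A] by (rule L2_set_le_sum) auto
 then show ?thesis by (simp add: sum_3)
qed

lemma cof_diff_le: "norm (cof (S + K) - cof S) <= 3*(2*norm S*norm K + (norm K)^2)"
proof -
 have *: "norm (cross3 ((S + K) $ i) ((S + K) $ j) - cross3 (S $ i) (S $ j)) <= 2*norm S*norm K + (norm K)^2" for i j
 proof -
  have "cross3 ((S + K) $ i) ((S + K) $ j) - cross3 (S $ i) (S $ j)
   = cross3 (S $ i) (K $ j) + cross3 (K $ i) (S $ j) + cross3 (K $ i) (K $ j)"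
   by (simp add: cross_add_left cross_add_right)
  also have "norm ... <= norm (S $ i)*norm (K $ j) + norm (K $ i)*norm (S $ j) + norm (K $ i)*norm (K $ j)"
   by (intro norm_triangle_le add_mono norm_cross_le)
  also have "... <= norm S*norm K + norm K*norm S + norm K*norm K"
   by (intro add_mono mult_mono norm_row_le) auto
  finally show ?thesis by (simp add: power2_eq_square mult_ac)
 qed
 show ?thesis
  using norm_le_rows[of "cof (S + K) - cof S"] *[of 2 3] *[of 3 1] *[of 1 2] by (simp add: cof_nth)
qed

text \<open>Both quantities vanish at the nearest rotation, where \<open>cof S = S\<close> and the
  squared norm is 3, and both are Lipschitz on bounded sets. They are the two polynomial tests by
  which the distance to \<open>SO3\<close> enters the rigidity argument.\<close>

lemma SO3_defect_bounds:
 fixes F :: "real^3^3"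
 assumes "norm F <= M"
 defines "d \<equiv> infdist F SO3"
 shows "norm (F - cof F) <= (19 + 3*M)*d" "\<bar>(norm F)\<^sup>2 - 3\<bar> <= (M + 2)*d"
proof -
 obtain S where S: "S \<in> SO3" and d: "d = norm (F - S)" unfolding d_def by (rule SO3_nearest)
 have dM: "d <= M + 2" unfolding d using norm_triangle_ineq4[of F S] assms(1) norm_SO3(2)[OF S] by linarith
 have "norm (F - cof F) <= norm (F - S) + norm (cof (S + (F - S)) - cof S)"
  using norm_triangle_ineq4[of "F - S" "cof F - cof S"] by (simp add: cof_SO3[OF S] algebra_simps)
 also have "... <= d + 3*(2*norm S*d + d^2)" using cof_diff_le[of S "F - S"] d by simp
 also have "... <= d + 3*(2*2*d + (M + 2)*d)"
  using norm_SO3(2)[OF S] dM d by (intro add_left_mono mult_left_mono add_mono mult_mono) (auto simp: power2_eq_square mult_right_mono)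
 finally show "norm (F - cof F) <= (19 + 3*M)*d" by (simp add: algebra_simps)
 have "(norm F)^2 - 3 = (norm F - norm S)*(norm F + norm S)"
  using norm_SO3(1)[OF S] by (simp add: power2_eq_square algebra_simps)
 then have "\<bar>(norm F)\<^sup>2 - 3\<bar> = \<bar>norm F - norm S\<bar> * (norm F + norm S)"
  by (simp add: abs_mult)
 also have "... <= d*(M + 2)"
  using norm_triangle_ineq3[of F S] assms(1) norm_SO3(2)[OF S] by (intro mult_mono) (auto simp: d)
 finally show "\<bar>(norm F)\<^sup>2 - 3\<bar> <= (M + 2)*d" by (simp add: mult.commute)
qed

definition symm :: "real^3^3 => real^3^3" where "symm A = (1/2)*\<^sub>R (A + transpose A)"

lemma norm_transpose: "norm (transpose A) = norm (A::real^3^3)"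
proof -
 have "(norm (transpose A))^2 = (norm A)^2" unfolding norm_mat_sq by (subst sum.swap) (simp add: transpose_def)
 then show ?thesis by (simp add: power2_eq_iff_nonneg)
qed

lemma symm_norm_le: "norm (symm A) <= norm A"
 using norm_triangle_ineq[of A "transpose A"] by (simp add: symm_def norm_transpose)

lemma norm_matrix_mult_le: "norm ((A::real^3^3) ** (B::real^3^3)) <= norm A*norm B"
proof -
 have "((A ** B) $ i $ j)^2 <= (norm (A $ i))^2*(norm (column j B))^2" for i j
 proof -
  have "(A ** B) $ i $ j = A $ i \<bullet> column j B" by (simp add: matrix_matrix_mult_def inner_vec_def column_def)
  then have "\<bar>(A ** B) $ i $ j\<bar> <= norm (A $ i)*norm (column j B)" using Cauchy_Schwarz_ineq2 by metis
  from power_mono[OF this, of 2] show ?thesis by (simp add: power_mult_distrib)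
 qed
 then have "(norm (A ** B))^2 <= (\<Sum>i\<in>UNIV. \<Sum>j\<in>UNIV. (norm (A $ i))\<^sup>2*(norm (column j B))^2)"
  unfolding norm_mat_sq[of "A ** B"] by (intro sum_mono)
 also have "... = (\<Sum>i\<in>UNIV. (norm (A $ i))\<^sup>2)*(\<Sum>j\<in>UNIV. (norm (column j B))\<^sup>2)"
  by (simp add: sum_product)
 also have "(\<Sum>i\<in>UNIV. (norm (A $ i))\<^sup>2) = (norm A)^2"
  by (simp add: norm_mat_sq norm_vec_def L2_set_def sum_nonneg)
 also have "(\<Sum>j\<in>UNIV. (norm (column j B))\<^sup>2) = (norm B)^2"
  unfolding norm_mat_sq by (subst sum.swap) (simp add: norm_vec_def L2_set_def sum_nonneg column_def)
 finally have "(norm (A ** B))^2 <= (norm A*norm B)^2" by (simp add: power_mult_distrib)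
 then show ?thesis by (rule power2_le_imp_le) simp
qed

text \<open>For a rotation \<open>S\<close> the matrix \<open>symm S - mat 1\<close> equals minus
  half of \<open>transpose (S - mat 1) ** (S - mat 1)\<close>, which is quadratic in the deviation.
  Near the identity the strain is therefore bounded by the distance to \<open>SO3\<close> up to a
  quadratic error.\<close>

lemma symm_defect_bound:
 fixes B :: "real^3^3"
 defines "d \<equiv> infdist B SO3"
 shows "norm (symm B - mat 1) <= d + (d + norm (B - mat 1))^2"
proof -
 obtain S where S: "S \<in> SO3" and d: "d = norm (B - S)" unfolding d_def by (rule SO3_nearest)
 have "transpose (S - mat 1) = transpose S - mat 1"
  by (simp add: transpose_def vec_eq_iff mat_def)
 then have "transpose (S - mat 1) ** (S - mat 1) = mat 1 - transpose S - S + mat 1"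
  by (simp add: matrix_diff_mult SO3_D(1)[OF S])
 moreover have "symm S - mat 1 = (- 1/2)*\<^sub>R (mat 1 - transpose S - S + mat 1)"
  by (simp add: symm_def vec_eq_iff field_simps)
 ultimately have "symm S - mat 1 = (- 1/2)*\<^sub>R (transpose (S - mat 1) ** (S - mat 1))"
  by (simp only:)
 then have "norm (symm S - mat 1) = 1/2*norm (transpose (S - mat 1) ** (S - mat 1))" by simp
 moreover have "norm (transpose (S - mat 1) ** (S - mat 1)) <= (norm (S - mat 1))^2"
  using norm_matrix_mult_le[of "transpose (S - mat 1)" "S - mat 1"] norm_transpose[of "S - mat 1"]
  by (simp add: power2_eq_square)
 ultimately have "norm (symm S - mat 1) <= (norm (S - mat 1))^2"
  using zero_le_power2[of "norm (S - mat 1)"] by linarith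
 also have "... <= (d + norm (B - mat 1))^2"
  using norm_triangle_ineq[of "S - B" "B - mat 1"] d
  by (intro power_mono) (simp_all add: norm_minus_commute)
 finally have 1: "norm (symm S - mat 1) <= (d + norm (B - mat 1))^2" .
 have "symm B - mat 1 = symm (B - S) + (symm S - mat 1)"
  by (simp add: symm_def vec_eq_iff transpose_def algebra_simps)
 then have "norm (symm B - mat 1) <= norm (symm (B - S)) + norm (symm S - mat 1)"
  using norm_triangle_ineq by metis
 then show ?thesis using symm_norm_le[of "B - S"] 1 d by linarith
qed

section \<open>Rigidity with bounded gradient\<close>

lemma cof_scaleR: "cof (c*\<^sub>R A) = c^2*\<^sub>R cof A"
 by (simp add: vec_eq_iff[of "cof (c*\<^sub>R A)"] forall_3 cof_nth cross_mult_left cross_mult_right power2_eq_square)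

lemma gradM_affine:
 assumes "gradM v F"
 shows "gradM (%x. v (c + r*\<^sub>R x)) (%x. r*\<^sub>R F (c + r*\<^sub>R x))"
 using grad1_affine[OF gradM_nth[OF assms]] by (auto simp: gradM_def)

lemma continuous_on_cof [continuous_intros]:
 fixes S :: "'a::t2_space set"
 assumes "continuous_on S f"
 shows "continuous_on S (%x. cof (f x))"
proof -
 have "continuous_on S (%x. cof (f x) $ i)" for i
 proof -
  have "i = 1 \<or> i = 2 \<or> i = 3" using exhaust_3 by blast
  moreover have c: "continuous_on S (%x. cross3 (f x $ j) (f x $ k))" for j k
   by (intro continuous_intros assms)
  ultimately show ?thesis using c[of 2 3] c[of 3 1] c[of 1 2] by (auto simp: cof_nth)
 qed
 then have "continuous_on S (%x. \<chi> i. cof (f x) $ i)" by (intro continuous_on_vec_lambda)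
 then show ?thesis by simp
qed

text \<open>The weight \<open>ker y *\<^sub>R y\<close> is minus the gradient of the compactly
  supported \<open>kpot\<close>, and cofactors of gradients are divergence free. Rescaling
  multiplies the cofactor by \<open>t\<^sup>2\<close>, which must be cancelled; at
  \<open>t = 0\<close> the claim is the vanishing first moment.\<close>

lemma ker_cof_zero:
 assumes "gradM v F"
 shows "integral B1 (%y. cof (F (x + t*\<^sub>R y)) $ i \<bullet> (ker y*\<^sub>R y)) = 0"
proof (cases "t = 0")
 case False
 have "integral B1 (%y. cof (t*\<^sub>R F (x + t*\<^sub>R y)) $ i \<bullet> (- ker y*\<^sub>R y)) = 0"
  by (rule integral_cof_zero[OF gradM_affine[OF assms] grad1_kpot]) (simp add: ker_outside)
 then have "- t\<^sup>2*integral B1 (%y. cof (F (x + t*\<^sub>R y)) $ i \<bullet> (ker y*\<^sub>R y)) = 0"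
  by (simp add: cof_scaleR mult_ac flip: integral_mult_right)
 then show ?thesis using False by simp
next
 case True
 have "integral B1 (%y. c \<bullet> (ker y*\<^sub>R y)) = 0" for c :: "real^3"
 proof -
  have "integral B1 (%y. c \<bullet> (ker y*\<^sub>R y)) = integral B1 (%y. c $ 1*(ker y*y $ 1) + c $ 2*(ker y*y $ 2) + c $ 3*(ker y*y $ 3))"
   by (simp add: inner_vec_def sum_3 algebra_simps)
  also have "... = c $ 1*integral B1 (%y. ker y*y $ 1) + c $ 2*integral B1 (%y. ker y*y $ 2) + c $ 3*integral B1 (%y. ker y*y $ 3)"
   by (subst integral_add integral_add; (intro integrable_add integrable_continuous continuous_intros cont_ker)?)+ simp
  finally show ?thesis by (simp add: integral_ker_first_moment)
 qed
 then show ?thesis using True by simp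
qed

lemma norm_ker_scale: "norm (ker y*\<^sub>R y) <= ker y"
proof (cases "norm y <= 1")
 case True then show ?thesis using ker_nonneg[of y] by (simp add: mult_left_le)
next
 case False
 then have "1 - y \<bullet> y <= 0" by (simp add: dot_square_norm)
 then show ?thesis by (simp add: ker_def)
qed

lemma cont_Icc_integrable:
 fixes f :: "real => real"
 shows "continuous_on {0..1} f ==> f integrable_on {0..1}"
 by (rule integrable_continuous_real)

text \<open>Integration along segments gives this formula with \<open>F\<close> alone, and the
  cofactor may be subtracted because of \<open>ker_cof_zero\<close>. So the oscillation of
  \<open>v\<close> at scale \<open>r\<close> is governed by \<open>F - cof F\<close>, which is small
  near \<open>SO3\<close> whereas \<open>F\<close> is not.\<close>

lemma mol_sub_formula:
 assumes v: "gradM v F"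
 shows "mol r (%x. v x $ i) x - v x $ i
  = r*integral {0..1} (%t. integral B1 (%y. (F (x + (t*r)*\<^sub>R y) - cof (F (x + (t*r)*\<^sub>R y))) $ i \<bullet> (ker y*\<^sub>R y)))"
proof -
 let ?w = "%x. v x $ i"
 let ?g = "%x. F x $ i"
 have gw: "grad1 ?w ?g" by (rule gradM_nth[OF v])
 have cF: "continuous_on UNIV F" by (rule gradM_cont[OF v])
 have cg: "continuous_on UNIV ?g" and cw: "continuous_on UNIV ?w"
  using grad1_cont[OF gw] grad1_cont_grad[OF gw] by auto
 have ftc: "?w (x + r*\<^sub>R y) - ?w x = integral {0..1} (%t. ?g (x + (t*r)*\<^sub>R y) \<bullet> (r*\<^sub>R y))" for y
 proof -
  have "((%t. ?g (x + (t*r)*\<^sub>R y) \<bullet> (r*\<^sub>R y)) has_integral (?w (x + (1*r)*\<^sub>R y) - ?w (x + (0*r)*\<^sub>R y))) {0..1}"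
  proof (rule fundamental_theorem_of_calculus)
   fix t :: real
   have "((%t. ?w (x + (t*r)*\<^sub>R y)) has_derivative (%h. ?g (x + (t*r)*\<^sub>R y) \<bullet> ((h*r)*\<^sub>R y))) (at t within {0..1})"
    by (rule has_derivative_compose[OF _ grad1_D[OF gw], of "%t. x + (t*r)*\<^sub>R y" "%h. (h*r)*\<^sub>R y"])
     (auto intro!: derivative_eq_intros)
   then show "((%t. ?w (x + (t*r)*\<^sub>R y)) has_vector_derivative ?g (x + (t*r)*\<^sub>R y) \<bullet> (r*\<^sub>R y)) (at t within {0..1})"
    by (simp add: has_vector_derivative_def mult_ac)
  qed simp
  from integral_unique[OF this] show ?thesis by simp
 qed
 have "mol r ?w x - ?w x = mol r (%z. ?w z - ?w x) x"
  by (simp add: mol_diff[OF cw] mol_const)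
 also have "... = integral B1 (%y. integral {0..1} (%t. r*(?g (x + (t*r)*\<^sub>R y) \<bullet> (ker y*\<^sub>R y))))"
  unfolding mol_def ftc by (simp flip: integral_mult_right add: mult_ac)
 also have "... = integral {0..1} (%t. integral B1 (%y. r*(?g (x + (t*r)*\<^sub>R y) \<bullet> (ker y*\<^sub>R y))))"
  unfolding cbox_interval[symmetric]
  by (rule integral_swap_continuous)
   (auto simp: split_beta intro!: continuous_intros cont_param[OF cg] continuous_on_UNIV_comp[OF cont_ker(1)])
 also have "... = r*integral {0..1} (%t. integral B1 (%y. ?g (x + (t*r)*\<^sub>R y) \<bullet> (ker y*\<^sub>R y)))"
  by simp
 also have "(%t. integral B1 (%y. ?g (x + (t*r)*\<^sub>R y) \<bullet> (ker y*\<^sub>R y)))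
  = (%t. integral B1 (%y. (F (x + (t*r)*\<^sub>R y) - cof (F (x + (t*r)*\<^sub>R y))) $ i \<bullet> (ker y*\<^sub>R y)))"
 proof
  fix t
  have "integral B1 (%y. ?g (x + (t*r)*\<^sub>R y) \<bullet> (ker y*\<^sub>R y) - cof (F (x + (t*r)*\<^sub>R y)) $ i \<bullet> (ker y*\<^sub>R y))
   = integral B1 (%y. ?g (x + (t*r)*\<^sub>R y) \<bullet> (ker y*\<^sub>R y)) - integral B1 (%y. cof (F (x + (t*r)*\<^sub>R y)) $ i \<bullet> (ker y*\<^sub>R y))"
   by (intro integral_diff integrable_continuous continuous_intros cont_param[OF cg] cont_param[OF cF] cont_ker)
  then show "integral B1 (%y. ?g (x + (t*r)*\<^sub>R y) \<bullet> (ker y*\<^sub>R y))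
   = integral B1 (%y. (F (x + (t*r)*\<^sub>R y) - cof (F (x + (t*r)*\<^sub>R y))) $ i \<bullet> (ker y*\<^sub>R y))"
   using ker_cof_zero[OF v, of x "t*r" i] by (simp add: inner_diff_left right_diff_distrib)
 qed
 finally show ?thesis .
qed

lemma integral_01_sq_le:
 fixes f :: "real => real"
 assumes "continuous_on {0..1} f"
 shows "(integral {0..1} f)^2 <= integral {0..1} (%t. (f t)\<^sup>2)"
 using integral_sq_le[of 0 1 f] assms by simp

lemma mol_sub_n2_row:
 assumes v: "gradM v F" and r: "0 <= r"
 shows "n2 l s (%x. mol r (%x. v x $ i) x - v x $ i) <= r^2*n2 l (s + r) (%x. F x - cof (F x))"
proof -
 define g where "g = (%x. F x - cof (F x))"
 define G where "G = (%x. (norm (g x))\<^sup>2)"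
 have cF: "continuous_on UNIV F" by (rule gradM_cont[OF v])
 have cg: "continuous_on UNIV g" unfolding g_def by (intro continuous_intros cF)
 have cG: "continuous_on UNIV G" unfolding G_def by (intro continuous_intros cg)
 have cn: "continuous_on UNIV (%x. norm (g x))" by (intro continuous_intros cg)
 have cv: "continuous_on UNIV (%x. v x $ i)" using grad1_cont[OF gradM_nth[OF v]] .
 have pt: "(mol r (%x. v x $ i) x - v x $ i)^2 <= r^2*integral {0..1} (%t. mol (t*r) G x)" for x
 proof -
  let ?m = "%t. integral B1 (%y. g (x + (t*r)*\<^sub>R y) $ i \<bullet> (ker y*\<^sub>R y))"
  have m: "\<bar>?m t\<bar> <= mol (t*r) (%x. norm (g x)) x" for t
   unfolding mol_def real_norm_def[symmetric]
  proof (rule integral_norm_bound_integral)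
   fix y
   have "norm (g (x + (t*r)*\<^sub>R y) $ i \<bullet> (ker y*\<^sub>R y)) <= norm (g (x + (t*r)*\<^sub>R y) $ i)*norm (ker y*\<^sub>R y)"
    unfolding real_norm_def by (rule Cauchy_Schwarz_ineq2)
   also have "... <= norm (g (x + (t*r)*\<^sub>R y)) * ker y"
    by (intro mult_mono norm_row_le norm_ker_scale) auto
   finally show "norm (g (x + (t*r)*\<^sub>R y) $ i \<bullet> (ker y*\<^sub>R y)) <= ker y*\<^sub>R norm (g (x + (t*r)*\<^sub>R y))"
    by (simp add: mult.commute)
  qed (intro integrable_continuous continuous_intros cont_param[OF cg] cont_ker)+
  have m2: "(?m t)^2 <= mol (t*r) G x" for t
  proof -
   have "(?m t)^2 <= (mol (t*r) (%x. norm (g x)) x)^2"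
    using power_mono[OF m[of t] abs_ge_zero, of 2] by simp
   also have "... <= mol (t*r) G x" using mol_sq_le[OF cn, of "t*r" x] by (simp add: G_def)
   finally show ?thesis .
  qed
  have cm: "continuous_on {0..1} ?m"
   by (rule integral_continuous_on_param)
    (auto simp: split_beta intro!: continuous_intros cont_param[OF cg] continuous_on_UNIV_comp[OF cont_ker(1)])
  have "(mol r (%x. v x $ i) x - v x $ i)^2 = r^2*(integral {0..1} ?m)^2"
   unfolding mol_sub_formula[OF v] g_def by (simp add: power_mult_distrib)
  also have "... <= r^2*integral {0..1} (%t. (?m t)\<^sup>2)"
   by (intro mult_left_mono integral_01_sq_le cm) auto
  also have "... <= r^2*integral {0..1} (%t. mol (t*r) G x)"
   by (intro mult_left_mono integral_le cont_Icc_integrable continuous_intros cm m2 mol_joint_cont'[OF cG]) auto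
  finally show ?thesis .
 qed
 have cI: "continuous_on UNIV (%x. integral {0..1} (%t. mol (t*r) G x))"
  unfolding cbox_interval[symmetric]
  by (rule integral_continuous_on_param) (auto simp: split_beta intro!: continuous_intros mol_joint_cont'[OF cG])
 have "n2 l s (%x. mol r (%x. v x $ i) x - v x $ i) <= integral (Qb l s) (%x. r\<^sup>2*integral {0..1} (%t. mol (t*r) G x))"
  unfolding n2_def
  by (intro integral_le cont_integrable_Qb continuous_intros mol_cont cv cI) (use pt in auto)
 also have "... = r^2*integral (Qb l s) (%x. integral {0..1} (%t. mol (t*r) G x))" by simp
 also have "integral (Qb l s) (%x. integral {0..1} (%t. mol (t*r) G x)) = integral {0..1} (%t. integral (Qb l s) (%x. mol (t*r) G x))"
  unfolding cbox_interval[symmetric] Qb_def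
  by (rule integral_swap_continuous)
   (auto simp: split_beta intro!: continuous_intros mol_joint_cont'[OF cG])
 also have "... <= integral {0..1} (%t::real. n2 l (s + r) g)"
 proof (intro integral_le cont_Icc_integrable)
  show "continuous_on {0..1} (%t. integral (Qb l s) (%x. mol (t*r) G x))"
   unfolding Qb_def
   by (rule integral_continuous_on_param) (auto simp: split_beta intro!: continuous_intros mol_joint_cont'[OF cG])
  fix t :: real assume "t \<in> {0..1}"
  then show "integral (Qb l s) (%x. mol (t*r) G x) <= n2 l (s + r) g"
   using integral_mol_le[OF cG, of "t*r" s "s + r" l] r by (simp add: n2_def G_def mult_left_le_one_le)
 qed auto
 finally show ?thesis by (simp add: g_def mult_left_mono)
qed

lemma cutoff_exists:
 assumes "s < t" and ne0: "0 \<in> Qb l s"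
 obtains et et' C where "grad1 et et'" "!!x. 0 <= et x" "!!x. et x <= 1" "!!x. x \<in> Qb l s ==> et x = 1"
  "!!x. x \<notin> Qb l t ==> et x = 0" "!!x. norm (et' x) <= C"
proof -
 \<comment> \<open>One third of the gap for the ramp of \<open>f\<close>, one third on each side for
   the mollification.\<close>
 define dl where "dl = (t - s)/3"
 have d: "dl > 0" and d3: "3*dl = t - s" using assms by (simp_all add: dl_def)
 define f where "f x = max 0 (1 - infdist x (Qb l (s + dl))/dl)" for x
 have cf: "continuous_on UNIV f" unfolding f_def by (intro continuous_intros) (use d in auto)
 have f01: "0 <= f x" "f x <= 1" for x using d infdist_nonneg[of x] by (auto simp: f_def)
 define C where "C = sqrt (288/(kmass*dl^2))"
 show thesis
 proof
  show "grad1 (mol dl f) (dmol dl f)" by (rule grad1_mol[OF cf d])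
  show "0 <= mol dl f x" for x
   using mol_mono[of "%x. 0" f x dl] cf f01 by (simp add: mol_const)
  show "mol dl f x <= 1" for x
   using mol_mono[of f "%x. 1" x dl] cf f01 by (simp add: mol_const)
  show "mol dl f x = 1" if "x \<in> Qb l s" for x
  proof -
   have "f (x + dl*\<^sub>R y) = 1" if "y \<in> B1" for y
   proof -
    have "x + dl*\<^sub>R y \<in> Qb l (s + dl)" by (rule Qb_shift[OF \<open>x \<in> Qb l s\<close> that]) (use d in auto)
    then show ?thesis by (simp add: f_def)
   qed
   then have "mol dl f x = mol dl (%x. 1) x"
    unfolding mol_def by (intro integral_cong) simp
   then show ?thesis by (simp add: mol_const)
  qed
  show "mol dl f x = 0" if "x \<notin> Qb l t" for x
  proof -
   obtain i where i: "\<not> \<bar>x $ i\<bar> <= l $ i + t" using \<open>x \<notin> Qb l t\<close> by (auto simp: mem_Qb)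
   have "f (x + dl*\<^sub>R y) = 0" if y: "y \<in> B1" for y
   proof -
    let ?x = "x + dl*\<^sub>R y"
    have "\<bar>y $ i\<bar> <= 1" using y by (auto simp: mem_box_cart abs_le_iff minus_le_iff)
    then have "\<bar>dl * y $ i\<bar> <= dl" using d by (simp add: abs_mult mult_left_le)
    then have xi: "\<bar>?x $ i\<bar> > l $ i + s + 2*dl" using i d3
     unfolding vector_add_component vector_scaleR_component real_scaleR_def by linarith
    have ne: "Qb l (s + dl) \<noteq> {}" using ne0 Qb_mono[of s "s + dl" l] d by auto
    have "infdist ?x (Qb l (s + dl)) \<ge> dl"
     unfolding infdist_notempty[OF ne]
    proof (rule cINF_greatest[OF ne])
     fix q assume "q \<in> Qb l (s + dl)"
     then have "\<bar>q $ i\<bar> <= l $ i + (s + dl)" by (simp add: mem_Qb)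
     then have "dl <= \<bar>(?x - q) $ i\<bar>" using xi by simp
     also have "... <= dist ?x q" unfolding dist_norm by (rule component_le_norm_cart)
     finally show "dl <= dist ?x q" .
    qed
    then show ?thesis using d by (simp add: f_def field_simps)
   qed
   then have "mol dl f x = mol dl (%x. 0) x"
    unfolding mol_def by (intro integral_cong) simp
   then show ?thesis by (simp add: mol_const)
  qed
  show "norm (dmol dl f x) <= C" for x
  proof -
   have k: "288/(kmass*dl^2) \<ge> 0" using kmass_pos by simp
   have "(norm (dmol dl f x))^2 <= 288/(kmass*dl^2)*mol dl (%z. (f z - 0)\<^sup>2) x"
    by (rule dmol_sq_le[OF cf d])
   also have "... <= 288/(kmass*dl^2)*mol dl (%z. 1) x"
    using f01 by (intro mult_left_mono[OF _ k] mol_mono continuous_intros cf) (auto simp: power_le_one)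
   finally have "(norm (dmol dl f x))^2 <= 288/(kmass*dl^2)" by (simp add: mol_const)
   then show ?thesis unfolding C_def by (rule real_le_rsqrt)
  qed
 qed
qed

lemma cont_UNIV_sub: "continuous_on UNIV f ==> continuous_on S f"
 by (rule continuous_on_subset) auto

lemma n2_rows_mat:
 fixes F :: "real^3 => real^3^3"
 assumes "continuous_on UNIV F"
 shows "n2 l t F = (\<Sum>i\<in>UNIV. n2 l t (%x. F x $ i))"
proof -
 have "(norm (A::real^3^3))^2 = (\<Sum>i\<in>UNIV. (norm (A $ i))\<^sup>2)" for A
  by (simp add: norm_vec_def[of A] L2_set_def sum_nonneg)
 then show ?thesis unfolding n2_def
  by (subst integral_sum[symmetric]) (auto intro!: cont_integrable_Qb continuous_intros assms)
qed

lemma integral_mol_cof_zero: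
 assumes v: "gradM v F" and z: "grad1 z z'" and z0: "!!x. x \<notin> cbox p q ==> z x = 0"
 shows "integral (cbox p q) (%x. mol r (%x. cof (F x)) x $ i \<bullet> z' x) = 0"
proof -
 have cF: "continuous_on UNIV F" by (rule gradM_cont[OF v])
 have cz: "continuous_on UNIV z'" by (rule grad1_cont_grad[OF z])
 have cc: "continuous_on UNIV (%x. cof (F x))" by (intro continuous_intros cF)
 have bl: "bounded_linear (%A::real^3^3. A $ i \<bullet> w)" for w
  by (rule bounded_linear_compose[OF bounded_linear_inner_left bounded_linear_vec_nth])
 have "integral (cbox p q) (%x. mol r (%x. cof (F x)) x $ i \<bullet> z' x)
  = integral (cbox p q) (%x. integral B1 (%y. ker y*(cof (F (x + r*\<^sub>R y)) $ i \<bullet> z' x)))"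
  unfolding mol_linear[OF cc bl] by (simp add: mol_def)
 also have "... = integral B1 (%y. integral (cbox p q) (%x. ker y*(cof (F (x + r*\<^sub>R y)) $ i \<bullet> z' x)))"
  by (rule integral_swap_continuous)
   (auto simp: split_beta intro!: continuous_intros cont_param[OF cF] cont_param[OF cz] continuous_on_UNIV_comp[OF cont_ker(1)])
 also have "... = integral B1 (%y. 0)"
 proof (rule integral_cong)
  fix y
  have "gradM (%x. v (r*\<^sub>R y + 1*\<^sub>R x)) (%x. 1*\<^sub>R F (r*\<^sub>R y + 1*\<^sub>R x))" by (rule gradM_affine[OF v])
  from integral_cof_zero[OF this z z0, where i=i]
  have "integral (cbox p q) (%x. cof (F (x + r*\<^sub>R y)) $ i \<bullet> z' x) = 0" by (simp add: add.commute)
  then show "integral (cbox p q) (%x. ker y*(cof (F (x + r*\<^sub>R y)) $ i \<bullet> z' x)) = 0" by simp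
 qed
 finally show ?thesis by simp
qed

lemma mol_nth_mat: "continuous_on UNIV F ==> mol r F x $ i = mol r (%x. F x $ i) x" for F :: "real^3 => real^3^3"
 by (rule mol_linear[OF _ bounded_linear_vec_nth])

lemma gradM_mol:
 assumes "gradM v F"
 shows "gradM (mol r v) (mol r F)"
 unfolding gradM_def
proof
 fix i
 show "grad1 (%x. mol r v x $ i) (%x. mol r F x $ i)"
  using mol_grad[OF gradM_nth[OF assms], of r i]
  by (rule grad1_cong) (simp_all add: mol_nth mol_nth_mat gradM_cont[OF assms])
qed

lemma amgm_quarter: "2*a*d <= a^2/4 + 4*(d::real)^2"
proof -
 have "0 <= (a - 4*d)^2" by simp
 then show ?thesis by (simp add: power2_eq_square algebra_simps)
qed

lemma Caccioppoli_arith: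
 fixes K A x1 x2 x3 :: real
 assumes "K = A + x1 - x2 - x3" "\<bar>x1\<bar> <= y1" "\<bar>x2\<bar> <= y2" "\<bar>x3\<bar> <= y3"
  "y1 <= A/4 + 4*D" "y2 <= A/4 + B" "y3 <= B + D"
 shows "A <= 2*K + (4*B + 10*D)"
 using assms by linarith

text \<open>A Caccioppoli estimate. Since \<open>cof F\<close> and its mollification are both
  divergence free, the gradient \<open>Z\<close> of \<open>z = v - mol v\<close> is, against
  compactly supported gradients, the same as \<open>ga\<close>, the deviation of the defect from its
  mollification. Testing with \<open>et\<^sup>2 z\<close> bounds \<open>Z\<close> by
  \<open>ga\<close> and \<open>z\<close>, and \<open>mol_sub_n2_row\<close> bounds
  \<open>z\<close>.\<close>

lemma gradient_mol_close_row:
 assumes r: "r > 0" and ne0: "0 \<in> Qb l s"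
 shows "\<exists>C\<ge>0. \<forall>v F i. gradM v F -->
  n2 l s (%x. (F x - mol r F x) $ i) <= C*n2 l (s + 2*r) (%x. F x - cof (F x))"
proof -
 obtain et et' c where eta: "grad1 et et'" "!!x. 0 <= et x" "!!x. et x <= 1" "!!x. x \<in> Qb l s ==> et x = 1"
  "!!x. x \<notin> Qb l (s + r) ==> et x = 0" "!!x. norm (et' x) <= c"
  using cutoff_exists[of s "s + r" l] r ne0 by auto
 have c0: "c \<ge> 0" using eta(6)[of 0] norm_ge_zero order_trans by blast
 show ?thesis
 \<comment> \<open>The term \<open>ga\<close> costs a factor 4 in the Caccioppoli inequality and
   another 4 in comparison with the defect; \<open>z\<close> costs \<open>10*c^2\<close>, and
   \<open>r^2\<close> in comparison with the defect.\<close>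
 proof (intro exI[of _ "16 + 10*c^2*r^2"] conjI allI impI)
  show "16 + 10*c^2*r^2 \<ge> 0" by simp
  fix v F i assume v: "gradM v F"
  define g where "g = (%x. F x - cof (F x))"
  define z where "z = (%x. v x $ i - mol r (%x. v x $ i) x)"
  define Z where "Z = (%x. (F x - mol r F x) $ i)"
  define ga where "ga = (%x. (g x - mol r g x) $ i)"
  define ze' where "ze' = (%x. (et x*et x)*\<^sub>R Z x + z x*\<^sub>R (et x*\<^sub>R et' x + et x*\<^sub>R et' x))"
  let ?Q = "Qb l (s + r)"
  have cF: "continuous_on UNIV F" by (rule gradM_cont[OF v])
  have cc: "continuous_on UNIV (%x. cof (F x))" by (intro continuous_intros cF)
  have cg: "continuous_on UNIV g" unfolding g_def by (intro continuous_intros cF)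
  have gz: "grad1 z Z"
   unfolding z_def Z_def
   by (rule grad1_cong[OF grad1_diff[OF gradM_nth[OF v, of i] mol_grad[OF gradM_nth[OF v, of i]]]])
    (simp_all add: mol_nth_mat[OF cF])
  have cz: "continuous_on UNIV z" "continuous_on UNIV Z" using grad1_cont[OF gz] grad1_cont_grad[OF gz] .
  have ce: "continuous_on UNIV et" "continuous_on UNIV et'" using grad1_cont[OF eta(1)] grad1_cont_grad[OF eta(1)] .
  have cgm: "continuous_on UNIV ga" unfolding ga_def by (intro continuous_intros cg mol_cont)
  have gze: "grad1 (%x. (et x*et x)*z x) ze'"
   unfolding ze'_def by (rule grad1_mult[OF grad1_mult[OF eta(1) eta(1)] gz])
  have cze: "continuous_on UNIV ze'" by (rule grad1_cont_grad[OF gze])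
  have z0: "(et x*et x)*z x = 0" if "x \<notin> cbox (- (l + vec (s + r))) (l + vec (s + r))" for x
   using eta(5)[of x] that by (simp add: Qb_def)
  have Zg: "Z x = ga x + (cof (F x) $ i - mol r (%x. cof (F x)) x $ i)" for x
   unfolding Z_def ga_def g_def mol_diff[OF cF cc] by simp
  have I0: "integral ?Q (%x. cof (F x) $ i \<bullet> ze' x) = 0"
   unfolding Qb_def by (rule integral_cof_zero[OF v gze z0])
  have I1: "integral ?Q (%x. mol r (%x. cof (F x)) x $ i \<bullet> ze' x) = 0"
   unfolding Qb_def by (rule integral_mol_cof_zero[OF v gze z0])
  have "integral ?Q (%x. Z x \<bullet> ze' x - ga x \<bullet> ze' x)
   = integral ?Q (%x. cof (F x) $ i \<bullet> ze' x - mol r (%x. cof (F x)) x $ i \<bullet> ze' x)"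
   unfolding Zg by (simp add: inner_diff_left inner_add_left)
  also have "... = 0"
   by (subst integral_diff) (auto simp: I0 I1 intro!: cont_integrable_Qb continuous_intros cc cze mol_cont)
  finally have key: "integral ?Q (%x. Z x \<bullet> ze' x - ga x \<bullet> ze' x) = 0" .
  have pt: "(et x)^2*(norm (Z x))^2 <= 2*(Z x \<bullet> ze' x - ga x \<bullet> ze' x) + (4*(norm (ga x))^2 + 10*c^2*(norm (z x))^2)" for x
  proof -
   let ?a = "et x*norm (Z x)" and ?b = "norm (ga x)" and ?d = "c*\<bar>z x\<bar>"
   have e: "0 <= et x" "et x <= 1" by (rule eta)+
   have e1: "\<bar>Z x \<bullet> et' x\<bar> <= norm (Z x)*c" "\<bar>ga x \<bullet> et' x\<bar> <= ?b*c" "\<bar>ga x \<bullet> Z x\<bar> <= ?b*norm (Z x)"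
    using Cauchy_Schwarz_ineq2[of "Z x" "et' x"] Cauchy_Schwarz_ineq2[of "ga x" "et' x"] Cauchy_Schwarz_ineq2[of "ga x" "Z x"]
     mult_left_mono[OF eta(6)[of x], of "norm (Z x)"] mult_left_mono[OF eta(6)[of x], of ?b] by auto
   have exp: "Z x \<bullet> ze' x - ga x \<bullet> ze' x = (et x)^2*(norm (Z x))^2 + 2*et x*z x*(Z x \<bullet> et' x)
    - (et x)\<^sup>2*(ga x \<bullet> Z x) - 2*et x*z x*(ga x \<bullet> et' x)"
    unfolding ze'_def power2_norm_eq_inner inner_add_right inner_scaleR_right
    by (simp add: power2_eq_square algebra_simps)
   have t1: "\<bar>2*et x*z x*(Z x \<bullet> et' x)\<bar> <= 2 * ?a * ?d"
   proof -
    have "\<bar>2*et x*z x*(Z x \<bullet> et' x)\<bar> = 2*et x*\<bar>z x\<bar> * \<bar>Z x \<bullet> et' x\<bar>" using e by (simp add: abs_mult)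
    also have "... <= 2*et x*\<bar>z x\<bar> * (norm (Z x)*c)" using e e1 by (intro mult_left_mono) auto
    finally show ?thesis by (simp add: mult_ac)
   qed
   have t2: "\<bar>(et x)\<^sup>2*(ga x \<bullet> Z x)\<bar> <= ?a * ?b"
   proof -
    have "\<bar>(et x)\<^sup>2*(ga x \<bullet> Z x)\<bar> = (et x)^2*\<bar>ga x \<bullet> Z x\<bar>" by (simp add: abs_mult)
    also have "... <= et x*(?b*norm (Z x))" using e e1
     by (intro mult_mono) (auto simp: power2_eq_square mult_left_le)
    finally show ?thesis by (simp add: mult_ac)
   qed
   have t3: "\<bar>2*et x*z x*(ga x \<bullet> et' x)\<bar> <= 2 * ?b * ?d"
   proof -
    have "\<bar>2*et x*z x*(ga x \<bullet> et' x)\<bar> = et x*(2*\<bar>z x\<bar> * \<bar>ga x \<bullet> et' x\<bar>)" using e by (simp add: abs_mult)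
    also have "... <= 1*(2*\<bar>z x\<bar> * (?b*c))" using e e1 c0 by (intro mult_mono mult_left_mono) auto
    finally show ?thesis by (simp add: mult_ac)
   qed
   have s1: "2 * ?a * ?d <= ?a\<^sup>2/4 + 4 * ?d\<^sup>2" by (rule amgm_quarter)
   have s2: "?a * ?b <= ?a\<^sup>2/4 + ?b\<^sup>2" using amgm_quarter[of ?a "?b/2"] by (simp add: power_divide)
   have s3: "2 * ?b * ?d <= ?b\<^sup>2 + ?d\<^sup>2" using sum_squares_bound[of ?b ?d] by simp
   have sq: "?a\<^sup>2 = (et x)^2*(norm (Z x))^2" "?d\<^sup>2 = c^2*(norm (z x))^2" by (simp_all add: power_mult_distrib)
   show ?thesis
    using Caccioppoli_arith[OF exp t1 t2 t3 s1[unfolded sq] s2[unfolded sq] s3[unfolded sq]] by (simp only: mult.assoc)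
  qed
  have "n2 l s Z = integral (Qb l s) (%x. (et x)\<^sup>2*(norm (Z x))^2)"
   unfolding n2_def using eta(4) by (intro integral_cong) simp
  also have "... <= integral ?Q (%x. (et x)\<^sup>2*(norm (Z x))^2)"
   using r by (intro integral_Qb_mono continuous_intros ce cz) auto
  also have "... <= integral ?Q (%x. 2*(Z x \<bullet> ze' x - ga x \<bullet> ze' x) + (4*(norm (ga x))^2 + 10*c^2*(norm (z x))^2))"
   by (intro integral_le cont_integrable_Qb continuous_intros ce cz cgm cze pt)
  also have "... = integral ?Q (%x. 2*(Z x \<bullet> ze' x - ga x \<bullet> ze' x))
    + integral ?Q (%x. 4*(norm (ga x))^2 + 10*c^2*(norm (z x))^2)"
   by (intro integral_add cont_integrable_Qb continuous_intros ce cz cgm cze)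
  also have "integral ?Q (%x. 4*(norm (ga x))^2 + 10*c^2*(norm (z x))^2)
   = integral ?Q (%x. 4*(norm (ga x))^2) + integral ?Q (%x. 10*c^2*(norm (z x))^2)"
   by (intro integral_add cont_integrable_Qb continuous_intros ce cz cgm cze)
  also have "integral ?Q (%x. 2*(Z x \<bullet> ze' x - ga x \<bullet> ze' x))
   + (integral ?Q (%x. 4*(norm (ga x))^2) + integral ?Q (%x. 10*c^2*(norm (z x))^2))
   = 4*n2 l (s + r) ga + 10*c^2*n2 l (s + r) z"
   unfolding n2_def integral_mult_right key by simp
  finally have 1: "n2 l s Z <= 4*n2 l (s + r) ga + 10*c^2*n2 l (s + r) z" .
  have cmg: "continuous_on UNIV (mol r g)" by (rule mol_cont[OF cg])
  have "n2 l (s + r) ga <= 2*n2 l (s + r) g + 2*n2 l (s + r) (mol r g)"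
  proof (rule n2_le2[OF cgm cg cmg])
   fix x
   have "norm (ga x) <= norm (g x - mol r g x)" unfolding ga_def by (rule norm_row_le)
   then show "norm (ga x) <= norm (g x) + norm (mol r g x)" using norm_triangle_ineq4 order_trans by blast
  qed
  also have "... <= 4*n2 l (s + 2*r) g"
   using n2_mol_le[OF cg, of r "s + r" "s + 2*r" l] n2_mono[OF cg, of "s + r" "s + 2*r" l] r by simp
  finally have 2: "n2 l (s + r) ga <= 4*n2 l (s + 2*r) g" .
  have "n2 l (s + r) z = n2 l (s + r) (%x. mol r (%x. v x $ i) x - v x $ i)"
   unfolding n2_def z_def by (simp add: norm_minus_commute abs_minus_commute)
  also have "... <= r^2*n2 l (s + r + r) g"
   unfolding g_def by (rule mol_sub_n2_row[OF v]) (use r in simp)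
  finally have 3: "n2 l (s + r) z <= r^2*n2 l (s + 2*r) g" by (simp add: algebra_simps)
  have "10*c^2*n2 l (s + r) z <= 10*c^2*(r^2*n2 l (s + 2*r) g)"
   using 3 by (intro mult_left_mono) auto
  then show "n2 l s (%x. (F x - mol r F x) $ i) <= (16 + 10*c^2*r^2)*n2 l (s + 2*r) (%x. F x - cof (F x))"
   using 1 2 by (simp add: Z_def g_def algebra_simps)
 qed
qed

lemma gradient_mol_close:
 assumes r: "r > 0" and ne0: "0 \<in> Qb l s"
 shows "\<exists>C\<ge>0. \<forall>v F. gradM v F -->
  n2 l s (%x. F x - mol r F x) <= C*n2 l (s + 2*r) (%x. F x - cof (F x))"
proof -
 obtain C where C0: "C \<ge> 0" and C': "\<forall>v F i. gradM v F -->
  n2 l s (%x. (F x - mol r F x) $ i) <= C*n2 l (s + 2*r) (%x. F x - cof (F x))"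
  using gradient_mol_close_row[OF r ne0] by (elim exE conjE) (rule that)
 note C = C'[rule_format]
 show ?thesis
 proof (intro exI[of _ "3*C"] conjI allI impI)
  fix v F assume v: "gradM v F"
  have cF: "continuous_on UNIV F" by (rule gradM_cont[OF v])
  have "n2 l s (%x. F x - mol r F x) = (\<Sum>i\<in>UNIV. n2 l s (%x. (F x - mol r F x) $ i))"
   by (intro n2_rows_mat continuous_intros cF mol_cont)
  also have "... <= (\<Sum>i\<in>(UNIV::3 set). C*n2 l (s + 2*r) (%x. F x - cof (F x)))"
   by (intro sum_mono C[OF v])
  finally show "n2 l s (%x. F x - mol r F x) <= (3*C)*n2 l (s + 2*r) (%x. F x - cof (F x))" by simp
 qed (use C0 in simp)
qed

lemma mol_sup_le:
 fixes f :: "real^3 => real"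
 assumes f: "continuous_on UNIV f" "!!x. 0 <= f x" and r: "0 < r" and x: "x \<in> Qb l s" "s + r <= t"
 shows "mol r f x <= 1/(kmass*r^3)*integral (Qb l t) f"
proof -
 have sub: "cbox (x - vec r) (x + vec r) \<subseteq> Qb l t"
 proof
  fix w assume "w \<in> cbox (x - vec r) (x + vec r)"
  then have w: "x $ i - r <= w $ i \<and> w $ i <= x $ i + r" for i
   by (simp add: mem_box_cart)
  have "\<bar>w $ i\<bar> <= l $ i + t" for i
  proof -
   have "\<bar>x $ i\<bar> <= l $ i + s" using x(1) by (simp add: mem_Qb)
   then show ?thesis using w[of i] x(2) by linarith
  qed
  then show "w \<in> Qb l t" by (simp add: mem_Qb)
 qed
 have "(f has_integral integral (cbox (x - vec r) (x + vec r)) f) (cbox (x - vec r) (x + vec r))"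
  by (intro integrable_integral integrable_continuous cont_UNIV_sub[OF f(1)])
 from has_integral_affinity'[OF this r, of x]
 have "((%y. f (r*\<^sub>R y + x)) has_integral integral (cbox (x - vec r) (x + vec r)) f /\<^sub>R r^3)
   (cbox ((x - vec r - x) /\<^sub>R r) ((x + vec r - x) /\<^sub>R r))" by simp
 moreover have "(x - vec r - x) /\<^sub>R r = -1" "(x + vec r - x) /\<^sub>R r = 1"
  using r by (simp_all add: vec_eq_iff)
 ultimately have hi: "((%y. f (x + r*\<^sub>R y)) has_integral integral (cbox (x - vec r) (x + vec r)) f/r^3) B1"
  by (simp add: add.commute divide_inverse mult.commute)
 have "mol r f x <= integral B1 (%y. (1/kmass)*f (x + r*\<^sub>R y))"
  unfolding mol_def real_scaleR_def
  by (intro integral_le integrable_continuous continuous_intros cont_ker cont_param[OF f(1)] mult_right_mono ker_le f)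
 also have "... = (1/kmass)*(integral (cbox (x - vec r) (x + vec r)) f/r^3)"
  using integral_unique[OF hi] by simp
 also have "... <= (1/kmass)*(integral (Qb l t) f/r^3)"
  using kmass_pos r f(2)
  by (intro mult_left_mono divide_right_mono integral_subset_le[OF sub])
   (auto intro!: cont_integrable_Qb f integrable_continuous cont_UNIV_sub[OF f(1)])
 finally show ?thesis by simp
qed

lemma grad1_lipschitz_Qb:
 assumes f: "grad1 f g" and g: "!!x. x \<in> Qb l s ==> norm (g x) <= K" and x: "x \<in> Qb l s" "0 \<in> Qb l s"
 shows "\<bar>f x - f 0\<bar> <= K*(\<Sum>i\<in>UNIV. l $ i + s)"
proof -
 have K: "K \<ge> 0" using g[OF x(1)] norm_ge_zero order_trans by blast
 have "norm (f x - f 0) <= K*norm (x - 0)"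
 proof (rule differentiable_bound[of "Qb l s" f "%x h. g x \<bullet> h"])
  show "convex (Qb l s)" by (simp add: Qb_def)
  fix w assume w: "w \<in> Qb l s"
  show "(f has_derivative (\<bullet>) (g w)) (at w within Qb l s)"
   using grad1_D[OF f] has_derivative_at_withinI by blast
  show "onorm ((\<bullet>) (g w)) <= K"
  proof (rule onorm_bound[OF K])
   fix h
   have "norm (g w \<bullet> h) <= norm (g w)*norm h" using Cauchy_Schwarz_ineq2 by simp
   also have "... <= K*norm h" using g[OF w] by (intro mult_right_mono) auto
   finally show "norm (g w \<bullet> h) <= K*norm h" .
  qed
 qed (use x in auto)
 have "norm x <= (\<Sum>i\<in>UNIV. l $ i + s)"
  using norm_le_l1_cart[of x] sum_mono[of UNIV "%i. \<bar>x $ i\<bar>" "%i. l $ i + s"] x(1) by (auto simp: mem_Qb)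
 from mult_left_mono[OF this K] \<open>norm (f x - f 0) <= K*norm (x - 0)\<close> show ?thesis by simp
qed

lemma integral_abs_le_sqrt:
 fixes f :: "real^3 => real"
 assumes f: "continuous_on UNIV f" and b: "n2 l t f <= c*e^2" and e: "0 <= e" "0 <= c"
 shows "integral (Qb l t) (%x. \<bar>f x\<bar>) <= sqrt (measure lborel (Qb l t)*c)*e"
proof -
 have "(integral (Qb l t) (%x. \<bar>f x\<bar>))^2 <= measure lborel (Qb l t)*integral (Qb l t) (%x. \<bar>f x\<bar>\<^sup>2)"
  unfolding Qb_def by (intro integral_sq_le continuous_intros cont_UNIV_sub[OF f])
 also have "... <= measure lborel (Qb l t)*(c*e^2)"
  using b by (intro mult_left_mono) (auto simp: n2_def)
 also have "... = (sqrt (measure lborel (Qb l t)*c)*e)^2"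
  using e by (simp add: power_mult_distrib)
 finally show ?thesis by (rule power2_le_imp_le) (use e in simp)
qed

text \<open>A pointwise triangle inequality, averaged over the box: a constant matrix close to
  \<open>F\<close> in mean square inherits the mean square distance of \<open>F\<close> to
  \<open>SO3\<close>.\<close>

lemma dist_const_bound:
 fixes F :: "real^3 => real^3^3"
 assumes cF: "continuous_on UNIV F" and l: "!!i. l $ i > 0" and t: "t \<ge> 0"
  and d: "n2 l t (%x. infdist (F x) SO3) <= a" and A: "n2 l t (%x. F x - A) <= b"
 shows "(infdist A SO3)^2 <= (2*a + 2*b)/measure lborel (Qb l t)" "measure lborel (Qb l t) > 0"
proof -
 have p: "0 < (l + vec t) $ i" for i using l[of i] t by simp
 have p': "0 < (l + vec t) $ i - (- (l + vec t)) $ i" for i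
  using p[of i] unfolding vector_uminus_component by linarith
 have "cbox (- (l + vec t)) (l + vec t) \<noteq> {}"
  unfolding interval_ne_empty_cart
 proof
  fix i show "(- (l + vec t)) $ i <= (l + vec t) $ i" using p'[of i] by linarith
 qed
 then show m: "measure lborel (Qb l t) > 0"
  unfolding Qb_def content_cbox_cart[OF \<open>cbox _ _ \<noteq> {}\<close>] using p' by (intro prod_pos) simp
 have "n2 l t (%x. infdist A SO3) <= 2*n2 l t (%x. infdist (F x) SO3) + 2*n2 l t (%x. F x - A)"
 proof (intro n2_le2 continuous_intros cF)
  fix x show "norm (infdist A SO3) <= norm (infdist (F x) SO3) + norm (F x - A)"
   using infdist_SO3_diff[of A "F x"] infdist_nonneg[of A SO3] infdist_nonneg[of "F x" SO3]
   by (simp add: norm_minus_commute)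
 qed
 moreover have "n2 l t (%x. infdist A SO3) = measure lborel (Qb l t)*(infdist A SO3)^2"
  unfolding n2_def Qb_def by simp
 ultimately show "(infdist A SO3)^2 <= (2*a + 2*b)/measure lborel (Qb l t)"
  using m d A by (simp add: pos_le_divide_eq mult.commute)
qed

lemma zero_in_Qb: "(!!i. l $ i > 0) ==> s \<ge> 0 ==> 0 \<in> Qb l s"
 by (simp add: mem_Qb add_nonneg_nonneg less_imp_le)

lemma norm_mat_le_entries:
 fixes A :: "real^3^3"
 assumes "!!i j. \<bar>A $ i $ j\<bar> <= K"
 shows "norm A <= 9*K"
proof -
 have "norm (A $ i) <= 3*K" for i
  using norm_le_l1_cart[of "A $ i"] sum_mono[of UNIV "%j. \<bar>A $ i $ j\<bar>" "%j. K"] assms by (simp add: sum_3)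
 then show ?thesis using norm_le_rows[of A] by (smt (verit))
qed

lemma mol_mat_nth: "continuous_on UNIV F ==> mol r F x $ i $ j = mol r (%x. F x $ i $ j) x" for F :: "real^3 => real^3^3"
 by (subst mol_nth_mat, assumption, subst mol_nth) (auto intro!: continuous_intros)

text \<open>The Frobenius norm is constant on rotations, so the mollified square of
  \<open>F z - F x\<close>, expanded as a variance, only involves
  \<open>(norm F)\<^sup>2 - 3\<close> and \<open>F - mol F\<close>. Both are of first order in the
  defect and are integrated to the first power, which is why the squared derivatives come out of
  order \<open>e\<close> and not \<open>e^2\<close>.\<close>

lemma rigidity_oscillation:
 assumes l: "!!i. l $ i > 0" and r: "r > 0" and M: "M \<ge> 0"
 shows "\<exists>C\<ge>0. \<forall>v F e. gradM v F --> (\<forall>x\<in>Qb l (8*r). norm (F x) <= M) --> 0 < e -->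
  n2 l (8*r) (%x. infdist (F x) SO3) <= e^2 -->
  n2 l (6*r) (%x. F x - mol r F x) <= C*e^2 \<and>
  (\<forall>x\<in>Qb l (5*r). \<forall>i j. (norm (mol r (dmol r (%x. F x $ i $ j)) x))\<^sup>2 <= C*e)"
proof -
 have "0 \<in> Qb l (6*r)" by (rule zero_in_Qb[OF l]) (use r in simp)
 from gradient_mol_close[OF r this] obtain C0 where C0p: "C0 \<ge> 0" and C0': "\<forall>v F. gradM v F -->
  n2 l (6*r) (%x. F x - mol r F x) <= C0*n2 l (6*r + 2*r) (%x. F x - cof (F x))"
  by (elim exE conjE) (rule that)
 note C0 = C0'[rule_format] C0p
 define C1 where "C1 = C0*(19 + 3*M)^2"
 have C1: "C1 \<ge> 0" unfolding C1_def using C0(2) by simp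
 define C2 where "C2 = 2*((M + 2) * sqrt (measure lborel (Qb l (8*r))*1)) + 2*M * sqrt (measure lborel (Qb l (6*r))*C1)"
 have C2: "C2 \<ge> 0" unfolding C2_def using C1 M by simp
 define kd where "kd = 288/(kmass*r^2)"
 have kd: "kd \<ge> 0" unfolding kd_def using kmass_pos by simp
 define C3 where "C3 = 1/(kmass*r^3)*(kd*C2)"
 have k3: "1/(kmass*r^3) \<ge> 0" using kmass_pos r by simp
 have C3: "C3 \<ge> 0" unfolding C3_def using k3 kd C2 by simp
 have main: "n2 l (6*r) (%x. F x - mol r F x) <= (C1 + C3)*e^2 \<and>
  (\<forall>x\<in>Qb l (5*r). \<forall>i j. (norm (mol r (dmol r (%x. F x $ i $ j)) x))\<^sup>2 <= (C1 + C3)*e)"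
  if v: "gradM v F" and FM: "!!x. x \<in> Qb l (8*r) ==> norm (F x) <= M"
   and e: "0 < e" and d: "n2 l (8*r) (%x. infdist (F x) SO3) <= e^2" for v F and e :: real
 proof -
  have cF: "continuous_on UNIV F" by (rule gradM_cont[OF v])
  have cm: "continuous_on UNIV (mol r F)" by (rule mol_cont[OF cF])
  have cd: "continuous_on UNIV (%x. infdist (F x) SO3)" by (intro continuous_intros cF)
  have "n2 l (8*r) (%x. F x - cof (F x)) <= (19 + 3*M)^2*n2 l (8*r) (%x. infdist (F x) SO3)"
  proof (rule n2_le[OF _ cd])
   fix x assume "x \<in> Qb l (8*r)"
   from SO3_defect_bounds(1)[OF FM[OF this]]
   show "norm (F x - cof (F x)) <= (19 + 3*M)*norm (infdist (F x) SO3)" by (simp add: infdist_nonneg)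
  qed (intro continuous_intros cF)
  also have "... <= (19 + 3*M)^2*e^2" using d by (intro mult_left_mono) auto
  finally have g: "n2 l (8*r) (%x. F x - cof (F x)) <= (19 + 3*M)^2*e^2" .
  have "n2 l (6*r) (%x. F x - mol r F x) <= C0*n2 l (8*r) (%x. F x - cof (F x))"
   using C0(1)[OF v] by simp
  also have "... <= C0*((19 + 3*M)^2*e^2)" using g C0(2) by (intro mult_left_mono)
  finally have 1: "n2 l (6*r) (%x. F x - mol r F x) <= C1*e^2" by (simp add: C1_def mult_ac)
  define q where "q = (%x. (norm (F x))\<^sup>2 - 3)"
  have cq: "continuous_on UNIV q" unfolding q_def by (intro continuous_intros cF)
  have caq: "continuous_on UNIV (%x. \<bar>q x\<bar>)" by (intro continuous_intros cq)
  have cn: "continuous_on UNIV (%x. (norm (F x))\<^sup>2)" by (intro continuous_intros cF)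
  \<comment> \<open>The variance form of the mollified square of \<open>F z - F x\<close>; the
    identification is \<open>DE\<close>.\<close>
  define E where "E x = mol r (%x. (norm (F x))\<^sup>2) x - (norm (F x))^2 + 2*(F x \<bullet> (F x - mol r F x))" for x
  have cE: "continuous_on UNIV E" unfolding E_def by (intro continuous_intros cF mol_cont cn)
  have DE: "mol r (%z. (norm (F z - F x))\<^sup>2) x = E x" for x
  proof -
   have "(%z. (norm (F z - F x))\<^sup>2) = (%z. (norm (F z))\<^sup>2 - ((F z \<bullet> (2*\<^sub>R F x)) - (norm (F x))^2))"
    by (auto simp: power2_norm_eq_inner inner_diff_left inner_diff_right inner_commute algebra_simps)
   moreover have "mol r (%z. F z \<bullet> (2*\<^sub>R F x)) x = mol r F x \<bullet> (2*\<^sub>R F x)"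
    using mol_linear[OF cF bounded_linear_inner_left, where r=r and x=x] by metis
   ultimately have "mol r (%z. (norm (F z - F x))\<^sup>2) x
     = mol r (%x. (norm (F x))\<^sup>2) x - (mol r F x \<bullet> (2*\<^sub>R F x) - (norm (F x))^2)"
    by (simp add: mol_diff mol_const continuous_intros cF cn)
   then show ?thesis unfolding E_def by (simp add: power2_norm_eq_inner inner_diff_right inner_commute)
  qed
  have Ele: "E x <= mol r (%x. \<bar>q x\<bar>) x + \<bar>q x\<bar> + 2*M*norm (F x - mol r F x)" if x: "x \<in> Qb l (6*r)" for x
  proof -
   have "x \<in> Qb l (8*r)" using x Qb_mono[of "6*r" "8*r" l] r by auto
   then have Fx: "norm (F x) <= M" by (rule FM)
   have "mol r (%x. (norm (F x))\<^sup>2) x - 3 = mol r q x"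
    unfolding q_def by (simp add: mol_diff[OF cn] mol_const)
   moreover have "mol r q x <= mol r (%x. \<bar>q x\<bar>) x" by (rule mol_mono[OF cq caq]) simp
   moreover have "F x \<bullet> (F x - mol r F x) <= M*norm (F x - mol r F x)"
    using norm_cauchy_schwarz[of "F x" "F x - mol r F x"] mult_right_mono[OF Fx norm_ge_zero[of "F x - mol r F x"]] by linarith
   ultimately show ?thesis unfolding E_def q_def by linarith
  qed
  have "integral (Qb l (6*r)) E <= integral (Qb l (6*r)) (%x. (mol r (%x. \<bar>q x\<bar>) x + \<bar>q x\<bar>) + 2*M*norm (F x - mol r F x))"
   by (intro integral_le cont_integrable_Qb continuous_intros cE cq cF cm mol_cont Ele)
  also have "... = integral (Qb l (6*r)) (%x. mol r (%x. \<bar>q x\<bar>) x + \<bar>q x\<bar>) + integral (Qb l (6*r)) (%x. 2*M*norm (F x - mol r F x))"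
   by (intro integral_add cont_integrable_Qb continuous_intros cq cF cm mol_cont)
  also have "integral (Qb l (6*r)) (%x. mol r (%x. \<bar>q x\<bar>) x + \<bar>q x\<bar>) = integral (Qb l (6*r)) (mol r (%x. \<bar>q x\<bar>)) + integral (Qb l (6*r)) (%x. \<bar>q x\<bar>)"
   by (intro integral_add cont_integrable_Qb continuous_intros cq mol_cont)
  also have "integral (Qb l (6*r)) (%x. 2*M*norm (F x - mol r F x)) = 2*M*integral (Qb l (6*r)) (%x. norm (F x - mol r F x))"
   by simp
  finally have E1: "integral (Qb l (6*r)) E <= integral (Qb l (6*r)) (mol r (%x. \<bar>q x\<bar>)) + integral (Qb l (6*r)) (%x. \<bar>q x\<bar>)
   + 2*M*integral (Qb l (6*r)) (%x. norm (F x - mol r F x))" .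
  have q1: "integral (Qb l (6*r)) (mol r (%x. \<bar>q x\<bar>)) <= integral (Qb l (8*r)) (%x. \<bar>q x\<bar>)"
   by (rule integral_mol_le[OF caq]) (use r in auto)
  have q2: "integral (Qb l (6*r)) (%x. \<bar>q x\<bar>) <= integral (Qb l (8*r)) (%x. \<bar>q x\<bar>)"
   by (rule integral_Qb_mono[OF caq]) (use r in auto)
  have "integral (Qb l (8*r)) (%x. \<bar>q x\<bar>) <= integral (Qb l (8*r)) (%x. (M + 2)*\<bar>infdist (F x) SO3\<bar>)"
  proof (intro integral_le cont_integrable_Qb continuous_intros cq cF)
   fix x assume "x \<in> Qb l (8*r)"
   from SO3_defect_bounds(2)[OF FM[OF this]] show "\<bar>q x\<bar> <= (M + 2)*\<bar>infdist (F x) SO3\<bar>"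
    by (simp add: q_def infdist_nonneg)
  qed
  also have "... = (M + 2)*integral (Qb l (8*r)) (%x. \<bar>infdist (F x) SO3\<bar>)" by simp
  also have "... <= (M + 2)*(sqrt (measure lborel (Qb l (8*r))*1)*e)"
   using M d e by (intro mult_left_mono integral_abs_le_sqrt cd) auto
  finally have q3: "integral (Qb l (8*r)) (%x. \<bar>q x\<bar>) <= (M + 2)*(sqrt (measure lborel (Qb l (8*r))*1)*e)" .
  have q4: "integral (Qb l (6*r)) (%x. norm (F x - mol r F x)) <= sqrt (measure lborel (Qb l (6*r))*C1)*e"
   using integral_abs_le_sqrt[of "%x. norm (F x - mol r F x)" l "6*r" C1 e] 1 e C1
   by (simp add: n2_def continuous_intros cF cm)
  have E2: "integral (Qb l (6*r)) E <= C2*e"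
  proof -
   have "2*M*integral (Qb l (6*r)) (%x. norm (F x - mol r F x)) <= 2*M*(sqrt (measure lborel (Qb l (6*r))*C1)*e)"
    using q4 M by (intro mult_left_mono) auto
   moreover have "C2*e = 2*((M + 2)*(sqrt (measure lborel (Qb l (8*r))*1)*e)) + 2*M*(sqrt (measure lborel (Qb l (6*r))*C1)*e)"
    unfolding C2_def by (simp add: algebra_simps)
   ultimately show ?thesis using E1 q1 q2 q3 by linarith
  qed
  have 2: "(norm (mol r (dmol r (%x. F x $ i $ j)) x))^2 <= C3*e" if x: "x \<in> Qb l (5*r)" for x i j
  proof -
   let ?f = "%x. F x $ i $ j"
   have cf: "continuous_on UNIV ?f" by (intro continuous_intros cF)
   have cdm: "continuous_on UNIV (dmol r ?f)" by (rule grad1_cont_grad[OF grad1_mol[OF cf r]])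
   have cdn: "continuous_on UNIV (%x. (norm (dmol r ?f x))\<^sup>2)" by (intro continuous_intros cdm)
   have dE: "(norm (dmol r ?f x))^2 <= kd*E x" for x
   proof -
    have "(norm (dmol r ?f x))^2 <= kd*mol r (%z. (?f z - ?f x)\<^sup>2) x"
     unfolding kd_def by (rule dmol_sq_le[OF cf r])
    also have "... <= kd*mol r (%z. (norm (F z - F x))\<^sup>2) x"
    proof (intro mult_left_mono[OF _ kd] mol_mono continuous_intros cF)
     fix z
     have "\<bar>(F z - F x) $ i $ j\<bar> <= norm ((F z - F x) $ i)" by (rule component_le_norm_cart)
     also have "... <= norm (F z - F x)" by (rule norm_row_le)
     finally show "(F z $ i $ j - F x $ i $ j)^2 <= (norm (F z - F x))^2"
      using power_mono[of "\<bar>(F z - F x) $ i $ j\<bar>" "norm (F z - F x)" 2] by simp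
    qed
    finally show ?thesis by (simp add: DE)
   qed
   have "(norm (mol r (dmol r ?f) x))^2 <= mol r (%x. (norm (dmol r ?f x))\<^sup>2) x" by (rule mol_sq_le[OF cdm])
   also have "... <= 1/(kmass*r^3)*integral (Qb l (6*r)) (%x. (norm (dmol r ?f x))\<^sup>2)"
    by (rule mol_sup_le[OF cdn _ r x]) (use r in auto)
   also have "... <= 1/(kmass*r^3)*integral (Qb l (6*r)) (%x. kd*E x)"
    by (intro mult_left_mono[OF _ k3] integral_le cont_integrable_Qb continuous_intros cdm cE dE)
   also have "... = 1/(kmass*r^3)*(kd*integral (Qb l (6*r)) E)" by simp
   also have "... <= 1/(kmass*r^3)*(kd*(C2*e))"
    by (intro mult_left_mono[OF _ k3] mult_left_mono[OF _ kd] E2)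
   finally show ?thesis by (simp add: C3_def)
  qed
  show ?thesis
  proof (intro conjI ballI allI)
   have "C1*e^2 <= (C1 + C3)*e^2" using C3 by (intro mult_right_mono) auto
   with 1 show "n2 l (6*r) (%x. F x - mol r F x) <= (C1 + C3)*e^2" by linarith
   fix x i j assume x: "x \<in> Qb l (5*r)"
   have "C3*e <= (C1 + C3)*e" using C1 e by (intro mult_right_mono) auto
   with 2[OF x, of i j] show "(norm (mol r (dmol r (%x. F x $ i $ j)) x))^2 <= (C1 + C3)*e" by linarith
  qed
 qed
 show ?thesis
  by (intro exI[of _ "C1 + C3"] conjI allI impI main) (use C1 C3 in auto)
qed


lemma n2_sup_le:
 fixes f :: "real^3 => 'b::euclidean_space"
 assumes "continuous_on UNIV f" "!!x. x \<in> Qb l t ==> norm (f x) <= c"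
 shows "n2 l t f <= measure lborel (Qb l t)*c^2"
proof -
 have "n2 l t f <= integral (Qb l t) (%x. c\<^sup>2)"
  unfolding n2_def using assms(2)
  by (intro integral_le cont_integrable_Qb continuous_intros assms(1) power_mono) auto
 then show ?thesis by (simp add: Qb_def)
qed

lemma dmol_affine_comb:
 assumes "continuous_on UNIV f" "continuous_on UNIV g"
 shows "dmol r (%x. (f x + g x)/2 - c) x $ k = (dmol r f x $ k + dmol r g x $ k)/2"
proof -
 let ?I = "%f. integral B1 (%y. f (x + r*\<^sub>R y)*dker y $ k)"
 have i: "(%y. f (x + r*\<^sub>R y)*dker y $ k) integrable_on B1" if "continuous_on UNIV f" for f :: "real^3 => real"
  by (intro integrable_continuous continuous_intros cont_param[OF that] cont_ker)
 have h: "((%y. f (x + r*\<^sub>R y)*dker y $ k) has_integral ?I f) B1" if "continuous_on UNIV f" for f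
  by (rule integrable_integral[OF i[OF that]])
 have d: "((%y. dker y $ k) has_integral 0) B1"
  using integrable_integral[OF integrable_continuous, of "-1" 1 "%y. dker y $ k"] integral_dker[of k]
  by (simp add: continuous_intros cont_ker)
 have "((%y. (1/2)*(f (x + r*\<^sub>R y)*dker y $ k) + (1/2)*(g (x + r*\<^sub>R y)*dker y $ k) - c*dker y $ k)
   has_integral ((1/2) * ?I f + (1/2) * ?I g - c*0)) B1"
  by (intro has_integral_add has_integral_diff has_integral_mult_right h d assms)
 moreover have "(%y. (1/2)*(f (x + r*\<^sub>R y)*dker y $ k) + (1/2)*(g (x + r*\<^sub>R y)*dker y $ k) - c*dker y $ k)
  = (%y. ((f (x + r*\<^sub>R y) + g (x + r*\<^sub>R y))/2 - c)*dker y $ k)"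
  by (auto simp: algebra_simps add_divide_distrib)
 ultimately have "?I (%x. (f x + g x)/2 - c) = (?I f + ?I g)/2"
  by (simp add: integral_unique)
 moreover have "continuous_on UNIV (%x. (f x + g x)/2 - c)" by (intro continuous_intros assms) auto
 ultimately show ?thesis
  by (simp add: dmol_nth assms algebra_simps add_divide_distrib)
qed

lemma transpose_mult_cancel:
 assumes "R \<in> SO3"
 shows "R ** (transpose R ** A) = A" "transpose R ** (R ** A) = A"
 using SO3_D(1,2)[OF assms] by (simp_all add: matrix_mul_assoc)

lemma norm_SO3_mult: "R \<in> SO3 ==> norm (R ** A) = norm A" for A :: "real^3^3"
 by (rule norm_orthogonal_mult[OF SO3_D(4)])

lemma bounded_linear_matrix_mult: "bounded_linear (%A::real^3^3. (R::real^3^3) ** A)"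
 by (rule bounded_linear_intro[where K="norm R"])
  (use norm_matrix_mult_le[of R] in \<open>auto simp: matrix_add_mult mult.commute
   matrix_matrix_mult_def vec_eq_iff sum_distrib_left sum.distrib algebra_simps\<close>)

lemma gradM_left_mult:
 assumes "gradM v F"
 shows "gradM (%x. A *v v x) (%x. A ** F x)"
 unfolding gradM_def
proof
 fix i
 have "grad1 (%x. \<Sum>k\<in>UNIV. A $ i $ k * v x $ k) (%x. \<Sum>k\<in>UNIV. A $ i $ k*\<^sub>R F x $ k)"
  by (intro grad1_sum grad1_cmult gradM_nth[OF assms])
 then show "grad1 (%x. (A *v v x) $ i) (%x. (A ** F x) $ i)"
  by (rule grad1_cong) (auto simp: matrix_vector_mult_def matrix_matrix_mult_def vec_eq_iff)
qed

lemma sqrt_mult_le: "a^2 <= c*e ==> 0 <= c ==> 0 <= e ==> a <= sqrt c * sqrt e"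
 by (metis real_le_rsqrt real_sqrt_mult)

lemma sqrt_mult_sq_le: "a^2 <= c*e^2 ==> 0 <= c ==> 0 <= e ==> a <= sqrt c*e"
 using sqrt_mult_le[of a c "e^2"] by simp

text \<open>The doubly mollified gradient has derivatives of order \<open>sqrt e\<close> at every
  point, so it is that close to its value at the origin, and averaging shows this value to be that
  close to a rotation. The rate is not optimal; its purpose is to make quadratic errors of order
  \<open>e\<close>.\<close>

lemma rigidity_close_to_rotation:
 assumes l: "!!i. l $ i > 0" and r: "r > 0" and M: "M \<ge> 0"
 shows "\<exists>C\<ge>0. \<forall>v F e. gradM v F --> (\<forall>x\<in>Qb l (8*r). norm (F x) <= M) --> 0 < e --> e <= 1 -->
  n2 l (8*r) (%x. infdist (F x) SO3) <= e^2 -->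
  n2 l (6*r) (%x. F x - mol r F x) <= C*e^2 \<and>
  n2 l (5*r) (%x. F x - mol r (mol r F) x) <= C*e^2 \<and>
  n2 l (5*r) (%x. infdist (mol r (mol r F) x) SO3) <= C*e^2 \<and>
  (\<exists>R\<in>SO3. \<forall>x\<in>Qb l (5*r). norm (mol r (mol r F) x - R) <= C * sqrt e)"
proof -
 from rigidity_oscillation[OF l r M] obtain C where C0: "C \<ge> 0" and C': "\<forall>v F e. gradM v F --> (\<forall>x\<in>Qb l (8*r). norm (F x) <= M) --> 0 < e -->
  n2 l (8*r) (%x. infdist (F x) SO3) <= e^2 -->
  n2 l (6*r) (%x. F x - mol r F x) <= C*e^2 \<and>
  (\<forall>x\<in>Qb l (5*r). \<forall>i j. (norm (mol r (dmol r (%x. F x $ i $ j)) x))\<^sup>2 <= C*e)"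
  by (elim exE conjE) (rule that)
 define Lr where "Lr = (\<Sum>i\<in>UNIV. l $ i + 5*r)"
 have Lr: "Lr \<ge> 0" unfolding Lr_def using l r by (intro sum_nonneg add_nonneg_nonneg) (auto intro: less_imp_le)
 define m where "m = measure lborel (Qb l (5*r))"
 define K1 where "K1 = 9*(sqrt C*Lr)"
 define K2 where "K2 = 2 + 8*C"
 define K3 where "K3 = (2*K2 + 2*(m*K1^2))/m"
 define K4 where "K4 = K1 + sqrt K3"
 have m: "m > 0" unfolding m_def
  by (rule dist_const_bound(2)[OF continuous_on_const l _ order_refl order_refl]) (use r in auto)
 have K: "K1 \<ge> 0" "K2 \<ge> 0" "K3 \<ge> 0" "K4 \<ge> 0" unfolding K1_def K2_def K3_def K4_def using Lr C0 m by auto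
 have main: "n2 l (6*r) (%x. F x - mol r F x) <= C*e^2 \<and>
  n2 l (5*r) (%x. F x - mol r (mol r F) x) <= (4*C)*e^2 \<and>
  n2 l (5*r) (%x. infdist (mol r (mol r F) x) SO3) <= K2*e^2 \<and>
  (\<exists>R\<in>SO3. \<forall>x\<in>Qb l (5*r). norm (mol r (mol r F) x - R) <= K4 * sqrt e)"
  if v: "gradM v F" and FM: "\<forall>x\<in>Qb l (8*r). norm (F x) <= M" and e: "0 < e" "e <= 1"
   and d: "n2 l (8*r) (%x. infdist (F x) SO3) <= e^2" for v F and e :: real
 proof -
  note O = C'[rule_format, OF v FM[rule_format] e(1) d]
  define F1 where "F1 = mol r F"
  define F2 where "F2 = mol r F1"
  have cF: "continuous_on UNIV F" by (rule gradM_cont[OF v])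
  have cF1: "continuous_on UNIV F1" unfolding F1_def by (rule mol_cont[OF cF])
  have cF2: "continuous_on UNIV F2" unfolding F2_def by (rule mol_cont[OF cF1])
  have cd: "continuous_on UNIV (%x. F x - F1 x)" by (intro continuous_intros cF cF1)
  have b0: "n2 l (6*r) (%x. F x - F1 x) <= C*e^2" using O by (simp add: F1_def)
  have "n2 l (5*r) (%x. F x - F2 x) <= 2*n2 l (5*r) (%x. F x - F1 x) + 2*n2 l (5*r) (mol r (%x. F x - F1 x))"
  proof (rule n2_le2[OF _ cd mol_cont[OF cd]])
   fix x
   have "F x - F2 x = (F x - F1 x) + mol r (%x. F x - F1 x) x"
    by (simp add: mol_diff[OF cF cF1] F2_def) (simp add: F1_def)
   then show "norm (F x - F2 x) <= norm (F x - F1 x) + norm (mol r (%x. F x - F1 x) x)"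
    by (metis norm_triangle_ineq)
  qed (intro continuous_intros cF cF2)
  also have "... <= 4*n2 l (6*r) (%x. F x - F1 x)"
   using n2_mol_le[OF cd, of r "5*r" "6*r" l] n2_mono[OF cd, of "5*r" "6*r" l] r by simp
  finally have b: "n2 l (5*r) (%x. F x - F2 x) <= (4*C)*e^2" using b0 by simp
  have "n2 l (5*r) (%x. infdist (F2 x) SO3) <= 2*n2 l (5*r) (%x. infdist (F x) SO3) + 2*n2 l (5*r) (%x. F x - F2 x)"
  proof (intro n2_le2 continuous_intros cF cF2)
   fix x show "norm (infdist (F2 x) SO3) <= norm (infdist (F x) SO3) + norm (F x - F2 x)"
    using infdist_SO3_diff[of "F2 x" "F x"] infdist_nonneg[of "F2 x" SO3] infdist_nonneg[of "F x" SO3]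
    by (simp add: norm_minus_commute)
  qed
  moreover have "n2 l (5*r) (%x. infdist (F x) SO3) <= n2 l (8*r) (%x. infdist (F x) SO3)"
   using r by (intro n2_mono continuous_intros cF) auto
  ultimately have c: "n2 l (5*r) (%x. infdist (F2 x) SO3) <= K2*e^2"
   using b d by (simp add: K2_def algebra_simps)
  have z: "0 \<in> Qb l (5*r)" by (rule zero_in_Qb[OF l]) (use r in simp)
  have A: "norm (F2 x - F2 0) <= K1 * sqrt e" if x: "x \<in> Qb l (5*r)" for x
  proof -
   have "\<bar>(F2 x - F2 0) $ i $ j\<bar> <= sqrt C * sqrt e*Lr" for i j
   proof -
    let ?f = "%x. F x $ i $ j"
    have cf: "continuous_on UNIV ?f" by (intro continuous_intros cF)
    have F2f: "F2 x $ i $ j = mol r (mol r ?f) x" for x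
    proof -
     have "F2 x $ i $ j = mol r (%x. F1 x $ i $ j) x" unfolding F2_def by (rule mol_mat_nth[OF cF1])
     also have "(%x. F1 x $ i $ j) = mol r ?f" unfolding F1_def by (rule ext) (rule mol_mat_nth[OF cF])
     finally show ?thesis .
    qed
    have g: "grad1 (mol r (mol r ?f)) (mol r (dmol r ?f))" by (rule mol_grad[OF grad1_mol[OF cf r]])
    have n: "norm (mol r (dmol r ?f) x) <= sqrt C * sqrt e" if "x \<in> Qb l (5*r)" for x
     using O that C0 e by (intro sqrt_mult_le) auto
    show ?thesis using grad1_lipschitz_Qb[OF g n x z] by (simp add: F2f Lr_def)
   qed
   from norm_mat_le_entries[OF this] show ?thesis by (simp add: K1_def mult_ac)
  qed
  have "n2 l (5*r) (%x. F2 x - F2 0) <= m*(K1 * sqrt e)^2"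
   unfolding m_def by (intro n2_sup_le continuous_intros cF2 A)
  then have "n2 l (5*r) (%x. F2 x - F2 0) <= m*K1^2*e" using e by (simp add: power_mult_distrib)
  from dist_const_bound(1)[OF cF2 l _ c this]
  have "(infdist (F2 0) SO3)^2 <= (2*(K2*e^2) + 2*(m*K1^2*e))/m" using r by (simp add: m_def)
  also have "... <= (2*(K2*e) + 2*(m*K1^2*e))/m"
   using m K e by (intro divide_right_mono add_right_mono mult_left_mono) (auto simp: power2_eq_square mult_left_le)
  also have "... = K3*e" by (simp add: K3_def algebra_simps)
  finally have id: "infdist (F2 0) SO3 <= sqrt K3 * sqrt e" using K e by (intro sqrt_mult_le) auto
  obtain R where R: "R \<in> SO3" "infdist (F2 0) SO3 = norm (F2 0 - R)" by (rule SO3_nearest)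
  have "norm (F2 x - R) <= K4 * sqrt e" if "x \<in> Qb l (5*r)" for x
   using norm_triangle_ineq[of "F2 x - F2 0" "F2 0 - R"] A[OF that] id R(2) by (simp add: K4_def algebra_simps)
  then show ?thesis using b0 b c R(1) unfolding F1_def F2_def by blast
 qed
 define C4 where "C4 = 4*C + K2 + K4"
 have le: "C <= C4" "4*C <= C4" "K2 <= C4" "K4 <= C4" unfolding C4_def using C0 K by auto
 show ?thesis
 proof (intro exI[of _ C4] conjI allI impI)
  show "C4 \<ge> 0" using le C0 by simp
  fix v F and e :: real assume a: "gradM v F" "\<forall>x\<in>Qb l (8*r). norm (F x) <= M" "0 < e" "e <= 1"
   "n2 l (8*r) (%x. infdist (F x) SO3) <= e^2"
  note mm = main[OF a]
  have e2: "c*e^2 <= C4*e^2" if "c <= C4" for c using that by (intro mult_right_mono) auto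
  show "n2 l (6*r) (%x. F x - mol r F x) <= C4*e^2" using mm e2[OF le(1)] by linarith
  show "n2 l (5*r) (%x. F x - mol r (mol r F) x) <= C4*e^2" using mm e2[OF le(2)] by linarith
  show "n2 l (5*r) (%x. infdist (mol r (mol r F) x) SO3) <= C4*e^2" using mm e2[OF le(3)] by linarith
  have "K4 * sqrt e <= C4 * sqrt e" using le(4) a(3) by (intro mult_right_mono) auto
  then show "\<exists>R\<in>SO3. \<forall>x\<in>Qb l (5*r). norm (mol r (mol r F) x - R) <= C4 * sqrt e"
   using mm by (meson order_trans)
 qed
qed

text \<open>All second derivatives of a displacement are combinations of first derivatives of its
  strain. \<open>D i j k\<close> stands for the derivative in direction \<open>k\<close> of the
  gradient entry \<open>i j\<close>, and \<open>E\<close> for the same of the symmetrized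
  gradient.\<close>

lemma Korn_symmetric_gradient:
 fixes D E :: "3 => 3 => 3 => real"
 assumes "!!i j k. D i j k = D i k j" "!!i j k. E i j k = (D i j k + D j i k)/2"
 shows "D i j k = E i j k + E i k j - E j k i"
 using assms(1)[of i j k] assms(1)[of j i k] assms(1)[of k i j] by (simp add: assms(2) field_simps)

text \<open>Improves the rate from \<open>sqrt e\<close> to \<open>e\<close>. After removing the
  rotation already found, the strain is at most the distance to \<open>SO3\<close> plus the square
  of a quantity of order \<open>sqrt e\<close>. Korn's identity turns smallness of the strain into
  smallness of all derivatives of one more mollification, which is thus almost constant. The margins
  \<open>8*r\<close>, \<open>6*r\<close>, \<open>5*r\<close>, \<open>4*r\<close> record the
  mollifications spent.\<close>

lemma bounded_rigidity:
 assumes l: "!!i. l $ i > 0" and r: "r > 0" and M: "M \<ge> 0"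
 shows "\<exists>C\<ge>0. \<forall>v F e. gradM v F --> (\<forall>x\<in>Qb l (8*r). norm (F x) <= M) --> 0 < e --> e <= 1 -->
  n2 l (8*r) (%x. infdist (F x) SO3) <= e^2 --> (\<exists>R\<in>SO3. n2 l 0 (%x. F x - R) <= C*e^2)"
proof -
 from rigidity_close_to_rotation[OF l r M] obtain C where C0: "C \<ge> 0" and C': "\<forall>v F e. gradM v F --> (\<forall>x\<in>Qb l (8*r). norm (F x) <= M) --> 0 < e --> e <= 1 -->
  n2 l (8*r) (%x. infdist (F x) SO3) <= e^2 -->
  n2 l (6*r) (%x. F x - mol r F x) <= C*e^2 \<and>
  n2 l (5*r) (%x. F x - mol r (mol r F) x) <= C*e^2 \<and>
  n2 l (5*r) (%x. infdist (mol r (mol r F) x) SO3) <= C*e^2 \<and>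
  (\<exists>R\<in>SO3. \<forall>x\<in>Qb l (5*r). norm (mol r (mol r F) x - R) <= C * sqrt e)"
  by (elim exE conjE) (rule that)
 define m5 where "m5 = measure lborel (Qb l (5*r))"
 define m4 where "m4 = measure lborel (Qb l (4*r))"
 have m4: "m4 > 0" unfolding m4_def
  by (rule dist_const_bound(2)[OF continuous_on_const l _ order_refl order_refl]) (use r in auto)
 define Lr where "Lr = (\<Sum>i\<in>UNIV. l $ i + 4*r)"
 have Lr: "Lr \<ge> 0" unfolding Lr_def using l r by (intro sum_nonneg add_nonneg_nonneg) (auto intro: less_imp_le)
 define K5 where "K5 = 2*C + 2*(m5*(4*C^2)^2)"
 define kd where "kd = 288/(kmass*r^2)"
 define kk where "kk = 1/(kmass*r^3)"
 have kd: "kd \<ge> 0" "kk \<ge> 0" unfolding kd_def kk_def using kmass_pos r by simp_all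
 define K6 where "K6 = sqrt (kd * kk*K5)"
 define K7 where "K7 = 9*(9*K6*Lr)"
 define K8 where "K8 = 2*C + 2*(2*C + 2*(m4*K7^2))"
 define K9 where "K9 = (2*1 + 2*K8)/m4"
 have K: "K5 \<ge> 0" "K6 \<ge> 0" "K7 \<ge> 0" "K8 \<ge> 0" "K9 \<ge> 0"
  unfolding K5_def K6_def K7_def K8_def K9_def m5_def using C0 kd Lr m4 by (auto simp: K5_def[symmetric])
 have main: "\<exists>R\<in>SO3. n2 l 0 (%x. F x - R) <= (2*K8 + 2*(m4*K9))*e^2"
  if v: "gradM v F" and FM: "\<forall>x\<in>Qb l (8*r). norm (F x) <= M" and e: "0 < e" "e <= 1"
   and d: "n2 l (8*r) (%x. infdist (F x) SO3) <= e^2" for v F and e :: real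
 proof -
  define F1 where "F1 = mol r F"
  define F2 where "F2 = mol r F1"
  note O = C'[rule_format, OF v FM[rule_format] e d, folded F1_def, folded F2_def]
  obtain R where R: "R \<in> SO3" and FR: "!!x. x \<in> Qb l (5*r) ==> norm (F2 x - R) <= C * sqrt e"
   using O by auto
  have cF: "continuous_on UNIV F" by (rule gradM_cont[OF v])
  have cF1: "continuous_on UNIV F1" unfolding F1_def by (rule mol_cont[OF cF])
  have cF2: "continuous_on UNIV F2" unfolding F2_def by (rule mol_cont[OF cF1])
  have cF3: "continuous_on UNIV (mol r F2)" by (rule mol_cont[OF cF2])
  define B where "B = (%x. transpose R ** F2 x)"
  have gB: "gradM (%x. transpose R *v mol r (mol r v) x) B"
   unfolding B_def F2_def F1_def by (intro gradM_left_mult gradM_mol v)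
  have cB: "continuous_on UNIV B" by (rule gradM_cont[OF gB])
  have cBij: "continuous_on UNIV (%x. B x $ i $ j)" for i j by (intro continuous_intros cB)
  have RT: "transpose R \<in> SO3" by (rule SO3_transpose[OF R])
  have B1': "norm (B x - mat 1) = norm (F2 x - R)" for x
   using norm_SO3_mult[OF RT, of "F2 x - R"] by (simp add: B_def matrix_diff_mult SO3_D(1)[OF R])
  have Bd: "infdist (B x) SO3 = infdist (F2 x) SO3" for x unfolding B_def by (rule infdist_SO3_mult[OF RT])
  define S where "S = (%x. symm (B x) - mat 1)"
  have Sij: "S x $ i $ j = (B x $ i $ j + B x $ j $ i)/2 - mat 1 $ i $ j" for x i j
   by (simp add: S_def symm_def transpose_def)
  have cS: "continuous_on UNIV S"
   unfolding S_def symm_def transpose_def by (intro continuous_intros cB continuous_on_vec_lambda)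
  have cSij: "continuous_on UNIV (%x. S x $ i $ j)" for i j by (intro continuous_intros cS)
  \<comment> \<open>Distance and deviation are each at most \<open>C * sqrt e\<close>, so the
    quadratic error is \<open>(2*C*sqrt e)^2\<close>.\<close>
  have "n2 l (5*r) S <= 2*n2 l (5*r) (%x. infdist (F2 x) SO3) + 2*n2 l (5*r) (%x. 4*C^2*e)"
  proof (intro n2_le2 continuous_intros cS cF2)
   fix x assume x: "x \<in> Qb l (5*r)"
   let ?d = "infdist (F2 x) SO3"
   have dx: "?d <= C * sqrt e" using infdist_SO3_le[OF R, of "F2 x"] FR[OF x] by linarith
   have "norm (S x) <= ?d + (?d + norm (B x - mat 1))^2"
    using symm_defect_bound[of "B x"] by (simp add: S_def Bd)
   also have "... <= ?d + (C * sqrt e + C * sqrt e)^2"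
    using dx FR[OF x] by (intro add_left_mono power_mono add_mono) (auto simp: B1' infdist_nonneg)
   also have "(C * sqrt e + C * sqrt e)^2 = 4*C^2*e" using e by (simp add: power2_eq_square algebra_simps)
   finally show "norm (S x) <= norm ?d + norm (4*C^2*e)" using e by (simp add: infdist_nonneg)
  qed
  also have "n2 l (5*r) (%x. 4*C^2*e) <= m5*(4*C^2*e)^2"
   unfolding m5_def using e by (intro n2_sup_le continuous_intros) auto
  finally have "n2 l (5*r) S <= 2*n2 l (5*r) (%x. infdist (F2 x) SO3) + 2*(m5*(4*C^2*e)^2)" by simp
  then have S5: "n2 l (5*r) S <= K5*e^2" using O by (simp add: K5_def power_mult_distrib algebra_simps)
  have E: "norm (dmol r (%x. S x $ i $ j) x) <= K6*e" if x: "x \<in> Qb l (4*r)" for x i j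
  proof -
   have "(norm (dmol r (%x. S x $ i $ j) x))^2 <= kd*mol r (%z. (S z $ i $ j - 0)\<^sup>2) x"
    unfolding kd_def by (rule dmol_sq_le[OF cSij r])
   also have "mol r (%z. (S z $ i $ j - 0)\<^sup>2) x <= mol r (%z. (norm (S z))\<^sup>2) x"
   proof (intro mol_mono continuous_intros cS)
    fix z
    have "\<bar>S z $ i $ j\<bar> <= norm (S z)" using component_le_norm_cart[of "S z $ i" j] norm_row_le[of "S z" i] by linarith
    from power_mono[OF this, of 2] show "(S z $ i $ j - 0)^2 <= (norm (S z))^2" by simp
   qed
   also have "... <= kk*integral (Qb l (5*r)) (%z. (norm (S z))\<^sup>2)"
    unfolding kk_def by (rule mol_sup_le[OF _ _ r x]) (use r in \<open>auto intro!: continuous_intros cS\<close>)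
   also have "... <= kk*(K5*e^2)" using S5 kd by (intro mult_left_mono) (auto simp: n2_def)
   finally have "(norm (dmol r (%x. S x $ i $ j) x))^2 <= (kd * kk*K5)*e^2" using kd by (simp add: mult_left_mono mult.assoc)
   then show ?thesis unfolding K6_def using kd K e by (intro sqrt_mult_sq_le) auto
  qed
  have D: "norm (dmol r (%x. B x $ i $ j) x) <= 9*K6*e" if x: "x \<in> Qb l (4*r)" for x i j
  proof -
   have k: "\<bar>dmol r (%x. B x $ i $ j) x $ k\<bar> <= 3*K6*e" for k
   proof -
    have eq: "dmol r (%x. B x $ i $ j) x $ k = dmol r (%x. S x $ i $ j) x $ k + dmol r (%x. S x $ i $ k) x $ j - dmol r (%x. S x $ j $ k) x $ i"
    proof (rule Korn_symmetric_gradient[where D="%i j k. dmol r (%x. B x $ i $ j) x $ k" and E="%i j k. dmol r (%x. S x $ i $ j) x $ k"])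
     fix i j k
     show "dmol r (%x. B x $ i $ j) x $ k = dmol r (%x. B x $ i $ k) x $ j"
      by (rule dmol_sym[OF gradM_nth[OF gB] r])
     show "dmol r (%x. S x $ i $ j) x $ k = (dmol r (%x. B x $ i $ j) x $ k + dmol r (%x. B x $ j $ i) x $ k)/2"
      unfolding Sij by (rule dmol_affine_comb[OF cBij cBij])
    qed
    have "\<bar>dmol r (%x. S x $ a $ b) x $ c\<bar> <= K6*e" for a b c
     using component_le_norm_cart[of "dmol r (%x. S x $ a $ b) x" c] E[OF x, of a b] by linarith
    from this[of i j k] this[of i k j] this[of j k i] show ?thesis unfolding eq by linarith
   qed
   show ?thesis
    using norm_le_l1_cart[of "dmol r (%x. B x $ i $ j) x"] k[of 1] k[of 2] k[of 3] by (simp add: sum_3)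
  qed
  have z: "0 \<in> Qb l (4*r)" by (rule zero_in_Qb[OF l]) (use r in simp)
  define A where "A = mol r B 0"
  have BA: "norm (mol r B x - A) <= K7*e" if x: "x \<in> Qb l (4*r)" for x
  proof -
   have "\<bar>(mol r B x - A) $ i $ j\<bar> <= 9*K6*e*Lr" for i j
    using grad1_lipschitz_Qb[OF grad1_mol[OF cBij r] D x z] by (simp add: A_def mol_mat_nth[OF cB] Lr_def)
   from norm_mat_le_entries[OF this] show ?thesis by (simp add: K7_def mult_ac)
  qed
  have F3: "mol r F2 x = R ** mol r B x" for x
  proof -
   have "transpose R ** mol r F2 x = mol r B x"
    unfolding B_def by (rule mol_linear[OF cF2 bounded_linear_matrix_mult])
   then show ?thesis using transpose_mult_cancel(1)[OF R, of "mol r F2 x"] by simp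
  qed
  have h1: "n2 l (4*r) (%x. mol r F2 x - R ** A) <= m4*(K7*e)^2"
   unfolding m4_def
  proof (rule n2_sup_le)
   fix x assume "x \<in> Qb l (4*r)"
   from BA[OF this] show "norm (mol r F2 x - R ** A) <= K7*e"
    using norm_SO3_mult[OF R, of "mol r B x - A"] by (simp add: F3 matrix_diff_mult)
  qed (intro continuous_intros cF3)
  have cd: "continuous_on UNIV (%x. F x - F1 x)" by (intro continuous_intros cF cF1)
  have h2: "n2 l (4*r) (%x. F2 x - mol r F2 x) <= C*e^2"
  proof -
   have "(%x. F2 x - mol r F2 x) = mol r (mol r (%x. F x - F1 x))"
   proof
    fix x
    have "mol r (%x. F x - F1 x) = (%x. F1 x - F2 x)"
     by (rule ext) (simp add: mol_diff[OF cF cF1] F2_def, simp add: F1_def)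
    then show "F2 x - mol r F2 x = mol r (mol r (%x. F x - F1 x)) x"
     by (simp add: mol_diff[OF cF1 cF2]) (simp add: F2_def)
   qed
   then have "n2 l (4*r) (%x. F2 x - mol r F2 x) <= n2 l (5*r) (mol r (%x. F x - F1 x))"
    using n2_mol_le[OF mol_cont[OF cd], of r "4*r" "5*r" l] r by simp
   also have "... <= n2 l (6*r) (%x. F x - F1 x)"
    using n2_mol_le[OF cd, of r "5*r" "6*r" l] r by simp
   finally show ?thesis using O by simp
  qed
  have h3: "n2 l (4*r) (%x. F2 x - R ** A) <= 2*n2 l (4*r) (%x. F2 x - mol r F2 x) + 2*n2 l (4*r) (%x. mol r F2 x - R ** A)"
  proof (intro n2_le2 continuous_intros cF2 cF3)
   fix x show "norm (F2 x - R ** A) <= norm (F2 x - mol r F2 x) + norm (mol r F2 x - R ** A)"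
    using norm_triangle_ineq[of "F2 x - mol r F2 x" "mol r F2 x - R ** A"] by simp
  qed
  have h4: "n2 l (4*r) (%x. F x - R ** A) <= 2*n2 l (4*r) (%x. F x - F2 x) + 2*n2 l (4*r) (%x. F2 x - R ** A)"
  proof (intro n2_le2 continuous_intros cF cF2)
   fix x show "norm (F x - R ** A) <= norm (F x - F2 x) + norm (F2 x - R ** A)"
    using norm_triangle_ineq[of "F x - F2 x" "F2 x - R ** A"] by simp
  qed
  have h5: "n2 l (4*r) (%x. F x - F2 x) <= C*e^2"
   using n2_mono[of "%x. F x - F2 x" "4*r" "5*r" l] O r by (simp add: continuous_intros cF cF2)
  have h6: "n2 l (4*r) (%x. F x - R ** A) <= K8*e^2"
   using h1 h2 h3 h4 h5 by (simp add: K8_def algebra_simps)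
  have "n2 l (4*r) (%x. infdist (F x) SO3) <= n2 l (8*r) (%x. infdist (F x) SO3)"
   using r by (intro n2_mono continuous_intros cF) auto
  then have h7: "n2 l (4*r) (%x. infdist (F x) SO3) <= e^2" using d by simp
  \<comment> \<open>The constant \<open>R ** A\<close> need not be a rotation; replacing it by the
    nearest one costs only \<open>O(e)\<close>.\<close>
  from dist_const_bound(1)[OF cF l _ h7 h6] have "(infdist (R ** A) SO3)^2 <= K9*e^2"
   using r by (simp add: K9_def m4_def algebra_simps)
  moreover obtain R' where R': "R' \<in> SO3" "infdist (R ** A) SO3 = norm (R ** A - R')" by (rule SO3_nearest)
  ultimately have n: "norm (R ** A - R') <= sqrt K9*e" using K e by (intro sqrt_mult_sq_le) auto
  have "n2 l 0 (%x. F x - R') <= n2 l (4*r) (%x. F x - R')"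
   using r by (intro n2_mono continuous_intros cF) auto
  also have "... <= 2*n2 l (4*r) (%x. F x - R ** A) + 2*n2 l (4*r) (%x. R ** A - R')"
  proof (intro n2_le2 continuous_intros cF)
   fix x show "norm (F x - R') <= norm (F x - R ** A) + norm (R ** A - R')"
    using norm_triangle_ineq[of "F x - R ** A" "R ** A - R'"] by simp
  qed
  also have "n2 l (4*r) (%x. R ** A - R') <= m4*(sqrt K9*e)^2"
   unfolding m4_def using n by (intro n2_sup_le continuous_intros) auto
  finally have "n2 l 0 (%x. F x - R') <= 2*n2 l (4*r) (%x. F x - R ** A) + 2*(m4*(sqrt K9*e)^2)" by simp
  then have "n2 l 0 (%x. F x - R') <= (2*K8 + 2*(m4*K9))*e^2"
   using h6 K by (simp add: power_mult_distrib algebra_simps)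
  then show ?thesis using R'(1) by blast
 qed
 show ?thesis
  by (intro exI[of _ "2*K8 + 2*(m4*K9)"] conjI allI impI main) (use K m4 in auto)
qed

section \<open>Truncation and interior rigidity\<close>

lemma nn_integral_cbox_continuous:
 fixes f :: "real^3 => real"
 assumes f: "continuous_on UNIV f" "!!x. 0 <= f x"
 shows "(nnI (%x. ennreal (f x)*indicator (cbox a b) x)) = ennreal (integral (cbox a b) f)"
proof -
 have i: "set_integrable lborel (cbox a b) f"
  unfolding set_integrable_def by (rule borel_integrable_compact[OF compact_cbox cont_UNIV_sub[OF f(1)]])
 have "(nnI (%x. ennreal (f x)*indicator (cbox a b) x)) = (nnI (%x. ennreal (indicator (cbox a b) x*\<^sub>R f x)))"
  by (intro nn_integral_cong) (auto simp: indicator_def)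
 also have "... = ennreal (LINT x:cbox a b|lborel. f x)"
  unfolding set_lebesgue_integral_def
  by (rule nn_integral_eq_integral) (use i f in \<open>auto simp: set_integrable_def\<close>)
 also have "... = ennreal (integral (cbox a b) f)" using set_borel_integral_eq_integral(2)[OF i] by simp
 finally show ?thesis .
qed

text \<open>The exceptional set is merely open with small measure, so the comparison passes through
  nonnegative Lebesgue integrals before returning to integrals over boxes.\<close>

lemma integral_Qb_exceptional:
 fixes ph ps :: "real^3 => real"
 assumes ph: "continuous_on UNIV ph" "!!x. 0 <= ph x" and ps: "continuous_on UNIV ps" "!!x. 0 <= ps x"
  and G: "G \<in> sets borel" "emeasure lborel G <= ennreal g" and a: "0 <= a" "0 <= g"
  and le: "!!x. x \<in> Qb l t ==> ph x <= ps x + a*indicator G x"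
 shows "integral (Qb l t) ph <= integral (Qb l t) ps + a*g"
proof -
 have m: "(%x. ennreal (ps x)) \<in> borel_measurable borel"
  by (intro borel_measurable_continuous_onI measurable_ennreal measurable_compose[OF _ measurable_ennreal] ps)
 have mQ: "Qb l t \<in> sets borel" by (simp add: Qb_def)
 have p: "integral (Qb l t) ps \<ge> 0" using ps by (intro integral_nonneg cont_integrable_Qb) auto
 have "ennreal (integral (Qb l t) ph) = (nnI (%x. ennreal (ph x)*indicator (Qb l t) x))"
  unfolding Qb_def by (rule nn_integral_cbox_continuous[OF ph, symmetric])
 also have "... <= (nnI (%x. ennreal (ps x)*indicator (Qb l t) x + ennreal a*indicator G x))"
 proof (intro nn_integral_mono)
  fix x
  show "ennreal (ph x)*indicator (Qb l t) x <= ennreal (ps x)*indicator (Qb l t) x + ennreal a*indicator G x"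
  proof (cases "x \<in> Qb l t")
   case True
   then have "ennreal (ph x) <= ennreal (ps x + a*indicator G x)" using le by (intro ennreal_leI) auto
   also have "... = ennreal (ps x) + ennreal a*indicator G x"
    using ps a by (auto simp: indicator_def ennreal_plus)
   finally show ?thesis using True by simp
  qed simp
 qed
 also have "... = (nnI (%x. ennreal (ps x)*indicator (Qb l t) x)) + ennreal a*emeasure lborel G"
  using m mQ G by (subst nn_integral_add) (auto simp: nn_integral_cmult_indicator)
 also have "... <= ennreal (integral (Qb l t) ps) + ennreal a*ennreal g"
  unfolding Qb_def nn_integral_cbox_continuous[OF ps] by (intro add_left_mono mult_left_mono G) auto
 also have "... = ennreal (integral (Qb l t) ps + a*g)"
  using a p by (simp add: ennreal_mult ennreal_plus)
 finally show ?thesis by (subst (asm) ennreal_le_iff) (use p a in auto)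
qed

definition defect_measure :: "(real^3 => real^3^3) => (real^3) set => ennreal" where
 "defect_measure F S = (nnI (%x. ennreal ((infdist (F x) SO3)^2)*indicator S x))"

lemma norm_sq_le_defect: "(norm F)^2 <= 6 + 2*(infdist F SO3)^2"
proof -
 obtain S where S: "S \<in> SO3" "infdist F SO3 = norm (F - S)" by (rule SO3_nearest)
 have "norm F <= norm S + infdist F SO3" using norm_triangle_ineq[of S "F - S"] S(2) by simp
 then have "(norm F)^2 <= (norm S + infdist F SO3)^2" by (intro power_mono) auto
 also have "... <= 2*(norm S)^2 + 2*(infdist F SO3)^2" by (rule sq_add_le)
 finally show ?thesis using norm_SO3(1)[OF S(1)] by simp
qed

text \<open>Vitali covering: the union of the balls on which the mean of the squared distance to
 \<open>SO3\<close> exceeds 1 is small.\<close>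

lemma exceptional_set:
 assumes cF: "continuous_on UNIV F" and t0: "t0 > 0"
  and sub: "!!x. x \<in> X ==> cball x t0 \<subseteq> Y" and Y: "Y \<in> sets borel"
 obtains G where "open G" "emeasure lborel G <= 125*defect_measure F Y"
  "!!x t. x \<in> X - G ==> 0 < t ==> t <= t0 ==> defect_measure F (cball x t) <= emeasure lborel (cball x t)"
proof -
 define mue where "mue = density lborel (%x. ennreal ((infdist (F x) SO3)^2))"
 have cd: "continuous_on UNIV (%x. (infdist (F x) SO3)\<^sup>2)" by (intro continuous_intros cF)
 then have md: "(%x. (infdist (F x) SO3)\<^sup>2) \<in> borel_measurable borel" by (rule borel_measurable_continuous_onI)
 have mue: "emeasure mue S = defect_measure F S" if "S \<in> sets borel" for S
  unfolding mue_def defect_measure_def using md that by (simp add: emeasure_density)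
 define P where "P x t \<longleftrightarrow> 0 < t \<and> t <= t0 \<and> \<not> defect_measure F (cball x t) <= emeasure lborel (cball x t)" for x t
 define K where "K = {x\<in>X. \<exists>t. P x t}"
 define ta where "ta x = (SOME t. P x t)" for x
 have ta: "P x (ta x)" if "x \<in> K" for x using that someI_ex[of "P x"] unfolding K_def ta_def by auto
 then have "!!x. x \<in> K ==> 0 < ta x \<and> ta x <= t0" unfolding P_def by auto
 then obtain C where C: "countable C" "C \<subseteq> K"
  "pairwise (%i j. disjnt (cball i (ta i)) (cball j (ta j))) C"
  "!!i. i \<in> K ==> \<exists>j. j \<in> C \<and> \<not> disjnt (cball i (ta i)) (cball j (ta j)) \<and> cball i (ta i) \<subseteq> ball j (5*ta j)"
  by (rule Vitali_covering_lemma_cballs_balls[of K ta t0 "%x. x"]) auto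
 define G where "G = (\<Union>j\<in>C. ball j (5*ta j))"
 show thesis
 proof
  show "open G" unfolding G_def by auto
  show "defect_measure F (cball x t) <= emeasure lborel (cball x t)" if x: "x \<in> X - G" "0 < t" "t <= t0" for x t
  proof (rule ccontr)
   assume "\<not> ?thesis"
   then have "P x t" using x by (simp add: P_def)
   then have "x \<in> K" using x unfolding K_def by auto
   then obtain j where "j \<in> C" "cball x (ta x) \<subseteq> ball j (5*ta j)" using C(4) by blast
   moreover have "x \<in> cball x (ta x)" using ta[OF \<open>x \<in> K\<close>] by (simp add: P_def)
   ultimately have "x \<in> G" unfolding G_def by blast
   then show False using x by simp
  qed
  have disj: "disjoint_family_on (%j. cball j (ta j)) C"
   using C(3) unfolding disjoint_family_on_def pairwise_def disjnt_def by blast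
  have "emeasure lborel G = (nnI (%x. indicator G x))"
   by (rule nn_integral_indicator[symmetric]) (auto simp: G_def intro!: borel_open)
  also have "... <= (\<integral>\<^sup>+x. (\<integral>\<^sup>+j. indicator (ball j (5*ta j)) x \<partial>count_space C) \<partial>lborel)"
  proof (rule nn_integral_mono)
   fix x
   show "indicator G x <= (\<integral>\<^sup>+j. indicator (ball j (5*ta j)) x \<partial>count_space C)"
   proof (cases "x \<in> G")
    case True
    then obtain j where j: "j \<in> C" "x \<in> ball j (5*ta j)" by (auto simp: G_def)
    from nn_integral_ge_point[OF j(1), of "%j. indicator (ball j (5*ta j)) x"] j(2) True
    show ?thesis by simp
   qed simp
  qed
  also have "... = (\<integral>\<^sup>+j. emeasure lborel (ball j (5*ta j)) \<partial>count_space C)"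
   by (subst nn_integral_count_space_nn_integral[OF C(1)]) (auto intro!: borel_measurable_indicator borel_open)
  finally have "emeasure lborel G <= (\<integral>\<^sup>+j. emeasure lborel (ball j (5*ta j)) \<partial>count_space C)" .
  also have "(\<integral>\<^sup>+j. emeasure lborel (ball j (5*ta j)) \<partial>count_space C) <= (\<integral>\<^sup>+j. 125*emeasure mue (cball j (ta j)) \<partial>count_space C)"
  proof (rule nn_integral_mono)
   fix j assume "j \<in> space (count_space C)"
   then have "j \<in> K" using C(2) by auto
   then have Pj: "P j (ta j)" by (rule ta)
   then have t: "0 <= ta j" by (simp add: P_def)
   have "emeasure lborel (ball j (5*ta j)) = 125*emeasure lborel (cball j (ta j))"
    using t by (simp add: emeasure_ball emeasure_cball power_mult_distrib ennreal_mult' mult_ac)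
   also have "... <= 125*emeasure mue (cball j (ta j))"
    using Pj by (intro mult_left_mono) (auto simp: P_def mue)
   finally show "emeasure lborel (ball j (5*ta j)) <= 125*emeasure mue (cball j (ta j))" .
  qed
  also have "... = 125*(\<integral>\<^sup>+j. emeasure mue (cball j (ta j)) \<partial>count_space C)"
   by (rule nn_integral_cmult) simp
  also have "(\<integral>\<^sup>+j. emeasure mue (cball j (ta j)) \<partial>count_space C) = emeasure mue (\<Union>j\<in>C. cball j (ta j))"
   by (rule emeasure_UN_countable[symmetric]) (use C(1) disj in \<open>auto simp: mue_def\<close>)
  also have "... <= emeasure mue Y"
  proof (rule emeasure_mono)
   have "cball j (ta j) \<subseteq> Y" if "j \<in> C" for j
   proof -
    have "j \<in> K" using that C(2) by auto
    then have "cball j (ta j) \<subseteq> cball j t0" "j \<in> X" using ta[of j] by (auto simp: P_def K_def)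
    then show ?thesis using sub by blast
   qed
   then show "(\<Union>j\<in>C. cball j (ta j)) \<subseteq> Y" by blast
  qed (use Y in \<open>simp add: mue_def\<close>)
  finally show "emeasure lborel G <= 125*defect_measure F Y" using mue[OF Y] by (simp add: mult_left_mono)
 qed
qed

lemma cball_subset_Qb:
 assumes "x \<in> Qb l s" "s + t <= u"
 shows "cball x t \<subseteq> Qb l u"
proof
 fix w assume "w \<in> cball x t"
 then have "norm (w - x) <= t" by (simp add: dist_norm norm_minus_commute)
 then have "\<bar>w $ i - x $ i\<bar> <= t" for i using component_le_norm_cart[of "w - x" i] by simp
 moreover have "\<bar>x $ i\<bar> <= l $ i + s" for i using assms(1) by (simp add: mem_Qb)
 ultimately have w: "\<bar>w $ i - x $ i\<bar> <= t" "\<bar>x $ i\<bar> <= l $ i + s" for i by auto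
 have "\<bar>w $ i\<bar> <= l $ i + u" for i using w[of i] assms(2) by linarith
 then show "w \<in> Qb l u" by (simp add: mem_Qb)
qed

section \<open>Mollification at a variable scale\<close>

definition vmol :: "(real^3 => real) => (real^3 => real^3) => real^3 => real^3" where
 "vmol rh v x = (\<chi> i. integral B1 (%y. ker y * v (x + rh x*\<^sub>R y) $ i))"

definition vmolD :: "(real^3 => real) => (real^3 => real^3) => (real^3 => real^3^3) => real^3 => real^3^3" where
 "vmolD rh rh' F x = (\<chi> i. integral B1 (%y. ker y*\<^sub>R (F (x + rh x*\<^sub>R y) $ i + (F (x + rh x*\<^sub>R y) $ i \<bullet> y)*\<^sub>R rh' x)))"

lemma gradM_vmol:
 assumes v: "gradM v F" and rh: "grad1 rh rh'"
 shows "gradM (vmol rh v) (vmolD rh rh' F)"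
 unfolding gradM_def
proof
 fix i
 have cv: "continuous_on UNIV v" and cF: "continuous_on UNIV F" by (rule gradM_cont[OF v])+
 have cr: "continuous_on UNIV rh" and cr': "continuous_on UNIV rh'" using grad1_cont[OF rh] grad1_cont_grad[OF rh] .
 have "grad1 (%x. integral B1 (%y. ker y * v (x + rh x*\<^sub>R y) $ i))
  (%x. integral B1 (%y. ker y*\<^sub>R (F (x + rh x*\<^sub>R y) $ i + (F (x + rh x*\<^sub>R y) $ i \<bullet> y)*\<^sub>R rh' x)))"
 proof (rule grad1_integral)
  fix x y
  have "((%x. x + rh x*\<^sub>R y) has_derivative (%h. h + (rh' x \<bullet> h)*\<^sub>R y)) (at x)"
   by (auto intro!: derivative_eq_intros grad1_D[OF rh])
  from has_derivative_compose[OF this grad1_D[OF gradM_nth[OF v, of i]]]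
  have "((%x. v (x + rh x*\<^sub>R y) $ i) has_derivative (%h. F (x + rh x*\<^sub>R y) $ i \<bullet> (h + (rh' x \<bullet> h)*\<^sub>R y))) (at x)" .
  from has_derivative_mult_right[OF this, of "ker y"]
  show "((%x. ker y * v (x + rh x*\<^sub>R y) $ i) has_derivative
   (%h. (ker y*\<^sub>R (F (x + rh x*\<^sub>R y) $ i + (F (x + rh x*\<^sub>R y) $ i \<bullet> y)*\<^sub>R rh' x)) \<bullet> h)) (at x)"
   by (simp add: inner_add_right inner_add_left mult_ac)
 qed (auto simp: split_beta intro!: continuous_intros cont_param[OF cv] cont_param[OF cF] cont_param[OF cr'] 
    continuous_on_UNIV_comp[OF cr] continuous_on_UNIV_comp[OF cont_ker(1)])
 then show "grad1 (%x. vmol rh v x $ i) (%x. vmolD rh rh' F x $ i)"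
  by (simp add: vmol_def vmolD_def)
qed

lemma norm_B1_le: "y \<in> B1 ==> norm y <= 2"
proof -
 assume "y \<in> B1"
 then have "\<bar>y $ i\<bar> <= 1" for i by (auto simp: mem_box_cart abs_le_iff minus_le_iff)
 then have "(y $ i)^2 <= 1" for i using abs_square_le_1 by blast
 from this[of 1] this[of 2] this[of 3] have "(norm y)^2 <= 2^2"
  by (simp add: norm_vec_def L2_set_def sum_3)
 then show ?thesis by (rule power2_le_imp_le) simp
qed

text \<open>A constant matrix \<open>A\<close> passes through unchanged: the extra term with the
  gradient of the radius contains the first moment of the kernel, which vanishes. Hence only
  \<open>F - A\<close> contributes. \<open>A = 0\<close> will give boundedness and
  \<open>A = F x\<close> closeness to \<open>F\<close>.\<close>

lemma vmolD_bound:
 assumes cF: "continuous_on UNIV F" and K: "norm (rh' x) <= K" and A: "mol (rh x) (%z. norm (F z - A)) x <= a"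
 shows "norm (vmolD rh rh' F x - A) <= 3*((1 + 2*K)*a)"
proof -
 have K0: "K \<ge> 0" using K norm_ge_zero order_trans by blast
 have row: "norm (vmolD rh rh' F x $ i - A $ i) <= (1 + 2*K)*a" for i
 proof -
  let ?w = "%y. x + rh x*\<^sub>R y"
  have cw: "continuous_on S (%y. F (?w y))" for S by (intro cont_param[OF cF] continuous_intros)
  have m0: "integral B1 (%y. ker y*\<^sub>R y) = 0"
  proof -
   have "(%y. ker y*\<^sub>R y) integrable_on B1" by (intro integrable_continuous continuous_intros cont_ker)
   from integral_linear[OF this bounded_linear_vec_nth] show ?thesis
    by (simp add: vec_eq_iff o_def integral_ker_first_moment)
  qed
  have h0: "((%y. ker y*\<^sub>R y) has_integral 0) B1"
   using integrable_integral[OF integrable_continuous, of "-1" 1 "%y. ker y*\<^sub>R y"] m0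
   by (simp add: continuous_intros cont_ker)
  have h1: "(ker has_integral 1) B1"
   using integral_ker integrable_integral[OF integrable_continuous[OF cont_ker(1), of "-1" 1]] by simp
  have i1: "((%y. ker y*\<^sub>R A $ i + (A $ i \<bullet> (ker y*\<^sub>R y))*\<^sub>R rh' x) has_integral (1*\<^sub>R A $ i + (A $ i \<bullet> 0)*\<^sub>R rh' x)) B1"
   using has_integral_linear[OF h0 bounded_linear_inner_right[of "A $ i"]]
   by (intro has_integral_add has_integral_scaleR_left h1) (simp add: o_def)
  have i2: "((%y. ker y*\<^sub>R (F (?w y) $ i + (F (?w y) $ i \<bullet> y)*\<^sub>R rh' x)) has_integral vmolD rh rh' F x $ i) B1"
   unfolding vmolD_def vec_lambda_beta
   by (intro integrable_integral integrable_continuous continuous_intros cw cont_ker)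
  have eq: "ker y*\<^sub>R (F (?w y) $ i + (F (?w y) $ i \<bullet> y)*\<^sub>R rh' x) - (ker y*\<^sub>R A $ i + (A $ i \<bullet> (ker y*\<^sub>R y))*\<^sub>R rh' x)
   = ker y*\<^sub>R ((F (?w y) - A) $ i + ((F (?w y) - A) $ i \<bullet> y)*\<^sub>R rh' x)" for y
   by (simp add: scaleR_add_right scaleR_diff_right scaleR_diff_left inner_diff_left algebra_simps)
  have i3: "((%y. ker y*\<^sub>R ((F (?w y) - A) $ i + ((F (?w y) - A) $ i \<bullet> y)*\<^sub>R rh' x)) has_integral (vmolD rh rh' F x $ i - A $ i)) B1"
   using has_integral_diff[OF i2 i1] unfolding eq by simp
  have "norm (vmolD rh rh' F x $ i - A $ i) <= integral B1 (%y. (1 + 2*K)*(ker y*norm (F (?w y) - A)))"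
   unfolding integral_unique[OF i3, symmetric]
  proof (rule integral_norm_bound_integral)
   fix y assume y: "y \<in> B1"
   let ?d = "(F (?w y) - A) $ i"
   have "norm (?d + (?d \<bullet> y)*\<^sub>R rh' x) <= norm ?d + \<bar>?d \<bullet> y\<bar> * norm (rh' x)"
    using norm_triangle_ineq[of ?d "(?d \<bullet> y)*\<^sub>R rh' x"] by simp
   also have "... <= norm ?d + (norm ?d*2)*K"
    using Cauchy_Schwarz_ineq2[of ?d y] mult_left_mono[OF norm_B1_le[OF y] norm_ge_zero[of ?d]] K
    by (intro add_left_mono mult_mono) auto
   also have "... = (1 + 2*K)*norm ?d" by (simp add: algebra_simps)
   also have "... <= (1 + 2*K)*norm (F (?w y) - A)" using K0 by (intro mult_left_mono norm_row_le) auto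
   finally have "ker y*norm (?d + (?d \<bullet> y)*\<^sub>R rh' x) <= ker y*((1 + 2*K)*norm (F (?w y) - A))"
    by (intro mult_left_mono ker_nonneg)
   then show "norm (ker y*\<^sub>R (?d + (?d \<bullet> y)*\<^sub>R rh' x)) <= (1 + 2*K)*(ker y*norm (F (?w y) - A))"
    using ker_nonneg[of y] by (simp add: mult_ac)
  qed (use i3 in \<open>auto intro!: integrable_continuous continuous_intros cw cont_ker\<close>)
  also have "... = (1 + 2*K)*mol (rh x) (%z. norm (F z - A)) x" by (simp add: mol_def)
  also have "... <= (1 + 2*K)*a" using K0 A by (intro mult_left_mono) auto
  finally show ?thesis .
 qed
 show ?thesis using norm_le_rows[of "vmolD rh rh' F x - A"] row[of 1] row[of 2] row[of 3] by simp
qed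


lemma defect_measure_Qb:
 assumes "continuous_on UNIV F"
 shows "defect_measure F (Qb l t) = ennreal (n2 l t (%x. infdist (F x) SO3))"
proof -
 have c: "continuous_on UNIV (%x. (infdist (F x) SO3)\<^sup>2)" by (intro continuous_intros assms)
 show ?thesis
  unfolding defect_measure_def Qb_def n2_def
  by (subst nn_integral_cbox_continuous[OF c]) (auto simp: infdist_nonneg)
qed

text \<open>Points of \<open>B1\<close> have norm at most 2, so the support of the kernel about
  \<open>x\<close> lies in the ball of radius \<open>3*t\<close> about the good point
  \<open>p\<close>. There the mean of the squared norm is at most \<open>6 + 2\<close>, and the
  volume supplies \<open>3^3\<close>; together this is 216.\<close>

lemma mol_norm_sq_good_ball:
 assumes cF: "continuous_on UNIV F" and t: "t > 0" and xp: "dist x p <= t"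
  and good: "defect_measure F (cball p (3*t)) <= emeasure lborel (cball p (3*t))"
 shows "mol t (%z. (norm (F z))\<^sup>2) x <= 216*unit_ball_vol 3/kmass"
proof -
 let ?f = "%z. (norm (F z))\<^sup>2"
 let ?u = "unit_ball_vol 3 :: real"
 have cf: "continuous_on UNIV ?f" by (intro continuous_intros cF)
 have md [measurable]: "(%x. (infdist (F x) SO3)\<^sup>2) \<in> borel_measurable borel"
  by (intro borel_measurable_continuous_onI continuous_intros cF)
 have [measurable]: "cball p (3*t) \<in> sets borel" by (intro borel_closed) simp
 have xQ: "0 \<in> Qb 0 0" by (simp add: mem_Qb)
 have x0: "mol t ?f x = mol t (%z. ?f (x + z)) 0" by (simp add: mol_def)
 have cs: "continuous_on UNIV (%z. ?f (x + z))" by (intro cont_param[OF cf] continuous_intros)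
 have "mol t ?f x <= 1/(kmass*t^3)*integral (Qb 0 t) (%z. ?f (x + z))"
  unfolding x0 by (rule mol_sup_le[OF cs _ t xQ]) auto
 also have "integral (Qb 0 t) (%z. ?f (x + z)) = integral (cbox (- vec t + x) (vec t + x)) ?f"
  using integral_shift_cbox_plus[of "- vec t" "vec t" ?f x] by (simp add: Qb_def o_def)
 also have "... <= 216 * ?u*t^3"
 proof -
  have sub: "cbox (- vec t + x) (vec t + x) \<subseteq> cball p (3*t)"
  proof
   fix w assume w: "w \<in> cbox (- vec t + x) (vec t + x)"
   then have "(1/t)*\<^sub>R (w - x) \<in> B1"
   proof -
    have "- t + x $ i <= w $ i \<and> w $ i <= t + x $ i" for i using w by (simp add: mem_box_cart)
    then have "- t <= w $ i - x $ i \<and> w $ i - x $ i <= t" for i using diff_le_eq le_diff_eq by (simp add: algebra_simps)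
    then show ?thesis using t by (simp add: mem_box_cart field_simps)
   qed
   from norm_B1_le[OF this] have "norm (w - x)/t <= 2" using t by simp
   then have "norm (w - x) <= 2*t" using t by (simp add: field_simps)
   then have "dist w x <= 2*t" by (simp add: dist_norm)
   then show "w \<in> cball p (3*t)" using xp dist_triangle[of p w x] by (simp add: dist_commute)
  qed
  have "ennreal (integral (cbox (- vec t + x) (vec t + x)) ?f) = (nnI (%z. ennreal (?f z)*indicator (cbox (- vec t + x) (vec t + x)) z))"
   by (rule nn_integral_cbox_continuous[OF cf, symmetric]) auto
  also have "... <= (nnI (%z. 6*indicator (cball p (3*t)) z + 2*(ennreal ((infdist (F z) SO3)^2)*indicator (cball p (3*t)) z)))"
  proof (rule nn_integral_mono)
   fix z
   have "ennreal (?f z) <= ennreal (6 + 2*(infdist (F z) SO3)^2)" by (intro ennreal_leI norm_sq_le_defect)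
   also have "... = 6 + 2*ennreal ((infdist (F z) SO3)^2)"
    by (simp add: ennreal_plus ennreal_mult)
   finally show "ennreal (?f z)*indicator (cbox (- vec t + x) (vec t + x)) z <= 6*indicator (cball p (3*t)) z + 2*(ennreal ((infdist (F z) SO3)^2)*indicator (cball p (3*t)) z)"
    using sub by (auto simp: indicator_def)
  qed
  also have "... = 6*emeasure lborel (cball p (3*t)) + 2*defect_measure F (cball p (3*t))"
   unfolding defect_measure_def using md
   by (subst nn_integral_add, measurable) (simp add: nn_integral_cmult nn_integral_cmult_indicator)
  also have "... <= 6*emeasure lborel (cball p (3*t)) + 2*emeasure lborel (cball p (3*t))"
   by (intro add_left_mono mult_left_mono good) simp
  also have "... = 8*emeasure lborel (cball p (3*t))" by (simp flip: distrib_right)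
  also have "... = ennreal (216 * ?u*t^3)"
   using t by (simp add: emeasure_cball power_mult_distrib ennreal_mult' mult_ac)
    (simp add: ennreal_mult'[symmetric] ennreal_numeral[symmetric] del: ennreal_numeral)
  finally show ?thesis using t by (subst (asm) ennreal_le_iff) auto
 qed
 finally show ?thesis using t kmass_pos by (simp add: field_simps mult_left_mono)
qed

text \<open>Cutting off \<open>F\<close> would destroy the gradient structure, so \<open>v\<close>
  is mollified with a radius comparable to the distance from the good set. Off the good set every
  averaging region sits in a ball of comparable size about a good point, which bounds the gradient;
  on the good set the radius is so tiny that the gradient hardly changes.\<close>

lemma truncation:
 assumes l: "!!i. l $ i > 0" and r: "r > 0"
 shows "\<exists>M\<ge>0. \<exists>e0>0. \<forall>v F e. gradM v F --> 0 < e --> e <= e0 --> n2 l (16*r) (%x. infdist (F x) SO3) <= e^2 -->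
  (\<exists>v' F' G. gradM v' F' \<and> (\<forall>x\<in>Qb l (8*r). norm (F' x) <= M) \<and> open G \<and> emeasure lborel G <= ennreal (125*e^2) \<and>
    (\<forall>x\<in>Qb l (8*r) - G. norm (F' x - F x) <= e))"
proof -
 \<comment> \<open>Gradient bound for a 1-Lipschitz function mollified at any scale
   \<open>s\<close>: the oscillation is at most \<open>2 * s\<close>, and
   \<open>288 * 4 = 1152\<close>.\<close>
 define K where "K = sqrt (1152/kmass)"
 have K0: "K \<ge> 0" unfolding K_def using kmass_pos by simp
 define M0 where "M0 = sqrt (216*unit_ball_vol 3/kmass)"
 define M where "M = 3*((1 + 2*K)*M0)"
 have M0: "M0 \<ge> 0" unfolding M0_def using kmass_pos by simp
 have M: "M \<ge> 0" unfolding M_def using K0 M0 by simp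
 \<comment> \<open>Makes \<open>125*e^2\<close> at most half the volume of a ball of radius
   \<open>r\<close>, so that no such ball is exceptional.\<close>
 define e0 where "e0 = sqrt (unit_ball_vol 3*r^3/250)"
 have e0: "e0 > 0" unfolding e0_def using r by simp
 have "\<exists>v' F' G. gradM v' F' \<and> (\<forall>x\<in>Qb l (8*r). norm (F' x) <= M) \<and> open G \<and> emeasure lborel G <= ennreal (125*e^2) \<and>
    (\<forall>x\<in>Qb l (8*r) - G. norm (F' x - F x) <= e)"
  if v: "gradM v F" and e: "0 < e" "e <= e0" and d: "n2 l (16*r) (%x. infdist (F x) SO3) <= e^2" for v F and e :: real
 proof -
  have cF: "continuous_on UNIV F" by (rule gradM_cont[OF v])
  obtain G where G: "open G" "emeasure lborel G <= 125*defect_measure F (Qb l (16*r))"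
   "!!x t. x \<in> Qb l (12*r) - G ==> 0 < t ==> t <= 4*r ==> defect_measure F (cball x t) <= emeasure lborel (cball x t)"
  proof (rule exceptional_set[OF cF, of "4*r" "Qb l (12*r)" "Qb l (16*r)"])
   show "cball x (4*r) \<subseteq> Qb l (16*r)" if "x \<in> Qb l (12*r)" for x
    by (rule cball_subset_Qb[OF that]) simp
   show "Qb l (16*r) \<in> sets borel" by (simp add: Qb_def)
  qed (use r in auto)
  have "125*defect_measure F (Qb l (16*r)) <= 125*ennreal (e^2)"
   unfolding defect_measure_Qb[OF cF] by (intro mult_left_mono ennreal_leI d) auto
  also have "... = ennreal (125*e^2)" by (simp add: ennreal_mult)
  finally have G2: "emeasure lborel G <= ennreal (125*e^2)" using G(2) by (rule order_trans[rotated])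
  define P where "P = Qb l (12*r) - G"
  have near: "\<exists>p\<in>P. dist x p < r" if x: "x \<in> Qb l (8*r)" for x
  proof (rule ccontr)
   assume no: "\<not> ?thesis"
   have "cball x r \<subseteq> Qb l (12*r)" by (rule cball_subset_Qb[OF x]) (use r in simp)
   then have "ball x r \<subseteq> Qb l (12*r)" using ball_subset_cball by blast
   then have "ball x r \<subseteq> G" using no unfolding P_def by auto
   then have "emeasure lborel (ball x r) <= emeasure lborel G"
    using G(1) by (intro emeasure_mono) auto
   also have "... <= ennreal (125*e^2)" by (rule G2)
   finally have "ennreal (unit_ball_vol 3*r^3) <= ennreal (125*e^2)" using r by (simp add: emeasure_ball)
   then have "unit_ball_vol 3*r^3 <= 125*e^2" by (subst (asm) ennreal_le_iff) auto
   also have "... <= 125*e0^2" using e by (intro mult_left_mono power_mono) auto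
   also have "... = unit_ball_vol 3*r^3/2" unfolding e0_def using r by simp
   finally show False using r by (simp add: mult_le_0_iff not_le)
  qed
  have "0 \<in> Qb l (8*r)" by (rule zero_in_Qb[OF l]) (use r in simp)
  then have Pne: "P \<noteq> {}" using near by blast
  define wm where "wm = e/(3*(1 + 2*K))"
  have wm: "wm > 0" unfolding wm_def using e K0 by (simp add: add_pos_nonneg)
  have "uniformly_continuous_on (Qb l (9*r)) F"
   unfolding Qb_def by (intro compact_uniformly_continuous cont_UNIV_sub[OF cF] compact_cbox)
  then obtain dl where dl: "dl > 0" "!!x x'. x \<in> Qb l (9*r) ==> x' \<in> Qb l (9*r) ==> dist x' x < dl ==> dist (F x') (F x) < wm"
   unfolding uniformly_continuous_on_def using wm by blast
  \<comment> \<open>Radii on the good set are at most \<open>5 * s\<close> and move points by at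
    most \<open>10 * s\<close>, below the modulus of continuity \<open>dl\<close>.\<close>
  define s where "s = min (r/20) (dl / 20)"
  have s: "s > 0" "20 * s <= r" "20 * s <= dl" unfolding s_def using r dl(1) by auto
  \<comment> \<open>The offset \<open>3 * s\<close> beats the mollification error
    \<open>2 * s\<close>, so the smoothed radius stays positive.\<close>
  define f where "f z = infdist z P + 3 * s" for z
  have cf: "continuous_on UNIV f" unfolding f_def by (intro continuous_intros)
  have fl: "\<bar>f (x + s*\<^sub>R y) - f x\<bar> <= 2 * s" if "y \<in> B1" for x y
  proof -
   have "\<bar>f (x + s*\<^sub>R y) - f x\<bar> <= dist (x + s*\<^sub>R y) x" unfolding f_def using infdist_triangle_abs[of "x + s*\<^sub>R y" P x] by simp
   also have "... = s*norm y" using s by (simp add: dist_norm)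
   also have "... <= s*2" using norm_B1_le[OF that] s by (intro mult_left_mono) auto
   finally show ?thesis by simp
  qed
  define rh where "rh = mol s f"
  define rh' where "rh' = dmol s f"
  have gr: "grad1 rh rh'" unfolding rh_def rh'_def by (rule grad1_mol[OF cf s(1)])
  have rhb: "infdist x P + s <= rh x" "rh x <= infdist x P + 5 * s" for x
  proof -
   have "\<bar>rh x - f x\<bar> <= 2 * s" unfolding rh_def real_norm_def[symmetric]
    by (rule mol_sub_le[OF cf]) (use fl in auto)
   then show "infdist x P + s <= rh x" "rh x <= infdist x P + 5 * s" unfolding f_def by linarith+
  qed
  have rh'b: "norm (rh' x) <= K" for x
  proof -
   have "(norm (rh' x))^2 <= 288/(kmass * s^2)*mol s (%z. (f z - f x)\<^sup>2) x"
    unfolding rh'_def by (rule dmol_sq_le[OF cf s(1)])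
   also have "... <= 288/(kmass * s^2)*mol s (%z. (2 * s)\<^sup>2) x"
   proof (intro mult_left_mono mol_mono continuous_intros cf)
    fix y :: "real^3" assume "y \<in> B1"
    from power_mono[OF fl[OF this, of x] abs_ge_zero, of 2] show "(f (x + s*\<^sub>R y) - f x)^2 <= (2 * s)^2" by simp
   qed (use kmass_pos in auto)
   also have "... = 1152/kmass" using s kmass_pos by (simp add: mol_const power2_eq_square field_simps)
   finally show ?thesis unfolding K_def by (rule real_le_rsqrt)
  qed
  have cn: "continuous_on UNIV (%z. norm (F z - A))" for A by (intro continuous_intros cF)
  have bd: "norm (vmolD rh rh' F x) <= M" if x: "x \<in> Qb l (8*r)" for x
  proof -
   obtain q where q: "q \<in> P" "dist x q < r" using near[OF x] by blast
   have Dr: "infdist x P < r" using infdist_le[OF q(1), of x] q(2) by simp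
   have "infdist x P < infdist x P + s" using s by simp
   then obtain p where p: "p \<in> P" "dist x p < infdist x P + s"
    unfolding infdist_notempty[OF Pne] using cINF_less_iff[OF Pne, of "dist x"] by (meson bdd_below.I2 zero_le_dist)
   have rh0: "rh x > 0" using rhb(1)[of x] infdist_nonneg[of x P] s by linarith
   have "3*rh x <= 4*r" using rhb(2)[of x] Dr s by linarith
   then have good: "defect_measure F (cball p (3*rh x)) <= emeasure lborel (cball p (3*rh x))"
    using p(1) rh0 by (intro G(3)) (auto simp: P_def)
   have xp: "dist x p <= rh x" using p(2) rhb(1)[of x] by linarith
   have "(mol (rh x) (%z. norm (F z - 0)) x)^2 <= mol (rh x) (%z. (norm (F z))\<^sup>2) x"
    using mol_sq_le[OF cn[of 0], of "rh x" x] by (simp add: power2_abs)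
   also have "... <= 216*unit_ball_vol 3/kmass" by (rule mol_norm_sq_good_ball[OF cF rh0 xp good])
   finally have "mol (rh x) (%z. norm (F z - 0)) x <= M0" unfolding M0_def by (rule real_le_rsqrt)
   from vmolD_bound[where rh=rh and rh'=rh' and x=x and A=0, OF cF rh'b this] show ?thesis by (simp add: M_def)
  qed
  have cl: "norm (vmolD rh rh' F x - F x) <= e" if x: "x \<in> Qb l (8*r) - G" for x
  proof -
   have "x \<in> P" using x Qb_mono[of "8*r" "12*r" l] r unfolding P_def by auto
   then have "infdist x P = 0" by (rule infdist_zero)
   then have rhx: "0 <= rh x" "rh x <= 5 * s" using rhb[of x] s by linarith+
   have "mol (rh x) (%z. norm (F z - F x)) x <= mol (rh x) (%z. wm) x"
   proof (intro mol_mono cn continuous_intros)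
    fix y :: "real^3" assume y: "y \<in> B1"
    have "dist (x + rh x*\<^sub>R y) x = rh x*norm y" using rhx by (simp add: dist_norm)
    also have "... <= (5 * s)*2" using rhx norm_B1_le[OF y] s by (intro mult_mono) auto
    also have "... < dl" using s by linarith
    finally have dd: "dist (x + rh x*\<^sub>R y) x < dl" .
    have "x + rh x*\<^sub>R y \<in> Qb l (9*r)" by (rule Qb_shift[OF _ y rhx(1), of _ _ "8*r"]) (use x rhx s in auto)
    moreover have "x \<in> Qb l (9*r)" using x Qb_mono[of "8*r" "9*r" l] r by auto
    ultimately have "dist (F (x + rh x*\<^sub>R y)) (F x) < wm" using dl(2) dd by blast
    then show "norm (F (x + rh x*\<^sub>R y) - F x) <= wm" by (simp add: dist_norm)
   qed
   then have "mol (rh x) (%z. norm (F z - F x)) x <= wm" by (simp add: mol_const)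
   from vmolD_bound[where rh=rh and rh'=rh' and x=x and A="F x", OF cF rh'b this] have "norm (vmolD rh rh' F x - F x) <= 3*((1 + 2*K)*wm)" .
   also have "... = e"
   proof -
    have "1 + 2*K \<noteq> 0" using K0 by linarith
    then show ?thesis unfolding wm_def by (simp add: field_simps)
   qed
   finally show ?thesis .
  qed
  show ?thesis
   using gradM_vmol[OF v gr] bd cl G(1) G2 by blast
 qed
 then show ?thesis using M e0 by blast
qed

theorem interior_rigidity:
 assumes l: "!!i. l $ i > 0" and r: "r > 0"
 shows "\<exists>C\<ge>0. \<exists>e0>0. \<forall>v F e. gradM v F --> 0 < e --> e <= e0 --> n2 l (16*r) (%x. infdist (F x) SO3) <= e^2 -->
  (\<exists>R\<in>SO3. n2 l 0 (%x. F x - R) <= C*e^2)"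
proof -
 from truncation[OF l r] obtain M e0 where M: "M \<ge> 0" and e0: "e0 > 0" and T: "\<forall>v F e. gradM v F --> 0 < e --> e <= e0 --> n2 l (16*r) (%x. infdist (F x) SO3) <= e^2 -->
  (\<exists>v' F' G. gradM v' F' \<and> (\<forall>x\<in>Qb l (8*r). norm (F' x) <= M) \<and> open G \<and> emeasure lborel G <= ennreal (125*e^2) \<and>
    (\<forall>x\<in>Qb l (8*r) - G. norm (F' x - F x) <= e))"
  by (elim exE conjE) (rule that)
 from bounded_rigidity[OF l r M] obtain C where C0: "C \<ge> 0" and C: "\<forall>v F e. gradM v F --> (\<forall>x\<in>Qb l (8*r). norm (F x) <= M) --> 0 < e --> e <= 1 -->
  n2 l (8*r) (%x. infdist (F x) SO3) <= e^2 --> (\<exists>R\<in>SO3. n2 l 0 (%x. F x - R) <= C*e^2)"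
  by (elim exE conjE) (rule that)
 define m8 where "m8 = measure lborel (Qb l (8*r))"
 define m0 where "m0 = measure lborel (Qb l 0)"
 have m: "m8 \<ge> 0" "m0 \<ge> 0" by (simp_all add: m8_def m0_def)
 \<comment> \<open>Off \<open>G\<close> the truncated gradient differs by at most \<open>e\<close>,
   which gives \<open>2 + 2*m8\<close>; on \<open>G\<close> its distance to \<open>SO3\<close> is at
   most \<open>M + 2\<close>.\<close>
 define c where "c = sqrt (2 + 2*m8 + (M + 2)^2*125)"
 have c: "c > 0" unfolding c_def using m by (simp add: add_pos_nonneg)
 define C1 where "C1 = 2*(C*c^2) + 2*m0 + 4 + 18*125"
 have "\<exists>R\<in>SO3. n2 l 0 (%x. F x - R) <= C1*e^2"
  if v: "gradM v F" and e: "0 < e" "e <= min e0 (1/c)" and d: "n2 l (16*r) (%x. infdist (F x) SO3) <= e^2" for v F and e :: real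
 proof -
  have cF: "continuous_on UNIV F" by (rule gradM_cont[OF v])
  have "e <= e0" using e by simp
  from T[rule_format, OF v e(1) this d] obtain v' F' G where v': "gradM v' F'" and b: "!!x. x \<in> Qb l (8*r) ==> norm (F' x) <= M"
   and G: "open G" "emeasure lborel G <= ennreal (125*e^2)" and cl: "!!x. x \<in> Qb l (8*r) - G ==> norm (F' x - F x) <= e"
   by blast
  have cF': "continuous_on UNIV F'" by (rule gradM_cont[OF v'])
  have mG: "G \<in> sets borel" using G(1) by auto
  let ?ps = "%x. 2*(infdist (F x) SO3)^2 + 2*e^2"
  have "integral (Qb l (8*r)) (%x. (infdist (F' x) SO3)\<^sup>2) <= integral (Qb l (8*r)) ?ps + (M + 2)^2*(125*e^2)"
  proof (rule integral_Qb_exceptional[OF _ _ _ _ mG G(2)])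
   fix x assume x: "x \<in> Qb l (8*r)"
   show "(infdist (F' x) SO3)^2 <= ?ps x + (M + 2)^2*indicator G x"
   proof (cases "x \<in> G")
    case True
    have "infdist (F' x) SO3 <= norm (F' x - mat 1)" by (rule infdist_SO3_le[OF mat1_SO3])
    also have "... <= M + 2" using norm_triangle_ineq4[of "F' x" "mat 1"] b[OF x] norm_SO3(2)[OF mat1_SO3] by linarith
    finally have "(infdist (F' x) SO3)^2 <= (M + 2)^2" by (intro power_mono infdist_nonneg)
    then show ?thesis using True by (simp add: add_increasing)
   next
    case False
    then have "infdist (F' x) SO3 <= infdist (F x) SO3 + e" using infdist_SO3_diff[of "F' x" "F x"] cl[of x] x by simp
    then have "(infdist (F' x) SO3)^2 <= (infdist (F x) SO3 + e)^2" by (intro power_mono infdist_nonneg)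
    then show ?thesis using sq_add_le[of "infdist (F x) SO3" e] False by simp
   qed
  qed (use M in \<open>auto intro!: continuous_intros cF cF'\<close>)
  also have "integral (Qb l (8*r)) ?ps = 2*n2 l (8*r) (%x. infdist (F x) SO3) + 2*m8*e^2"
   unfolding n2_def m8_def
   by (subst integral_add, (intro cont_integrable_Qb continuous_intros cF)+) (simp add: Qb_def infdist_nonneg)
  also have "n2 l (8*r) (%x. infdist (F x) SO3) <= n2 l (16*r) (%x. infdist (F x) SO3)"
   using r by (intro n2_mono continuous_intros cF) auto
  finally have "integral (Qb l (8*r)) (%x. (infdist (F' x) SO3)\<^sup>2) <= 2*n2 l (16*r) (%x. infdist (F x) SO3) + 2*m8*e^2 + (M + 2)^2*(125*e^2)"
   by simp
  then have "n2 l (8*r) (%x. infdist (F' x) SO3) <= (2 + 2*m8 + (M + 2)^2*125)*e^2"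
   using d by (simp add: n2_def algebra_simps infdist_nonneg)
  also have "... = (c*e)^2" unfolding c_def power_mult_distrib using m by (subst real_sqrt_pow2) (auto intro!: add_nonneg_nonneg)
  finally have d': "n2 l (8*r) (%x. infdist (F' x) SO3) <= (c*e)^2" .
  have ce: "0 < c*e" "c*e <= 1" using c e by (auto simp: field_simps)
  obtain R where R: "R \<in> SO3" and F'R: "n2 l 0 (%x. F' x - R) <= C*(c*e)^2"
   using C[rule_format, OF v' b ce d'] by blast
  let ?ps = "%x. (2*(norm (F' x - R))^2 + 2*e^2) + 4*(infdist (F x) SO3)^2"
  have "integral (Qb l 0) (%x. (norm (F x - R))\<^sup>2) <= integral (Qb l 0) ?ps + 18*(125*e^2)"
  proof (rule integral_Qb_exceptional[OF _ _ _ _ mG G(2)])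
   fix x assume x0: "x \<in> Qb l 0"
   then have x: "x \<in> Qb l (8*r)" using Qb_mono[of 0 "8*r" l] r by auto
   show "(norm (F x - R))^2 <= ?ps x + 18*indicator G x"
   proof (cases "x \<in> G")
    case True
    have "(norm (F x - R))^2 <= (norm (F x) + norm R)^2" by (intro power_mono norm_triangle_ineq4) auto
    also have "... <= 2*(norm (F x))^2 + 2*(norm R)^2" by (rule sq_add_le)
    also have "... <= 18 + 4*(infdist (F x) SO3)^2" using norm_sq_le_defect[of "F x"] norm_SO3(1)[OF R] by simp
    finally have "(norm (F x - R))^2 <= 18 + 4*(infdist (F x) SO3)^2" .
    moreover have "indicator G x = (1::real)" using True by simp
    moreover have "0 <= (norm (F' x - R))^2" "0 <= e^2" by simp_all
    ultimately show ?thesis by linarith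
   next
    case False
    have "norm (F x - R) <= norm (F' x - R) + norm (F' x - F x)"
     using norm_triangle_ineq4[of "F' x - R" "F' x - F x"] by simp
    also have "... <= norm (F' x - R) + e" using cl[of x] x False by simp
    finally have "(norm (F x - R))^2 <= (norm (F' x - R) + e)^2" by (intro power_mono) auto
    then show ?thesis using sq_add_le[of "norm (F' x - R)" e] False by (simp add: add_increasing2)
   qed
  qed (auto intro!: continuous_intros cF cF')
  also have "integral (Qb l 0) ?ps = integral (Qb l 0) (%x. 2*(norm (F' x - R))^2 + 2*e^2) + integral (Qb l 0) (%x. 4*(infdist (F x) SO3)^2)"
   by (intro integral_add cont_integrable_Qb continuous_intros cF cF')
  also have "integral (Qb l 0) (%x. 2*(norm (F' x - R))^2 + 2*e^2) = 2*n2 l 0 (%x. F' x - R) + 2*m0*e^2"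
   unfolding n2_def m0_def
   by (subst integral_add, (intro cont_integrable_Qb continuous_intros cF')+) (simp add: Qb_def)
  also have "integral (Qb l 0) (%x. 4*(infdist (F x) SO3)^2) = 4*n2 l 0 (%x. infdist (F x) SO3)"
   unfolding n2_def by (simp add: infdist_nonneg)
  also have "n2 l 0 (%x. infdist (F x) SO3) <= n2 l (16*r) (%x. infdist (F x) SO3)"
   using r by (intro n2_mono continuous_intros cF) auto
  finally have "n2 l 0 (%x. F x - R) <= 2*n2 l 0 (%x. F' x - R) + 2*m0*e^2 + 4*n2 l (16*r) (%x. infdist (F x) SO3) + 18*(125*e^2)"
   by (simp add: n2_def)
  then have "n2 l 0 (%x. F x - R) <= C1*e^2"
   using d F'R by (simp add: C1_def power_mult_distrib algebra_simps)
  then show ?thesis using R by blast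
 qed
 moreover have "C1 \<ge> 0" unfolding C1_def using C0 m by simp
 moreover have "min e0 (1/c) > 0" using e0 c by simp
 ultimately show ?thesis by blast
qed

section \<open>Smooth approximation of Sobolev maps\<close>

lemma Ck_on_Suc_imp: "Ck_on (Suc k) S f ==> Ck_on k S f"
proof (induction k arbitrary: f)
 case 0
 then show ?case
  by (auto intro!: continuous_at_imp_continuous_on differentiable_imp_continuous_within)
next
 case (Suc k)
 then show ?case by simp
qed

lemma Ck_on_add: "Ck_on k UNIV f ==> Ck_on k UNIV g ==> Ck_on k UNIV (%x. f x + g x)"
proof (induction k arbitrary: f g)
 case 0
 then show ?case by (auto intro!: continuous_intros)
next
 case (Suc k)
 have "frechet_derivative (%x. f x + g x) (at x) = (%h. frechet_derivative f (at x) h + frechet_derivative g (at x) h)" for x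
  by (rule frechet_derivative_at[symmetric])
   (use Suc.prems in \<open>auto intro!: derivative_eq_intros simp: frechet_derivative_works[symmetric]\<close>)
 then show ?case using Suc by (auto intro!: derivative_intros)
qed

lemma Ck_on_mult: "Ck_on k UNIV f ==> Ck_on k UNIV g ==> Ck_on k UNIV (%x. f x*g x)"
proof (induction k arbitrary: f g)
 case 0
 then show ?case by (auto intro!: continuous_intros)
next
 case (Suc k)
 have "frechet_derivative (%x. f x*g x) (at x) = (%h. f x*frechet_derivative g (at x) h + frechet_derivative f (at x) h*g x)" for x
  by (rule frechet_derivative_at[symmetric])
   (use Suc.prems in \<open>auto intro!: derivative_eq_intros simp: frechet_derivative_works[symmetric]\<close>)
 moreover have "Ck_on k UNIV f" "Ck_on k UNIV g" using Suc.prems Ck_on_Suc_imp by blast+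
 ultimately show ?case using Suc by (auto intro!: derivative_intros Ck_on_add)
qed

section \<open>An infinitely differentiable bump\<close>

definition Eexp :: "real poly => real => real" where
 "Eexp p t = (if t > 0 then poly p (1/t)*exp (- 1/t) else 0)"

text \<open>The polynomial such that differentiating \<open>poly p (1/t) * exp (- 1/t)\<close>
  reproduces the same form. The class \<open>Eexp\<close> is thus closed under differentiation and
  smoothness of all orders is a single induction.\<close>

definition Eder :: "real poly => real poly" where
 "Eder p = [:0, 0, 1:] * (p - pderiv p)"

lemma poly_exp_tendsto_0: "((%x. poly p x*exp (- x)) \<longlongrightarrow> (0::real)) at_top"
proof -
 have "((%x. (\<Sum>i\<le>degree p. coeff p i*(x^i/exp x))) \<longlongrightarrow> (\<Sum>i\<le>degree p. coeff p i*0)) at_top"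
  by (intro tendsto_sum tendsto_mult tendsto_const tendsto_power_div_exp_0)
 moreover have "(%x. (\<Sum>i\<le>degree p. coeff p i*(x^i/exp x))) = (%x. poly p x*exp (- x))"
  by (auto simp: poly_altdef sum_distrib_right sum_divide_distrib exp_minus field_simps)
 ultimately show ?thesis by simp
qed

lemma Eexp_deriv: "(Eexp p has_real_derivative Eexp (Eder p) t) (at t)"
proof -
 consider "t < 0" | "t > 0" | "t = 0" by linarith
 then show ?thesis
 proof cases
  case 1
  have "((%t. 0) has_real_derivative 0) (at t)" by simp
  then have "(Eexp p has_real_derivative 0) (at t)"
   by (rule DERIV_cong_ev[THEN iffD1, rotated -1])
    (use 1 in \<open>auto simp: Eexp_def intro!: eventually_mono[OF eventually_nhds_in_open[of "{..<0}"]]\<close>)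
  then show ?thesis using 1 by (simp add: Eexp_def)
 next
  case 2
  have "((%t. poly p (1/t)*exp (- 1/t)) has_real_derivative
   (poly (pderiv p) (1/t)*(- 1/t^2))*exp (- 1/t) + (exp (- 1/t)*(1/t^2))*poly p (1/t)) (at t)"
   using 2 by (auto intro!: derivative_eq_intros DERIV_chain'[OF _ poly_DERIV] simp: power2_eq_square field_simps)
  moreover have "(poly (pderiv p) (1/t)*(- 1/t^2))*exp (- 1/t) + (exp (- 1/t)*(1/t^2))*poly p (1/t) = Eexp (Eder p) t"
   using 2 by (simp add: Eexp_def Eder_def power2_eq_square field_simps)
  ultimately have "((%t. poly p (1/t)*exp (- 1/t)) has_real_derivative Eexp (Eder p) t) (at t)" by simp
  then show ?thesis
   by (rule DERIV_cong_ev[THEN iffD1, rotated -1])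
    (use 2 in \<open>auto simp: Eexp_def intro!: eventually_mono[OF eventually_nhds_in_open[of "{0<..}"]]\<close>)
 next
  case 3
  have "((%h. poly (pCons 0 p) (inverse h)*exp (- inverse h)) \<longlongrightarrow> 0) (at_right (0::real))"
   by (rule filterlim_compose[OF poly_exp_tendsto_0 filterlim_inverse_at_top_right])
  then have r: "((%h. Eexp p h/h) \<longlongrightarrow> 0) (at_right 0)"
  proof (rule Lim_transform_eventually)
   show "\<forall>\<^sub>F h in at_right 0. poly (pCons 0 p) (inverse h)*exp (- inverse h) = Eexp p h/h"
    by (rule eventually_at_right_less[THEN eventually_mono]) (simp add: Eexp_def divide_inverse)
  qed
  have l: "((%h. Eexp p h/h) \<longlongrightarrow> 0) (at_left 0)"
  proof (rule Lim_transform_eventually[OF tendsto_const])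
   show "\<forall>\<^sub>F h in at_left (0::real). 0 = Eexp p h/h"
    by (rule eventually_at_leftI[of "-1"]) (simp_all add: Eexp_def)
  qed
  have "((%h. Eexp p h/h) \<longlongrightarrow> 0) (at 0)"
   using l r filterlim_split_at by blast
  then show ?thesis using 3 by (simp add: DERIV_def Eexp_def)
 qed
qed

lemma Eexp_cont: "continuous_on UNIV (Eexp p)"
 using Eexp_deriv by (metis DERIV_isCont continuous_at_imp_continuous_on)

lemma Ck_on_Eexp: "Ck_on k UNIV (%z::real^3. r*Eexp p (c + a*z $ i))"
proof (induction k arbitrary: r p)
 case 0
 show ?case by (auto intro!: continuous_intros continuous_on_UNIV_comp[OF Eexp_cont])
next
 case (Suc k)
 have g: "grad1 (%z. r*Eexp p (c + a*z $ i)) (%z. r*\<^sub>R (Eexp (Eder p) (c + a*z $ i)*\<^sub>R (0 + a*\<^sub>R axis i 1)))"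
  by (intro grad1_cmult grad1_real_comp Eexp_deriv Eexp_cont grad1_add grad1_const grad1_coord)
 have d: "frechet_derivative (%z. r*Eexp p (c + a*z $ i)) (at x) = (%h. (r*\<^sub>R (Eexp (Eder p) (c + a*x $ i)*\<^sub>R (0 + a*\<^sub>R axis i 1))) \<bullet> h)" for x
  by (rule frechet_derivative_at[symmetric, OF grad1_D[OF g]])
 have "(%x. frechet_derivative (%z. r*Eexp p (c + a*z $ i)) (at x) b) = (%x. (r*(a*(axis i 1 \<bullet> b)))*Eexp (Eder p) (c + a*x $ i))" for b
  unfolding d by (auto simp: mult_ac)
 then have "Ck_on k UNIV (%x. frechet_derivative (%z. r*Eexp p (c + a*z $ i)) (at x) b)" for b
  using Suc.IH[of "r*(a*(axis i 1 \<bullet> b))" "Eder p"] by simp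
 moreover have "(%z. r*Eexp p (c + a*z $ i)) differentiable (at x)" for x
  using grad1_D[OF g] differentiable_def by blast
 ultimately show ?case by simp
qed

text \<open>Test functions for weak derivatives must have all derivatives, which \<open>ker\<close>
  has not. A product of one-dimensional bumps needs only closure of smoothness under
  products.\<close>

definition bump :: "real^3 => real" where
 "bump y = (Eexp 1 (1 + y $ 1)*Eexp 1 (1 - y $ 1))*((Eexp 1 (1 + y $ 2)*Eexp 1 (1 - y $ 2))*(Eexp 1 (1 + y $ 3)*Eexp 1 (1 - y $ 3)))"

lemma bump_smooth: "Ck_on k UNIV (%z. C*bump (s*\<^sub>R (z - x)))"
proof -
 have e: "Ck_on k UNIV (%z::real^3. Eexp 1 (1 + (s*\<^sub>R (z - x)) $ i))" "Ck_on k UNIV (%z::real^3. Eexp 1 (1 - (s*\<^sub>R (z - x)) $ i))" for i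
  using Ck_on_Eexp[of k 1 1 "1 - s*x $ i" s i] Ck_on_Eexp[of k 1 1 "1 + s*x $ i" "- s" i] by (simp_all add: algebra_simps)
 have c: "Ck_on k UNIV (%z::real^3. C)"
 proof (induction k arbitrary: C)
  case (Suc k)
  then show ?case by simp
 qed simp
 show ?thesis unfolding bump_def by (intro Ck_on_mult e c)
qed

lemma bump_nonneg: "bump y \<ge> 0"
 by (auto simp: bump_def Eexp_def)

lemma bump_outside: "y \<notin> B1 ==> bump y = 0"
proof -
 assume "y \<notin> B1"
 then obtain i where i: "\<not> (- 1 <= y $ i \<and> y $ i <= 1)" by (auto simp: mem_box_cart)
 have "i = 1 \<or> i = 2 \<or> i = 3" using exhaust_3 by blast
 then show ?thesis using i by (auto simp: bump_def Eexp_def)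
qed

lemma grad1_ex: "grad1 f g ==> \<exists>g. grad1 f g"
 by (rule exI)

lemma bump_grad: "\<exists>g. grad1 bump g"
proof -
 have e1: "grad1 (%y::real^3. Eexp 1 (1 + y $ i)) (%y. Eexp (Eder 1) (1 + y $ i)*\<^sub>R (0 + axis i 1))" for i
  by (rule grad1_real_comp[OF grad1_add[OF grad1_const grad1_coord] Eexp_deriv Eexp_cont])
 have e2: "grad1 (%y::real^3. Eexp 1 (1 - y $ i)) (%y. Eexp (Eder 1) (1 - y $ i)*\<^sub>R (0 - axis i 1))" for i
  by (rule grad1_real_comp[OF grad1_diff[OF grad1_const grad1_coord] Eexp_deriv Eexp_cont])
 have eq: "bump = (%y. (Eexp 1 (1 + y $ 1)*Eexp 1 (1 - y $ 1))*((Eexp 1 (1 + y $ 2)*Eexp 1 (1 - y $ 2))*(Eexp 1 (1 + y $ 3)*Eexp 1 (1 - y $ 3))))"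
  by (rule ext) (rule bump_def)
 show ?thesis
  unfolding eq
  by (rule grad1_ex[OF grad1_mult[OF grad1_mult[OF e1[of 1] e2[of 1]] grad1_mult[OF grad1_mult[OF e1[of 2] e2[of 2]] grad1_mult[OF e1[of 3] e2[of 3]]]]])
qed

definition dbump where "dbump = (SOME g. grad1 bump g)"

lemma grad1_bump: "grad1 bump dbump"
 unfolding dbump_def using someI_ex[OF bump_grad] .

definition bmass :: real where "bmass = integral B1 bump"

lemma bump_cont: "continuous_on S bump" "continuous_on S dbump"
 using grad1_cont[OF grad1_bump] grad1_cont_grad[OF grad1_bump] by (auto intro: cont_UNIV_sub)

lemma bmass_pos: "bmass > 0"
proof -
 have "bmass \<noteq> 0"
 proof
  assume "bmass = 0"
  then have "(bump has_integral 0) B1"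
   using integrable_integral[OF integrable_continuous[OF bump_cont(1), of "-1" 1]] by (simp add: bmass_def)
  then have "bump 0 = 0"
   by (intro has_integral_0_cbox_imp_0[OF bump_cont(1)]) (auto simp: mem_box_cart interval_ne_empty_cart bump_nonneg)
  then show False by (simp add: bump_def Eexp_def)
 qed
 moreover have "bmass \<ge> 0" unfolding bmass_def by (intro integral_nonneg integrable_continuous bump_cont bump_nonneg)
 ultimately show ?thesis by simp
qed

definition bks :: "real => real^3 => real" where
 "bks s y = (1/(bmass * s^3))*bump ((1/s)*\<^sub>R y)"

lemma bks_nonneg: "s > 0 ==> bks s y \<ge> 0"
 using bmass_pos bump_nonneg by (simp add: bks_def)

lemma bks_outside:
 assumes "s > 0" "\<not> (\<forall>i. \<bar>y $ i\<bar> <= s)"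
 shows "bks s y = 0"
proof -
 obtain i where "\<not> \<bar>y $ i\<bar> <= s" using assms(2) by blast
 then have "\<not> \<bar>((1/s)*\<^sub>R y) $ i\<bar> <= 1" using assms(1) by (simp add: abs_mult field_simps)
 then have "\<not> (- 1 <= ((1/s)*\<^sub>R y) $ i \<and> ((1/s)*\<^sub>R y) $ i <= 1)" by linarith
 then have "(1/s)*\<^sub>R y \<notin> B1" unfolding mem_box_cart by (metis one_index vector_uminus_component)
 then show ?thesis by (simp add: bks_def bump_outside)
qed

lemma bks_cont: "continuous_on S (bks s)"
 unfolding bks_def[abs_def] by (intro continuous_intros continuous_on_UNIV_comp[OF bump_cont(1)])

lemma bks_measurable [measurable]: "bks s \<in> borel_measurable borel"
 by (rule borel_measurable_continuous_onI[OF bks_cont])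

lemma nn_integral_bks:
 assumes s: "s > 0"
 shows "(nnI (%y. ennreal (bks s y))) = 1"
proof -
 let ?a = "- vec s :: real^3" and ?b = "vec s :: real^3"
 have "(nnI (%y. ennreal (bks s y))) = (nnI (%y. ennreal (bks s y)*indicator (cbox ?a ?b) y))"
 proof (rule nn_integral_cong)
  fix y
  show "ennreal (bks s y) = ennreal (bks s y)*indicator (cbox ?a ?b) y"
  proof (cases "y \<in> cbox ?a ?b")
   case False
   then have "\<not> (\<forall>i. \<bar>y $ i\<bar> <= s)" by (auto simp: mem_box_cart abs_le_iff minus_le_iff)
   then show ?thesis using bks_outside[OF s] by simp
  qed simp
 qed
 also have "... = ennreal (integral (cbox ?a ?b) (bks s))"
  by (rule nn_integral_cbox_continuous) (use bks_cont bks_nonneg s in auto)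
 also have "integral (cbox ?a ?b) (bks s) = 1"
 proof -
  have "(bump has_integral bmass) B1"
   unfolding bmass_def by (intro integrable_integral integrable_continuous bump_cont)
  from has_integral_affinity'[OF this, of "1/s" 0] s
  have "((%y. bump ((1/s)*\<^sub>R y)) has_integral (bmass /\<^sub>R (1/s)^3)) (cbox ((- 1) /\<^sub>R (1/s)) (1 /\<^sub>R (1/s)))" by simp
  moreover have "(- 1 :: real^3) /\<^sub>R (1/s) = ?a" "(1 :: real^3) /\<^sub>R (1/s) = ?b" by (simp_all add: vec_eq_iff)
  ultimately have "((%y. bump ((1/s)*\<^sub>R y)) has_integral (bmass * s^3)) (cbox ?a ?b)"
   by (simp add: power_one_over mult.commute)
  from has_integral_mult_right[OF this, of "1/(bmass * s^3)"]
  have "(bks s has_integral 1) (cbox ?a ?b)" using bmass_pos s by (simp add: bks_def[abs_def])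
  then show ?thesis by (rule integral_unique)
 qed
 finally show ?thesis by simp
qed


lemma bks_even: "bks s (- y) = bks s y"
 by (simp add: bks_def bump_def mult_ac)

lemma nn_integral_lborel_translate:
 fixes f :: "real^3 => ennreal"
 assumes [measurable]: "f \<in> borel_measurable borel"
 shows "(nnI (%x. f (x - z))) = (nnI (%x. f x))"
proof -
 have "(nnI (%x. f x)) = (\<integral>\<^sup>+x. f x \<partial>(distr lborel borel ((+) (- z))))" by (simp add: lborel_distr_plus)
 also have "... = (nnI (%x. f (- z + x)))" by (rule nn_integral_distr) auto
 finally show ?thesis by simp
qed

lemma clamp_diff_le:
 fixes a b k :: real
 assumes "k \<ge> 0"
 shows "\<bar>max (- k) (min k a)\<bar> <= k" "\<bar>a - max (- k) (min k a)\<bar> <= \<bar>a\<bar>"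
 using assms by (auto simp: max_def min_def)

lemma sq_le_of_abs: "\<bar>a\<bar> <= \<bar>b\<bar> ==> (a::real)\<^sup>2 <= b^2"
 using power_mono[of "\<bar>a\<bar>" "\<bar>b\<bar>" 2] by simp

text \<open>Clamping supplies the dominating function. The level \<open>k\<close> is fixed first
  with \<open>f\<close> itself; then continuous functions converging to \<open>f\<close> almost
  everywhere are clamped at the same level, and dominated convergence applies on the bounded
  box.\<close>

lemma L2_continuous_dense:
 fixes f :: "real^3 => real"
 assumes f [measurable]: "f \<in> borel_measurable borel"
  and fin: "(nnI (%x. ennreal ((f x)^2)*indicator (cbox a b) x)) < \<infinity>" and e: "e > 0"
 obtains g where "continuous_on UNIV g" "(nnI (%x. ennreal ((f x - g x)^2)*indicator (cbox a b) x)) < ennreal e"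
proof -
 let ?P = "cbox a b"
 define c where "c k t = max (- real k) (min (real k) t)" for k :: nat and t :: real
 have cb: "\<bar>c k t\<bar> <= real k" "\<bar>t - c k t\<bar> <= \<bar>t\<bar>" for k t unfolding c_def by (rule clamp_diff_le, simp)+
 have cc: "continuous_on UNIV (c k)" for k unfolding c_def by (intro continuous_intros)
 then have [measurable]: "c k \<in> borel_measurable borel" for k by (rule borel_measurable_continuous_onI)
 have "f \<in> borel_measurable (lebesgue_on UNIV)" using f by (simp add: borel_measurable_if_D measurable_completion)
 then have "f measurable_on UNIV" by (simp add: measurable_on_iff_borel_measurable)
 then obtain N g where N: "negligible N" and g: "!!n. continuous_on UNIV (g n)" "!!x. x \<notin> N ==> (%n. g n x) \<longlonglongrightarrow> f x"
  unfolding measurable_on_def by auto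
 have [measurable]: "g n \<in> borel_measurable borel" for n by (rule borel_measurable_continuous_onI[OF g(1)])
 have AEN: "AE x in lborel. x \<notin> N"
 proof -
  have "N \<in> null_sets lebesgue" using N by (simp add: negligible_iff_null_sets)
  then have "AE x in lebesgue. x \<notin> N" by (rule AE_not_in)
  then show ?thesis by (simp add: AE_completion_iff)
 qed
 have l1: "(%k. \<integral>\<^sup>+x. ennreal ((f x - c k (f x))^2)*indicator ?P x \<partial>lborel) \<longlonglongrightarrow> integral\<^sup>N lborel (%x::real^3. 0)"
 proof (rule nn_integral_dominated_convergence[where w="%x. ennreal ((f x)^2)*indicator ?P x"])
  show "AE x in lborel. (%k. ennreal ((f x - c k (f x))^2)*indicator ?P x) \<longlonglongrightarrow> 0"
  proof (rule AE_I2)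
   fix x
   obtain k0 :: nat where k0: "\<bar>f x\<bar> <= real k0" using real_arch_simple by blast
   have "\<forall>\<^sub>F k in sequentially. ennreal ((f x - c k (f x))^2)*indicator ?P x = 0"
   proof (rule eventually_sequentiallyI[of k0])
    fix k assume "k0 <= k"
    then have "\<bar>f x\<bar> <= real k" using k0 by linarith
    then have "c k (f x) = f x" unfolding c_def by (auto simp: max_def min_def)
    then show "ennreal ((f x - c k (f x))^2)*indicator ?P x = 0" by simp
   qed
   then show "(%k. ennreal ((f x - c k (f x))^2)*indicator ?P x) \<longlonglongrightarrow> 0" by (rule tendsto_eventually)
  qed
  show "AE x in lborel. ennreal ((f x - c k (f x))^2)*indicator ?P x <= ennreal ((f x)^2)*indicator ?P x" for k
   using cb(2) by (intro AE_I2 mult_right_mono ennreal_leI sq_le_of_abs) auto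
 qed (use fin in \<open>auto simp: less_top\<close>)
 have ev: "\<forall>\<^sub>F k in sequentially. (nnI (%x. ennreal ((f x - c k (f x))^2)*indicator ?P x)) < ennreal (e/4)"
  using order_tendstoD(2)[OF l1, of "ennreal (e/4)"] e by simp
 then obtain k where k: "(nnI (%x. ennreal ((f x - c k (f x))^2)*indicator ?P x)) < ennreal (e/4)"
  using eventually_happens by fastforce
 have l2: "(%n. \<integral>\<^sup>+x. ennreal ((c k (f x) - c k (g n x))^2)*indicator ?P x \<partial>lborel) \<longlonglongrightarrow> integral\<^sup>N lborel (%x::real^3. 0)"
 proof (rule nn_integral_dominated_convergence[where w="%x. ennreal ((2*real k)^2)*indicator ?P x"])
  show "AE x in lborel. (%n. ennreal ((c k (f x) - c k (g n x))^2)*indicator ?P x) \<longlonglongrightarrow> 0"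
   using AEN
  proof (rule AE_mp, intro AE_I2 impI)
   fix x assume "x \<notin> N"
   then have "(%n. c k (g n x)) \<longlonglongrightarrow> c k (f x)"
    using g(2) cc by (intro continuous_on_tendsto_compose[OF cc]) auto
   then have "(%n. (c k (f x) - c k (g n x))\<^sup>2) \<longlonglongrightarrow> (c k (f x) - c k (f x))\<^sup>2" by (intro tendsto_intros)
   then have "(%n. ennreal ((c k (f x) - c k (g n x))^2)) \<longlonglongrightarrow> ennreal 0" by (intro tendsto_ennrealI) simp
   then show "(%n. ennreal ((c k (f x) - c k (g n x))^2)*indicator ?P x) \<longlonglongrightarrow> 0"
    by (cases "x \<in> ?P") auto
  qed
  show "AE x in lborel. ennreal ((c k (f x) - c k (g n x))^2)*indicator ?P x <= ennreal ((2*real k)^2)*indicator ?P x" for n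
  proof (intro AE_I2 mult_right_mono ennreal_leI sq_le_of_abs)
   fix x show "\<bar>c k (f x) - c k (g n x)\<bar> <= \<bar>2*real k\<bar>" using cb(1)[of k "f x"] cb(1)[of k "g n x"] by linarith
  qed auto
  show "(nnI (%x. ennreal ((2*real k)^2)*indicator ?P x)) < \<infinity>"
   using emeasure_lborel_cbox_finite[of a b] by (simp add: nn_integral_cmult_indicator ennreal_mult_less_top less_top)
 qed auto
 have "\<forall>\<^sub>F n in sequentially. (nnI (%x. ennreal ((c k (f x) - c k (g n x))^2)*indicator ?P x)) < ennreal (e/4)"
  using order_tendstoD(2)[OF l2, of "ennreal (e/4)"] e by simp
 then obtain n where n: "(nnI (%x. ennreal ((c k (f x) - c k (g n x))^2)*indicator ?P x)) < ennreal (e/4)"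
  using eventually_happens by fastforce
 show thesis
 proof
  show "continuous_on UNIV (%x. c k (g n x))" by (rule continuous_on_UNIV_comp[OF cc g(1)])
  have "(nnI (%x. ennreal ((f x - c k (g n x))^2)*indicator ?P x))
   <= (nnI (%x. 2*(ennreal ((f x - c k (f x))^2)*indicator ?P x) + 2*(ennreal ((c k (f x) - c k (g n x))^2)*indicator ?P x)))"
  proof (rule nn_integral_mono)
   fix x
   have "(f x - c k (g n x))^2 <= 2*(f x - c k (f x))^2 + 2*(c k (f x) - c k (g n x))^2"
    using sq_add_le[of "f x - c k (f x)" "c k (f x) - c k (g n x)"] by simp
   then have "ennreal ((f x - c k (g n x))^2) <= ennreal (2*(f x - c k (f x))^2 + 2*(c k (f x) - c k (g n x))^2)" by (rule ennreal_leI)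
   also have "... = 2*ennreal ((f x - c k (f x))^2) + 2*ennreal ((c k (f x) - c k (g n x))^2)"
    by (simp add: ennreal_plus ennreal_mult)
   finally show "ennreal ((f x - c k (g n x))^2)*indicator ?P x <= 2*(ennreal ((f x - c k (f x))^2)*indicator ?P x) + 2*(ennreal ((c k (f x) - c k (g n x))^2)*indicator ?P x)"
    by (auto simp: indicator_def)
  qed
  also have "... = 2*(nnI (%x. ennreal ((f x - c k (f x))^2)*indicator ?P x)) + 2*(nnI (%x. ennreal ((c k (f x) - c k (g n x))^2)*indicator ?P x))"
   by (subst nn_integral_add, measurable) (simp add: nn_integral_cmult)
  also have "... < 2*ennreal (e/4) + 2*ennreal (e/4)"
   using k n by (intro add_strict_mono ennreal_mult_strict_left_mono) auto
  also have "... = ennreal e"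
  proof -
   have "2*ennreal (e/4) = ennreal (e/2)" using e by (simp flip: ennreal_numeral ennreal_mult')
   then show ?thesis using e by (simp flip: ennreal_plus)
  qed
  finally show "(nnI (%x. ennreal ((f x - c k (g n x))^2)*indicator ?P x)) < ennreal e" .
 qed
qed

lemma ennreal_combination:
 assumes "0 <= a" "0 <= b" "0 <= c"
 shows "ennreal (3*((a + b*c) + a)) = 3*((ennreal a + ennreal b*ennreal c) + ennreal a)"
proof -
 have "ennreal (3*((a + b*c) + a)) = ennreal 3*ennreal ((a + b*c) + a)" using assms by (intro ennreal_mult) auto
 also have "ennreal ((a + b*c) + a) = ennreal (a + b*c) + ennreal a" using assms by (intro ennreal_plus) auto
 also have "ennreal (a + b*c) = ennreal a + ennreal (b*c)" using assms by (intro ennreal_plus) auto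
 also have "ennreal (b*c) = ennreal b*ennreal c" using assms by (intro ennreal_mult) auto
 finally show ?thesis by simp
qed

lemma ennreal_sq_sum3: "((a::ennreal) + b + c)^2 <= 3*(a^2 + b^2 + c^2)"
proof (cases "a = top \<or> b = top \<or> c = top")
 case True
 then have "a^2 + b^2 + c^2 = top" by (auto simp: power2_eq_square ennreal_top_mult)
 moreover have "3*(top::ennreal) = top" by (simp add: ennreal_mult_top)
 ultimately have "3*(a^2 + b^2 + c^2) = top" by (simp only:)
 then show ?thesis by (simp only: top_greatest)
next
 case False
 then obtain x y z where r: "x \<ge> 0" "y \<ge> 0" "z \<ge> 0" "a = ennreal x" "b = ennreal y" "c = ennreal z"
  by (metis ennreal_cases)
 have "(x + y + z)^2 <= 3*(x^2 + y^2 + z^2)"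
  using sum_squares_bound[of x y] sum_squares_bound[of y z] sum_squares_bound[of x z] by (simp add: power2_eq_square algebra_simps)
 then have "ennreal ((x + y + z)^2) <= ennreal (3*(x^2 + y^2 + z^2))" by (rule ennreal_leI)
 moreover have "(a + b + c)^2 = ennreal ((x + y + z)^2)" using r by (simp add: ennreal_power flip: ennreal_plus)
 moreover have "3*(a^2 + b^2 + c^2) = ennreal (3*(x^2 + y^2 + z^2))" using r by (simp add: ennreal_power ennreal_plus ennreal_mult)
 ultimately show ?thesis by (simp only:)
qed


lemma bump_le_1: "bump y <= 1"
proof -
 have "0 <= Eexp 1 t" "Eexp 1 t <= 1" for t by (auto simp: Eexp_def)
 then show ?thesis unfolding bump_def by (intro mult_le_one mult_nonneg_nonneg) auto
qed

lemma bks_support_norm: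
 assumes "s > 0" "bks s y \<noteq> 0"
 shows "norm y <= 2 * s" "!!i. \<bar>y $ i\<bar> <= s"
proof -
 show c: "\<bar>y $ i\<bar> <= s" for i using bks_outside[OF assms(1)] assms(2) by blast
 have "(1/s)*\<^sub>R y \<in> B1"
 proof -
  have "- 1 <= y $ i/s \<and> y $ i/s <= 1" for i using c[of i] assms(1) by (simp add: field_simps abs_le_iff)
  then show ?thesis by (simp add: mem_box_cart)
 qed
 from norm_B1_le[OF this] have "norm y/s <= 2" using assms(1) by simp
 then show "norm y <= 2 * s" using assms(1) by (simp add: field_simps)
qed

lemma nn_integral_bks_shift:
 assumes "s > 0"
 shows "(nnI (%z. ennreal (bks s (z - x)))) = 1" "(nnI (%x. ennreal (bks s (z - x)))) = 1"
proof -
 show 1: "(nnI (%z. ennreal (bks s (z - x)))) = 1" for x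
  using nn_integral_lborel_translate[of "%y. ennreal (bks s y)" x] nn_integral_bks[OF assms] by simp
 have "bks s (z - x) = bks s (x - z)" for x using bks_even[of s "x - z"] by simp
 then show "(nnI (%x. ennreal (bks s (z - x)))) = 1" using 1[of z] by simp
qed

text \<open>Approximate \<open>f\<close> by a continuous \<open>g\<close>. The mollification of
  \<open>f - g\<close> is controlled uniformly in the scale by Cauchy-Schwarz against the kernel and
  Fubini (\<open>A2\<close>), that of \<open>g\<close> by uniform continuity (\<open>w\<close>), and
  \<open>h\<close> is the pointwise error of the approximation.\<close>

lemma mollify_L2:
 fixes f :: "real^3 => real"
 assumes f [measurable]: "f \<in> borel_measurable borel"
  and fin: "(nnI (%x. ennreal ((f x)^2)*indicator (cbox a b) x)) < \<infinity>" and e: "e > 0"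
  and K [measurable]: "K \<in> sets borel" and margin: "!!x y. x \<in> K ==> (!!i. \<bar>y $ i\<bar> <= 1) ==> x + y \<in> cbox a b"
 shows "\<exists>s0>0. s0 <= 1 \<and> (\<forall>s. 0 < s \<and> s <= s0 -->
  (\<integral>\<^sup>+x. ennreal (((\<integral>z. f z*bks s (z - x) \<partial>lborel) - f x)^2)*indicator K x \<partial>lborel) <= ennreal e)"
proof -
 let ?P = "cbox a b"
 obtain g where g: "continuous_on UNIV g" "(nnI (%x. ennreal ((f x - g x)^2)*indicator ?P x)) < ennreal (e/12)"
  using L2_continuous_dense[OF f fin, of "e/12"] e by auto
 have [measurable]: "g \<in> borel_measurable borel" by (rule borel_measurable_continuous_onI[OF g(1)])
 define m where "m = measure lborel ?P"
 have "emeasure lborel ?P \<noteq> top" using emeasure_lborel_cbox_finite[of a b] by (auto simp: less_top)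
 then have m: "m \<ge> 0" "emeasure lborel ?P = ennreal m" unfolding m_def by (simp_all add: emeasure_eq_ennreal_measure)
 have KP: "K \<subseteq> ?P" using margin[of _ 0] by auto
 have mK: "emeasure lborel K <= ennreal m" using KP m(2) emeasure_mono[of K ?P lborel] by auto
 \<comment> \<open>With the factor 3 from squaring a sum of three terms, the shares are
   \<open>e/4\<close> for \<open>A2\<close>, \<open>e/2\<close> for \<open>w\<close> and
   \<open>e/4\<close> for \<open>h\<close>.\<close>
 define w where "w = sqrt (e/(6*(m + 1)))"
 have w: "w > 0" unfolding w_def using e m by simp
 have "uniformly_continuous_on ?P g" by (intro compact_uniformly_continuous cont_UNIV_sub[OF g(1)] compact_cbox)
 then obtain dl where dl: "dl > 0" "!!x x'. x \<in> ?P ==> x' \<in> ?P ==> dist x' x < dl ==> dist (g x') (g x) < w"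
  unfolding uniformly_continuous_on_def using w by blast
 define h where "h z = \<bar>f z - g z\<bar>" for z
 have [measurable]: "h \<in> borel_measurable borel" unfolding h_def by measurable
 have h2: "(nnI (%x. ennreal ((h x)^2)*indicator ?P x)) < ennreal (e/12)" using g(2) by (simp add: h_def)
 have main: "(\<integral>\<^sup>+x. ennreal (((\<integral>z. f z*bks s (z - x) \<partial>lborel) - f x)^2)*indicator K x \<partial>lborel) <= ennreal e"
  if s: "0 < s" "s <= min 1 (dl / 4)" for s
 proof -
  define A where "A x = (nnI (%z. (ennreal (h z)*indicator ?P z)*ennreal (bks s (z - x))))" for x
  define A2 where "A2 x = (nnI (%z. (ennreal ((h z)^2)*indicator ?P z)*ennreal (bks s (z - x))))" for x
  have mA2 [measurable]: "A2 \<in> borel_measurable borel" unfolding A2_def by measurable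
  have AA2: "(A x)^2 <= A2 x" for x
  proof -
   let ?q = "%z. ennreal (sqrt (bks s (z - x)))"
   have q: "?q z * ?q z = ennreal (bks s (z - x))" for z using bks_nonneg[OF s(1)] by (simp flip: ennreal_mult)
   have "A x = (nnI (%z. (ennreal (h z)*indicator ?P z * ?q z) * ?q z))"
    unfolding A_def by (intro nn_integral_cong) (simp add: mult.assoc q)
   then have "(A x)^2 <= (nnI (%z. (ennreal (h z)*indicator ?P z * ?q z)\<^sup>2))*(nnI (%z. (?q z)\<^sup>2))"
    by (simp only:) (rule Cauchy_Schwarz_nn_integral, measurable)
   also have "(nnI (%z. (?q z)\<^sup>2)) = 1" by (simp add: power2_eq_square q nn_integral_bks_shift[OF s(1)])
   also have "(nnI (%z. (ennreal (h z)*indicator ?P z * ?q z)\<^sup>2)) = A2 x"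
    unfolding A2_def
   proof (intro nn_integral_cong)
    fix z
    have "(ennreal (h z)*indicator ?P z * ?q z)^2 = (ennreal (h z)*ennreal (h z))*(indicator ?P z*indicator ?P z)*(?q z * ?q z)"
     by (simp add: power2_eq_square mult_ac)
    also have "... = ennreal ((h z)^2)*indicator ?P z*ennreal (bks s (z - x))"
     by (simp add: q power2_eq_square indicator_def h_def flip: ennreal_mult)
    finally show "(ennreal (h z)*indicator ?P z * ?q z)^2 = ennreal ((h z)^2)*indicator ?P z*ennreal (bks s (z - x))" .
   qed
   finally show ?thesis by simp
  qed
  have "(nnI (%x. A2 x*indicator K x)) <= (nnI (%x. A2 x))"
   by (intro nn_integral_mono) (auto simp: indicator_def)
  also have "... = (\<integral>\<^sup>+z. (nnI (%x. (ennreal ((h z)^2)*indicator ?P z)*ennreal (bks s (z - x)))) \<partial>lborel)"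
   unfolding A2_def by (rule lborel_pair.Fubini') measurable
  also have "... = (nnI (%z. ennreal ((h z)^2)*indicator ?P z))"
   by (intro nn_integral_cong) (simp add: nn_integral_cmult nn_integral_bks_shift[OF s(1)])
  finally have IA: "(nnI (%x. A2 x*indicator K x)) <= ennreal (e/12)" using h2 by simp
  have pt: "ennreal (((\<integral>z. f z*bks s (z - x) \<partial>lborel) - f x)^2) <= 3*(A2 x + ennreal (w^2) + ennreal ((h x)^2))" if x: "x \<in> K" for x
  proof -
   let ?b = "%z. bks s (z - x)"
   have b0: "?b z \<ge> 0" for z by (rule bks_nonneg[OF s(1)])
   have zP: "z \<in> ?P" "\<bar>g z - g x\<bar> <= w" if "?b z \<noteq> 0" for z
   proof -
    note bs = bks_support_norm[OF s(1) that]
    have "x + (z - x) \<in> ?P" by (rule margin[OF x]) (use bs(2) s in \<open>auto intro: order_trans\<close>)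
    then show zP: "z \<in> ?P" by simp
    have "dist z x < dl" using bs(1) s dl(1) by (simp add: dist_norm)
    then have "dist (g z) (g x) < w" using dl(2) zP KP x by blast
    then show "\<bar>g z - g x\<bar> <= w" by (simp add: dist_real_def)
   qed
   have hb: "has_bochner_integral lborel ?b 1"
    by (rule has_bochner_integral_nn_integral) (use b0 nn_integral_bks_shift[OF s(1)] in auto)
   have ib: "integrable lborel ?b" "(\<integral>z. ?b z \<partial>lborel) = 1" using hb by (auto simp: has_bochner_integral_iff)
   define C where "C = 1/(bmass * s^3)"
   have C: "C \<ge> 0" "?b z <= C" for z unfolding C_def bks_def using bmass_pos s bump_le_1 by (auto intro!: divide_right_mono)
   have if': "integrable lborel (%z. f z * ?b z)"
   proof (rule integrableI_bounded)
    have "(nnI (%z. ennreal (norm (f z * ?b z)))) <= (nnI (%z. ennreal C*(1*indicator ?P z + ennreal ((f z)^2)*indicator ?P z)))"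
    proof (rule nn_integral_mono)
     fix z
     show "ennreal (norm (f z * ?b z)) <= ennreal C*(1*indicator ?P z + ennreal ((f z)^2)*indicator ?P z)"
     proof (cases "?b z = 0")
      case False
      then have "z \<in> ?P" by (rule zP)
      have "norm (f z * ?b z) = \<bar>f z\<bar> * ?b z" using b0 by (simp add: abs_mult)
      also have "... <= (1 + (f z)^2)*C"
      proof (intro mult_mono)
       show "\<bar>f z\<bar> <= 1 + (f z)^2" using zero_le_power2[of "\<bar>f z\<bar> - 1"] by (simp add: power2_diff)
      qed (use C b0 in auto)
      finally have "ennreal (norm (f z * ?b z)) <= ennreal ((1 + (f z)^2)*C)" by (rule ennreal_leI)
      also have "... = ennreal C*(1 + ennreal ((f z)^2))" using C by (simp add: ennreal_mult ennreal_plus mult.commute)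
      finally show ?thesis using \<open>z \<in> ?P\<close> by simp
     qed simp
    qed
    also have "... = ennreal C*(nnI (%z. 1*indicator ?P z + ennreal ((f z)^2)*indicator ?P z))"
     by (rule nn_integral_cmult) measurable
    also have "(nnI (%z. 1*indicator ?P z + ennreal ((f z)^2)*indicator ?P z))
      = (nnI (%z. 1*indicator ?P z)) + (nnI (%z. ennreal ((f z)^2)*indicator ?P z))"
     by (rule nn_integral_add) measurable
    also have "(nnI (%z. 1*indicator ?P z)) = emeasure lborel ?P" by simp
    also have "ennreal C*(emeasure lborel ?P + (nnI (%z. ennreal ((f z)^2)*indicator ?P z))) < \<infinity>"
     using fin emeasure_lborel_cbox_finite[of a b] by (simp add: ennreal_mult_less_top less_top)
    finally show "(nnI (%z. ennreal (norm (f z * ?b z)))) < \<infinity>" .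
   qed simp
   have id: "integrable lborel (%z. (f z - f x) * ?b z)"
    unfolding left_diff_distrib by (intro Bochner_Integration.integrable_diff if' integrable_mult_right ib)
   have "(\<integral>z. f z * ?b z \<partial>lborel) - f x = (\<integral>z. (f z - f x) * ?b z \<partial>lborel)"
    unfolding left_diff_distrib using if' ib by (subst Bochner_Integration.integral_diff) auto
   then have "ennreal \<bar>(\<integral>z. f z * ?b z \<partial>lborel) - f x\<bar> <= (nnI (%z. ennreal (norm ((f z - f x) * ?b z))))"
    using integral_norm_bound_ennreal[OF id] by simp
   also have "... <= (nnI (%z. (ennreal (h z)*indicator ?P z)*ennreal (?b z) + (ennreal w + ennreal (h x))*ennreal (?b z)))"
   proof (rule nn_integral_mono)
    fix z
    show "ennreal (norm ((f z - f x) * ?b z)) <= (ennreal (h z)*indicator ?P z)*ennreal (?b z) + (ennreal w + ennreal (h x))*ennreal (?b z)"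
    proof (cases "?b z = 0")
     case False
     note z = zP[OF False]
     have "norm ((f z - f x) * ?b z) = \<bar>f z - f x\<bar> * ?b z" using b0 by (simp add: abs_mult)
     also have "... <= (h z + (w + h x)) * ?b z" using z(2) b0 unfolding h_def by (intro mult_right_mono) linarith+
     finally have "ennreal (norm ((f z - f x) * ?b z)) <= ennreal ((h z + (w + h x)) * ?b z)" by (rule ennreal_leI)
     also have "... = ennreal (h z)*ennreal (?b z) + (ennreal w + ennreal (h x))*ennreal (?b z)"
      using w b0 by (simp add: h_def ennreal_mult ennreal_plus distrib_right)
     finally show ?thesis using z(1) by simp
    qed simp
   qed
   also have "... = A x + (ennreal w + ennreal (h x))"
    unfolding A_def by (subst nn_integral_add, measurable) (simp add: nn_integral_cmult nn_integral_bks_shift[OF s(1)])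
   finally have "(ennreal \<bar>(\<integral>z. f z * ?b z \<partial>lborel) - f x\<bar>)^2 <= (A x + ennreal w + ennreal (h x))^2"
    by (intro power_mono) (simp_all add: add.assoc)
   also have "... <= 3*((A x)^2 + (ennreal w)^2 + (ennreal (h x))^2)" by (rule ennreal_sq_sum3)
   also have "... <= 3*(A2 x + ennreal (w^2) + ennreal ((h x)^2))"
    using AA2 w by (intro mult_left_mono add_mono) (auto simp: ennreal_power h_def)
   finally show ?thesis by (simp add: ennreal_power)
  qed
  have "(\<integral>\<^sup>+x. ennreal (((\<integral>z. f z*bks s (z - x) \<partial>lborel) - f x)^2)*indicator K x \<partial>lborel)
   <= (nnI (%x. 3*((A2 x*indicator K x + ennreal (w^2)*indicator K x) + ennreal ((h x)^2)*indicator ?P x)))"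
  proof (rule nn_integral_mono)
   fix x
   show "ennreal (((\<integral>z. f z*bks s (z - x) \<partial>lborel) - f x)^2)*indicator K x <= 3*((A2 x*indicator K x + ennreal (w^2)*indicator K x) + ennreal ((h x)^2)*indicator ?P x)"
    using pt[of x] KP by (cases "x \<in> K") auto
  qed
  also have "... = 3*(nnI (%x. (A2 x*indicator K x + ennreal (w^2)*indicator K x) + ennreal ((h x)^2)*indicator ?P x))"
   by (rule nn_integral_cmult) measurable
  also have "(nnI (%x. (A2 x*indicator K x + ennreal (w^2)*indicator K x) + ennreal ((h x)^2)*indicator ?P x))
   = (nnI (%x. A2 x*indicator K x + ennreal (w^2)*indicator K x)) + (nnI (%x. ennreal ((h x)^2)*indicator ?P x))"
   by (rule nn_integral_add) measurable
  also have "(nnI (%x. A2 x*indicator K x + ennreal (w^2)*indicator K x))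
   = (nnI (%x. A2 x*indicator K x)) + (nnI (%x. ennreal (w^2)*indicator K x))"
   by (rule nn_integral_add) measurable
  also have "(nnI (%x. ennreal (w^2)*indicator K x)) = ennreal (w^2)*emeasure lborel K"
   by (simp add: nn_integral_cmult_indicator)
  also have "3*(((nnI (%x. A2 x*indicator K x)) + ennreal (w^2)*emeasure lborel K) + (nnI (%x. ennreal ((h x)^2)*indicator ?P x)))
   <= 3*((ennreal (e/12) + ennreal (w^2)*ennreal m) + ennreal (e/12))"
   using IA h2 mK by (intro mult_left_mono add_mono) auto
  also have "... = ennreal (3*((e/12 + w^2*m) + e/12))"
   by (rule ennreal_combination[symmetric]) (use e m in auto)
  also have "... <= ennreal e"
  proof (rule ennreal_leI)
   have "w^2*m = e/6*(m/(m + 1))" unfolding w_def using e m by (simp add: field_simps)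
   also have "... <= e/6*1" using e m by (intro mult_left_mono) auto
   finally show "3*((e/12 + w^2*m) + e/12) <= e" by simp
  qed
  finally show ?thesis .
 qed
 show ?thesis using dl(1) main by (intro exI[of _ "min 1 (dl / 4)"]) auto
qed

text \<open>Sobolev functions are measurable only for the completed measure restricted to the
  domain. A Borel representative extended by zero can be convolved over the whole space.\<close>

lemma borel_version:
 fixes w :: "real^3 => real"
 assumes w: "w \<in> borel_measurable (lebesgue_on Om)" and Om: "Om \<in> sets borel"
 shows "\<exists>w0\<in>borel_measurable borel. (\<forall>x. x \<notin> Om --> w0 x = 0) \<and> (AE x in lborel. x \<in> Om --> w0 x = w x)"
proof -
 have Om': "Om \<in> sets lebesgue" using Om by auto
 have "(%x. if x \<in> Om then w x else 0) \<in> borel_measurable lebesgue"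
  using w borel_measurable_if_I[OF w Om'] by simp
 from completion_ex_borel_measurable_real[OF this]
 obtain g where g: "g \<in> borel_measurable lborel" "AE x in lborel. (if x \<in> Om then w x else 0) = g x" by blast
 have [measurable]: "g \<in> borel_measurable borel" "Om \<in> sets borel" using g Om by auto
 show ?thesis
 proof (intro bexI[of _ "%x. g x*indicator Om x"] conjI allI impI)
  show "AE x in lborel. x \<in> Om --> g x*indicator Om x = w x"
   using g(2) by (rule AE_mp) (intro AE_I2, auto)
 qed auto
qed

lemma integral_lebesgue_on_version:
 fixes w w0 ps :: "real^3 => real"
 assumes w: "w \<in> borel_measurable (lebesgue_on Om)" and Om: "Om \<in> sets borel"
  and w0: "w0 \<in> borel_measurable borel" "!!x. x \<notin> Om ==> w0 x = 0" "AE x in lborel. x \<in> Om --> w0 x = w x"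
  and ps: "ps \<in> borel_measurable borel"
 shows "(\<integral>x. w x*ps x \<partial>(lebesgue_on Om)) = (\<integral>x. w0 x*ps x \<partial>lborel)"
proof -
 have Om': "Om \<in> sets lebesgue" using Om by auto
 have [measurable]: "(%x. if x \<in> Om then w x else 0) \<in> borel_measurable lebesgue"
  using borel_measurable_if_I[OF w Om'] by simp
 have [measurable]: "w0 \<in> borel_measurable lebesgue" "ps \<in> borel_measurable lebesgue"
  using w0(1) ps by (auto intro: measurable_completion)
 have "(\<integral>x. w x*ps x \<partial>(lebesgue_on Om)) = (\<integral>x. indicator Om x*\<^sub>R (w x*ps x) \<partial>lebesgue)"
  using Om' by (subst integral_restrict_space) auto
 also have "... = (\<integral>x. (if x \<in> Om then w x else 0)*ps x \<partial>lebesgue)"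
  by (intro Bochner_Integration.integral_cong) auto
 also have "... = (\<integral>x. w0 x*ps x \<partial>lebesgue)"
 proof (rule integral_cong_AE)
  have "AE x in lebesgue. x \<in> Om --> w0 x = w x" using w0(3) by (simp add: AE_completion)
  then show "AE x in lebesgue. (if x \<in> Om then w x else 0)*ps x = w0 x*ps x"
   by (rule AE_mp) (intro AE_I2, auto simp: w0(2))
 qed auto
 also have "... = (\<integral>x. w0 x*ps x \<partial>lborel)"
  by (rule integral_completion) (use w0 ps in auto)
 finally show ?thesis .
qed

lemma nn_integral_version:
 fixes w w0 :: "real^3 => real"
 assumes w: "integrable (lebesgue_on Om) (%x. (w x)\<^sup>2)" and Om: "Om \<in> sets borel"
  and w0: "w0 \<in> borel_measurable borel" "!!x. x \<notin> Om ==> w0 x = 0" "AE x in lborel. x \<in> Om --> w0 x = w x"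
 shows "(nnI (%x. ennreal ((w0 x)^2))) < \<infinity>"
proof -
 have Om': "Om \<in> sets lebesgue" using Om by auto
 have "(nnI (%x. ennreal ((w0 x)^2))) = (\<integral>\<^sup>+x. ennreal ((w0 x)^2) \<partial>lebesgue)" by (simp add: nn_integral_completion)
 also have "... = (\<integral>\<^sup>+x. ennreal ((w x)^2)*indicator Om x \<partial>lebesgue)"
 proof (rule nn_integral_cong_AE)
  have "AE x in lebesgue. x \<in> Om --> w0 x = w x" using w0(3) by (simp add: AE_completion)
  then show "AE x in lebesgue. ennreal ((w0 x)^2) = ennreal ((w x)^2)*indicator Om x"
   by (rule AE_mp) (intro AE_I2, auto simp: w0(2) indicator_def)
 qed
 also have "... = (\<integral>\<^sup>+x. ennreal ((w x)^2) \<partial>(lebesgue_on Om))"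
  using Om' by (subst nn_integral_restrict_space) auto
 also have "... < \<infinity>" using w by (simp add: integrable_iff_bounded)
 finally show ?thesis .
qed

lemma ennreal_combination2:
 assumes "0 <= a" "0 <= b" "0 <= c"
 shows "ennreal (a*b + 2*c) = ennreal a*ennreal b + 2*ennreal c"
proof -
 have "ennreal (a*b + 2*c) = ennreal (a*b) + ennreal (2*c)" using assms by (intro ennreal_plus) auto
 also have "ennreal (2*c) = ennreal 2*ennreal c" using assms by (intro ennreal_mult) auto
 also have "ennreal (a*b) = ennreal a*ennreal b" using assms by (intro ennreal_mult) auto
 finally show ?thesis by simp
qed

definition dbks :: "real => real^3 => real^3" where
 "dbks s y = (1/(bmass * s^3))*\<^sub>R ((1/s)*\<^sub>R dbump ((1/s)*\<^sub>R y))"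

lemma grad1_bks: "grad1 (bks s) (dbks s)"
 using grad1_cmult[OF grad1_affine[OF grad1_bump, of 0 "1/s"], of "1/(bmass * s^3)"]
 by (rule grad1_cong) (simp_all add: bks_def dbks_def)

lemma dbks_cont: "continuous_on S (dbks s)"
 using grad1_cont_grad[OF grad1_bks] by (rule cont_UNIV_sub)

lemma dbks_outside:
 assumes "s > 0" "\<not> (\<forall>i. \<bar>y $ i\<bar> <= s)"
 shows "dbks s y = 0"
proof -
 let ?a = "- vec s :: real^3" and ?b = "vec s :: real^3"
 have z: "bks s x = 0" if "x \<notin> cbox ?a ?b" for x
  using bks_outside[OF assms(1), of x] that by (auto simp: mem_box_cart abs_le_iff minus_le_iff)
 have "y \<notin> box ?a ?b"
 proof
  assume "y \<in> box ?a ?b"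
  then have "- s < y $ i \<and> y $ i < s" for i by (simp add: mem_box_cart)
  then have "\<bar>y $ i\<bar> <= s" for i by (smt (verit))
  then show False using assms(2) by blast
 qed
 with grad1_zero_outside(2)[OF grad1_bks z] show ?thesis by simp
qed

lemma test_fn_bks:
 assumes s: "s > 0" and sub: "cbox (x - vec s) (x + vec s) \<subseteq> Om"
 shows "test_fn Om (%z. bks s (z - x))"
  "frechet_derivative (%z. bks s (z - x)) (at z) (axis j 1) = dbks s (z - x) $ j"
proof -
 have "{z. bks s (z - x) \<noteq> 0} \<subseteq> cbox (x - vec s) (x + vec s)"
 proof
  fix z assume "z \<in> {z. bks s (z - x) \<noteq> 0}"
  then have "\<bar>(z - x) $ i\<bar> <= s" for i using bks_outside[OF s, of "z - x"] by blast
  then have "\<bar>z $ i - x $ i\<bar> <= s" for i by simp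
  then have "x $ i - s <= z $ i \<and> z $ i <= x $ i + s" for i by (simp add: abs_diff_le_iff)
  then show "z \<in> cbox (x - vec s) (x + vec s)" by (simp add: mem_box_cart)
 qed
 then have cl: "closure {z. bks s (z - x) \<noteq> 0} \<subseteq> cbox (x - vec s) (x + vec s)"
  by (rule closure_minimal[OF _ closed_cbox])
 have "smooth_on UNIV (%z. bks s (z - x))"
  unfolding smooth_on_def bks_def using bump_smooth by blast
 moreover have "compact (closure {z. bks s (z - x) \<noteq> 0})"
  using cl bounded_subset[OF bounded_cbox cl] by (simp add: compact_eq_bounded_closed)
 ultimately show "test_fn Om (%z. bks s (z - x))" unfolding test_fn_def using cl sub by blast
 have "grad1 (%z. bks s (- x + 1*\<^sub>R z)) (%z. 1*\<^sub>R dbks s (- x + 1*\<^sub>R z))" by (rule grad1_affine[OF grad1_bks])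
 from grad1_D[OF this, of z] have "((%z. bks s (z - x)) has_derivative (%h. dbks s (z - x) \<bullet> h)) (at z)" by simp
 from frechet_derivative_at[OF this, symmetric]
 show "frechet_derivative (%z. bks s (z - x)) (at z) (axis j 1) = dbks s (z - x) $ j"
  by (simp only: inner_axis) simp
qed

text \<open>Convolving with the kernel of scale \<open>s\<close> turns the weak derivative into
  \<open>I s i j\<close>, which is close to \<open>Du\<close> by \<open>mollify_L2\<close>. With
  \<open>s\<close> fixed, \<open>u\<close> is replaced in the convolution by a continuous
  \<open>w\<close>, so that differentiation under the integral sign is the one for continuous
  integrands. The error is multiplied by the sup norm \<open>Sd\<close> of the kernel gradient,
  which is why \<open>w\<close> is chosen after \<open>s\<close>.\<close>

lemma Sobolev_smooth_approx:
 assumes Om: "open Om" "bounded Om" and S: "sobolev12 Om u Du"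
 shows "\<exists>D\<in>borel_measurable borel. (AE x in lborel. x \<in> Om --> D x = Du x) \<and>
  (\<forall>K e. compact K \<and> K \<subseteq> Om \<and> e > 0 --> (\<exists>v V. gradM v V \<and>
   (nnI (%x. ennreal ((norm (V x - D x))^2)*indicator K x)) <= ennreal e))"
proof -
 have mOm: "Om \<in> sets borel" using Om by auto
 have mu: "(%x. u x $ i) \<in> borel_measurable (lebesgue_on Om)" for i
  using S unfolding sobolev12_def by (intro measurable_compose[OF _ borel_measurable_continuous_onI[of "%v. v $ i"]]) (auto intro!: continuous_intros)
 have mD: "(%x. Du x $ i $ j) \<in> borel_measurable (lebesgue_on Om)" for i j
  using S unfolding sobolev12_def by (intro measurable_compose[OF _ borel_measurable_continuous_onI[of "%v. v $ i $ j"]]) (auto intro!: continuous_intros)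
 have "\<forall>i. \<exists>w0. w0 \<in> borel_measurable borel \<and> (\<forall>x. x \<notin> Om --> w0 x = 0) \<and> (AE x in lborel. x \<in> Om --> w0 x = u x $ i)"
  using borel_version[OF mu mOm] unfolding Bex_def by (rule allI)
 from choice[OF this] obtain u0 where u0': "\<forall>i. u0 i \<in> borel_measurable borel \<and> (\<forall>x. x \<notin> Om --> u0 i x = 0) \<and> (AE x in lborel. x \<in> Om --> u0 i x = u x $ i)"
  by (rule exE)
 have u0: "u0 i \<in> borel_measurable borel" "!!x. x \<notin> Om ==> u0 i x = 0" "AE x in lborel. x \<in> Om --> u0 i x = u x $ i" for i
  using u0'[rule_format, of i] by auto
 have "\<forall>p. \<exists>w0. w0 \<in> borel_measurable borel \<and> (\<forall>x. x \<notin> Om --> w0 x = 0) \<and> (AE x in lborel. x \<in> Om --> w0 x = Du x $ fst p $ snd p)"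
  using borel_version[OF mD mOm] unfolding Bex_def by (rule allI)
 from choice[OF this] obtain d0' where d0': "\<forall>p. d0' p \<in> borel_measurable borel \<and> (\<forall>x. x \<notin> Om --> d0' p x = 0) \<and> (AE x in lborel. x \<in> Om --> d0' p x = Du x $ fst p $ snd p)"
  by (rule exE)
 define d0 where "d0 i j = d0' (i, j)" for i j
 have d0: "d0 i j \<in> borel_measurable borel" "!!x. x \<notin> Om ==> d0 i j x = 0" "AE x in lborel. x \<in> Om --> d0 i j x = Du x $ i $ j" for i j
  using d0'[rule_format, of "(i, j)"] by (auto simp: d0_def)
 note [measurable] = u0(1) d0(1)
 define D where "D x = (\<chi> i j. d0 i j x)" for x
 have Dm: "D \<in> borel_measurable borel"
  unfolding borel_measurable_euclidean_space[of D] Basis_vec_def by (auto simp: D_def inner_axis)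
 have DAE: "AE x in lborel. x \<in> Om --> D x = Du x"
 proof -
  have "AE x in lborel. \<forall>i. \<forall>j. x \<in> Om --> d0 i j x = Du x $ i $ j"
   unfolding AE_all_countable using d0(3) by blast
  then show ?thesis by (rule AE_mp) (intro AE_I2, auto simp: D_def vec_eq_iff)
 qed
 obtain c :: "real^3" where c: "Om \<subseteq> cbox (- c) c" using bounded_subset_cbox_symmetric[OF Om(2)] by blast
 define a where "a = - c - 1"
 define b where "b = c + 1"
 let ?P = "cbox a b"
 have margin1: "x + y \<in> ?P" if "x \<in> Om" "!!i. \<bar>y $ i\<bar> <= 1" for x y
 proof -
  have x: "- c $ i <= x $ i \<and> x $ i <= c $ i" for i using c that(1) by (auto simp: mem_box_cart)
  have y: "- 1 <= y $ i \<and> y $ i <= 1" for i using that(2)[of i] by (simp add: abs_le_iff minus_le_iff)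
  show ?thesis unfolding mem_box_cart
  proof
   fix i show "a $ i <= (x + y) $ i \<and> (x + y) $ i <= b $ i" using x[of i] y[of i] by (simp add: a_def b_def)
  qed
 qed
 define m where "m = measure lborel ?P"
 have "emeasure lborel ?P \<noteq> top" using emeasure_lborel_cbox_finite[of a b] by (auto simp: less_top)
 then have m: "m \<ge> 0" "emeasure lborel ?P = ennreal m" unfolding m_def by (simp_all add: emeasure_eq_ennreal_measure)
 have finP: "(nnI (%x. ennreal ((w x)^2)*indicator ?P x)) < \<infinity>" if "(nnI (%x. ennreal ((w x)^2))) < \<infinity>" for w :: "real^3 => real"
  by (rule le_less_trans[OF nn_integral_mono that]) (auto simp: indicator_def)
 have fu: "(nnI (%x. ennreal ((u0 i x)^2)*indicator ?P x)) < \<infinity>" for i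
  using S by (intro finP nn_integral_version[OF _ mOm u0]) (auto simp: sobolev12_def)
 have fd: "(nnI (%x. ennreal ((d0 i j x)^2)*indicator ?P x)) < \<infinity>" for i j
  using S by (intro finP nn_integral_version[OF _ mOm d0]) (auto simp: sobolev12_def)
 have main: "\<exists>v V. gradM v V \<and> (nnI (%x. ennreal ((norm (V x - D x))^2)*indicator K x)) <= ennreal e"
  if K: "compact K" "K \<subseteq> Om" and e: "e > 0" for K e
 proof -
  have mK [measurable]: "K \<in> sets borel" using K(1) by (simp add: borel_compact)
  obtain eps where eps: "eps > 0" "(\<Union>x\<in>K. ball x eps) \<subseteq> Om"
   by (rule compact_subset_open_imp_ball_epsilon_subset[OF K(1) Om(1) K(2)])
  define I where "I s i j x = (\<integral>z. d0 i j z*bks s (z - x) \<partial>lborel)" for s i j x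
  have "\<forall>p. \<exists>s0>0. s0 <= 1 \<and> (\<forall>s. 0 < s \<and> s <= s0 -->
   (nnI (%x. ennreal ((I s (fst p) (snd p) x - d0 (fst p) (snd p) x)^2)*indicator K x)) <= ennreal (e/36))"
   unfolding I_def
  proof
   fix p :: "3 \<times> 3"
   show "\<exists>s0>0. s0 <= 1 \<and> (\<forall>s. 0 < s \<and> s <= s0 -->
   (\<integral>\<^sup>+x. ennreal (((\<integral>z. d0 (fst p) (snd p) z*bks s (z - x) \<partial>lborel) - d0 (fst p) (snd p) x)^2)*indicator K x \<partial>lborel) <= ennreal (e/36))"
    by (rule mollify_L2[OF d0(1) fd _ mK]) (use e margin1 K in auto)
  qed
  from choice[OF this] obtain s0 where s0: "!!p. s0 p > 0" "!!p. s0 p <= 1"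
   "!!p s. 0 < s ==> s <= s0 p ==> (nnI (%x. ennreal ((I s (fst p) (snd p) x - d0 (fst p) (snd p) x)^2)*indicator K x)) <= ennreal (e/36)"
   by blast
  \<comment> \<open>The bound \<open>eps / 4\<close> keeps the cube of half-side \<open>s\<close>
    about each point of \<open>K\<close> inside \<open>Om\<close>, so that the shifted kernel is an
    admissible test function.\<close>
  define s where "s = min (eps / 4) (Min (range s0))"
  have "Min (range s0) > 0" using s0(1) by (subst Min_gr_iff) auto
  then have s: "s > 0" "2 * s < eps" unfolding s_def using eps(1) by auto
  have sp: "s <= s0 p" for p unfolding s_def by (intro min.coboundedI2 Min_le) auto
  have s1: "s <= 1" using sp[of undefined] s0(2) order_trans by blast
  have IK: "(nnI (%x. ennreal ((I s i j x - d0 i j x)^2)*indicator K x)) <= ennreal (e/36)" for i j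
   using s0(3)[OF s(1) sp[of "(i, j)"]] by simp
  have cubeK: "cbox (x - vec s) (x + vec s) \<subseteq> Om" if "x \<in> K" for x
  proof
   fix z assume "z \<in> cbox (x - vec s) (x + vec s)"
   then have "x $ i - s <= z $ i \<and> z $ i <= x $ i + s" for i by (simp add: mem_box_cart)
   then have "- 1 <= (z $ i - x $ i)/s \<and> (z $ i - x $ i)/s <= 1" for i using s(1) by (simp add: field_simps)
   then have "(1/s)*\<^sub>R (z - x) \<in> B1" by (simp add: mem_box_cart)
   from norm_B1_le[OF this] have "norm (z - x)/s <= 2" using s(1) by simp
   then have "norm (z - x) <= 2 * s" using s(1) by (simp add: field_simps)
   then have "z \<in> ball x eps" using s(2) by (simp add: dist_norm norm_minus_commute)
   then show "z \<in> Om" using eps(2) that by blast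
  qed
  have "bounded (dbks s ` cbox (- vec s) (vec s))"
   by (rule compact_imp_bounded[OF compact_continuous_image[OF dbks_cont compact_cbox]])
  then obtain Sd where Sd: "!!y. y \<in> cbox (- vec s) (vec s) ==> norm (dbks s y) <= Sd"
   unfolding bounded_iff by auto
  have "0 \<in> cbox (- vec s) (vec s :: real^3)" using s by (simp add: mem_box_cart)
  from Sd[OF this] have Sd0: "Sd \<ge> 0" using norm_ge_zero order_trans by blast
  have Sd': "norm (dbks s y) <= Sd" for y
  proof (cases "y \<in> cbox (- vec s) (vec s)")
   case False
   then have "\<not> (\<forall>i. \<bar>y $ i\<bar> <= s)" by (auto simp: mem_box_cart abs_le_iff minus_le_iff)
   then show ?thesis using dbks_outside[OF s(1)] Sd0 by simp
  qed (rule Sd)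
  \<comment> \<open>The squared pointwise error \<open>Sd^2*m*e2\<close> then integrates over
    \<open>K\<close> to at most \<open>e/36\<close>.\<close>
  define e2 where "e2 = e/(36*(Sd^2*m^2 + 1))"
  have e2: "e2 > 0" unfolding e2_def using e by (simp add: add_nonneg_pos)
  have "\<forall>i. \<exists>w. continuous_on UNIV w \<and> (nnI (%x. ennreal ((u0 i x - w x)^2)*indicator ?P x)) < ennreal e2"
  proof
   fix i
   obtain g where "continuous_on UNIV g" "(nnI (%x. ennreal ((u0 i x - g x)^2)*indicator ?P x)) < ennreal e2"
    by (rule L2_continuous_dense[OF u0(1) fu e2])
   then show "\<exists>w. continuous_on UNIV w \<and> (nnI (%x. ennreal ((u0 i x - w x)^2)*indicator ?P x)) < ennreal e2" by blast
  qed
  from choice[OF this] obtain w where w: "!!i. continuous_on UNIV (w i)" "!!i. (nnI (%x. ennreal ((u0 i x - w i x)^2)*indicator ?P x)) < ennreal e2"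
   by blast
  have [measurable]: "w i \<in> borel_measurable borel" for i by (rule borel_measurable_continuous_onI[OF w(1)])
  have [measurable]: "dbks s \<in> borel_measurable borel" by (rule borel_measurable_continuous_onI[OF dbks_cont])
  have dbj [measurable]: "(%z. dbks s (z - x) $ j) \<in> borel_measurable borel" for x j
   by (intro borel_measurable_continuous_onI continuous_intros continuous_on_UNIV_comp[OF dbks_cont])
  define v where "v x = (\<chi> i. integral ?P (%z. w i z*bks s (z - x)))" for x
  define V where "V x = (\<chi> i. integral ?P (%z. (- w i z)*\<^sub>R dbks s (z - x)))" for x
  have gV: "gradM v V"
   unfolding gradM_def
  proof
   fix i
   have "grad1 (%x. integral ?P (%z. w i z*bks s (z - x))) (%x. integral ?P (%z. (- w i z)*\<^sub>R dbks s (z - x)))"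
   proof (rule grad1_integral)
    fix x z
    have "grad1 (%x. w i z*bks s (z + (-1)*\<^sub>R x)) (%x. w i z*\<^sub>R ((-1)*\<^sub>R dbks s (z + (-1)*\<^sub>R x)))"
     by (rule grad1_cmult[OF grad1_affine[OF grad1_bks]])
    from grad1_D[OF this, of x] show "((%x. w i z*bks s (z - x)) has_derivative (%h. ((- w i z)*\<^sub>R dbks s (z - x)) \<bullet> h)) (at x)"
     by simp
   qed (auto simp: split_beta intro!: continuous_intros cont_param[OF w(1)] continuous_on_UNIV_comp[OF bks_cont] continuous_on_UNIV_comp[OF dbks_cont])
   then show "grad1 (%x. v x $ i) (%x. V x $ i)" by (simp add: v_def V_def)
  qed
  have VI: "ennreal ((V x $ i $ j - I s i j x)^2) <= ennreal (Sd^2*m*e2)" if x: "x \<in> K" for x i j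
  proof -
   let ?d = "%z. dbks s (z - x) $ j"
   have dz: "z \<in> ?P \<and> \<bar>?d z\<bar> <= Sd" if "?d z \<noteq> 0" for z
   proof -
    have "dbks s (z - x) \<noteq> 0" using that by auto
    then have "\<bar>(z - x) $ i\<bar> <= s" for i using dbks_outside[OF s(1)] by blast
    then have "x + (z - x) \<in> ?P" using x K(2) s1 by (intro margin1) (auto intro: order_trans)
    then show ?thesis using component_le_norm_cart[of "dbks s (z - x)" j] Sd'[of "z - x"] by simp
   qed
   have "(\<integral>y. u y $ i*frechet_derivative (%z. bks s (z - x)) (at y) (axis j 1) \<partial>(lebesgue_on Om))
     = - (\<integral>y. Du y $ i $ j*bks s (y - x) \<partial>(lebesgue_on Om))"
    using S test_fn_bks(1)[OF s(1) cubeK[OF x]] unfolding sobolev12_def by blast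
   then have "(\<integral>y. u y $ i * ?d y \<partial>(lebesgue_on Om)) = - (\<integral>y. Du y $ i $ j*bks s (y - x) \<partial>(lebesgue_on Om))"
    unfolding test_fn_bks(2)[OF s(1) cubeK[OF x]] .
   moreover have "(\<integral>y. u y $ i * ?d y \<partial>(lebesgue_on Om)) = (\<integral>y. u0 i y * ?d y \<partial>lborel)"
    by (rule integral_lebesgue_on_version[OF mu mOm u0]) measurable
   moreover have "(\<integral>y. Du y $ i $ j*bks s (y - x) \<partial>(lebesgue_on Om)) = I s i j x"
    unfolding I_def by (rule integral_lebesgue_on_version[OF mD mOm d0]) measurable
   ultimately have Ieq: "I s i j x = - (\<integral>y. u0 i y * ?d y \<partial>lborel)" by simp
   have wP: "set_integrable lborel ?P (%z. - (w i z * ?d z))"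
    unfolding set_integrable_def
    by (rule borel_integrable_compact[OF compact_cbox]) (intro continuous_intros cont_UNIV_sub[OF w(1)] continuous_on_UNIV_comp[OF dbks_cont])
   have "V x $ i $ j = integral ?P (%z. - (w i z * ?d z))"
   proof -
    have "(%z. (- w i z)*\<^sub>R dbks s (z - x)) integrable_on ?P"
     by (intro integrable_continuous continuous_intros cont_UNIV_sub[OF w(1)] continuous_on_UNIV_comp[OF dbks_cont])
    from integral_linear[OF this bounded_linear_vec_nth[of j]] show ?thesis by (simp add: V_def o_def)
   qed
   also have "... = (\<integral>z. indicator ?P z*\<^sub>R (- (w i z * ?d z)) \<partial>lborel)"
    using set_borel_integral_eq_integral(2)[OF wP] by (simp add: set_lebesgue_integral_def)
   also have "... = (\<integral>z. - (w i z * ?d z) \<partial>lborel)"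
    by (intro Bochner_Integration.integral_cong) (use dz in \<open>auto simp: indicator_def\<close>)
   finally have Veq: "V x $ i $ j = - (\<integral>z. w i z * ?d z \<partial>lborel)" by simp
   have iw: "integrable lborel (%z. w i z * ?d z)"
   proof -
    have "integrable lborel (%z. indicator ?P z*\<^sub>R (- (w i z * ?d z)))" using wP by (simp add: set_integrable_def)
    moreover have "(%z. indicator ?P z*\<^sub>R (- (w i z * ?d z))) = (%z. - (w i z * ?d z))" using dz by (auto simp: indicator_def fun_eq_iff)
    ultimately have "integrable lborel (%z. - (w i z * ?d z))" by (simp only:)
    then show ?thesis by simp
   qed
   define q where "q z = \<bar>u0 i z - w i z\<bar>" for z
   have [measurable]: "q \<in> borel_measurable borel" unfolding q_def by measurable
   let ?A = "\<integral>\<^sup>+z. (ennreal (q z)*indicator ?P z)*indicator ?P z \<partial>lborel"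
   have A2: "?A\<^sup>2 <= ennreal (e2*m)"
   proof -
    have "?A\<^sup>2 <= (nnI (%z. (ennreal (q z)*indicator ?P z)\<^sup>2))*(nnI (%z. (indicator ?P z)\<^sup>2))"
     by (rule Cauchy_Schwarz_nn_integral) measurable
    also have "(nnI (%z. (indicator ?P z)\<^sup>2)) = (nnI (%z. indicator ?P z))"
     by (intro nn_integral_cong) (auto simp: indicator_def)
    also have "... = ennreal m" using m by simp
    also have "(nnI (%z. (ennreal (q z)*indicator ?P z)\<^sup>2)) = (nnI (%z. ennreal ((u0 i z - w i z)^2)*indicator ?P z))"
     by (intro nn_integral_cong) (auto simp: indicator_def q_def ennreal_power)
    also have "... * ennreal m <= ennreal e2*ennreal m" using w(2)[of i] by (intro mult_right_mono) auto
    finally show ?thesis using e2 m by (simp add: ennreal_mult)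
   qed
   have bd: "ennreal (norm ((w i z - u0 i z) * ?d z)) <= ennreal Sd*((ennreal (q z)*indicator ?P z)*indicator ?P z)" for z
   proof (cases "?d z = 0")
    case False
    have "norm ((w i z - u0 i z) * ?d z) <= Sd*q z"
     using dz[OF False] by (simp add: q_def abs_mult abs_minus_commute mult.commute mult_right_mono)
    then have "ennreal (norm ((w i z - u0 i z) * ?d z)) <= ennreal (Sd*q z)" by (rule ennreal_leI)
    then show ?thesis using dz[OF False] Sd0 by (simp add: ennreal_mult')
   qed simp
   have nb: "(nnI (%z. ennreal (norm ((w i z - u0 i z) * ?d z)))) <= ennreal Sd * ?A"
   proof -
    have "(nnI (%z. ennreal (norm ((w i z - u0 i z) * ?d z)))) <= (nnI (%z. ennreal Sd*((ennreal (q z)*indicator ?P z)*indicator ?P z)))"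
     by (intro nn_integral_mono bd)
    also have "... = ennreal Sd * ?A" by (rule nn_integral_cmult) measurable
    finally show ?thesis .
   qed
   have Afin: "?A < \<infinity>"
   proof (rule ccontr)
    assume "\<not> ?A < \<infinity>"
    then have "?A = top" using top.not_eq_extremum[of ?A] by auto
    then have "?A\<^sup>2 = top" by (simp add: power2_eq_square ennreal_top_mult)
    then show False using A2 by (simp add: top_unique)
   qed
   have idf: "integrable lborel (%z. (w i z - u0 i z) * ?d z)"
   proof (rule integrableI_bounded)
    show "(nnI (%z. ennreal (norm ((w i z - u0 i z) * ?d z)))) < \<infinity>"
     by (rule le_less_trans[OF nb]) (use Afin in \<open>simp add: ennreal_mult_less_top\<close>)
   qed measurable
   have "(%z. u0 i z * ?d z) = (%z. w i z * ?d z - (w i z - u0 i z) * ?d z)" by (auto simp: algebra_simps)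
   then have "(\<integral>z. u0 i z * ?d z \<partial>lborel) = (\<integral>z. w i z * ?d z \<partial>lborel) - (\<integral>z. (w i z - u0 i z) * ?d z \<partial>lborel)"
    using Bochner_Integration.integral_diff[OF iw idf] by simp
   then have "V x $ i $ j - I s i j x = - (\<integral>z. (w i z - u0 i z) * ?d z \<partial>lborel)" using Veq Ieq by simp
   then have "ennreal \<bar>V x $ i $ j - I s i j x\<bar> <= ennreal Sd * ?A"
    using integral_norm_bound_ennreal[OF idf] nb by simp
   then have "(ennreal \<bar>V x $ i $ j - I s i j x\<bar>)^2 <= (ennreal Sd * ?A)^2" by (intro power_mono) auto
   also have "... = ennreal (Sd^2) * ?A\<^sup>2" using Sd0 by (simp add: power_mult_distrib ennreal_power)
   also have "... <= ennreal (Sd^2)*ennreal (e2*m)" by (intro mult_left_mono A2) auto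
   also have "... = ennreal (Sd^2*m*e2)" using e2 m by (simp add: ennreal_mult[symmetric] mult_ac)
   finally show ?thesis by (simp add: ennreal_power)
  qed
  have KP: "K \<subseteq> ?P" using margin1[of _ 0] K(2) by auto
  have mKm: "emeasure lborel K <= ennreal m" using KP m(2) emeasure_mono[of K ?P lborel] by auto
  have [measurable]: "(%x. I s i j x) \<in> borel_measurable borel" for i j unfolding I_def by measurable
  have entry: "(nnI (%x. ennreal ((V x $ i $ j - d0 i j x)^2)*indicator K x)) <= ennreal (e/9)" for i j
  proof -
   have "(nnI (%x. ennreal ((V x $ i $ j - d0 i j x)^2)*indicator K x))
    <= (nnI (%x. ennreal (2*(Sd^2*m*e2))*indicator K x + 2*(ennreal ((I s i j x - d0 i j x)^2)*indicator K x)))"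
   proof (rule nn_integral_mono)
    fix x
    show "ennreal ((V x $ i $ j - d0 i j x)^2)*indicator K x <= ennreal (2*(Sd^2*m*e2))*indicator K x + 2*(ennreal ((I s i j x - d0 i j x)^2)*indicator K x)"
    proof (cases "x \<in> K")
     case True
     have "(V x $ i $ j - d0 i j x)^2 <= 2*(V x $ i $ j - I s i j x)^2 + 2*(I s i j x - d0 i j x)^2"
      using sq_add_le[of "V x $ i $ j - I s i j x" "I s i j x - d0 i j x"] by simp
     moreover have "(V x $ i $ j - I s i j x)^2 <= Sd^2*m*e2"
      using VI[OF True, of i j] m e2 by (subst (asm) ennreal_le_iff) auto
     ultimately have "(V x $ i $ j - d0 i j x)^2 <= 2*(Sd^2*m*e2) + 2*(I s i j x - d0 i j x)^2" by linarith
     then have "ennreal ((V x $ i $ j - d0 i j x)^2) <= ennreal (2*(Sd^2*m*e2) + 2*(I s i j x - d0 i j x)^2)" by (rule ennreal_leI)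
     also have "... = ennreal (2*(Sd^2*m*e2)) + 2*ennreal ((I s i j x - d0 i j x)^2)"
      using m e2 by (subst ennreal_plus) (auto simp: ennreal_mult')
     finally show ?thesis using True by simp
    qed simp
   qed
   also have "... = ennreal (2*(Sd^2*m*e2))*emeasure lborel K + 2*(nnI (%x. ennreal ((I s i j x - d0 i j x)^2)*indicator K x))"
    by (subst nn_integral_add, measurable) (simp add: nn_integral_cmult nn_integral_cmult_indicator)
   also have "... <= ennreal (2*(Sd^2*m*e2))*ennreal m + 2*ennreal (e/36)"
    by (intro add_mono mult_left_mono mKm IK) auto
   also have "... = ennreal (2*(Sd^2*m*e2)*m + 2*(e/36))"
    by (rule ennreal_combination2[symmetric]) (use m e e2 in auto)
   also have "... <= ennreal (e/9)"
   proof (rule ennreal_leI)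
    have q: "0 < Sd^2*m^2 + 1" by (simp add: add_nonneg_pos)
    have "Sd^2*m*e2*m = e/36*(Sd^2*m^2/(Sd^2*m^2 + 1))"
     unfolding e2_def using q by (simp add: field_simps power2_eq_square)
    also have "... <= e/36*1" using e q by (intro mult_left_mono) (auto simp: divide_le_eq_1)
    finally show "2*(Sd^2*m*e2)*m + 2*(e/36) <= e/9" by simp
   qed
   finally show ?thesis .
  qed
  have mV [measurable]: "(%x. V x $ i $ j) \<in> borel_measurable borel" for i j
   by (intro borel_measurable_continuous_onI continuous_intros gradM_cont[OF gV])
  have "(nnI (%x. ennreal ((norm (V x - D x))^2)*indicator K x))
   = (nnI (%x. (\<Sum>i\<in>UNIV. \<Sum>j\<in>UNIV. ennreal ((V x $ i $ j - d0 i j x)^2)*indicator K x)))"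
  proof (intro nn_integral_cong)
   fix x
   have "ennreal ((norm (V x - D x))^2) = (\<Sum>i\<in>UNIV. \<Sum>j\<in>UNIV. ennreal ((V x $ i $ j - d0 i j x)^2))"
    unfolding norm_mat_sq by (simp add: D_def sum_nonneg flip: sum_ennreal)
   then show "ennreal ((norm (V x - D x))^2)*indicator K x = (\<Sum>i\<in>UNIV. \<Sum>j\<in>UNIV. ennreal ((V x $ i $ j - d0 i j x)^2)*indicator K x)"
    by (simp add: sum_distrib_right)
  qed
  also have "... = (\<Sum>i\<in>UNIV. \<Sum>j\<in>UNIV. \<integral>\<^sup>+x. ennreal ((V x $ i $ j - d0 i j x)^2)*indicator K x \<partial>lborel)"
   by (subst nn_integral_sum, measurable, intro sum.cong refl, subst nn_integral_sum, measurable)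
  also have "... <= (\<Sum>i\<in>(UNIV::3 set). \<Sum>j\<in>(UNIV::3 set). ennreal (e/9))" by (intro sum_mono entry)
  also have "... = ennreal e" using e by (simp add: ennreal_mult'[symmetric] flip: ennreal_numeral ennreal_of_nat_eq_real_of_nat)
  finally show ?thesis using gV by blast
 qed
 show ?thesis using Dm DAE main by blast
qed

section \<open>Linearization of the energy density\<close>

lemma pos_def_sqrt_scalar:
 fixes S :: "real^3^3"
 assumes S: "pos_def S" "S ** S = (c*c)*\<^sub>R mat 1" and c: "c > 0"
 shows "S = c*\<^sub>R mat 1"
proof -
 have "S *v x = c*\<^sub>R x" for x
 proof -
  define w where "w = S *v x - c*\<^sub>R x"
  have "S *v w = (S ** S) *v x - c*\<^sub>R (S *v x)"
   unfolding w_def by (simp add: matrix_vector_mult_diff_distrib matrix_vector_mul_assoc matrix_vector_mult_scaleR)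
  also have "(S ** S) *v x = (c*c)*\<^sub>R x"
   unfolding S(2) by (simp add: scaleR_matrix_vector_assoc[symmetric])
  finally have Sw: "S *v w = - c*\<^sub>R w" by (simp add: w_def scaleR_diff_right algebra_simps)
  have "w = 0"
  proof (rule ccontr)
   assume "w \<noteq> 0"
   then have "w \<bullet> (S *v w) > 0" using S(1) by (simp add: pos_def_def)
   moreover have "w \<bullet> (S *v w) = - c*(w \<bullet> w)" unfolding Sw by simp
   moreover have "0 <= c*(w \<bullet> w)" using c by (intro mult_nonneg_nonneg inner_ge_zero) simp
   ultimately show False by linarith
  qed
  then show ?thesis by (simp add: w_def)
 qed
 moreover have "(c*\<^sub>R mat 1) *v x = c*\<^sub>R x" for x :: "real^3" by (simp add: scaleR_matrix_vector_assoc[symmetric])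
 ultimately show ?thesis by (simp add: matrix_eq)
qed

lemma scaleR_mat_mult: "(a*\<^sub>R mat 1) ** (b*\<^sub>R mat 1) = (a*b)*\<^sub>R (mat 1 :: real^3^3)"
 unfolding matrix_eq by (simp add: matrix_vector_mul_assoc[symmetric] scaleR_matrix_vector_assoc[symmetric] matrix_vector_mult_scaleR)

text \<open>The definite description in \<open>inv_sqrt\<close> is resolved by uniqueness: for a
  positive definite root \<open>S\<close> the vector \<open>w = S *v x - c *\<^sub>R x\<close>
  satisfies \<open>S *v w = - c *\<^sub>R w\<close>, which forces \<open>w = 0\<close>.\<close>

lemma inv_sqrt_metricG: "inv_sqrt (metricG ph x) = exp (- ph (x $ 3))*\<^sub>R mat 1"
proof -
 let ?c = "exp (- ph (x $ 3))"
 have e: "exp (2*ph (x $ 3))*(?c * ?c) = 1" by (simp add: mult_exp_exp)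
 have mi: "matrix_inv (metricG ph x) = (?c * ?c)*\<^sub>R mat 1"
 proof -
  let ?A = "metricG ph x" and ?B = "(?c * ?c)*\<^sub>R (mat 1 :: real^3^3)"
  have AB: "?A ** ?B = mat 1" "?B ** ?A = mat 1"
   unfolding metricG_def scaleR_mat_mult using e by (simp_all add: mult.commute)
  then have "?A ** matrix_inv ?A = mat 1"
   unfolding matrix_inv_def using someI[of "%A'. ?A ** A' = mat 1 \<and> A' ** ?A = mat 1" ?B] by auto
  then have "?B ** (?A ** matrix_inv ?A) = ?B" by simp
  then show ?thesis using AB by (simp add: matrix_mul_assoc)
 qed
 have pd: "pos_def (?c*\<^sub>R mat 1)"
  unfolding pos_def_def
 proof (intro conjI allI impI)
  show "transpose (?c*\<^sub>R mat 1 :: real^3^3) = ?c*\<^sub>R mat 1" by (auto simp: transpose_def mat_def vec_eq_iff)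
  fix v :: "real^3" assume "v \<noteq> 0"
  moreover have "(?c*\<^sub>R mat 1) *v v = ?c*\<^sub>R v" by (simp add: scaleR_matrix_vector_assoc[symmetric])
  ultimately show "0 < v \<bullet> ((?c*\<^sub>R mat 1) *v v)" by simp
 qed
 show ?thesis
  unfolding inv_sqrt_def mi
 proof (rule the_equality)
  show "pos_def (?c*\<^sub>R mat 1) \<and> (?c*\<^sub>R mat 1) ** (?c*\<^sub>R mat 1) = (?c * ?c)*\<^sub>R (mat 1 :: real^3^3)"
   using pd by (simp add: scaleR_mat_mult)
  show "S = ?c*\<^sub>R mat 1" if "pos_def S \<and> S ** S = (?c * ?c)*\<^sub>R mat 1" for S
   by (rule pos_def_sqrt_scalar) (use that in auto)
 qed
qed

section \<open>Second order expansion of the density at the identity\<close>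

definition Hij :: "(real^3^3 => ennreal) => real^3^3 => real^3^3 => real^3^3 => real" where
 "Hij W X i j = frechet_derivative (%X. frechet_derivative (Wreal W) (at X) i) (at X) j"

text \<open>Smoothness in the sense of \<open>Ck_on\<close> speaks about basis directions, so the
  second derivative is assembled from its matrix of second partial derivatives.\<close>

definition Bform :: "(real^3^3 => ennreal) => real^3^3 => real^3^3 => real^3^3 => real" where
 "Bform W X F G = (\<Sum>i\<in>Basis. \<Sum>j\<in>Basis. (F \<bullet> i)*(G \<bullet> j)*Hij W X i j)"

lemma Bform_linear:
 "Bform W X (F + F') G = Bform W X F G + Bform W X F' G" "Bform W X F (G + G') = Bform W X F G + Bform W X F G'"
 "Bform W X (c*\<^sub>R F) G = c*Bform W X F G" "Bform W X F (c*\<^sub>R G) = c*Bform W X F G"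
 by (simp_all add: Bform_def inner_add_left sum.distrib sum_distrib_left algebra_simps)

locale admissible =
 fixes W :: "real^3^3 => ennreal"
 assumes adm: "admissible_density W"
begin

abbreviation "Wr \<equiv> Wreal W"

definition "U = (SOME U. open U \<and> SO3 \<subseteq> U \<and> (\<forall>F\<in>U. W F \<noteq> \<infinity>) \<and> Ck_on 2 U (Wreal W))"

lemma U: "open U" "SO3 \<subseteq> U" "!!F. F \<in> U ==> W F \<noteq> \<infinity>" "Ck_on 2 U Wr"
proof -
 have "\<exists>U. open U \<and> SO3 \<subseteq> U \<and> (\<forall>F\<in>U. W F \<noteq> \<infinity>) \<and> Ck_on 2 U (Wreal W)"
  using adm by (simp add: admissible_density_def)
 from someI_ex[OF this] show "open U" "SO3 \<subseteq> U" "!!F. F \<in> U ==> W F \<noteq> \<infinity>" "Ck_on 2 U Wr"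
  unfolding U_def[symmetric] by auto
qed

lemma W_Wr: "F \<in> U ==> W F = ennreal (Wr F)"
 using U(3)[of F] by (simp add: Wreal_def less_top)

lemma Wr_nonneg: "Wr F \<ge> 0" by (simp add: Wreal_def)

lemma Wr_SO3: "R \<in> SO3 ==> Wr R = 0"
 using adm by (simp add: admissible_density_def Wreal_def)

lemma Id_U: "mat 1 \<in> U" using U(2) mat1_SO3 by blast

lemma C2:
 "X \<in> U ==> Wr differentiable (at X)"
 "X \<in> U ==> i \<in> Basis ==> (%X. frechet_derivative Wr (at X) i) differentiable (at X)"
 "i \<in> Basis ==> j \<in> Basis ==> continuous_on U (%X. Hij W X i j)"
 using U(4) by (simp_all add: numeral_2_eq_2 Hij_def)

lemma fd_expand:
 assumes "X \<in> U"
 shows "frechet_derivative Wr (at X) F = (\<Sum>i\<in>Basis. (F \<bullet> i)*frechet_derivative Wr (at X) i)"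
proof -
 have l: "linear (frechet_derivative Wr (at X))" by (rule linear_frechet_derivative[OF C2(1)[OF assms]])
 have "frechet_derivative Wr (at X) F = frechet_derivative Wr (at X) (\<Sum>i\<in>Basis. (F \<bullet> i)*\<^sub>R i)"
  by (simp add: euclidean_representation)
 also have "... = (\<Sum>i\<in>Basis. (F \<bullet> i)*frechet_derivative Wr (at X) i)"
  by (simp add: linear_sum[OF l] linear_cmul[OF l])
 finally show ?thesis .
qed

lemma second_derivative:
 assumes X: "X \<in> U"
 shows "((%X. frechet_derivative Wr (at X) F) has_derivative (%G. Bform W X F G)) (at X)"
proof -
 have d: "((%X. frechet_derivative Wr (at X) i) has_derivative (%G. \<Sum>j\<in>Basis. (G \<bullet> j)*Hij W X i j)) (at X)" if i: "i \<in> Basis" for i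
 proof -
  let ?g = "%X. frechet_derivative Wr (at X) i"
  have hd: "(?g has_derivative frechet_derivative ?g (at X)) (at X)"
   using C2(2)[OF X i] frechet_derivative_works by blast
  have l: "linear (frechet_derivative ?g (at X))" by (rule linear_frechet_derivative[OF C2(2)[OF X i]])
  have "frechet_derivative ?g (at X) G = (\<Sum>j\<in>Basis. (G \<bullet> j)*Hij W X i j)" for G
  proof -
   have "frechet_derivative ?g (at X) G = frechet_derivative ?g (at X) (\<Sum>j\<in>Basis. (G \<bullet> j)*\<^sub>R j)"
    by (simp add: euclidean_representation)
   also have "... = (\<Sum>j\<in>Basis. (G \<bullet> j)*Hij W X i j)" by (simp add: linear_sum[OF l] linear_cmul[OF l] Hij_def)
   finally show ?thesis .
  qed
  then have "frechet_derivative ?g (at X) = (%G. \<Sum>j\<in>Basis. (G \<bullet> j)*Hij W X i j)" by (rule ext)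
  with hd show ?thesis by simp
 qed
 have "((%X. \<Sum>i\<in>Basis. (F \<bullet> i)*frechet_derivative Wr (at X) i) has_derivative (%G. \<Sum>i\<in>Basis. (F \<bullet> i)*(\<Sum>j\<in>Basis. (G \<bullet> j)*Hij W X i j))) (at X)"
  by (intro has_derivative_sum has_derivative_mult_right d)
 moreover have "(%G. \<Sum>i\<in>Basis. (F \<bullet> i)*(\<Sum>j\<in>Basis. (G \<bullet> j)*Hij W X i j)) = (%G. Bform W X F G)"
  by (simp add: Bform_def sum_distrib_left mult.assoc)
 ultimately have "((%X. \<Sum>i\<in>Basis. (F \<bullet> i)*frechet_derivative Wr (at X) i) has_derivative (%G. Bform W X F G)) (at X)" by (simp only:)
 then show ?thesis
  by (rule has_derivative_transform_within_open[OF _ U(1) X]) (simp add: fd_expand[symmetric])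
qed

text \<open>The symmetric part of the second derivative at the identity; its diagonal values, which
  are all that \<open>Q2\<close> sees, are those of \<open>D2W\<close>.\<close>

definition "B F G = (Bform W (mat 1) F G + Bform W (mat 1) G F)/2"

lemma D2W_B: "D2W W (mat 1) F F = B F F"
 unfolding D2W_def B_def frechet_derivative_at[OF second_derivative[OF Id_U], symmetric] by simp

lemma B_linear:
 "B (F + F') G = B F G + B F' G" "B F (G + G') = B F G + B F G'"
 "B (c*\<^sub>R F) G = c*B F G" "B F (c*\<^sub>R G) = c*B F G" "B F G = B G F"
 by (simp_all add: B_def Bform_linear add_divide_distrib algebra_simps)

lemma B_neg: "B (- F) G = - B F G" "B F (- G) = - B F G"
 using B_linear(3)[of "-1" F G] B_linear(4)[of F "-1" G] by simp_all

lemma B_diff: "B (F - F') G = B F G - B F' G" "B F (G - G') = B F G - B F G'"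
 using B_linear(1)[of F "- F'" G] B_linear(2)[of F G "- G'"] by (simp_all add: B_neg)

lemma B_cont: "continuous_on S (%F. B F F)"
 unfolding B_def Bform_def by (intro continuous_intros) auto

lemma B_bound: "\<exists>K\<ge>0. \<forall>F. \<bar>B F F\<bar> <= K*(norm F)^2"
proof -
 define K where "K = (\<Sum>i\<in>(Basis::(real^3^3) set). \<Sum>j\<in>(Basis::(real^3^3) set). \<bar>Hij W (mat 1) i j\<bar>)"
 have "\<bar>B F F\<bar> <= K*(norm F)^2" for F
 proof -
  have "\<bar>B F F\<bar> = \<bar>Bform W (mat 1) F F\<bar>" by (simp add: B_def)
  also have "... <= (\<Sum>i\<in>Basis. \<Sum>j\<in>Basis. \<bar>(F \<bullet> i)*(F \<bullet> j)*Hij W (mat 1) i j\<bar>)"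
   unfolding Bform_def by (intro order_trans[OF sum_abs] sum_mono sum_abs)
  also have "... <= (\<Sum>i\<in>Basis. \<Sum>j\<in>Basis. (norm F)\<^sup>2*\<bar>Hij W (mat 1) i j\<bar>)"
   unfolding abs_mult power2_eq_square by (intro sum_mono mult_mono Basis_le_norm) auto
  finally show ?thesis by (simp add: K_def sum_distrib_left mult.commute sum_distrib_right)
 qed
 moreover have "K \<ge> 0" unfolding K_def by (intro sum_nonneg) auto
 ultimately show ?thesis by blast
qed

text \<open>The density is nonnegative and vanishes at the identity, so the first order term is
  zero; the remainder is controlled by continuity of the second partial derivatives along the
  segment.\<close>

lemma Taylor:
 assumes "et > 0"
 shows "\<exists>cka>0. \<forall>F. norm F < cka --> mat 1 + F \<in> U \<and> \<bar>Wr (mat 1 + F) - B F F/2\<bar> <= et * (norm F)^2"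
proof -
 obtain r0 where r0: "r0 > 0" "ball (mat 1) r0 \<subseteq> U" using U(1) Id_U open_contains_ball by blast
 define N where "N = card (Basis :: (real^3^3) set)"
 have N: "real N > 0" unfolding N_def by (simp add: card_gt_0_iff)
 \<comment> \<open>There are \<open>N*N\<close> second partial derivatives, and the Taylor
   coefficient contributes a factor one half.\<close>
 define eps where "eps = 2*et / (real N*real N)"
 have eps: "eps > 0" using assms N by (simp add: eps_def)
 have "\<forall>p\<in>Basis \<times> Basis. \<exists>d>0. \<forall>X. norm (X - mat 1) < d --> \<bar>Hij W X (fst p) (snd p) - Hij W (mat 1) (fst p) (snd p)\<bar> <= eps"
 proof
  fix p :: "(real^3^3) \<times> (real^3^3)" assume p: "p \<in> Basis \<times> Basis"
  have "continuous (at (mat 1)) (%X. Hij W X (fst p) (snd p))"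
   using C2(3)[of "fst p" "snd p"] p U(1) Id_U by (auto simp: continuous_on_eq_continuous_at)
  then obtain d where "d > 0" "!!X. dist X (mat 1) < d ==> dist (Hij W X (fst p) (snd p)) (Hij W (mat 1) (fst p) (snd p)) < eps"
   unfolding continuous_at_eps_delta using eps by blast
  then show "\<exists>d>0. \<forall>X. norm (X - mat 1) < d --> \<bar>Hij W X (fst p) (snd p) - Hij W (mat 1) (fst p) (snd p)\<bar> <= eps"
   by (intro exI[of _ d]) (auto simp: dist_norm intro: less_imp_le)
 qed
 from bchoice[OF this] obtain d where d: "\<forall>p\<in>Basis \<times> Basis. d p > 0 \<and> (\<forall>X. norm (X - mat 1) < d p --> \<bar>Hij W X (fst p) (snd p) - Hij W (mat 1) (fst p) (snd p)\<bar> <= eps)"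
  by (rule exE)
 define d0 where "d0 = Min (d ` (Basis \<times> Basis))"
 have ne: "(Basis :: (real^3^3) set) \<times> (Basis :: (real^3^3) set) \<noteq> {}" by simp
 have d0: "d0 > 0" unfolding d0_def using d ne by (subst Min_gr_iff) auto
 have Hc: "\<bar>Hij W X i j - Hij W (mat 1) i j\<bar> <= eps" if "norm (X - mat 1) < d0" "i \<in> Basis" "j \<in> Basis" for X i j
 proof -
  have "d0 <= d (i, j)" unfolding d0_def using that by (intro Min_le) auto
  then show ?thesis using d that by fastforce
 qed
 have "mat 1 + F \<in> U \<and> \<bar>Wr (mat 1 + F) - B F F/2\<bar> <= et * (norm F)^2" if F: "norm F < min r0 d0" for F
 proof
  have seg: "mat 1 + t*\<^sub>R F \<in> U" if "\<bar>t\<bar> <= 1" for t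
  proof -
   have "norm (t*\<^sub>R F) <= norm F" using that by (simp add: mult_left_le_one_le)
   then show ?thesis using r0(2) F by (auto simp: dist_norm)
  qed
  show "mat 1 + F \<in> U" using seg[of 1] by simp
  define f where "f t = Wr (mat 1 + t*\<^sub>R F)" for t
  define f1 where "f1 t = frechet_derivative Wr (at (mat 1 + t*\<^sub>R F)) F" for t
  define f2 where "f2 t = Bform W (mat 1 + t*\<^sub>R F) F F" for t
  have path: "((%t. mat 1 + t*\<^sub>R F) has_derivative (%h. h*\<^sub>R F)) (at t)" for t
   by (auto intro!: derivative_eq_intros)
  have D1: "DERIV f t :> f1 t" if "\<bar>t\<bar> <= 1" for t
  proof -
   have "(Wr has_derivative frechet_derivative Wr (at (mat 1 + t*\<^sub>R F))) (at (mat 1 + t*\<^sub>R F))"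
    using C2(1)[OF seg[OF that]] frechet_derivative_works by blast
   from has_derivative_compose[OF path this]
   have "(f has_derivative (%h. frechet_derivative Wr (at (mat 1 + t*\<^sub>R F)) (h*\<^sub>R F))) (at t)" unfolding f_def .
   moreover have "(%h. frechet_derivative Wr (at (mat 1 + t*\<^sub>R F)) (h*\<^sub>R F)) = (%h. f1 t*h)"
    unfolding f1_def using linear_cmul[OF linear_frechet_derivative[OF C2(1)[OF seg[OF that]]]] by auto
   ultimately show ?thesis by (simp add: has_field_derivative_def)
  qed
  have D2: "DERIV f1 t :> f2 t" if "\<bar>t\<bar> <= 1" for t
  proof -
   from has_derivative_compose[OF path second_derivative[OF seg[OF that]], of F]
   have "(f1 has_derivative (%h. Bform W (mat 1 + t*\<^sub>R F) F (h*\<^sub>R F))) (at t)" unfolding f1_def .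
   moreover have "(%h. Bform W (mat 1 + t*\<^sub>R F) F (h*\<^sub>R F)) = (%h. f2 t*h)"
    by (auto simp: f2_def Bform_linear)
   ultimately show ?thesis by (simp add: has_field_derivative_def)
  qed
  have f0: "f 0 = 0" by (simp add: f_def Wr_SO3[OF mat1_SO3])
  have f10: "f1 0 = 0"
   by (rule DERIV_local_min[OF D1[of 0], of 1]) (use f0 Wr_nonneg in \<open>auto simp: f_def\<close>)
  define df where "df n = (if n = 0 then f else if n = 1 then f1 else f2)" for n :: nat
  have "\<exists>t. (if 1 < (0::real) then 1 < t \<and> t < 0 else 0 < t \<and> t < 1) \<and>
    f 1 = (\<Sum>m<2. (df m 0/fact m)*(1 - 0)^m) + (df 2 t/fact 2)*(1 - 0)^2"
  proof (rule Taylor[of 2 df f 0 1])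
   show "\<forall>m t. m < 2 \<and> 0 <= t \<and> t <= 1 --> DERIV (df m) t :> df (Suc m) t"
    using D1 D2 by (auto simp: df_def less_2_cases_iff)
  qed (auto simp: df_def)
  then obtain t where t: "0 < t" "t < 1" "f 1 = f2 t/2"
   by (auto simp: df_def numeral_2_eq_2 f0 f10)
  have "norm (t*\<^sub>R F) <= norm F" using t by (simp add: mult_left_le_one_le)
  then have Xd: "norm ((mat 1 + t*\<^sub>R F) - mat 1) < d0" using F by simp
  have "\<bar>f2 t - Bform W (mat 1) F F\<bar> = \<bar>\<Sum>i\<in>Basis. \<Sum>j\<in>Basis. (F \<bullet> i)*(F \<bullet> j)*(Hij W (mat 1 + t*\<^sub>R F) i j - Hij W (mat 1) i j)\<bar>"
   unfolding f2_def Bform_def by (simp add: sum_subtractf right_diff_distrib)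
  also have "... <= (\<Sum>i\<in>Basis. \<Sum>j\<in>Basis. \<bar>(F \<bullet> i)*(F \<bullet> j)*(Hij W (mat 1 + t*\<^sub>R F) i j - Hij W (mat 1) i j)\<bar>)"
   by (intro order_trans[OF sum_abs] sum_mono sum_abs)
  also have "... <= (\<Sum>i\<in>(Basis::(real^3^3) set). \<Sum>j\<in>(Basis::(real^3^3) set). (norm F)\<^sup>2*eps)"
   unfolding abs_mult power2_eq_square by (intro sum_mono mult_mono Basis_le_norm Hc[OF Xd]) auto
  also have "... = real N*(real N*((norm F)^2*eps))" by (simp only: sum_constant N_def)
  also have "... = 2*et * (norm F)^2" using N by (simp add: eps_def)
  finally have "\<bar>f2 t - B F F\<bar> <= 2*et * (norm F)^2" by (simp add: B_def)
  moreover have "Wr (mat 1 + F) = f2 t/2" using t(3) by (simp add: f_def)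
  ultimately show "\<bar>Wr (mat 1 + F) - B F F/2\<bar> <= et * (norm F)^2" unfolding abs_le_iff by linarith
 qed
 then show ?thesis using r0(1) d0 by (intro exI[of _ "min r0 d0"]) auto
qed

text \<open>Insert \<open>mat 1 + t *\<^sub>R F\<close> in the quadratic growth condition. By
  \<open>symm_defect_bound\<close> its distance to \<open>SO3\<close> is at least
  \<open>t * norm (symm F)\<close> up to \<open>O(t^2)\<close>, and dividing by \<open>t^2\<close>
  leaves the form.\<close>

lemma coercive: "\<exists>c0>0. \<forall>F. c0*(norm (symm F))^2 <= B F F"
proof -
 have "\<exists>c>0. \<forall>F. W F \<ge> ennreal (c*(infdist F SO3)^2)" using adm by (simp only: admissible_density_def)
 then obtain c where c: "c > 0" "!!F. W F \<ge> ennreal (c*(infdist F SO3)^2)" by blast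
 have "c/2*(norm (symm F))^2 <= B F F" for F
 proof -
  have step: "c*(norm (symm F))^2/4 <= B F F/2 + et * (norm F)^2" if et: "et > 0" for et
  proof -
   obtain cka where cka: "cka > 0" "!!F. norm F < cka ==> mat 1 + F \<in> U \<and> \<bar>Wr (mat 1 + F) - B F F/2\<bar> <= et * (norm F)^2"
    using Taylor[OF et] by (elim exE conjE) (rule that, auto)
   define s where "s = norm (symm F)"
   define f where "f = norm F"
   have s0: "s \<ge> 0" "f \<ge> 0" by (simp_all add: s_def f_def)
   show ?thesis
   proof (cases "s = 0")
    case True
    define t where "t = cka / (2*(f + 1))"
    have f1: "2*(f + 1) > 0" using s0 by simp
    have t: "t > 0" using cka(1) f1 by (simp add: t_def)
    have "t*(2*(f + 1)) = cka" using f1 by (simp add: t_def)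
    then have "2*(t*f) + 2*t = cka" by (simp add: algebra_simps)
    moreover have "0 <= t*f" using t s0 by simp
    ultimately have "t*f < cka" using t by linarith
    note t = t this
    have "0 <= Wr (mat 1 + t*\<^sub>R F)" by (rule Wr_nonneg)
    moreover have "\<bar>Wr (mat 1 + t*\<^sub>R F) - B (t*\<^sub>R F) (t*\<^sub>R F)/2\<bar> <= et * (norm (t*\<^sub>R F))^2"
     using cka(2)[of "t*\<^sub>R F"] t by (simp add: f_def)
    ultimately have "0 <= t^2*(B F F/2 + et * f^2)"
     using t by (simp add: B_linear(3,4) f_def power_mult_distrib power2_eq_square algebra_simps)
    then have "0 <= B F F/2 + et * f^2" using t(1) by (simp add: zero_le_mult_iff)
    then show ?thesis using True by (simp add: s_def f_def)
   next
    case False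
    with s0 have s: "s > 0" by simp
    \<comment> \<open>The first bound keeps \<open>t *\<^sub>R F\<close> in the range of the Taylor
      estimate; the second makes the quadratic error at most half of \<open>t * s\<close>, so the
      distance is at least \<open>t * s/2\<close>.\<close>
    define t where "t = min (cka / (2*(f + 1))) (s/(8*(f^2 + 1)))"
    have "cka / (2*(f + 1)) > 0" using cka(1) s0 by (simp add: add_nonneg_pos)
    moreover have "s/(8*(f^2 + 1)) > 0" using s by (simp add: add_nonneg_pos)
    ultimately have t0: "t > 0" by (simp add: t_def)
    have "t <= cka / (2*(f + 1))" by (simp add: t_def)
    then have "t*(2*(f + 1)) <= cka" using s0 by (subst (asm) pos_le_divide_eq) auto
    then have "2*(t*f) + 2*t <= cka" by (simp add: algebra_simps)
    moreover have "0 <= t*f" using t0 s0 by simp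
    ultimately have tf: "t*f < cka" using t0 by linarith
    have "t <= s/(8*(f^2 + 1))" by (simp add: t_def)
    then have "t*(8*(f^2 + 1)) <= s" by (subst (asm) pos_le_divide_eq) (auto simp: add_nonneg_pos)
    then have ts: "4*t*f^2 <= s/2" using t0 by (simp add: algebra_simps)
    let ?X = "mat 1 + t*\<^sub>R F"
    let ?d = "infdist ?X SO3"
    have d1: "?d <= t*f" using infdist_SO3_le[OF mat1_SO3, of ?X] t0 by (simp add: f_def)
    have "symm ?X - mat 1 = t*\<^sub>R symm F" by (simp add: symm_def vec_eq_iff transpose_def mat_def algebra_simps)
    then have "t * s <= ?d + (?d + t*f)^2"
     using symm_defect_bound[of ?X] t0 by (simp add: s_def f_def)
    also have "(?d + t*f)^2 <= (2*(t*f))^2"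
    proof (intro power_mono)
     show "?d + t*f <= 2*(t*f)" using d1 by linarith
     show "0 <= ?d + t*f" using infdist_nonneg[of ?X SO3] t0 s0 by simp
    qed
    also have "... = t*(4*t*f^2)" by (simp add: power2_eq_square)
    also have "... <= t*(s/2)" using ts t0 by (intro mult_left_mono) auto
    finally have "t * s/2 <= ?d" by simp
    then have "(t * s/2)^2 <= ?d\<^sup>2" using t0 s by (intro power_mono) auto
    then have "c*(t * s/2)^2 <= c * ?d\<^sup>2" using c(1) by (intro mult_left_mono) auto
    also have "... <= Wr ?X"
    proof -
     have "?X \<in> U" using cka(2)[of "t*\<^sub>R F"] tf t0 by (simp add: f_def)
     then have "ennreal (c * ?d\<^sup>2) <= ennreal (Wr ?X)" using c(2)[of ?X] W_Wr by simp
     then show ?thesis using Wr_nonneg by (subst (asm) ennreal_le_iff) auto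
    qed
    also have "... <= B (t*\<^sub>R F) (t*\<^sub>R F)/2 + et * (norm (t*\<^sub>R F))^2"
     using cka(2)[of "t*\<^sub>R F"] tf t0 by (simp add: f_def abs_le_iff)
    finally have "t^2*(c * s^2/4) <= t^2*(B F F/2 + et * f^2)"
     using t0 by (simp add: B_linear(3,4) f_def power_mult_distrib power_divide power2_eq_square algebra_simps)
    then show ?thesis using t0 by (simp add: s_def f_def)
   qed
  qed
  have "c*(norm (symm F))^2/4 <= B F F/2"
  proof (rule field_le_epsilon)
   fix e :: real assume e: "e > 0"
   define et where "et = e/((norm F)^2 + 1)"
   have p: "(norm F)^2 + 1 > 0" by (simp add: add_nonneg_pos)
   have "et > 0" using e p by (simp add: et_def)
   have "et * (norm F)^2 <= e" using e p by (simp add: et_def field_simps)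
   then show "c*(norm (symm F))^2/4 <= B F F/2 + e" using step[OF \<open>et > 0\<close>] by linarith
  qed
  then show ?thesis by simp
 qed
 then show ?thesis using c(1) by (intro exI[of _ "c/2"]) auto
qed

lemma B_nonneg: "B F F \<ge> 0"
proof -
 obtain c where "c > 0" "c*(norm (symm F))^2 <= B F F" using coercive by blast
 moreover from this have "0 <= c*(norm (symm F))^2" by (intro mult_nonneg_nonneg) auto
 ultimately show ?thesis by linarith
qed

lemma B_quadratic: "B (F + t*\<^sub>R G) (F + t*\<^sub>R G) = B F F + 2*t*B F G + t^2*B G G"
 using B_linear(5)[of G F] by (simp add: B_linear(1-4) power2_eq_square algebra_simps)

lemma B_Cauchy_Schwarz: "(B F G)^2 <= B F F*B G G"
proof (cases "B G G = 0")
 case True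
 have "B F G = 0"
 proof (rule ccontr)
  assume "B F G \<noteq> 0"
  define k where "k = - (B F F + 1)/(2*B F G)"
  have "2 * k*B F G = - (B F F + 1)" using \<open>B F G \<noteq> 0\<close> by (simp add: k_def)
  moreover have "0 <= B F F + 2 * k*B F G + k^2*B G G" using B_nonneg[of "F + k*\<^sub>R G"] unfolding B_quadratic .
  ultimately show False unfolding True by simp
 qed
 then show ?thesis using B_nonneg by simp
next
 case False
 with B_nonneg[of G] have g: "B G G > 0" by simp
 have "0 <= B F F + 2*(- B F G/B G G)*B F G + (- B F G/B G G)^2*B G G"
  using B_nonneg[of "F + (- B F G/B G G)*\<^sub>R G"] unfolding B_quadratic .
 then have "0 <= B F F - (B F G)^2/B G G" using g by (simp add: power2_eq_square field_simps)
 then show ?thesis using g by (simp add: field_simps)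
qed


text \<open>The density vanishes along a curve of rotations, so the Taylor estimate, divided by
  \<open>t^2\<close>, forces the form to vanish on the velocity of the curve at the
  identity.\<close>

lemma B_zero_of_rotations:
 assumes R: "!!t. R t \<in> SO3" and lim: "((%t. (1/t)*\<^sub>R (R t - mat 1)) \<longlongrightarrow> S) (at_right 0)"
 shows "B S S = 0"
proof -
 have "B S S/2 <= et * (norm S)^2" if et: "et > 0" for et
 proof -
  obtain cka where cka: "cka > 0" "!!F. norm F < cka ==> mat 1 + F \<in> U \<and> \<bar>Wr (mat 1 + F) - B F F/2\<bar> <= et * (norm F)^2"
   using Taylor[OF et] by (elim exE conjE) (rule that, auto)
  let ?Y = "%t. (1/t)*\<^sub>R (R t - mat 1)"
  have "((%t. t*\<^sub>R ?Y t) \<longlongrightarrow> 0*\<^sub>R S) (at_right 0)" by (intro tendsto_scaleR lim tendsto_ident_at)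
  then have "((%t. t*\<^sub>R ?Y t) \<longlongrightarrow> 0) (at_right 0)" unfolding scaleR_zero_left .
  then have "((%t. norm (t*\<^sub>R ?Y t)) \<longlongrightarrow> 0) (at_right 0)" by (rule tendsto_norm_zero)
  then have small: "\<forall>\<^sub>F t in at_right 0. norm (t*\<^sub>R ?Y t) < cka" using cka(1) by (rule order_tendstoD(2))
  have ev: "\<forall>\<^sub>F t in at_right 0. B (?Y t) (?Y t)/2 <= et * (norm (?Y t))^2"
   using small eventually_at_right_less[of 0]
  proof eventually_elim
   case (elim t)
   have e: "t*\<^sub>R ?Y t = R t - mat 1" using elim(2) by simp
   have "\<bar>Wr (mat 1 + (R t - mat 1)) - B (R t - mat 1) (R t - mat 1)/2\<bar> <= et * (norm (R t - mat 1))^2"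
    using cka(2)[of "R t - mat 1"] elim(1) unfolding e by blast
   then have "B (R t - mat 1) (R t - mat 1)/2 <= et * (norm (R t - mat 1))^2" using Wr_SO3[OF R[of t]] by simp
   then have "(1/t)^2*(B (R t - mat 1) (R t - mat 1)/2) <= (1/t)^2*(et * (norm (R t - mat 1))^2)" by (intro mult_left_mono) auto
   then show ?case by (simp add: B_linear(3,4) power2_eq_square power_mult_distrib abs_mult mult_ac)
  qed
  have cB: "isCont (%F. B F F) S" using B_cont[of UNIV] by (simp add: continuous_on_eq_continuous_at)
  have l1: "((%t. B (?Y t) (?Y t)/2) \<longlongrightarrow> B S S/2) (at_right 0)"
   by (intro tendsto_intros isCont_tendsto_compose[OF cB lim]) auto
  have l2: "((%t. et * (norm (?Y t))^2) \<longlongrightarrow> et * (norm S)^2) (at_right 0)"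
   by (intro tendsto_intros lim)
  show ?thesis by (rule tendsto_le[OF _ l2 l1 ev]) simp
 qed
 then have "B S S/2 <= 0 + e" if "e > 0" for e
 proof -
  define et where "et = e/((norm S)^2 + 1)"
  have p: "(norm S)^2 + 1 > 0" by (simp add: add_nonneg_pos)
  have "et > 0" using that p by (simp add: et_def)
  moreover have "et * (norm S)^2 <= e" using that p by (simp add: et_def field_simps)
  ultimately show ?thesis using \<open>!!et. et > 0 ==> B S S/2 <= et * (norm S)^2\<close>[of et] by linarith
 qed
 then have "B S S/2 <= 0" by (rule field_le_epsilon)
 then show ?thesis using B_nonneg[of S] by simp
qed

section \<open>Infinitesimal rotations and the relaxed form \<open>Q2\<close>\<close>

lemma cos_sin_quotients: "((%t::real. (cos t - 1)/t) \<longlongrightarrow> 0) (at_right 0)" "((%t::real. sin t/t) \<longlongrightarrow> 1) (at_right 0)"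
proof -
 have "(cos has_real_derivative - sin 0) (at 0)" "(sin has_real_derivative cos 0) (at (0::real))" by (auto intro!: derivative_eq_intros)
 then have "((%t::real. (cos t - 1)/t) \<longlongrightarrow> 0) (at 0)" "((%t::real. sin t/t) \<longlongrightarrow> 1) (at 0)"
  by (simp_all add: has_field_derivative_iff)
 then show "((%t::real. (cos t - 1)/t) \<longlongrightarrow> 0) (at_right 0)" "((%t::real. sin t/t) \<longlongrightarrow> 1) (at_right 0)"
  by (auto intro: tendsto_mono[OF at_le])
qed

definition skew :: "real => real => real => real^3^3" where
 "skew a b c = vector [vector [0, -a, -b], vector [a, 0, -c], vector [b, c, 0]]"

lemma SO3_entries:
 fixes A :: "real^3^3"
 assumes "det A = 1" "A $ 1 \<bullet> A $ 1 = 1" "A $ 2 \<bullet> A $ 2 = 1" "A $ 3 \<bullet> A $ 3 = 1" "A $ 1 \<bullet> A $ 2 = 0" "A $ 1 \<bullet> A $ 3 = 0" "A $ 2 \<bullet> A $ 3 = 0"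
 shows "A \<in> SO3"
proof -
 have "(A ** transpose A) $ i $ j = A $ i \<bullet> A $ j" for i j
  by (simp add: matrix_matrix_mult_def transpose_def inner_vec_def)
 then have "A ** transpose A = mat 1" using assms by (simp add: vec_eq_iff forall_3 mat_def inner_commute)
 then have "orthogonal_matrix (transpose A)" by (simp add: orthogonal_matrix)
 then have "orthogonal_matrix A" using orthogonal_matrix_transpose[of A] by simp
 then show ?thesis using assms(1) by (simp add: SO3_def)
qed

lemma vec3_tendsto:
 fixes f :: "real => real^3^3"
 assumes "!!i j. ((%t. f t $ i $ j) \<longlongrightarrow> l $ i $ j) F"
 shows "(f \<longlongrightarrow> l) F"
 by (intro vec_tendstoI assms)

lemma B_skew_basis: "B (skew 1 0 0) (skew 1 0 0) = 0" "B (skew 0 1 0) (skew 0 1 0) = 0" "B (skew 0 0 1) (skew 0 0 1) = 0"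
proof -
 have t: "(sin t)^2 + (cos t)^2 = 1" for t :: real by simp
 note S = SO3_entries cos_sin_quotients
 show "B (skew 1 0 0) (skew 1 0 0) = 0"
 proof (rule B_zero_of_rotations[where R="%t. vector [vector [cos t, - sin t, 0], vector [sin t, cos t, 0], vector [0, 0, 1]]"])
  fix t :: real
  show "vector [vector [cos t, - sin t, 0], vector [sin t, cos t, 0], vector [0, 0, 1]] \<in> SO3"
   by (rule SO3_entries) (use t[of t] in \<open>simp_all add: det_3 inner_vec_def sum_3 power2_eq_square algebra_simps\<close>)
 next
  show "((%t. (1/t)*\<^sub>R (vector [vector [cos t, - sin t, 0], vector [sin t, cos t, 0], vector [0, 0, 1]] - mat 1)) \<longlongrightarrow> skew 1 0 0) (at_right 0)"
  proof (rule vec3_tendsto)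
   fix i j :: 3
   have "i = 1 \<or> i = 2 \<or> i = 3" "j = 1 \<or> j = 2 \<or> j = 3" using exhaust_3 by blast+
   then show "((%t. ((1/t)*\<^sub>R (vector [vector [cos t, - sin t, 0], vector [sin t, cos t, 0], vector [0, 0, 1]] - mat 1)) $ i $ j) \<longlongrightarrow> skew 1 0 0 $ i $ j) (at_right 0)"
    using cos_sin_quotients tendsto_minus[OF cos_sin_quotients(2)] by (auto simp: skew_def mat_def)
  qed
 qed
 show "B (skew 0 1 0) (skew 0 1 0) = 0"
 proof (rule B_zero_of_rotations[where R="%t. vector [vector [cos t, 0, - sin t], vector [0, 1, 0], vector [sin t, 0, cos t]]"])
  fix t :: real
  show "vector [vector [cos t, 0, - sin t], vector [0, 1, 0], vector [sin t, 0, cos t]] \<in> SO3"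
   by (rule SO3_entries) (use t[of t] in \<open>simp_all add: det_3 inner_vec_def sum_3 power2_eq_square algebra_simps\<close>)
 next
  show "((%t. (1/t)*\<^sub>R (vector [vector [cos t, 0, - sin t], vector [0, 1, 0], vector [sin t, 0, cos t]] - mat 1)) \<longlongrightarrow> skew 0 1 0) (at_right 0)"
  proof (rule vec3_tendsto)
   fix i j :: 3
   have "i = 1 \<or> i = 2 \<or> i = 3" "j = 1 \<or> j = 2 \<or> j = 3" using exhaust_3 by blast+
   then show "((%t. ((1/t)*\<^sub>R (vector [vector [cos t, 0, - sin t], vector [0, 1, 0], vector [sin t, 0, cos t]] - mat 1)) $ i $ j) \<longlongrightarrow> skew 0 1 0 $ i $ j) (at_right 0)"
    using cos_sin_quotients tendsto_minus[OF cos_sin_quotients(2)] by (auto simp: skew_def mat_def)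
  qed
 qed
 show "B (skew 0 0 1) (skew 0 0 1) = 0"
 proof (rule B_zero_of_rotations[where R="%t. vector [vector [1, 0, 0], vector [0, cos t, - sin t], vector [0, sin t, cos t]]"])
  fix t :: real
  show "vector [vector [1, 0, 0], vector [0, cos t, - sin t], vector [0, sin t, cos t]] \<in> SO3"
   by (rule SO3_entries) (use t[of t] in \<open>simp_all add: det_3 inner_vec_def sum_3 power2_eq_square algebra_simps\<close>)
 next
  show "((%t. (1/t)*\<^sub>R (vector [vector [1, 0, 0], vector [0, cos t, - sin t], vector [0, sin t, cos t]] - mat 1)) \<longlongrightarrow> skew 0 0 1) (at_right 0)"
  proof (rule vec3_tendsto)
   fix i j :: 3
   have "i = 1 \<or> i = 2 \<or> i = 3" "j = 1 \<or> j = 2 \<or> j = 3" using exhaust_3 by blast+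
   then show "((%t. ((1/t)*\<^sub>R (vector [vector [1, 0, 0], vector [0, cos t, - sin t], vector [0, sin t, cos t]] - mat 1)) $ i $ j) \<longlongrightarrow> skew 0 0 1 $ i $ j) (at_right 0)"
    using cos_sin_quotients tendsto_minus[OF cos_sin_quotients(2)] by (auto simp: skew_def mat_def)
  qed
 qed
qed

text \<open>Cauchy-Schwarz upgrades vanishing of the nonnegative form on the three generators to
  their orthogonality to everything, and the generators span the skew matrices. Consequently the
  form depends only on symmetric parts.\<close>

lemma B_skew: "B F (skew a b c) = 0"
proof -
 have "B F S = 0" if "B S S = 0" for S using B_Cauchy_Schwarz[of F S] that by simp
 then have z: "B F (skew 1 0 0) = 0" "B F (skew 0 1 0) = 0" "B F (skew 0 0 1) = 0" using B_skew_basis by auto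
 have "skew a b c = a*\<^sub>R skew 1 0 0 + b*\<^sub>R skew 0 1 0 + c*\<^sub>R skew 0 0 1"
  by (simp add: skew_def vec_eq_iff forall_3)
 then show ?thesis by (simp add: B_linear(2,4) z)
qed

lemma B_symm: "B F (symm G) = B F G"
proof -
 have e: "symm G + skew ((G $ 2 $ 1 - G $ 1 $ 2)/2) ((G $ 3 $ 1 - G $ 1 $ 3)/2) ((G $ 3 $ 2 - G $ 2 $ 3)/2) = G"
  unfolding vec_eq_iff forall_3 by (simp add: symm_def skew_def transpose_def) (simp add: field_simps)
 have "B F G = B F (symm G) + B F (skew ((G $ 2 $ 1 - G $ 1 $ 2)/2) ((G $ 3 $ 1 - G $ 1 $ 3)/2) ((G $ 3 $ 2 - G $ 2 $ 3)/2))"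
  unfolding B_linear(2)[symmetric] e ..
 then show ?thesis by (simp add: B_skew)
qed

lemma minor22_eq: "minor22 F = G \<longleftrightarrow> F $ 1 $ 1 = G $ 1 $ 1 \<and> F $ 1 $ 2 = G $ 1 $ 2 \<and> F $ 2 $ 1 = G $ 2 $ 1 \<and> F $ 2 $ 2 = G $ 2 $ 2"
 by (auto simp: minor22_def vec_eq_iff forall_2)

text \<open>Coercivity controls only the symmetric part, but the form depends on nothing else and
  symmetrizing preserves the prescribed block. So the minimum is sought among symmetric extensions
  in a large ball, which is compact.\<close>

lemma minimizer: "\<exists>M. minor22 M = mat 1 \<and> (\<forall>X. minor22 X = mat 1 --> B M M <= B X X) \<and> B M M > 0"
proof -
 obtain c where c: "c > 0" "!!F. c*(norm (symm F))^2 <= B F F" using coercive by blast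
 define I where "I = (mat 1 :: real^3^3)"
 have I1: "minor22 I = mat 1" by (simp add: I_def minor22_eq mat_def)
 have I2: "symm I = I" by (auto simp: I_def mat_def symm_def transpose_def vec_eq_iff)
 note I = I1 I2
 \<comment> \<open>Beyond this radius coercivity already gives a value of at least
   \<open>B I I\<close>; the summand \<open>norm I\<close> keeps the competitor \<open>I\<close> in
   the ball.\<close>
 define rh where "rh = sqrt (B I I/c) + norm I"
 define A where "A = {X::real^3^3. X $ 1 $ 1 = 1 \<and> X $ 1 $ 2 = 0 \<and> X $ 2 $ 1 = 0 \<and> X $ 2 $ 2 = 1 \<and> symm X = X} \<inter> cball 0 rh"
 have BI: "B I I \<ge> 0" by (rule B_nonneg)
 have "closed {X::real^3^3. X $ 1 $ 1 = 1 \<and> X $ 1 $ 2 = 0 \<and> X $ 2 $ 1 = 0 \<and> X $ 2 $ 2 = 1 \<and> symm X = X}"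
  unfolding symm_def transpose_def
  by (intro closed_Collect_conj closed_Collect_eq continuous_intros continuous_on_vec_lambda)
 then have "compact A" unfolding A_def by (simp add: closed_Int_compact)
 moreover have "I \<in> A" unfolding A_def using I c(1) BI by (simp add: rh_def) (simp add: I_def mat_def)
 ultimately obtain M where M: "M \<in> A" "!!X. X \<in> A ==> B M M <= B X X"
  using continuous_attains_inf[OF \<open>compact A\<close> _ B_cont[of A]] by blast
 have min: "B M M <= B X X" if X: "minor22 X = mat 1" for X
 proof -
  have e: "B (symm X) (symm X) = B X X" using B_symm[of "symm X" X] B_symm[of X X] B_linear(5)[of "symm X" X] by simp
  show ?thesis
  proof (cases "norm (symm X) <= rh")
   case True
   have "X $ 1 $ 1 = 1" "X $ 1 $ 2 = 0" "X $ 2 $ 1 = 0" "X $ 2 $ 2 = 1" using X by (simp_all add: minor22_eq mat_def)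
   then have "symm X $ 1 $ 1 = 1" "symm X $ 1 $ 2 = 0" "symm X $ 2 $ 1 = 0" "symm X $ 2 $ 2 = 1"
    by (simp_all add: symm_def transpose_def)
   moreover have "symm (symm X) = symm X" unfolding vec_eq_iff by (simp add: symm_def transpose_def field_simps)
   ultimately have "symm X \<in> A" using True by (simp add: A_def)
   from M(2)[OF this] show ?thesis using e by simp
  next
   case False
   then have "sqrt (B I I/c) <= norm (symm X)" using norm_ge_zero[of I] by (simp add: rh_def del: norm_ge_zero)
   then have "(sqrt (B I I/c))^2 <= (norm (symm X))^2" using BI c(1) by (intro power_mono) auto
   then have "B I I/c <= (norm (symm X))^2" using BI c(1) by simp
   then have "B I I <= c*(norm (symm X))^2" using c(1) by (simp add: field_simps)
   then show ?thesis using c(2)[of X] M(2)[OF \<open>I \<in> A\<close>] by linarith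
  qed
 qed
 have mM: "minor22 M = mat 1" using M(1) by (simp add: A_def minor22_eq mat_def)
 have sM: "symm M = M" "M \<noteq> 0" using M(1) by (auto simp: A_def)
 then have "c*(norm (symm M))^2 > 0" using c(1) by simp
 then have "B M M > 0" using c(2)[of M] by linarith
 then show ?thesis using mM min by blast
qed

text \<open>The Euler-Lagrange equation of the minimizer \<open>M\<close> says that
  \<open>B M E\<close> depends only on the in-plane block of \<open>E\<close>; its coefficients are
  \<open>t11\<close>, \<open>t12\<close>, \<open>t22\<close>. Evaluation at \<open>M\<close> gives
  the trace \<open>Q2\<close>, and Cauchy-Schwarz gives the dual bound. These coefficients become
  the in-plane part of the test stress.\<close>

lemma linearization:
 "\<exists>c0 t11 t12 t22. c0 > 0 \<and> (\<forall>E. c0*(norm (symm E))^2 <= B E E) \<and> t11 + t22 = Q2 W (mat 1) \<and> Q2 W (mat 1) > 0 \<and>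
  (\<forall>E. (t11*E $ 1 $ 1 + t12*(E $ 1 $ 2 + E $ 2 $ 1) + t22*E $ 2 $ 2)\<^sup>2 <= Q2 W (mat 1)*B E E)"
proof -
 obtain c where c: "c > 0" "!!F. c*(norm (symm F))^2 <= B F F" using coercive by blast
 obtain M where M: "minor22 M = mat 1" "!!X. minor22 X = mat 1 ==> B M M <= B X X" "B M M > 0" using minimizer by blast
 have Q2: "Q2 W (mat 1) = B M M"
  unfolding Q2_def D2W_B by (rule cInf_eq_minimum) (use M in auto)
 have z: "B M N = 0" if N: "N $ 1 $ 1 = 0" "N $ 1 $ 2 = 0" "N $ 2 $ 1 = 0" "N $ 2 $ 2 = 0" for N
 proof (rule ccontr)
  assume nz: "B M N \<noteq> 0"
  have q: "0 <= 2*t*B M N + t^2*B N N" for t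
  proof -
   have "minor22 (M + t*\<^sub>R N) = mat 1" using M(1) N by (simp add: minor22_eq)
   from M(2)[OF this] show ?thesis unfolding B_quadratic by simp
  qed
  \<comment> \<open>The added 1 keeps the denominator positive even for directions on which the form
    degenerates.\<close>
  define t where "t = - B M N/(B N N + 1)"
  have p: "B N N + 1 > 0" using B_nonneg[of N] by simp
  have t1: "t*(B N N + 1) = - B M N" using p by (simp add: t_def)
  have "t*(t*(B N N + 1)) = t*(- B M N)" unfolding t1 ..
  then have e: "t^2*B N N = - (t*B M N) - t^2" by (simp add: power2_eq_square algebra_simps)
  have "t*B M N = - ((B M N)^2/(B N N + 1))" by (simp add: t_def power2_eq_square)
  moreover have "(B M N)^2/(B N N + 1) > 0" using nz p by simp
  ultimately have "t*B M N < 0" by simp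
  then show False using q[of t] e zero_le_power2[of t] by simp
 qed
 define e where "e i j = (\<chi> a b. if a = i \<and> b = j then (1::real) else 0)" for i j :: 3
 define t11 where "t11 = B M (e 1 1)"
 define t12 where "t12 = B M (e 1 2)"
 define t22 where "t22 = B M (e 2 2)"
 have t21: "B M (e 2 1) = t12"
 proof -
  have "e 2 1 = e 1 2 + skew 1 0 0" by (simp add: e_def skew_def vec_eq_iff forall_3)
  then show ?thesis by (simp add: B_linear(2) B_skew t12_def)
 qed
 have BE: "B M E = t11*E $ 1 $ 1 + t12*(E $ 1 $ 2 + E $ 2 $ 1) + t22*E $ 2 $ 2" for E
 proof -
  define N where "N = E - (E $ 1 $ 1*\<^sub>R e 1 1 + E $ 1 $ 2*\<^sub>R e 1 2 + E $ 2 $ 1*\<^sub>R e 2 1 + E $ 2 $ 2*\<^sub>R e 2 2)"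
  have "B M N = 0" by (rule z) (simp_all add: N_def e_def)
  then show ?thesis unfolding N_def by (simp add: B_diff B_linear(2,4) t11_def t12_def t22_def t21[symmetric]) (simp add: t21 t12_def algebra_simps)
 qed
 have "t11 + t22 = B M M" using BE[of M] M(1) by (simp add: minor22_eq mat_def)
 moreover have "(t11*E $ 1 $ 1 + t12*(E $ 1 $ 2 + E $ 2 $ 1) + t22*E $ 2 $ 2)^2 <= B M M*B E E" for E
  using B_Cauchy_Schwarz[of M E] by (simp add: BE)
 ultimately show ?thesis using c M(3) unfolding Q2 by blast
qed

end

section \<open>A divergence free test stress\<close>

text \<open>The derivatives of order \<open>i\<close> up to 3 of the function
  \<open>max 0 (1 - s^2) ^ 4\<close>. The fourth power leaves three continuous derivatives: two
  enter the stress and one more is taken when it is tested.\<close>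

definition profile :: "nat => real => real" where
 "profile i s = (let m = max 0 (1 - s^2) in
  if i = 0 then m^4 else if i = 1 then (- 8 * s)*m^3
  else if i = 2 then (48 * s^2)*m^2 - 8*m^3 else 144 * s*m^2 - 192 * s^3*m)"

lemma profile_deriv: assumes "i <= 2" shows "(profile i has_real_derivative profile (Suc i) s) (at s)"
proof -
 let ?m = "%s::real. max 0 (1 - s^2)"
 have q: "((%s::real. 1 - s^2) has_real_derivative - 2 * s) (at s)" by (auto intro!: derivative_eq_intros)
 have m: "((%s. ?m s^Suc (Suc k)) has_real_derivative real (k + 2) * ?m s^Suc k*(- 2 * s)) (at s)" for k
  by (rule DERIV_chain2[OF pospow_deriv q])
 have m4: "((%s. ?m s^4) has_real_derivative 4 * ?m s^3*(- 2 * s)) (at s)" using m[of 2] by (simp add: eval_nat_numeral)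
 have m3: "((%s. ?m s^3) has_real_derivative 3 * ?m s^2*(- 2 * s)) (at s)" using m[of 1] by (simp add: eval_nat_numeral)
 have m2: "((%s. ?m s^2) has_real_derivative 2 * ?m s*(- 2 * s)) (at s)" using m[of 0] by (simp add: eval_nat_numeral)
 consider "i = 0" | "i = 1" | "i = 2" using assms by linarith
 then show ?thesis
 proof cases
  case 1
  have "profile i = (%s. ?m s^4)" "profile (Suc i) s = 4 * ?m s^3*(- 2 * s)" using 1 by (auto simp: profile_def Let_def)
  then show ?thesis using m4 by simp
 next
  case 2
  have d: "((%s::real. - 8 * s) has_real_derivative - 8) (at s)" by (auto intro!: derivative_eq_intros)
  have "profile i = (%s. (- 8 * s) * ?m s^3)" using 2 by (auto simp: profile_def Let_def)
  moreover have "profile (Suc i) s = (- 8) * ?m s^3 + (3 * ?m s^2*(- 2 * s))*(- 8 * s)"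
   using 2 by (simp add: profile_def Let_def) (simp add: power2_eq_square)
  ultimately show ?thesis using DERIV_mult[OF d m3] by simp
 next
  case 3
  have d: "((%s::real. 48 * s^2) has_real_derivative 96 * s) (at s)" by (auto intro!: derivative_eq_intros)
  have "profile i = (%s. (48 * s^2) * ?m s^2 - 8 * ?m s^3)" using 3 by (auto simp: profile_def Let_def)
  moreover have "profile (Suc i) s = (96 * s * ?m s^2 + (2 * ?m s*(- 2 * s))*(48 * s^2)) - 8*(3 * ?m s^2*(- 2 * s))"
   using 3 by (simp add: profile_def Let_def) (simp add: power2_eq_square power3_eq_cube)
  ultimately show ?thesis using DERIV_diff[OF DERIV_mult[OF d m2] DERIV_cmult[OF m3, of 8]] by simp
 qed
qed

lemma profile_cont: "continuous_on UNIV (profile i)"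
 unfolding profile_def Let_def
 by (cases "i = 0"; cases "i = 1"; cases "i = 2"; simp; intro continuous_intros)

lemma profile_zero: assumes "\<bar>s\<bar> \<ge> 1" shows "profile i s = 0"
proof -
 have "1 <= s^2" using abs_le_square_iff[of 1 s] assms by simp
 then have "max 0 (1 - s^2) = 0" by simp
 then show ?thesis by (simp add: profile_def)
qed

text \<open>The largest bound comes from the second derivative: \<open>48 + 8 = 56\<close>.\<close>

lemma profile_bound: assumes "i <= 2" shows "\<bar>profile i s\<bar> <= 56"
proof (cases "\<bar>s\<bar> \<ge> 1")
 case True
 then show ?thesis by (simp add: profile_zero)
next
 case False
 define m where "m = max 0 (1 - s^2)"
 have m: "0 <= m" "m <= 1" by (auto simp: m_def)
 have p: "0 <= m^k" "m^k <= 1" for k using m by (auto intro: power_le_one)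
 have s2: "0 <= s^2" "s^2 <= 1" using False abs_square_le_1[of s] by auto
 have a: "\<bar>s*m^3\<bar> <= 1" using False p[of 3] by (simp add: abs_mult mult_le_one)
 have b: "0 <= s^2*m^2" "s^2*m^2 <= 1" using s2 p[of 2] by (simp_all add: mult_le_one)
 consider "i = 0" | "i = 1" | "i = 2" using assms by linarith
 then show ?thesis
 proof cases
  case 1
  then have "profile i s = m^4" by (simp add: profile_def m_def)
  then show ?thesis using p[of 4] by linarith
 next
  case 2
  then have "profile i s = - 8*(s*m^3)" by (simp add: profile_def m_def)
  then show ?thesis using a by linarith
 next
  case 3
  then have "profile i s = 48*(s^2*m^2) - 8*m^3" by (simp add: profile_def m_def Let_def)
  then show ?thesis using b p[of 3] by linarith
 qed
qed

lemma profile_nonneg: "profile 0 s \<ge> 0" by (simp add: profile_def)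

lemma profile_lower: assumes "\<bar>s\<bar> <= 1/2" shows "profile 0 s \<ge> (3/4)^4"
proof -
 have "s^2 <= (1/2)^2" using assms by (intro abs_le_square_iff[THEN iffD1]) auto
 then have "3/4 <= 1 - s^2" by (simp add: power2_eq_square)
 then have "3/4 <= max 0 (1 - s^2)" by (rule max.coboundedI2)
 then have "(3/4)^4 <= max 0 (1 - s^2)^4" by (rule power_mono) simp
 then show ?thesis by (simp only: profile_def Let_def simp_thms if_True)
qed

section \<open>Cutoffs on a flat cell\<close>

definition Xc :: "real => nat => real => real" where "Xc l i s = profile i (s/l)/l^i"

text \<open>The profile is centred at \<open>1/8\<close> and supported in \<open>[0, 1/4]\<close>,
  on one side of the midplane, so that moments with powers of the height are positive for every
  exponent, odd ones included.\<close>

definition Gc :: "nat => real => real" where "Gc i s = 8^i*profile i (8 * s - 1)"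

lemma Xc_deriv: assumes "i <= 2" shows "(Xc l i has_real_derivative Xc l (Suc i) s) (at s)"
proof -
 have "((%s::real. s/l) has_real_derivative 1/l) (at s)" using DERIV_cdivide[OF DERIV_ident] .
 from DERIV_cdivide[OF DERIV_chain2[OF profile_deriv[OF assms] this], of "l^i"]
 show ?thesis unfolding Xc_def by (simp add: mult.commute)
qed

lemma Gc_deriv: assumes "i <= 2" shows "(Gc i has_real_derivative Gc (Suc i) s) (at s)"
proof -
 have "((%s::real. 8 * s - 1) has_real_derivative 8) (at s)" by (auto intro!: derivative_eq_intros)
 from DERIV_cmult[OF DERIV_chain2[OF profile_deriv[OF assms] this], of "8^i"]
 show ?thesis unfolding Gc_def by (simp add: mult_ac)
qed

lemma Xc_cont: "continuous_on UNIV (Xc l i)"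
 unfolding Xc_def divide_inverse by (intro continuous_intros continuous_on_UNIV_comp[OF profile_cont])

lemma Gc_cont: "continuous_on UNIV (Gc i)"
 unfolding Gc_def by (intro continuous_intros continuous_on_UNIV_comp[OF profile_cont])

definition cellcut :: "real => nat => nat => nat => real^3 => real" where
 "cellcut l i j k y = Xc l i (y $ 1)*Xc l j (y $ 2)*Gc k (y $ 3)"

text \<open>Half-sides of a box that contains the support of the stress. With the margin
  \<open>1/8\<close> the half-height is \<open>3/8\<close>, still below the \<open>1/2\<close> of
  the rescaled plate.\<close>

definition cl :: "real => real^3" where "cl l = vector [l, l, 1/4]"

lemma cl_nth: "cl l $ 1 = l" "cl l $ 2 = l" "cl l $ 3 = 1/4" by (simp_all add: cl_def)

lemma cut_cont: "continuous_on UNIV (cellcut l i j k)"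
 unfolding cellcut_def
 by (intro continuous_intros continuous_on_UNIV_comp[OF Xc_cont] continuous_on_UNIV_comp[OF Gc_cont])

lemma grad1_cut:
 assumes "i <= 2" "j <= 2" "k <= 2"
 shows "grad1 (cellcut l i j k) (%y. vector [cellcut l (Suc i) j k y, cellcut l i (Suc j) k y, cellcut l i j (Suc k) y])"
proof -
 note a = grad1_real_comp[OF grad1_coord[of 1] Xc_deriv[OF assms(1), of l] Xc_cont]
 note b = grad1_real_comp[OF grad1_coord[of 2] Xc_deriv[OF assms(2), of l] Xc_cont]
 note c = grad1_real_comp[OF grad1_coord[of 3] Gc_deriv[OF assms(3)] Gc_cont]
 show ?thesis
  by (rule grad1_cong[OF grad1_mult[OF grad1_mult[OF a b] c]])
   (simp_all add: cellcut_def vec_eq_iff forall_3 axis_def mult_ac)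
qed

lemma cut_zero: assumes "y \<notin> Qb (cl l) 0" "l > 0" shows "cellcut l i j k y = 0"
proof -
 have "\<bar>y $ 1\<bar> > l \<or> \<bar>y $ 2\<bar> > l \<or> \<bar>y $ 3\<bar> > 1/4"
  using assms(1) by (auto simp: mem_Qb forall_3 cl_nth)
 moreover have "Xc l i s = 0" if "\<bar>s\<bar> > l" for s i
  using that assms(2) by (simp add: Xc_def profile_zero)
 moreover have "Gc i s = 0" if "\<bar>s\<bar> > 1/4" for s i
 proof -
  have "\<bar>8 * s - 1\<bar> \<ge> 1" using that by linarith
  then show ?thesis by (simp add: Gc_def profile_zero)
 qed
 ultimately show ?thesis by (auto simp: cellcut_def)
qed

lemma cut_by_parts:
 assumes "grad1 f F" "i <= 2" "j <= 2" "k <= 2" "l > 0"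
 shows "integral (Qb (cl l) 0) (%y. F y $ 1*cellcut l i j k y) = - integral (Qb (cl l) 0) (%y. f y*cellcut l (Suc i) j k y)"
  "integral (Qb (cl l) 0) (%y. F y $ 2*cellcut l i j k y) = - integral (Qb (cl l) 0) (%y. f y*cellcut l i (Suc j) k y)"
  "integral (Qb (cl l) 0) (%y. F y $ 3*cellcut l i j k y) = - integral (Qb (cl l) 0) (%y. f y*cellcut l i j (Suc k) y)"
proof -
 have z: "cellcut l i j k y = 0" if "y \<notin> cbox (- (cl l + vec 0)) (cl l + vec 0)" for y
  using cut_zero[of y l] that assms(5) unfolding Qb_def by blast
 have P: "integral (Qb (cl l) 0) (%y. F y $ c*cellcut l i j k y)
   = - integral (Qb (cl l) 0) (%y. f y * vector [cellcut l (Suc i) j k y, cellcut l i (Suc j) k y, cellcut l i j (Suc k) y] $ c)" for c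
  unfolding Qb_def by (rule integral_by_parts[OF assms(1) grad1_cut[OF assms(2-4)] z])
 show "integral (Qb (cl l) 0) (%y. F y $ 1*cellcut l i j k y) = - integral (Qb (cl l) 0) (%y. f y*cellcut l (Suc i) j k y)"
  using P[of 1] by simp
 show "integral (Qb (cl l) 0) (%y. F y $ 2*cellcut l i j k y) = - integral (Qb (cl l) 0) (%y. f y*cellcut l i (Suc j) k y)"
  using P[of 2] by simp
 show "integral (Qb (cl l) 0) (%y. F y $ 3*cellcut l i j k y) = - integral (Qb (cl l) 0) (%y. f y*cellcut l i j (Suc k) y)"
  using P[of 3] by simp
qed

lemma cut_bound:
 assumes "i <= 2" "j <= 2" "k <= 2" "l > 0"
 shows "\<bar>cellcut l i j k y\<bar> <= 56^3*8^k/l^(i + j)"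
proof -
 have x: "\<bar>Xc l i s\<bar> <= 56/l^i" if "i <= 2" for i s
  using profile_bound[OF that, of "s/l"] assms(4) by (simp add: Xc_def abs_mult divide_right_mono)
 have g: "\<bar>Gc k s\<bar> <= 8^k*56" for s
  using profile_bound[OF assms(3), of "8 * s - 1"] by (simp add: Gc_def abs_mult)
 have "\<bar>cellcut l i j k y\<bar> <= (56/l^i)*(56/l^j)*(8^k*56)"
  unfolding cellcut_def abs_mult using assms(4)
  by (intro mult_mono x g assms mult_nonneg_nonneg) auto
 also have "... = 56^3*8^k/l^(i + j)" by (simp add: power_add power3_eq_cube)
 finally show ?thesis .
qed

text \<open>The stress is built from an Airy-type potential, so it is symmetric and divergence free.\<close>

definition stress :: "real => real => real => real => real^3 => real^3^3" where
 "stress l p q r y =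
  vector [vector [p*cellcut l 0 0 2 y, q*cellcut l 0 0 2 y, - (p*cellcut l 1 0 1 y + q*cellcut l 0 1 1 y)],
      vector [q*cellcut l 0 0 2 y, r*cellcut l 0 0 2 y, - (q*cellcut l 1 0 1 y + r*cellcut l 0 1 1 y)],
      vector [- (p*cellcut l 1 0 1 y + q*cellcut l 0 1 1 y), - (q*cellcut l 1 0 1 y + r*cellcut l 0 1 1 y),
          p*cellcut l 2 0 0 y + 2*q*cellcut l 1 1 0 y + r*cellcut l 0 2 0 y]]"

lemma stress_cont: "continuous_on UNIV (stress l p q r)"
proof -
 have "continuous_on UNIV (%y. stress l p q r y $ i $ j)" for i j
 proof -
  have "i = 1 \<or> i = 2 \<or> i = 3" "j = 1 \<or> j = 2 \<or> j = 3" using exhaust_3 by blast+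
  then show ?thesis by (elim disjE; simp add: stress_def; intro continuous_intros cut_cont)
 qed
 then have "continuous_on UNIV (%y. \<chi> i j. stress l p q r y $ i $ j)" by (intro continuous_on_vec_lambda)
 then show ?thesis by simp
qed

lemma stress_inner:
 "stress l p q r y \<bullet> E =
  p*(E $ 1 $ 1*cellcut l 0 0 2 y) + q*(E $ 1 $ 2*cellcut l 0 0 2 y) - p*(E $ 1 $ 3*cellcut l 1 0 1 y) - q*(E $ 1 $ 3*cellcut l 0 1 1 y)
  + q*(E $ 2 $ 1*cellcut l 0 0 2 y) + r*(E $ 2 $ 2*cellcut l 0 0 2 y) - q*(E $ 2 $ 3*cellcut l 1 0 1 y) - r*(E $ 2 $ 3*cellcut l 0 1 1 y)
  - p*(E $ 3 $ 1*cellcut l 1 0 1 y) - q*(E $ 3 $ 1*cellcut l 0 1 1 y) - q*(E $ 3 $ 2*cellcut l 1 0 1 y) - r*(E $ 3 $ 2*cellcut l 0 1 1 y)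
  + p*(E $ 3 $ 3*cellcut l 2 0 0 y) + 2*q*(E $ 3 $ 3*cellcut l 1 1 0 y) + r*(E $ 3 $ 3*cellcut l 0 2 0 y)"
 by (simp add: inner_mat sum_3 stress_def) (simp add: algebra_simps)

text \<open>One integration by parts turns each of the fifteen terms into a component of
  \<open>v\<close> against a third derivative of the cutoff; in this form they cancel.\<close>

lemma stress_orthogonal:
 assumes V: "gradM v V" and l: "l > 0"
 shows "integral (Qb (cl l) 0) (%y. stress l p q r y \<bullet> V y) = 0"
proof -
 let ?I = "%a b i j k. integral (Qb (cl l) 0) (%y. V y $ a $ b*cellcut l i j k y)"
 have h: "((%y. V y $ a $ b*cellcut l i j k y) has_integral ?I a b i j k) (Qb (cl l) 0)" for a b i j k
  by (intro integrable_integral cont_integrable_Qb continuous_intros cut_cont gradM_cont[OF V])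
 have "((%y. stress l p q r y \<bullet> V y) has_integral
  p * ?I 1 1 0 0 2 + q * ?I 1 2 0 0 2 - p * ?I 1 3 1 0 1 - q * ?I 1 3 0 1 1
  + q * ?I 2 1 0 0 2 + r * ?I 2 2 0 0 2 - q * ?I 2 3 1 0 1 - r * ?I 2 3 0 1 1
  - p * ?I 3 1 1 0 1 - q * ?I 3 1 0 1 1 - q * ?I 3 2 1 0 1 - r * ?I 3 2 0 1 1
  + p * ?I 3 3 2 0 0 + 2*q * ?I 3 3 1 1 0 + r * ?I 3 3 0 2 0) (Qb (cl l) 0)"
  unfolding stress_inner by (intro has_integral_add has_integral_diff has_integral_mult_right h)
 moreover note P = cut_by_parts[OF gradM_nth[OF V] _ _ _ l]
 have "?I 1 1 0 0 2 = ?I 1 3 1 0 1" "?I 1 2 0 0 2 = ?I 1 3 0 1 1" "?I 2 1 0 0 2 = ?I 2 3 1 0 1" "?I 2 2 0 0 2 = ?I 2 3 0 1 1"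
  "?I 3 3 2 0 0 = ?I 3 1 1 0 1" "?I 3 3 1 1 0 = ?I 3 1 0 1 1" "?I 3 2 1 0 1 = ?I 3 1 0 1 1" "?I 3 3 0 2 0 = ?I 3 2 0 1 1"
  by (simp_all add: P eval_nat_numeral)
 ultimately show ?thesis by (auto dest!: integral_unique simp: algebra_simps)
qed

lemma prod_UNIV_3: "(\<Prod>i\<in>UNIV. f (i::3)) = f 1*f 2*(f 3 :: real)"
proof -
 have "(\<Prod>i\<in>{1,2,3::3}. f i) = f 1*f 2*f 3" by simp
 then show ?thesis unfolding UNIV_3 .
qed

lemma content_cell: assumes "l > 0" shows "measure lborel (Qb (cl l) 0) = 2*l^2"
proof -
 have "0 \<in> Qb (cl l) 0" using assms by (simp add: mem_Qb forall_3 cl_nth)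
 then have "cbox (- (cl l + vec 0)) (cl l + vec 0) \<noteq> {}" unfolding Qb_def by blast
 from content_cbox_cart[OF this] show ?thesis unfolding Qb_def prod_UNIV_3 by (simp add: cl_nth power2_eq_square)
qed

text \<open>Restrict to the box of half the size about the centre of the cutoff: each of the three
  profiles is at least \<open>(3/4)^4\<close>, the height is at least \<open>1/16\<close>, and the
  volume is \<open>l^2/8\<close>.\<close>

lemma cut_moment_lower:
 assumes l: "l > 0"
 shows "integral (Qb (cl l) 0) (%y. (y $ 3)^n*cellcut l 0 0 0 y) \<ge> (3/4)^12*(1/16)^n/8*l^2"
proof -
 let ?f = "%y::real^3. (y $ 3)^n*cellcut l 0 0 0 y"
 define a :: "real^3" where "a = vector [- l/2, - l/2, 1/16]"
 define b :: "real^3" where "b = vector [l/2, l/2, 3/16]"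
 have ab: "a $ 1 = - l/2" "a $ 2 = - l/2" "a $ 3 = 1/16" "b $ 1 = l/2" "b $ 2 = l/2" "b $ 3 = 3/16"
  by (simp_all add: a_def b_def)
 have c: "continuous_on S ?f" for S
  by (rule cont_UNIV_sub) (intro continuous_intros cut_cont)
 have sub: "cbox a b \<subseteq> Qb (cl l) 0"
  using l by (auto simp: mem_Qb mem_box_cart forall_3 ab cl_nth)
 have "a \<in> cbox a b" using l by (simp add: mem_box_cart forall_3 ab)
 then have "cbox a b \<noteq> {}" by blast
 from content_cbox_cart[OF this] have vol: "measure lborel (cbox a b) = l^2/8"
  unfolding prod_UNIV_3 by (simp add: ab power2_eq_square)
 have nn: "0 <= ?f y" for y
 proof (cases "y $ 3 \<ge> 0")
  case True
  then show ?thesis by (simp add: cellcut_def Xc_def Gc_def profile_nonneg)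
 next
  case False
  then have "Gc 0 (y $ 3) = 0" by (simp add: Gc_def profile_zero)
  then show ?thesis by (simp add: cellcut_def)
 qed
 have low: "(3/4)^12*(1/16)^n <= ?f y" if y: "y \<in> cbox a b" for y
 proof -
  have y': "\<bar>y $ 1\<bar> <= l/2" "\<bar>y $ 2\<bar> <= l/2" "1/16 <= y $ 3" "y $ 3 <= 3/16"
   using y by (auto simp: mem_box_cart forall_3 ab)
  have "\<bar>y $ 1/l\<bar> <= 1/2" "\<bar>y $ 2/l\<bar> <= 1/2"
   using y' l by (auto simp: field_simps)
  moreover have "\<bar>8*y $ 3 - 1\<bar> <= 1/2" unfolding abs_le_iff using y'(3,4) by linarith
  ultimately have p: "(3/4)^4 <= Xc l 0 (y $ 1)" "(3/4)^4 <= Xc l 0 (y $ 2)" "(3/4)^4 <= Gc 0 (y $ 3)"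
   using profile_lower by (simp_all add: Xc_def Gc_def)
  have "((3/4)^4*(3/4)^4)*(3/4)^4 <= cellcut l 0 0 0 y"
   unfolding cellcut_def by (intro mult_mono p mult_nonneg_nonneg order_trans[OF _ p(1)] order_trans[OF _ p(2)]) auto
  then have d: "(3/4)^12 <= cellcut l 0 0 0 y" by (simp add: power_add[symmetric])
  have e: "(1/16)^n <= (y $ 3)^n" using y'(3) by (intro power_mono) auto
  have "(1/16)^n*(3/4)^12 <= ?f y"
   by (intro mult_mono d e order_trans[OF _ e]) auto
  then show ?thesis by (simp add: mult.commute)
 qed
 have "(3/4)^12*(1/16)^n/8*l^2 = integral (cbox a b) (%y. (3/4)^12*(1/16)^n)"
  by (simp add: vol)
 also have "... <= integral (cbox a b) ?f"
  by (intro integral_le integrable_continuous c continuous_on_const low)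
 also have "... <= integral (Qb (cl l) 0) ?f"
  by (intro integral_subset_le sub integrable_continuous c ballI nn) (auto simp: Qb_def intro!: integrable_continuous c)
 finally show ?thesis .
qed

text \<open>Two integrations by parts across the thickness lower the exponent by two. The in-plane
  second derivatives in the \<open>3 3\<close> entry contribute nothing, as a power of the height
  does not depend on the other variables.\<close>

lemma stress_moment:
 assumes l: "l > 0"
 shows "integral (Qb (cl l) 0) (%y. (y $ 3)^Suc (Suc n)*(stress l p q r y \<bullet> mat 1))
  = (p + r)*(real (n + 2)*real (n + 1))*integral (Qb (cl l) 0) (%y. (y $ 3)^n*cellcut l 0 0 0 y)"
proof -
 let ?Q = "Qb (cl l) 0"
 let ?f = "%y::real^3. (y $ 3)^Suc (Suc n)" and ?f1 = "%y::real^3. real (n + 2)*(y $ 3)^Suc n"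
 let ?f2 = "%y::real^3. real (n + 2)*(real (n + 1)*(y $ 3)^n)"
 have g: "grad1 ?f (%y. ?f1 y*\<^sub>R axis 3 1)" "grad1 ?f1 (%y. ?f2 y*\<^sub>R axis 3 1)"
 proof -
  have d: "((%s. s^Suc k) has_real_derivative real (k + 1) * s^k) (at s)" for s :: real and k
   using DERIV_pow[of "Suc k" s] by simp
  show "grad1 ?f (%y. ?f1 y*\<^sub>R axis 3 1)"
   using grad1_real_comp[OF grad1_coord[of 3] d[of "Suc n"]] by (simp add: continuous_intros)
  show "grad1 ?f1 (%y. ?f2 y*\<^sub>R axis 3 1)"
   using grad1_cmult[OF grad1_real_comp[OF grad1_coord[of 3] d[of n]], of "real (n + 2)"] by (simp add: continuous_intros mult.assoc)
 qed
 let ?I = "%f i j k. integral ?Q (%y. f y*cellcut l i j k y)"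
 have "?I ?f 2 0 0 = 0" "?I ?f 1 1 0 = 0" "?I ?f 0 2 0 = 0"
  using cut_by_parts(1)[OF g(1) _ _ _ l, of 1 0 0] cut_by_parts(1)[OF g(1) _ _ _ l, of 0 1 0]
   cut_by_parts(2)[OF g(1) _ _ _ l, of 0 1 0] by (simp_all add: axis_def numeral_2_eq_2)
 note z = this
 have "?I ?f 0 0 2 = - ?I ?f1 0 0 1"
  using cut_by_parts(3)[OF g(1) _ _ _ l, of 0 0 1] by (simp add: axis_def numeral_2_eq_2)
 also have "... = ?I ?f2 0 0 0"
  using cut_by_parts(3)[OF g(2) _ _ _ l, of 0 0 0] by (simp add: axis_def)
 also have "... = integral ?Q (%y. (real (n + 2)*real (n + 1))*((y $ 3)^n*cellcut l 0 0 0 y))"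
  by (simp add: mult.assoc)
 also have "... = real (n + 2)*real (n + 1)*integral ?Q (%y. (y $ 3)^n*cellcut l 0 0 0 y)"
  by (rule integral_mult_right)
 finally have m: "?I ?f 0 0 2 = real (n + 2)*real (n + 1)*integral ?Q (%y. (y $ 3)^n*cellcut l 0 0 0 y)" .
 have h: "((%y. ?f y*cellcut l i j k y) has_integral ?I ?f i j k) ?Q" for i j k
  by (intro integrable_integral cont_integrable_Qb continuous_intros cut_cont)
 have "((%y. (p + r)*(?f y*cellcut l 0 0 2 y) + p*(?f y*cellcut l 2 0 0 y) + 2*q*(?f y*cellcut l 1 1 0 y) + r*(?f y*cellcut l 0 2 0 y))
  has_integral (p + r) * ?I ?f 0 0 2 + p * ?I ?f 2 0 0 + 2*q * ?I ?f 1 1 0 + r * ?I ?f 0 2 0) ?Q"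
  by (intro has_integral_add has_integral_mult_right h)
 moreover have "(%y. (p + r)*(?f y*cellcut l 0 0 2 y) + p*(?f y*cellcut l 2 0 0 y) + 2*q*(?f y*cellcut l 1 1 0 y) + r*(?f y*cellcut l 0 2 0 y))
  = (%y. ?f y*(stress l p q r y \<bullet> mat 1))"
  unfolding stress_inner by (rule ext) (simp add: mat_def algebra_simps)
 ultimately have "((%y. ?f y*(stress l p q r y \<bullet> mat 1)) has_integral (p + r) * ?I ?f 0 0 2 + p * ?I ?f 2 0 0 + 2*q * ?I ?f 1 1 0 + r * ?I ?f 0 2 0) ?Q"
  by simp
 from integral_unique[OF this] show ?thesis unfolding z m by (simp only: mult_zero_right add_0_right mult.assoc)
qed

text \<open>Bound for the second thickness derivative of the cutoff,
  \<open>56^3 * 8^2\<close>.\<close>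

definition kb :: real where "kb = 56^3*64"

text \<open>The moment of order \<open>n\<close> per unit of trace and of \<open>l^2\<close>: two
  powers brought down by integration by parts, times the bound of \<open>cut_moment_lower\<close>
  with exponent \<open>n - 2\<close>.\<close>

definition jn :: "nat => real" where
 "jn n = real n*real (n - 1)*((3/4)^12*(1/16)^(n - 2)/8)"

context admissible
begin

text \<open>Only the in-plane block is of order one, and it is a multiple of the functional bounded
  by \<open>Q\<close>. All other entries contain in-plane derivatives of a cutoff of width
  \<open>l\<close>, hence are \<open>O(1/l)\<close>, and they are estimated through
  coercivity.\<close>

lemma stress_dual:
 assumes c0: "c0 > 0" "!!E. c0*(norm (symm E))^2 <= B E E" and l: "l \<ge> 1"
  and Q: "!!E. (p*E $ 1 $ 1 + q*(E $ 1 $ 2 + E $ 2 $ 1) + r*E $ 2 $ 2)\<^sup>2 <= Q*B E E"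
 shows "(stress l p q r y \<bullet> E)^2 <= (2 * kb^2*Q + 50 * kb^2*(\<bar>p\<bar> + 2*\<bar>q\<bar> + \<bar>r\<bar>)^2/(l^2*c0))*B E E"
proof -
 define Th where "Th = \<bar>p\<bar> + 2*\<bar>q\<bar> + \<bar>r\<bar>"
 define s where "s = norm (symm E)"
 define d where "d = kb/l"
 have lp: "l > 0" using l by simp
 have kb: "kb > 0" by (simp add: kb_def)
 have d: "d > 0" using kb lp by (simp add: d_def)
 have ent: "\<bar>E $ i $ j + E $ j $ i\<bar> <= 2 * s" for i j
 proof -
  have "\<bar>symm E $ i $ j\<bar> <= s" unfolding s_def using component_le_norm_cart[of "symm E $ i" j] norm_row_le[of "symm E" i] by linarith
  moreover have "E $ i $ j + E $ j $ i = 2 * symm E $ i $ j" by (simp add: symm_def transpose_def)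
  ultimately show ?thesis by linarith
 qed
 have k2: "\<bar>cellcut l 0 0 2 y\<bar> <= kb" using cut_bound[of 0 0 2 l y] lp by (simp add: kb_def)
 have kl: "56^3*8/l <= d" "56^3/l^2 <= d"
 proof -
  show "56^3*8/l <= d" using lp by (simp add: d_def kb_def divide_right_mono)
  have "l <= l^2" using l by (simp add: power2_eq_square)
  then have "56^3/l^2 <= 56^3/l" using lp by (intro divide_left_mono) auto
  also have "... <= d" using lp by (simp add: d_def kb_def divide_right_mono)
  finally show "56^3/l^2 <= d" .
 qed
 have cs: "\<bar>cellcut l 1 0 1 y\<bar> <= d" "\<bar>cellcut l 0 1 1 y\<bar> <= d" "\<bar>cellcut l 2 0 0 y\<bar> <= d" "\<bar>cellcut l 1 1 0 y\<bar> <= d" "\<bar>cellcut l 0 2 0 y\<bar> <= d"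
  using cut_bound[of 1 0 1 l y] cut_bound[of 0 1 1 l y] cut_bound[of 2 0 0 l y] cut_bound[of 1 1 0 l y] cut_bound[of 0 2 0 l y] lp kl
  by (simp_all add: numeral_2_eq_2[symmetric])
 have lin: "\<bar>u*x\<bar> <= \<bar>u\<bar> * d" if "\<bar>x\<bar> <= d" for u x using that by (simp add: abs_mult mult_left_mono)
 have Thd: "Th * d = \<bar>p\<bar> * d + 2*(\<bar>q\<bar> * d) + \<bar>r\<bar> * d" by (simp add: Th_def algebra_simps)
 have nn: "0 <= \<bar>p\<bar> * d" "0 <= \<bar>q\<bar> * d" "0 <= \<bar>r\<bar> * d" using d by auto
 have r13: "\<bar>p*cellcut l 1 0 1 y + q*cellcut l 0 1 1 y\<bar> <= Th * d"
  using lin[OF cs(1), of p] lin[OF cs(2), of q] nn Thd by linarith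
 have r23: "\<bar>q*cellcut l 1 0 1 y + r*cellcut l 0 1 1 y\<bar> <= Th * d"
  using lin[OF cs(1), of q] lin[OF cs(2), of r] nn Thd by linarith
 have r33: "\<bar>p*cellcut l 2 0 0 y + 2*q*cellcut l 1 1 0 y + r*cellcut l 0 2 0 y\<bar> <= Th * d"
 proof -
  have "\<bar>2*q*cellcut l 1 1 0 y\<bar> <= \<bar>2*q\<bar> * d" by (rule lin[OF cs(4)])
  moreover have "Th * d = \<bar>p\<bar> * d + \<bar>2*q\<bar> * d + \<bar>r\<bar> * d" by (simp add: Th_def algebra_simps abs_mult)
  ultimately show ?thesis using lin[OF cs(3), of p] lin[OF cs(5), of r] by linarith
 qed
 define ta where "ta = p*E $ 1 $ 1 + q*(E $ 1 $ 2 + E $ 2 $ 1) + r*E $ 2 $ 2"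
 define x1 where "x1 = (p*cellcut l 1 0 1 y + q*cellcut l 0 1 1 y)*(E $ 1 $ 3 + E $ 3 $ 1)"
 define x2 where "x2 = (q*cellcut l 1 0 1 y + r*cellcut l 0 1 1 y)*(E $ 2 $ 3 + E $ 3 $ 2)"
 define x3 where "x3 = (p*cellcut l 2 0 0 y + 2*q*cellcut l 1 1 0 y + r*cellcut l 0 2 0 y)*E $ 3 $ 3"
 define rh where "rh = x3 - x1 - x2"
 have eq: "stress l p q r y \<bullet> E = cellcut l 0 0 2 y*ta + rh"
  unfolding stress_inner ta_def rh_def x1_def x2_def x3_def by (simp add: algebra_simps)
 have s0: "s \<ge> 0" by (simp add: s_def)
 have Td: "Th * d \<ge> 0" using d by (simp add: Th_def)
 \<comment> \<open>\<open>x3\<close> counts once, \<open>x1\<close> and \<open>x2\<close> twice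
   because off-diagonal strain entries occur in pairs; the 5 squared and doubled is the 50 of the
   claim.\<close>
 have rh: "\<bar>rh\<bar> <= 5*Th * d * s"
 proof -
  have mm: "\<bar>u * v\<bar> <= (Th * d)*(2 * s)" if "\<bar>u\<bar> <= Th * d" "\<bar>v\<bar> <= 2 * s" for u v
   unfolding abs_mult by (intro mult_mono that) (use Td in auto)
  have e3: "\<bar>E $ 3 $ 3\<bar> <= s" using ent[of 3 3] by simp
  have "\<bar>x3\<bar> <= (Th * d) * s"
   unfolding x3_def abs_mult by (intro mult_mono r33 e3) (use Td in auto)
  moreover have "\<bar>x1\<bar> <= (Th * d)*(2 * s)" unfolding x1_def by (rule mm[OF r13 ent])
  moreover have "\<bar>x2\<bar> <= (Th * d)*(2 * s)" unfolding x2_def by (rule mm[OF r23 ent])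
  moreover have "(Th * d)*(2 * s) = 2*((Th * d) * s)" "5*Th * d * s = 5*((Th * d) * s)" by simp_all
  ultimately show ?thesis unfolding rh_def by linarith
 qed
 have "(stress l p q r y \<bullet> E)^2 <= 2*(cellcut l 0 0 2 y*ta)^2 + 2*rh^2" unfolding eq by (rule sq_add_le)
 moreover have "(cellcut l 0 0 2 y*ta)^2 <= kb^2*(Q*B E E)"
  unfolding power_mult_distrib using k2 kb Q[of E]
  by (intro mult_mono) (auto simp: ta_def intro: sq_le_of_abs)
 moreover have "rh^2 <= 25 * kb^2*Th^2/(l^2*c0)*B E E"
 proof -
  have "rh^2 <= (5*Th * d * s)^2" using rh by (rule sq_le_of_abs[OF order_trans[OF _ abs_ge_self]])
  also have "... = 25 * kb^2*Th^2/(l^2*c0)*(c0 * s^2)" using c0(1) lp by (simp add: d_def power_mult_distrib power_divide)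
  also have "... <= 25 * kb^2*Th^2/(l^2*c0)*B E E"
   using c0 lp unfolding s_def by (intro mult_left_mono) auto
  finally show ?thesis .
 qed
 moreover define w where "w = kb^2*Th^2/(l^2*c0)*B E E"
 moreover have "25 * kb^2*Th^2/(l^2*c0)*B E E = 25*w" by (simp add: w_def)
 moreover have "(2 * kb^2*Q + 50 * kb^2*Th^2/(l^2*c0))*B E E = 2*(kb^2*(Q*B E E)) + 50*w"
  by (simp add: w_def ring_distribs mult_ac)
 ultimately show ?thesis unfolding Th_def[symmetric] by linarith
qed

text \<open>For large \<open>l\<close> the coercivity term is below the in-plane one, whence the
  factor 3. The coercivity constant of \<open>W\<close> thus disappears from the dual bound. The
  width \<open>l\<close> depends on \<open>W\<close>, but moment and cell area both scale like
  \<open>l^2\<close>.\<close>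

lemma stress_exists:
 "Q2 W (mat 1) > 0 \<and> (\<exists>l\<ge>1. \<exists>gs :: real^3 => real^3^3. continuous_on UNIV gs \<and>
  (\<forall>y E. (gs y \<bullet> E)\<^sup>2 <= 3 * kb^2*Q2 W (mat 1)*B E E) \<and>
  (\<forall>v V. gradM v V --> integral (Qb (cl l) 0) (%y. gs y \<bullet> V y) = 0) \<and>
  (\<forall>n\<ge>2. jn n*Q2 W (mat 1)*l^2 <= integral (Qb (cl l) 0) (%y. (y $ 3)^n*(gs y \<bullet> mat 1))))"
proof -
 obtain c0 p q r where lin': "c0 > 0" "\<forall>E. c0*(norm (symm E))^2 <= B E E" "p + r = Q2 W (mat 1)" "Q2 W (mat 1) > 0"
  "\<forall>E. (p*E $ 1 $ 1 + q*(E $ 1 $ 2 + E $ 2 $ 1) + r*E $ 2 $ 2)\<^sup>2 <= Q2 W (mat 1)*B E E"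
  using linearization by (elim exE conjE) (rule that)
 note lin = lin'(1) lin'(2)[rule_format] lin'(3,4) lin'(5)[rule_format]
 define Q where "Q = Q2 W (mat 1)"
 define Th where "Th = \<bar>p\<bar> + 2*\<bar>q\<bar> + \<bar>r\<bar>"
 \<comment> \<open>Since \<open>l >= 1\<close>, also \<open>l^2\<close> exceeds
   \<open>50*Th^2/(c0*Q)\<close>, which is what the comparison of the two terms requires.\<close>
 define l where "l = 1 + 50*Th^2/(c0*Q)"
 have Q: "Q > 0" using lin(4) by (simp add: Q_def)
 have l: "l \<ge> 1" using lin(1) Q by (simp add: l_def)
 have "50*Th^2/(c0*Q) <= l^2"
 proof -
  have "l <= l^2" using l by (simp add: power2_eq_square)
  then show ?thesis unfolding l_def by linarith
 qed
 then have "50*Th^2 <= l^2*(c0*Q)" using lin(1) Q by (simp add: pos_divide_le_eq)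
 then have small: "50*Th^2/(l^2*c0) <= Q" using lin(1) l by (simp add: pos_divide_le_eq mult_ac)
 have dual: "(stress l p q r y \<bullet> E)^2 <= 3 * kb^2*Q*B E E" for y E
 proof -
  have "(stress l p q r y \<bullet> E)^2 <= (2 * kb^2*Q + 50 * kb^2*Th^2/(l^2*c0))*B E E"
   unfolding Th_def Q_def by (rule stress_dual[OF lin(1,2) l lin(5)])
  also have "... <= (3 * kb^2*Q)*B E E"
  proof (intro mult_right_mono B_nonneg)
   have "kb^2*(50*Th^2/(l^2*c0)) <= kb^2*Q" by (intro mult_left_mono small) simp
   then show "2 * kb^2*Q + 50 * kb^2*Th^2/(l^2*c0) <= 3 * kb^2*Q" by (simp add: mult_ac)
  qed
  finally show ?thesis .
 qed
 have moment: "jn n*Q*l^2 <= integral (Qb (cl l) 0) (%y. (y $ 3)^n*(stress l p q r y \<bullet> mat 1))" if n: "n \<ge> 2" for n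
 proof -
  define m where "m = n - 2"
  have m: "n = Suc (Suc m)" using n by (simp add: m_def)
  have l0: "l > 0" using l by simp
  have "jn n*Q*l^2 = Q*(real (m + 2)*real (m + 1))*((3/4)^12*(1/16)^m/8*l^2)"
   by (simp add: jn_def m)
  also have "... <= Q*(real (m + 2)*real (m + 1))*integral (Qb (cl l) 0) (%y. (y $ 3)^m*cellcut l 0 0 0 y)"
   using Q by (intro mult_left_mono cut_moment_lower l0) auto
  also have "... = integral (Qb (cl l) 0) (%y. (y $ 3)^n*(stress l p q r y \<bullet> mat 1))"
   unfolding m stress_moment[OF l0] using lin(3) by (simp add: Q_def)
  finally show ?thesis .
 qed
 show ?thesis
 proof (intro conjI exI[of _ l] exI[of _ "stress l p q r"] allI impI)
  show "Q2 W (mat 1) > 0" "1 <= l" "continuous_on UNIV (stress l p q r)" by (rule lin(4) l stress_cont)+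
  show "integral (Qb (cl l) 0) (%y. stress l p q r y \<bullet> V y) = 0" if "gradM v V" for v V
   by (rule stress_orthogonal[OF that]) (use l in simp)
 qed (use dual moment in \<open>simp_all only: Q_def\<close>)
qed

end

section \<open>The energy of a cell\<close>

text \<open>Exchanges real error terms between the two sides of an estimate whose energy term
  \<open>w\<close> may be infinite.\<close>

lemma ennreal_shift:
 fixes w :: ennreal
 assumes "ennreal x <= w + ennreal y" "0 <= y" "0 <= z" "g - z <= x - y"
 shows "ennreal g <= w + ennreal z"
proof (cases w)
 case (real r)
 then have "x <= r + y" using assms(1,2) by (simp add: ennreal_plus[symmetric] del: ennreal_plus)
 then have "g <= r + z" using assms(4) by linarith
 then show ?thesis using real assms(3) by (simp add: ennreal_plus[symmetric] ennreal_leI del: ennreal_plus)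
qed simp

lemma twice_le_of_sq_le: fixes x p q :: real assumes "x^2 <= p*q" "0 <= p" "0 <= q" shows "2*x <= p + q"
proof -
 have "(2*x)^2 <= 4*(p*q)" using assms(1) by (simp add: power_mult_distrib)
 also have "... <= (p + q)^2" using zero_le_power2[of "p - q"] by (simp add: power2_eq_square algebra_simps)
 finally show ?thesis using assms(2,3) by (intro power2_le_imp_le[of "2*x"]) auto
qed

lemma abs_prod3_le: fixes x y z :: real
 assumes "\<bar>x\<bar> <= a" "\<bar>y\<bar> <= b" "\<bar>z\<bar> <= c" shows "\<bar>x*y*z\<bar> <= a*b*c"
proof -
 have "0 <= a" "0 <= b" using assms by linarith+
 then show ?thesis unfolding abs_mult by (intro mult_mono assms mult_nonneg_nonneg) auto
qed

text \<open>\<open>ennreal\<close> sends negative values to zero, so the right side integrates the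
  positive part of \<open>g\<close>, which dominates the signed integral.\<close>

lemma nn_integral_cbox_lower:
 fixes g :: "real^3 => real"
 assumes g: "continuous_on UNIV g"
 shows "ennreal (integral (cbox a b) g) <= (nnI (%x. ennreal (g x)*indicator (cbox a b) x))"
proof -
 have c: "continuous_on UNIV (%x. max 0 (g x))" by (intro continuous_intros g)
 have "integral (cbox a b) g <= integral (cbox a b) (%x. max 0 (g x))"
  by (intro integral_le integrable_continuous cont_UNIV_sub[OF g] cont_UNIV_sub[OF c]) auto
 then have "ennreal (integral (cbox a b) g) <= ennreal (integral (cbox a b) (%x. max 0 (g x)))" by (rule ennreal_leI)
 also have "... = (nnI (%x. ennreal (max 0 (g x))*indicator (cbox a b) x))"
  by (rule nn_integral_cbox_continuous[OF c, symmetric]) simp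
 also have "(%x. ennreal (max 0 (g x))) = (%x. ennreal (g x))" by (rule ext) (auto simp: max_def ennreal_neg)
 finally show ?thesis by (simp add: fun_eq_iff)
qed

lemma norm_le_infdist_SO3: "norm V <= infdist V SO3 + 2"
proof -
 obtain S where S: "S \<in> SO3" "infdist V SO3 = norm (V - S)" by (rule SO3_nearest)
 show ?thesis using norm_triangle_sub[of V S] norm_SO3(2)[OF S(1)] S(2) by linarith
qed

text \<open>Passes from the rescaled true gradient \<open>D\<close> to its smooth approximation
  \<open>V\<close>. The rescaling error contains the norm of \<open>V\<close> and hence its distance
  to \<open>SO3\<close>; because of \<open>dl <= 1/2\<close> this part is absorbed on the
  left.\<close>

lemma infdist_SO3_sq_perturb:
 assumes f: "\<bar>f - 1\<bar> <= dl" "dl <= 1/2"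
 shows "(infdist V SO3)^2 <= 12*(infdist (f*\<^sub>R D) SO3)^2 + 48*(norm (V - D))^2 + 48*dl^2"
proof -
 define x where "x = infdist V SO3"
 define d where "d = infdist (f*\<^sub>R D) SO3"
 define nd where "nd = norm (V - D)"
 have x0: "0 <= x" "0 <= d" "0 <= nd" "0 <= dl" using f(1) by (auto simp: x_def d_def nd_def infdist_nonneg)
 have "V - f*\<^sub>R D = f*\<^sub>R (V - D) + (1 - f)*\<^sub>R V" by (simp add: algebra_simps)
 then have "norm (V - f*\<^sub>R D) <= \<bar>f\<bar> * nd + \<bar>1 - f\<bar> * norm V"
  using norm_triangle_ineq[of "f*\<^sub>R (V - D)" "(1 - f)*\<^sub>R V"] by (simp add: nd_def)
 also have "... <= 2*nd + dl * (x + 2)"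
  using f x0 norm_le_infdist_SO3[of V] by (intro add_mono mult_mono) (auto simp: x_def)
 also have "dl * (x + 2) <= x/2 + 2*dl" using mult_right_mono[OF f(2) x0(1)] by (simp add: algebra_simps)
 finally have "x <= d + (2*nd + (x/2 + 2*dl))"
  using infdist_SO3_diff[of V "f*\<^sub>R D"] by (simp add: x_def d_def)
 then have "x <= 2*d + (4*nd + 4*dl)" by simp
 then have "x^2 <= (2*d + (4*nd + 4*dl))^2" using x0 by (intro power_mono) auto
 also have "... <= 12*d^2 + 48*nd^2 + 48*dl^2"
 proof -
  have "0 <= (2*d - 4*nd)^2 + (2*d - 4*dl)^2 + (4*nd - 4*dl)^2" by simp
  then show ?thesis by (simp add: power2_eq_square algebra_simps)
 qed
 finally show ?thesis unfolding x_def d_def nd_def .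
qed

context admissible
begin

text \<open>Young's inequality between the linear functional \<open>s\<close> and the form it is
  dual to, with the Taylor estimate replacing \<open>B E E/2\<close> by the density near the
  identity. For \<open>norm E >= cka\<close> the linear term is itself at most a multiple of
  \<open>(norm E)\<^sup>2\<close>, so large and infinite values of \<open>W\<close> are covered by
  the same formula.\<close>

lemma pointwise_lower:
 assumes T: "!!F. norm F < cka ==> mat 1 + F \<in> U \<and> \<bar>Wr (mat 1 + F) - B F F/2\<bar> <= et * (norm F)^2"
  and pos: "cka > 0" "et \<ge> 0" "S \<ge> 0" and s: "norm s <= M" "!!E. (s \<bullet> E)\<^sup>2 <= S*B E E"
 shows "ennreal (c*(s \<bullet> E) - c^2*S/2) <= W (mat 1 + E) + ennreal ((et + \<bar>c\<bar> * M/cka)*(norm E)^2)"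
proof -
 have M: "M \<ge> 0" using s(1) norm_ge_zero[of s] by linarith
 define y where "y = \<bar>c\<bar> * M/cka * (norm E)^2"
 have y: "y \<ge> 0" using M pos by (simp add: y_def)
 have sp: "(et + \<bar>c\<bar> * M/cka)*(norm E)^2 = et * (norm E)^2 + y" by (simp add: y_def algebra_simps)
 have nn: "0 <= et * (norm E)^2" using pos by simp
 show ?thesis
 proof (cases "norm E < cka")
  case True
  note t = T[OF True]
  have "(c*(s \<bullet> E))^2 <= (c^2*S)*B E E" unfolding power_mult_distrib using s(2)[of E] by (simp add: mult.assoc mult_left_mono)
  then have "2*(c*(s \<bullet> E)) <= c^2*S + B E E" by (rule twice_le_of_sq_le) (use pos B_nonneg in auto)
  then have "c*(s \<bullet> E) - c^2*S/2 <= Wr (mat 1 + E) + (et * (norm E)^2 + y)" using t y unfolding abs_le_iff by linarith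
  then show ?thesis unfolding sp using t Wr_nonneg[of "mat 1 + E"] nn y
   by (simp add: W_Wr ennreal_plus[symmetric] ennreal_leI del: ennreal_plus)
 next
  case False
  then have "1 <= norm E/cka" using pos by simp
  then have "\<bar>c\<bar> * M*norm E*1 <= \<bar>c\<bar> * M*norm E*(norm E/cka)" using M by (intro mult_left_mono) auto
  also have "... = y" by (simp add: y_def power2_eq_square)
  finally have "\<bar>c\<bar> * M*norm E <= y" by simp
  moreover have "c*(s \<bullet> E) <= \<bar>c\<bar> * (M*norm E)"
  proof -
   have "\<bar>s \<bullet> E\<bar> <= M*norm E" using Cauchy_Schwarz_ineq2[of s E] mult_right_mono[OF s(1) norm_ge_zero[of E]] by linarith
   then have "\<bar>c*(s \<bullet> E)\<bar> <= \<bar>c\<bar> * (M*norm E)" unfolding abs_mult by (intro mult_left_mono) auto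
   then show ?thesis by linarith
  qed
  moreover have "0 <= c^2*S/2" using pos by simp
  ultimately have "c*(s \<bullet> E) - c^2*S/2 <= et * (norm E)^2 + y" using nn by (simp add: mult.assoc)
  then have "ennreal (c*(s \<bullet> E) - c^2*S/2) <= ennreal (et * (norm E)^2 + y)" by (rule ennreal_leI)
  also have "... <= W (mat 1 + E) + ennreal (et * (norm E)^2 + y)" by simp
  finally show ?thesis unfolding sp .
 qed
qed

text \<open>\<open>E\<close> is the deviation of the rescaled true gradient from the rotation,
  \<open>A\<close> that of its smooth approximation. Expanding \<open>E\<close> leaves the linear
  term in \<open>A\<close>, which will integrate to zero, the incompatible part with factor
  \<open>a*eps * z\<close>, and errors that are quadratic in \<open>A\<close>, carry
  \<open>eps\<^sup>2\<close> with a constant to be balanced, or are multiples of the squared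
  approximation error.\<close>

lemma cell_pointwise:
 fixes V D :: "real^3^3"
 assumes T: "!!F. norm F < cka ==> mat 1 + F \<in> U \<and> \<bar>Wr (mat 1 + F) - B F F/2\<bar> <= et * (norm F)^2"
  and pos: "cka > 0" "et \<ge> 0" "S \<ge> 0" and s: "norm s <= M" "!!E. (s \<bullet> E)\<^sup>2 <= S*B E E"
  and R: "R \<in> SO3" and eps: "eps > 0" and k: "k*eps <= 1" "\<bar>f - 1\<bar> <= k*eps" and f: "\<bar>f - 1 + a*eps * z\<bar> <= rh * eps"
  and A: "A = transpose R ** V - mat 1" and wm: "wm = et + eps * \<bar>mue\<bar> * M/cka"
 shows "ennreal (eps * mue * (s \<bullet> A) - eps^2*mue * a*(z*(s \<bullet> mat 1)) - (12*wm + \<bar>mue\<bar> * M * k*eps)*(norm A)^2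
   - eps\<^sup>2*(12*wm * k^2 + 2*\<bar>mue\<bar> * rh * M + \<bar>mue\<bar> * M * k*eps + \<bar>mue\<bar> * M*eps + mue^2*S/2))
  <= W (f*\<^sub>R D) + ennreal ((12*wm + \<bar>mue\<bar> * M/eps)*(norm (V - D))^2)"
proof -
 define E where "E = f*\<^sub>R (transpose R ** D) - mat 1"
 define Z where "Z = transpose R ** (D - V)"
 define nA where "nA = norm A"
 define nd where "nd = norm (V - D)"
 define m where "m = \<bar>mue\<bar>"
 have M: "M \<ge> 0" using s(1) norm_ge_zero[of s] by linarith
 have m: "m \<ge> 0" by (simp add: m_def)
 have wm0: "wm \<ge> 0" unfolding wm using pos M eps by simp
 have k0: "k*eps \<ge> 0" using k(2) by linarith
 then have kk: "k \<ge> 0" using eps by (simp add: zero_le_mult_iff)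
 have fb: "\<bar>f\<bar> <= 2" using k by linarith
 have ndZ: "norm Z = nd" unfolding Z_def nd_def norm_SO3_mult[OF SO3_transpose[OF R]] by (rule norm_minus_commute)
 have sc: "transpose R ** (f*\<^sub>R D) = f*\<^sub>R (transpose R ** D)"
  using bounded_linear_matrix_mult[of "transpose R"] by (simp add: linear_cmul bounded_linear.linear)
 have WD: "W (f*\<^sub>R D) = W (mat 1 + E)"
 proof -
  have "W (transpose R ** (f*\<^sub>R D)) = W (f*\<^sub>R D)"
   using adm SO3_transpose[OF R] by (simp add: admissible_density_def)
  then show ?thesis by (simp add: sc E_def)
 qed
 have Eeq: "E = A + (f - 1)*\<^sub>R A + (f - 1)*\<^sub>R mat 1 + f*\<^sub>R Z"
  by (simp add: E_def A Z_def matrix_diff_mult algebra_simps)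
 have inner: "s \<bullet> E = s \<bullet> A + (f - 1)*(s \<bullet> A) + (f - 1)*(s \<bullet> mat 1) + f*(s \<bullet> Z)"
  unfolding Eeq by (simp add: inner_add_right)
 have CS: "\<bar>s \<bullet> X\<bar> <= M*norm X" for X
  using Cauchy_Schwarz_ineq2[of s X] mult_right_mono[OF s(1) norm_ge_zero[of X]] by linarith
 have s1: "\<bar>s \<bullet> mat 1\<bar> <= M*2" using CS[of "mat 1"] mult_left_mono[OF norm_SO3(2)[OF mat1_SO3] M] by linarith
 have c: "\<bar>eps * mue\<bar> <= eps * m" using eps by (simp add: m_def abs_mult)
 have b1: "\<bar>eps * mue * (f - 1)*(s \<bullet> A)\<bar> <= eps * m*(k*eps)*(M*nA)"
  unfolding nA_def by (rule abs_prod3_le[OF c k(2) CS])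
 have b2: "\<bar>eps * mue * (f - 1 + a*eps * z)*(s \<bullet> mat 1)\<bar> <= eps * m*(rh * eps)*(M*2)"
  by (rule abs_prod3_le[OF c f s1])
 have b3: "\<bar>eps * mue * f*(s \<bullet> Z)\<bar> <= eps * m*2*(M*nd)"
  by (rule abs_prod3_le[OF c fb]) (use CS[of Z] ndZ in simp)
 have expand: "eps * mue * (s \<bullet> E) = eps * mue * (s \<bullet> A) + eps * mue * (f - 1)*(s \<bullet> A)
   + (eps * mue * (f - 1 + a*eps * z)*(s \<bullet> mat 1) - eps^2*mue * a*(z*(s \<bullet> mat 1))) + eps * mue * f*(s \<bullet> Z)"
  unfolding inner by (simp add: algebra_simps power2_eq_square)
 have y1: "eps * m*(k*eps)*(M*nA) <= m*M * k*eps ^ 3 + m*M * k*(eps * nA^2)"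
 proof -
  have "0 <= eps * nA" using eps by (simp add: nA_def)
  moreover have "2*(eps * nA) <= eps^2 + nA^2" using zero_le_power2[of "eps - nA"] by (simp add: power2_diff)
  ultimately have "eps * nA <= eps^2 + nA^2" by linarith
  then have "(m*M * k*eps)*(eps * nA) <= (m*M * k*eps)*(eps^2 + nA^2)" using m M kk eps by (intro mult_left_mono) auto
  then show ?thesis by (simp add: power2_eq_square power3_eq_cube algebra_simps)
 qed
 \<comment> \<open>Weighted so that both terms end up of order \<open>eps ^ 3\<close>: the square of
   \<open>nd\<close> will integrate to at most \<open>eps ^ 4\<close>.\<close>
 have y2: "eps * m*2*(M*nd) <= m*M*eps ^ 3 + m*M*(nd^2/eps)"
 proof -
  have "0 <= (eps^2 - nd)^2/eps" using eps by simp
  also have "(eps^2 - nd)^2/eps = eps ^ 3 + nd^2/eps - 2*eps * nd"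
   using eps by (simp add: power2_diff diff_divide_distrib add_divide_distrib) (simp add: eval_nat_numeral)
  finally have "2*eps * nd <= eps ^ 3 + nd^2/eps" by simp
  then have "(m*M)*(2*eps * nd) <= (m*M)*(eps ^ 3 + nd^2/eps)" using m M by (intro mult_left_mono) auto
  then show ?thesis by (simp add: ring_distribs mult_ac)
 qed
 have nE: "(norm E)^2 <= 12*nA^2 + 12*(k^2*eps^2) + 12*nd^2"
 proof -
  have E2: "E = f*\<^sub>R A + (f - 1)*\<^sub>R mat 1 + f*\<^sub>R Z" unfolding Eeq by (simp add: algebra_simps)
  have "norm E <= norm (f*\<^sub>R A) + norm ((f - 1)*\<^sub>R (mat 1 :: real^3^3)) + norm (f*\<^sub>R Z)"
   unfolding E2 using norm_triangle_ineq[of "f*\<^sub>R A + (f - 1)*\<^sub>R mat 1" "f*\<^sub>R Z"] norm_triangle_ineq[of "f*\<^sub>R A" "(f - 1)*\<^sub>R mat 1"] by linarith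
  also have "... = \<bar>f\<bar> * nA + \<bar>f - 1\<bar> * norm (mat 1 :: real^3^3) + \<bar>f\<bar> * nd" by (simp add: nA_def ndZ)
  also have "... <= 2*nA + (k*eps)*2 + 2*nd"
   by (intro add_mono mult_mono fb k norm_SO3(2) mat1_SO3 k0) (auto simp: nA_def nd_def)
  finally have "(norm E)^2 <= (2*nA + (k*eps)*2 + 2*nd)^2" by (intro power_mono) auto
  also have "... <= 12*nA^2 + 12*(k*eps)^2 + 12*nd^2"
  proof -
   define x where "x = k*eps"
   have "0 <= (2*nA - 2*x)^2 + (2*nA - 2*nd)^2 + (2*x - 2*nd)^2" by simp
   then show ?thesis unfolding x_def[symmetric] by (simp add: power2_eq_square algebra_simps)
  qed
  finally show ?thesis by (simp add: power_mult_distrib)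
 qed
 have wE: "wm * (norm E)^2 <= 12*(wm * nA^2) + 12*(wm * (k^2*eps^2)) + 12*(wm * nd^2)"
  using mult_left_mono[OF nE wm0] by (simp add: ring_distribs mult_ac)
 have wm': "wm = et + \<bar>eps * mue\<bar> * M/cka" unfolding wm using eps by (simp add: abs_mult)
 have low: "ennreal (eps * mue * (s \<bullet> E) - (eps * mue)^2*S/2) <= W (f*\<^sub>R D) + ennreal (wm * (norm E)^2)"
  unfolding WD wm' by (rule pointwise_lower[OF T pos s])
 have C0: "0 <= (12*wm + m*M/eps)*nd^2" using wm0 m M eps by simp
 have e1: "(12*wm + m*M * k*eps)*nA^2 = 12*(wm * nA^2) + m*M * k*(eps * nA^2)" by (simp add: algebra_simps)
 have e2: "eps^2*(12*wm * k^2 + 2*m*rh * M + m*M * k*eps + m*M*eps + mue^2*S/2)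
  = 12*(wm * (k^2*eps^2)) + eps * m*(rh * eps)*(M*2) + m*M * k*eps ^ 3 + m*M*eps ^ 3 + (eps * mue)^2*S/2"
  by (simp add: ring_distribs power2_eq_square power3_eq_cube mult_ac)
 have e3: "(12*wm + m*M/eps)*nd^2 = 12*(wm * nd^2) + m*M*(nd^2/eps)" by (simp add: ring_distribs)
 show ?thesis
  unfolding m_def[symmetric] nA_def[symmetric] nd_def[symmetric]
 proof (rule ennreal_shift[OF low _ C0])
  show "0 <= wm * (norm E)^2" using wm0 by simp
  show "eps * mue * (s \<bullet> A) - eps^2*mue * a*(z*(s \<bullet> mat 1)) - (12*wm + m*M * k*eps)*nA^2
   - eps\<^sup>2*(12*wm * k^2 + 2*m*rh * M + m*M * k*eps + m*M*eps + mue^2*S/2) - (12*wm + m*M/eps)*nd^2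
   <= eps * mue * (s \<bullet> E) - (eps * mue)^2*S/2 - wm * (norm E)^2"
   unfolding e1 e2 e3 expand using b1[unfolded abs_le_iff] b2[unfolded abs_le_iff] b3[unfolded abs_le_iff] y1 y2 wE by linarith
 qed
qed

lemma W_measurable [measurable]: "W \<in> borel_measurable borel"
 using adm by (simp add: admissible_density_def)

text \<open>The density dominates the squared distance to \<open>SO3\<close>; an energy of order
  \<open>eps^2\<close> therefore bounds this distance for \<open>V\<close> in mean square, once the
  metric factor and the approximation error, both of order at most \<open>eps\<close>, are removed.
  The larger box provides the margin for interior rigidity.\<close>

lemma cell_rigidity:
 assumes l: "l \<ge> 1" and K: "K \<ge> 0" and k: "k \<ge> 0"
 shows "\<exists>C\<ge>0. \<exists>eps1>0. \<forall>eps f D v V. 0 < eps --> eps <= eps1 --> f \<in> borel_measurable borel --> D \<in> borel_measurable borel --> gradM v V -->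
  (\<forall>t. \<bar>t\<bar> <= 1/2 --> \<bar>f t - 1\<bar> <= k*eps) -->
  (nnI (%y. ennreal ((norm (V y - D y))^2)*indicator (Qb (cl l) (1/8)) y)) <= ennreal (eps ^ 4) -->
  (nnI (%y. W (f (y $ 3)*\<^sub>R D y)*indicator (Qb (cl l) (1/8)) y)) <= ennreal (K*eps^2) -->
  (\<exists>R\<in>SO3. n2 (cl l) 0 (%y. V y - R) <= C*eps^2)"
proof -
 let ?Q = "Qb (cl l) (1/8)"
 have cl0: "cl l $ i > 0" for i
 proof -
  have "i = 1 \<or> i = 2 \<or> i = 3" using exhaust_3 by blast
  then show ?thesis using l by (auto simp: cl_nth)
 qed
 \<comment> \<open>Interior rigidity uses the margin \<open>16*r\<close>, and
   \<open>16*(1/128)\<close> is the margin \<open>1/8\<close> of the cell.\<close>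
 have r128: "(0::real) < 1/128" by simp
 obtain C e0 where C: "C \<ge> 0" "e0 > 0" and rig: "\<forall>v F e. gradM v F --> 0 < e --> e <= e0 --> n2 (cl l) (16*(1/128)) (%x. infdist (F x) SO3) <= e^2 -->
  (\<exists>R\<in>SO3. n2 (cl l) 0 (%x. F x - R) <= C*e^2)"
  using interior_rigidity[OF cl0 r128] by (elim exE conjE) (rule that)
 have "\<exists>c>0. \<forall>F. W F \<ge> ennreal (c*(infdist F SO3)^2)" using adm by (simp only: admissible_density_def)
 then obtain c where c: "c > 0" "!!F. W F \<ge> ennreal (c*(infdist F SO3)^2)" by blast
 define vol where "vol = measure lborel ?Q"
 define H where "H = 12*K/c + 48 + 48 * k^2 * vol"
 have vol: "vol \<ge> 0" by (simp add: vol_def)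
 have H: "H > 0" using K c(1) vol by (simp add: H_def add_nonneg_pos add_pos_nonneg)
 define eps1 where "eps1 = min 1 (min (e0/sqrt H) (1/(2 * k + 1)))"
 have eps1: "eps1 > 0" using C(2) H k by (simp add: eps1_def add_nonneg_pos)
 have "\<exists>R\<in>SO3. n2 (cl l) 0 (%y. V y - R) <= C*H*eps^2"
  if eps: "0 < eps" "eps <= eps1" and f[measurable]: "f \<in> borel_measurable borel" and D[measurable]: "D \<in> borel_measurable borel" and V: "gradM v V"
   and fk: "\<forall>t. \<bar>t\<bar> <= 1/2 --> \<bar>f t - 1\<bar> <= k*eps"
   and VD: "(nnI (%y. ennreal ((norm (V y - D y))^2)*indicator ?Q y)) <= ennreal (eps ^ 4)"
   and WK: "(nnI (%y. W (f (y $ 3)*\<^sub>R D y)*indicator ?Q y)) <= ennreal (K*eps^2)" for eps f D v V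
 proof -
  have eps': "eps <= 1" "eps <= e0/sqrt H" "eps <= 1/(2 * k + 1)" using eps(2) by (auto simp: eps1_def)
  have "eps * (2 * k + 1) <= 1" using eps'(3) k by (simp add: field_simps)
  then have keps: "k*eps <= 1/2" using eps(1) by (simp add: algebra_simps)
  have cV: "continuous_on UNIV V" by (rule gradM_cont[OF V])
  have [measurable]: "V \<in> borel_measurable borel" by (rule borel_measurable_continuous_onI[OF cV])
  have [measurable]: "(%y::real^3. y $ 3) \<in> borel_measurable borel" by (intro borel_measurable_continuous_onI continuous_intros)
  have [measurable]: "(%y::real^3. f (y $ 3)) \<in> borel_measurable borel" by (rule measurable_compose[OF _ f]) measurable
  have [measurable]: "?Q \<in> sets borel" by (simp add: Qb_def)
  have cI: "continuous_on UNIV (%y. infdist (V y) SO3)" by (intro continuous_intros cV)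
  have pt: "ennreal ((infdist (V y) SO3)^2)*indicator ?Q y
    <= ennreal (12/c)*(W (f (y $ 3)*\<^sub>R D y)*indicator ?Q y) + ennreal 48*(ennreal ((norm (V y - D y))^2)*indicator ?Q y)
     + ennreal (48*(k*eps)^2)*indicator ?Q y" for y
  proof (cases "y \<in> ?Q")
   case True
   then have "\<bar>y $ 3\<bar> <= 1/2" unfolding mem_Qb by (drule_tac spec[of _ 3]) (simp add: cl_nth)
   then have fy: "\<bar>f (y $ 3) - 1\<bar> <= k*eps" using fk by blast
   define d where "d = infdist (f (y $ 3)*\<^sub>R D y) SO3"
   have "ennreal ((infdist (V y) SO3)^2) <= ennreal (12/c*(c*d^2) + 48*(norm (V y - D y))^2 + 48*(k*eps)^2)"
    using infdist_SO3_sq_perturb[OF fy keps, of "V y" "D y"] c(1) by (intro ennreal_leI) (simp add: d_def)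
   also have "... = ennreal (12/c)*ennreal (c*d^2) + ennreal 48*ennreal ((norm (V y - D y))^2) + ennreal (48*(k*eps)^2)"
    using c(1) by (simp only: ennreal_plus ennreal_mult mult_nonneg_nonneg add_nonneg_nonneg zero_le_power2 divide_nonneg_nonneg less_imp_le zero_le_numeral norm_ge_zero)
   also have "... <= ennreal (12/c)*W (f (y $ 3)*\<^sub>R D y) + ennreal 48*ennreal ((norm (V y - D y))^2) + ennreal (48*(k*eps)^2)"
    unfolding d_def by (intro add_mono mult_left_mono c(2)) auto
   finally show ?thesis using True by simp
  qed simp
  have "ennreal (n2 (cl l) (1/8) (%y. infdist (V y) SO3)) = (nnI (%y. ennreal ((infdist (V y) SO3)^2)*indicator ?Q y))"
   unfolding n2_def Qb_def using nn_integral_cbox_continuous[OF continuous_on_power[OF cI, of 2]] by (simp add: infdist_nonneg)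
  also have "... <= (nnI (%y. ennreal (12/c)*(W (f (y $ 3)*\<^sub>R D y)*indicator ?Q y) + ennreal 48*(ennreal ((norm (V y - D y))^2)*indicator ?Q y)
     + ennreal (48*(k*eps)^2)*indicator ?Q y))"
   by (rule nn_integral_mono) (rule pt)
  also have "... = (nnI (%y. ennreal (12/c)*(W (f (y $ 3)*\<^sub>R D y)*indicator ?Q y) + ennreal 48*(ennreal ((norm (V y - D y))^2)*indicator ?Q y)))
     + (nnI (%y. ennreal (48*(k*eps)^2)*indicator ?Q y))"
   by (rule nn_integral_add) measurable
  also have "(nnI (%y. ennreal (12/c)*(W (f (y $ 3)*\<^sub>R D y)*indicator ?Q y) + ennreal 48*(ennreal ((norm (V y - D y))^2)*indicator ?Q y)))
    = (nnI (%y. ennreal (12/c)*(W (f (y $ 3)*\<^sub>R D y)*indicator ?Q y))) + (nnI (%y. ennreal 48*(ennreal ((norm (V y - D y))^2)*indicator ?Q y)))"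
   by (rule nn_integral_add) measurable
  also have "(nnI (%y. ennreal (12/c)*(W (f (y $ 3)*\<^sub>R D y)*indicator ?Q y))) = ennreal (12/c)*(nnI (%y. W (f (y $ 3)*\<^sub>R D y)*indicator ?Q y))"
   by (rule nn_integral_cmult) measurable
  also have "(nnI (%y. ennreal 48*(ennreal ((norm (V y - D y))^2)*indicator ?Q y))) = ennreal 48*(nnI (%y. ennreal ((norm (V y - D y))^2)*indicator ?Q y))"
   by (rule nn_integral_cmult) measurable
  also have "(nnI (%y. ennreal (48*(k*eps)^2)*indicator ?Q y)) = ennreal (48*(k*eps)^2)*ennreal vol"
  proof -
   have "emeasure lborel ?Q = ennreal vol"
    unfolding vol_def Qb_def by (rule emeasure_eq_ennreal_measure) (use emeasure_lborel_cbox_finite in \<open>simp add: less_top\<close>)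
   moreover have "(nnI (%y. ennreal (48*(k*eps)^2)*indicator ?Q y)) = ennreal (48*(k*eps)^2)*emeasure lborel ?Q"
    by (rule nn_integral_cmult_indicator) simp
   ultimately show ?thesis by simp
  qed
  also have "ennreal (12/c)*(nnI (%y. W (f (y $ 3)*\<^sub>R D y)*indicator ?Q y)) + ennreal 48*(nnI (%y. ennreal ((norm (V y - D y))^2)*indicator ?Q y))
    + ennreal (48*(k*eps)^2)*ennreal vol
    <= ennreal (12/c)*ennreal (K*eps^2) + ennreal 48*ennreal (eps ^ 4) + ennreal (48*(k*eps)^2)*ennreal vol"
   by (intro add_mono mult_left_mono WK VD order_refl) auto
  also have "... = ennreal (12/c*(K*eps^2) + 48*eps ^ 4 + 48*(k*eps)^2 * vol)"
  proof -
   have "0 <= 12/c" "0 <= K*eps^2" "0 <= eps ^ 4" "0 <= 48*(k*eps)^2" using c(1) K eps(1) by auto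
   then show ?thesis using vol by (simp only: ennreal_plus ennreal_mult mult_nonneg_nonneg add_nonneg_nonneg zero_le_numeral)
  qed
  finally have "n2 (cl l) (1/8) (%y. infdist (V y) SO3) <= 12/c*(K*eps^2) + 48*eps ^ 4 + 48*(k*eps)^2 * vol"
   using c(1) K vol by (subst (asm) ennreal_le_iff) auto
  also have "... <= H*eps^2"
  proof -
   have "eps ^ 4 <= eps^2" using eps(1) eps'(1) by (intro power_decreasing) auto
   moreover have "12/c*(K*eps^2) + 48*eps^2 + 48*(k*eps)^2 * vol = H*eps^2" by (simp add: H_def algebra_simps power_mult_distrib)
   ultimately show ?thesis by linarith
  qed
  also have "... = (sqrt H*eps)^2" using H by (simp add: power_mult_distrib)
  finally have n2: "n2 (cl l) (16*(1/128)) (%y. infdist (V y) SO3) <= (sqrt H*eps)^2" by simp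
  have "0 < sqrt H*eps" "sqrt H*eps <= e0" using H eps(1) eps'(2) by (simp_all add: field_simps)
  from rig[rule_format, OF V this n2] have "\<exists>R\<in>SO3. n2 (cl l) 0 (%x. V x - R) <= C*(sqrt H*eps)^2" .
  then show ?thesis using H by (simp add: power_mult_distrib mult.assoc)
 qed
 then show ?thesis using C(1) H eps1 by (intro exI[of _ "C*H"] exI[of _ eps1] conjI allI impI) auto
qed


text \<open>The order of choices avoids circularity: \<open>Z\<close> depends only on the data, the
  rigidity constant \<open>C1\<close> on \<open>Z\<close> and \<open>k\<close>, the Taylor accuracy
  \<open>et\<close> on \<open>C1\<close>, then \<open>cka\<close> and \<open>rh\<close>, and
  \<open>eps0\<close> last. Of the gain \<open>Z\<close> at most one half is lost to errors.\<close>

theorem cell_bound: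
 assumes n: "n \<ge> 2" and a: "a \<noteq> 0"
 shows "\<exists>l\<ge>1. \<exists>rh>0. \<exists>eps0>0. \<forall>eps f D v V. 0 < eps --> eps <= eps0 --> f \<in> borel_measurable borel --> D \<in> borel_measurable borel --> gradM v V -->
  (\<forall>t. \<bar>t\<bar> <= 1/2 --> \<bar>f t - 1 + a*eps * t^n\<bar> <= rh * eps) -->
  (nnI (%y. ennreal ((norm (V y - D y))^2)*indicator (Qb (cl l) (1/8)) y)) <= ennreal (eps ^ 4) -->
  ennreal ((jn n)^2/(24 * kb^2)*a^2*Q2 W (mat 1)*l^2*eps^2)
   <= (nnI (%y. W (f (y $ 3)*\<^sub>R D y)*indicator (Qb (cl l) (1/8)) y))"
proof -
 define Q where "Q = Q2 W (mat 1)"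
 obtain l gs where Q: "Q > 0" and l: "l \<ge> 1" and gs: "continuous_on UNIV gs"
  and dual': "\<forall>y E. (gs y \<bullet> E)\<^sup>2 <= 3 * kb^2*Q*B E E"
  and orth': "\<forall>v V. gradM v V --> integral (Qb (cl l) 0) (%y. gs y \<bullet> V y) = 0"
  and mom': "\<forall>n\<ge>2. jn n*Q*l^2 <= integral (Qb (cl l) 0) (%y. (y $ 3)^n*(gs y \<bullet> mat 1))"
  using stress_exists unfolding Q_def[symmetric] by (elim exE conjE) (rule that)
 note dual = dual'[rule_format] and orth = orth'[rule_format] and mom = mom'[rule_format, OF n]
 let ?Qin = "Qb (cl l) 0" and ?Q = "Qb (cl l) (1/8)"
 have lp: "l > 0" using l by simp
 have kb: "kb > 0" by (simp add: kb_def)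
 have jn: "jn n > 0" using n by (simp add: jn_def)
 define vol where "vol = 2*l^2"
 have vol: "vol > 0" using lp by (simp add: vol_def)
 define Z where "Z = (jn n)^2/(12 * kb^2)*a^2*Q*l^2"
 have Z: "Z > 0" using jn kb a Q lp by (simp add: Z_def)
 have "compact (gs ` ?Qin)" unfolding Qb_def by (intro compact_continuous_image cont_UNIV_sub[OF gs] compact_cbox)
 then obtain M where M: "M > 0" "!!y. y \<in> ?Qin ==> norm (gs y) <= M"
  using compact_imp_bounded[THEN bounded_pos[THEN iffD1]] by (metis imageI)
 define k where "k = \<bar>a\<bar> + 1"
 have k: "k > 0" by (simp add: k_def)
 \<comment> \<open>The maximizer of \<open>jn n*m' - 3 * kb^2*m'^2\<close>, the gain from the moment
   minus the dual cost. Multiplied by \<open>a^2*Q*l^2\<close> the maximum is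
   \<open>Z\<close>.\<close>
 define m' where "m' = jn n/(6 * kb^2)"
 define mue where "mue = - a*m'"
 define m where "m = \<bar>mue\<bar>"
 have m: "m \<ge> 0" by (simp add: m_def)
 have K0: "Z/2 \<ge> 0" and k0: "k \<ge> 0" using Z k by auto
 obtain C1 eps1 where C1: "C1 \<ge> 0" "eps1 > 0" and rig: "\<forall>eps f D v V. 0 < eps --> eps <= eps1 --> f \<in> borel_measurable borel --> D \<in> borel_measurable borel --> gradM v V -->
  (\<forall>t. \<bar>t\<bar> <= 1/2 --> \<bar>f t - 1\<bar> <= k*eps) -->
  (nnI (%y. ennreal ((norm (V y - D y))^2)*indicator ?Q y)) <= ennreal (eps ^ 4) -->
  (nnI (%y. W (f (y $ 3)*\<^sub>R D y)*indicator ?Q y)) <= ennreal (Z/2*eps^2) -->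
  (\<exists>R\<in>SO3. n2 (cl l) 0 (%y. V y - R) <= C1*eps^2)"
  using cell_rigidity[OF l K0 k0] by (elim exE conjE) (rule that)
 define G where "G = C1 + k^2 * vol + 1"
 have G: "G > 0" using C1 vol by (simp add: G_def add_nonneg_pos)
 \<comment> \<open>The errors are held to three shares of \<open>Z/8\<close>: from
   \<open>et\<close>, from \<open>rh\<close>, and from the terms with a positive power of
   \<open>eps\<close> collected in \<open>H\<close>.\<close>
 define et where "et = Z/(96*G)"
 have et: "et > 0" "12*et * G = Z/8" using Z G by (simp_all add: et_def)
 obtain cka where cka: "cka > 0" and T': "\<forall>F. norm F < cka --> mat 1 + F \<in> U \<and> \<bar>Wr (mat 1 + F) - B F F/2\<bar> <= et * (norm F)^2"
  using Taylor[OF et(1)] by (elim exE conjE) (rule that)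
 note T = T'[rule_format]
 define rh where "rh = min 1 (Z/(8*(2*m*M * vol + 1)))"
 have den: "2*m*M * vol + 1 > 0" using m M vol by (simp add: add_nonneg_pos)
 have rh: "rh > 0" "rh <= 1" using Z den by (auto simp: rh_def)
 have rh': "2*m*rh * M * vol <= Z/8"
 proof -
  have "rh * (2*m*M * vol + 1) <= Z/(8*(2*m*M * vol + 1))*(2*m*M * vol + 1)"
   using den by (intro mult_right_mono) (auto simp: rh_def)
  also have "... = Z/8"
  proof -
   have "Z/(8*w)*w = Z/8" if "w > 0" for w using that by simp
   from this[OF den] show ?thesis .
  qed
  finally show ?thesis using rh(1) by (simp add: algebra_simps)
 qed
 define H where "H = 12*(m*M/cka)*G + m*M * k*C1 + m*M*(k + 1) * vol + m*M"
 have H: "H \<ge> 0" using m M cka G k C1 vol by (simp add: H_def)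
 define eps0 where "eps0 = min eps1 (min 1 (min (1/k) (Z/(8*(H + 1)))))"
 have eps0: "eps0 > 0" using C1 k Z H by (simp add: eps0_def)
 have main: "ennreal (Z/2*eps^2) <= (nnI (%y. W (f (y $ 3)*\<^sub>R D y)*indicator ?Q y))"
  if eps: "0 < eps" "eps <= eps0" and f[measurable]: "f \<in> borel_measurable borel" and D[measurable]: "D \<in> borel_measurable borel" and V: "gradM v V"
   and fa: "\<forall>t. \<bar>t\<bar> <= 1/2 --> \<bar>f t - 1 + a*eps * t^n\<bar> <= rh * eps"
   and VD: "(nnI (%y. ennreal ((norm (V y - D y))^2)*indicator ?Q y)) <= ennreal (eps ^ 4)" for eps f D v V
 proof (cases "(nnI (%y. W (f (y $ 3)*\<^sub>R D y)*indicator ?Q y)) <= ennreal (Z/2*eps^2)")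
  case False
  then show ?thesis by simp
 next
  case True
  have eps': "eps <= eps1" "eps <= 1" "eps <= 1/k" "eps <= Z/(8*(H + 1))" using eps(2) by (auto simp: eps0_def)
  have fk: "\<bar>f t - 1\<bar> <= k*eps" if t: "\<bar>t\<bar> <= 1/2" for t
  proof -
   have "\<bar>t^n\<bar> <= 1" unfolding power_abs using t by (intro power_le_one) auto
   then have "\<bar>a*eps * t^n\<bar> <= \<bar>a\<bar> * eps * 1" unfolding abs_mult using eps(1) by (intro mult_mono) auto
   moreover have "rh * eps <= 1*eps" using rh eps(1) by (intro mult_right_mono) auto
   moreover have "k*eps = \<bar>a\<bar> * eps * 1 + 1*eps" by (simp add: k_def algebra_simps)
   ultimately show ?thesis using fa[rule_format, OF t] by linarith
  qed
  have keps: "k*eps <= 1" using eps'(3) k by (simp add: field_simps)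
  have "\<exists>R\<in>SO3. n2 (cl l) 0 (%y. V y - R) <= C1*eps^2"
   by (rule rig[rule_format, OF eps(1) eps'(1) f D V _ VD True]) (rule fk)
  then obtain R where R: "R \<in> SO3" and nR: "n2 (cl l) 0 (%y. V y - R) <= C1*eps^2"
   by (elim bexE) (rule that)
  define A where "A y = transpose R ** V y - mat 1" for y
  have gA: "gradM (%x. transpose R *v v x - x) A"
  proof -
   have "grad1 (%x. (transpose R *v v x) $ i - x $ i) (%x. (transpose R ** V x) $ i - axis i 1)" for i
    by (intro grad1_diff grad1_coord gradM_nth[OF gradM_left_mult[OF V]])
   moreover have "(mat 1 :: real^3^3) $ i = axis i 1" for i by (simp add: mat_def axis_def vec_eq_iff)
   ultimately show ?thesis by (simp add: gradM_def A_def)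
  qed
  have cA: "continuous_on UNIV A" by (rule gradM_cont[OF gA])
  have n2A: "integral ?Qin (%y. (norm (A y))\<^sup>2) <= C1*eps^2"
  proof -
   have "norm (A y) = norm (V y - R)" for y
   proof -
    have "A y = transpose R ** (V y - R)" unfolding A_def using SO3_D(1,2)[OF R] by (simp add: matrix_diff_mult)
    then show ?thesis by (simp add: norm_SO3_mult[OF SO3_transpose[OF R]])
   qed
   then show ?thesis using nR by (simp add: n2_def)
  qed
  define wm where "wm = et + eps * \<bar>mue\<bar> * M/cka"
  have wm: "wm \<ge> 0" using et eps(1) M cka by (simp add: wm_def)
  define S where "S = 3 * kb^2*Q"
  have S: "S \<ge> 0" using Q by (simp add: S_def)
  define P where "P = 12*wm * k^2 + 2*\<bar>mue\<bar> * rh * M + \<bar>mue\<bar> * M * k*eps + \<bar>mue\<bar> * M*eps + mue^2*S/2"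
  define c2 where "c2 = 12*wm + \<bar>mue\<bar> * M * k*eps"
  define c3 where "c3 = 12*wm + \<bar>mue\<bar> * M/eps"
  have c2: "c2 \<ge> 0" and c3: "c3 \<ge> 0" using wm M k eps(1) by (simp_all add: c2_def c3_def)
  define g where "g y = eps * mue * (gs y \<bullet> A y) - eps^2*mue * a*((y $ 3)^n*(gs y \<bullet> mat 1)) - c2*(norm (A y))^2 - eps^2*P" for y
  have pt: "ennreal (g y)*indicator ?Qin y <= W (f (y $ 3)*\<^sub>R D y)*indicator ?Q y + ennreal c3*(ennreal ((norm (V y - D y))^2)*indicator ?Q y)" for y
  proof (cases "y \<in> ?Qin")
   case y: True
   then have yQ: "y \<in> ?Q" using Qb_mono[of 0 "1/8" "cl l"] by auto
   have "\<bar>y $ 3\<bar> <= 1/2" using y unfolding mem_Qb by (drule_tac spec[of _ 3]) (simp add: cl_nth)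
   note y3 = this
   have "ennreal (g y) <= W (f (y $ 3)*\<^sub>R D y) + ennreal (c3*(norm (V y - D y))^2)"
    unfolding g_def c2_def c3_def P_def
    by (rule cell_pointwise[OF T cka less_imp_le[OF et(1)] S M(2)[OF y] dual[folded S_def] R eps(1) keps fk[OF y3] fa[rule_format, OF y3] A_def wm_def])
   also have "ennreal (c3*(norm (V y - D y))^2) = ennreal c3*ennreal ((norm (V y - D y))^2)" using c3 by (simp add: ennreal_mult)
   finally show ?thesis using y yQ by simp
  qed simp
  have cV: "continuous_on UNIV V" by (rule gradM_cont[OF V])
  have [measurable]: "V \<in> borel_measurable borel" by (rule borel_measurable_continuous_onI[OF cV])
  have [measurable]: "(%y::real^3. y $ 3) \<in> borel_measurable borel" by (intro borel_measurable_continuous_onI continuous_intros)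
  have [measurable]: "(%y::real^3. f (y $ 3)) \<in> borel_measurable borel" by (rule measurable_compose[OF _ f]) measurable
  have [measurable]: "?Q \<in> sets borel" by (simp add: Qb_def)
  have cg: "continuous_on UNIV g" unfolding g_def by (intro continuous_intros gs cA)
  have "ennreal (integral ?Qin g) <= (nnI (%y. ennreal (g y)*indicator ?Qin y))"
   unfolding Qb_def by (rule nn_integral_cbox_lower[OF cg])
  also have "... <= (nnI (%y. W (f (y $ 3)*\<^sub>R D y)*indicator ?Q y + ennreal c3*(ennreal ((norm (V y - D y))^2)*indicator ?Q y)))"
   by (rule nn_integral_mono) (rule pt)
  also have "... = (nnI (%y. W (f (y $ 3)*\<^sub>R D y)*indicator ?Q y)) + (nnI (%y. ennreal c3*(ennreal ((norm (V y - D y))^2)*indicator ?Q y)))"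
   by (rule nn_integral_add) measurable
  also have "(nnI (%y. ennreal c3*(ennreal ((norm (V y - D y))^2)*indicator ?Q y))) = ennreal c3*(nnI (%y. ennreal ((norm (V y - D y))^2)*indicator ?Q y))"
   by (rule nn_integral_cmult) measurable
  also have "ennreal c3*(nnI (%y. ennreal ((norm (V y - D y))^2)*indicator ?Q y)) <= ennreal c3*ennreal (eps ^ 4)"
   by (intro mult_left_mono VD) simp
  also have "... = ennreal (c3*eps ^ 4)" using c3 eps(1) by (simp add: ennreal_mult)
  finally have fin: "ennreal (integral ?Qin g) <= (nnI (%y. W (f (y $ 3)*\<^sub>R D y)*indicator ?Q y)) + ennreal (c3*eps ^ 4)"
   by (simp add: add_left_mono)
  have ig: "integral ?Qin g = eps * mue * integral ?Qin (%y. gs y \<bullet> A y) - eps^2*mue * a*integral ?Qin (%y. (y $ 3)^n*(gs y \<bullet> mat 1))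
    - c2*integral ?Qin (%y. (norm (A y))\<^sup>2) - vol*(eps^2*P)"
  proof (rule integral_unique)
   have "((%y::real^3. eps\<^sup>2*P) has_integral vol*(eps^2*P)) ?Qin"
    using has_integral_const[of "eps^2*P" "- (cl l + vec 0)" "cl l + vec 0"] content_cell[OF lp] unfolding Qb_def by (simp add: vol_def)
   then show "(g has_integral eps * mue * integral ?Qin (%y. gs y \<bullet> A y) - eps^2*mue * a*integral ?Qin (%y. (y $ 3)^n*(gs y \<bullet> mat 1))
    - c2*integral ?Qin (%y. (norm (A y))\<^sup>2) - vol*(eps^2*P)) ?Qin"
    unfolding g_def by (intro has_integral_diff has_integral_mult_right integrable_integral cont_integrable_Qb continuous_intros gs cA)
  qed
  have lower: "Z/2*eps^2 + c3*eps ^ 4 <= integral ?Qin g"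
  proof -
   define J where "J = integral ?Qin (%y. (y $ 3)^n*(gs y \<bullet> mat 1))"
   have J: "jn n*Q*l^2 <= J" unfolding J_def by (rule mom)
   have g1: "integral ?Qin g \<ge> eps^2*(a^2*m'*J - c2*C1 - P * vol)"
   proof -
    have "c2*integral ?Qin (%y. (norm (A y))\<^sup>2) <= c2*(C1*eps^2)" by (intro mult_left_mono n2A c2)
    moreover have "- (eps^2*mue * a*J) = eps^2*(a^2*m'*J)" by (simp add: mue_def power2_eq_square mult_ac)
    moreover have "eps^2*(a^2*m'*J - c2*C1 - P * vol) = eps^2*(a^2*m'*J) - c2*(C1*eps^2) - vol*(eps^2*P)"
     by (simp add: right_diff_distrib mult_ac)
    ultimately show ?thesis unfolding ig orth[OF gA] J_def[symmetric] by linarith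
   qed
   have m'0: "m' > 0" using jn kb by (simp add: m'_def)
   have lead: "Z <= a^2*m'*J - mue^2*S/2 * vol"
   proof -
    have "a^2*m'*(jn n*Q*l^2) <= a^2*m'*J" using m'0 by (intro mult_left_mono J) auto
    moreover have "a^2*m'*(jn n*Q*l^2) = 2*Z"
     using kb by (simp add: m'_def Z_def power2_eq_square)
    moreover have "mue^2*S/2 * vol = Z"
     using kb by (simp add: mue_def m'_def S_def vol_def Z_def power2_eq_square)
    ultimately show ?thesis by linarith
   qed
   define e where "e = m*M"
   have e0: "e \<ge> 0" using m M by (simp add: e_def)
   have err: "c2*C1 + (P - mue^2*S/2) * vol + c3*eps^2 <= Z/2"
   proof -
    have c3e: "c3*eps^2 <= 12*wm + e*eps"
    proof -
     have "c3*eps^2 = 12*wm * eps^2 + e*eps" using eps(1) by (simp add: c3_def e_def m_def field_simps power2_eq_square)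
     moreover have "12*wm * eps^2 <= 12*wm * 1" using wm eps(1) eps'(2) by (intro mult_left_mono power_le_one) auto
     ultimately show ?thesis by linarith
    qed
    have wme: "wm = et + eps * (e/cka)" by (simp add: wm_def e_def m_def)
    have "c2*C1 + (P - mue^2*S/2) * vol + (12*wm + e*eps)
      = 12*wm * G + 2*m*rh * M * vol + eps * (e * k*C1 + e*(k + 1) * vol + e)"
     unfolding c2_def P_def G_def e_def m_def by (simp add: algebra_simps)
    also have "... = 12*et * G + 2*m*rh * M * vol + eps * H"
     unfolding wme H_def e_def by (simp add: algebra_simps)
    also have "... <= Z/8 + Z/8 + Z/8"
    proof -
     have "eps * H <= eps * (H + 1)" using eps(1) by (intro mult_left_mono) auto
     also have "... <= Z/(8*(H + 1))*(H + 1)" using eps'(4) H by (intro mult_right_mono) auto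
     also have "... = Z/8"
     proof -
      have "Z/(8*w)*w = Z/8" if "w > 0" for w using that by simp
      from this[of "H + 1"] show ?thesis using H by simp
     qed
     finally show ?thesis using rh' et(2) by linarith
    qed
    finally show ?thesis using c3e Z by linarith
   qed
   have "Z/2 + c3*eps^2 <= a^2*m'*J - c2*C1 - P * vol"
    using lead err by (simp add: left_diff_distrib)
   then have "eps^2*(Z/2 + c3*eps^2) <= eps^2*(a^2*m'*J - c2*C1 - P * vol)" by (intro mult_left_mono) auto
   moreover have "eps^2*(Z/2 + c3*eps^2) = Z/2*eps^2 + c3*eps ^ 4" by (simp add: algebra_simps eval_nat_numeral)
   ultimately show ?thesis using g1 by linarith
  qed
  have "ennreal (Z/2*eps^2) <= (nnI (%y. W (f (y $ 3)*\<^sub>R D y)*indicator ?Q y)) + ennreal 0"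
   by (rule ennreal_shift[OF fin]) (use lower c3 eps(1) in auto)
  then show ?thesis by simp
 qed
 have "(jn n)^2/(24 * kb^2)*a^2*Q2 W (mat 1)*l^2 = Z/2" by (simp add: Z_def Q_def)
 then show ?thesis using main l rh(1) eps0 by (intro exI[of _ l] exI[of _ rh] exI[of _ eps0] conjI allI impI) (simp_all only:)
qed

end

section \<open>The conformal factor and the upper bound\<close>

lemma smooth_on_real_derivative:
 fixes f :: "real => real"
 assumes f: "smooth_on S f"
 shows "smooth_on S (%x. frechet_derivative f (at x) 1)"
  "x \<in> S ==> (f has_real_derivative frechet_derivative f (at x) 1) (at x)"
proof -
 have "Ck_on k S (%x. frechet_derivative f (at x) 1)" for k
  using f[unfolded smooth_on_def, rule_format, of "Suc k"] by simp
 then show "smooth_on S (%x. frechet_derivative f (at x) 1)" by (simp add: smooth_on_def)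
 assume x: "x \<in> S"
 have "f differentiable at x" using f[unfolded smooth_on_def, rule_format, of "Suc 0"] x by simp
 then have d: "(f has_derivative frechet_derivative f (at x)) (at x)" by (rule frechet_derivative_works[THEN iffD1])
 have "frechet_derivative f (at x) = (%h. frechet_derivative f (at x) 1*h)"
 proof
  fix h :: real
  have "frechet_derivative f (at x) (h*\<^sub>R 1) = h*\<^sub>R frechet_derivative f (at x) 1"
   using has_derivative_linear[OF d] by (rule linear_cmul)
  then show "frechet_derivative f (at x) h = frechet_derivative f (at x) 1*h" by (simp add: mult.commute)
 qed
 with d show "(f has_real_derivative frechet_derivative f (at x) 1) (at x)"
  unfolding has_field_derivative_def by simp
qed

text \<open>Nothing is known about \<open>deriv\<close> outside \<open>S\<close>, so the iterates
  are matched with a smooth function on \<open>S\<close> only; openness makes this enough to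
  differentiate again.\<close>

lemma smooth_on_iterated_deriv:
 fixes f :: "real => real"
 assumes S: "open S" and f: "smooth_on S f"
 shows "\<exists>g. smooth_on S g \<and> (\<forall>x\<in>S. (deriv ^^ k) f x = g x)"
proof (induction k)
 case 0
 then show ?case using f by auto
next
 case (Suc k)
 then obtain g where g: "smooth_on S g" "!!x. x \<in> S ==> (deriv ^^ k) f x = g x" by blast
 have "(deriv ^^ Suc k) f x = frechet_derivative g (at x) 1" if x: "x \<in> S" for x
 proof -
  have "((deriv ^^ k) f has_real_derivative frechet_derivative g (at x) 1) (at x)"
   by (rule has_field_derivative_transform_within_open[OF smooth_on_real_derivative(2)[OF g(1) x] S x]) (simp add: g(2))
  then show ?thesis by (simp add: DERIV_imp_deriv)
 qed
 then show ?case using smooth_on_real_derivative(1)[OF g(1)] by blast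
qed

lemma smooth_on_deriv_Suc:
 fixes f :: "real => real"
 assumes S: "open S" and f: "smooth_on S f" and x: "x \<in> S"
 shows "((deriv ^^ k) f has_real_derivative (deriv ^^ Suc k) f x) (at x)"
proof -
 obtain g where g: "smooth_on S g" "!!x. x \<in> S ==> (deriv ^^ k) f x = g x"
  using smooth_on_iterated_deriv[OF S f, of k] by blast
 have "((deriv ^^ k) f has_real_derivative frechet_derivative g (at x) 1) (at x)"
  by (rule has_field_derivative_transform_within_open[OF smooth_on_real_derivative(2)[OF g(1) x] S x]) (simp add: g(2))
 moreover from this have "(deriv ^^ Suc k) f x = frechet_derivative g (at x) 1" by (simp add: DERIV_imp_deriv)
 ultimately show ?thesis by simp
qed

text \<open>Lagrange's remainder contains the derivative of order \<open>n\<close> at an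
  intermediate point; continuity at the origin replaces it by the value there at the price of
  \<open>dl\<close>.\<close>

lemma flat_Taylor:
 fixes ph :: "real => real"
 assumes ph: "smooth_on {-1/2<..<1/2} ph" and n: "n > 2" and z: "\<forall>k\<in>{1..n-1}. (deriv ^^ k) ph 0 = 0" and dl: "dl > 0"
 shows "\<exists>r>0. r < 1/2 \<and> (\<forall>x. \<bar>x\<bar> <= r --> \<bar>ph x - ph 0 - (deriv ^^ n) ph 0/fact n*x^n\<bar> <= dl * \<bar>x\<bar> ^ n)"
proof -
 let ?S = "{-1/2<..<1/2::real}" and ?d = "%k. (deriv ^^ k) ph"
 have d: "(?d k has_real_derivative ?d (Suc k) x) (at x)" if "x \<in> ?S" for k x
  by (rule smooth_on_deriv_Suc[OF _ ph that]) simp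
 have "isCont (?d n) 0" by (rule DERIV_isCont[OF d]) simp
 then obtain s where s: "s > 0" "!!x. \<bar>x\<bar> < s ==> \<bar>?d n x - ?d n 0\<bar> < dl"
  using dl unfolding continuous_at_eps_delta by (auto simp: dist_real_def)
 define r where "r = min (s/2) (1/4)"
 have r: "r > 0" "r < 1/2" "r < s" using s(1) by (auto simp: r_def)
 have "\<bar>ph x - ph 0 - ?d n 0/fact n*x^n\<bar> <= dl * \<bar>x\<bar> ^ n" if x: "\<bar>x\<bar> <= r" for x
 proof (cases "x = 0")
  case True
  then show ?thesis using n by (simp add: power_0_left)
 next
  case False
  have "\<exists>t. (if x < 0 then x < t \<and> t < 0 else 0 < t \<and> t < x) \<and>
   ph x = (\<Sum>m<n. (?d m 0/fact m)*(x - 0)^m) + (?d n t/fact n)*(x - 0)^n"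
  proof (rule Taylor[where a="-r" and b=r])
   show "\<forall>m t. m < n \<and> - r <= t \<and> t <= r --> DERIV (?d m) t :> ?d (Suc m) t" using d r by auto
  qed (use n r x False in auto)
  then obtain t where t: "if x < 0 then x < t \<and> t < 0 else 0 < t \<and> t < x"
   and e: "ph x = (\<Sum>m<n. (?d m 0/fact m)*x^m) + (?d n t/fact n)*x^n" by auto
  have "(\<Sum>m<n. (?d m 0/fact m)*x^m) = (\<Sum>m\<in>{0}. (?d m 0/fact m)*x^m)"
  proof (rule sum.mono_neutral_right)
   show "\<forall>i\<in>{..<n} - {0}. ?d i 0/fact i*x^i = 0"
   proof
    fix i assume "i \<in> {..<n} - {0}"
    then have "i \<in> {1..n-1}" by auto
    then have "?d i 0 = 0" using z by blast
    then show "?d i 0/fact i*x^i = 0" by simp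
   qed
  qed (use n in auto)
  then have e': "ph x - ph 0 - ?d n 0/fact n*x^n = (?d n t - ?d n 0)/fact n*x^n"
   unfolding e by (simp add: diff_divide_distrib left_diff_distrib)
  have "\<bar>t\<bar> < s" using t x r by (auto split: if_splits)
  then have "\<bar>?d n t - ?d n 0\<bar> <= dl" using s(2)[of t] by simp
  moreover have "(1::real) <= fact n" by (rule fact_ge_1)
  ultimately have "\<bar>?d n t - ?d n 0\<bar> / fact n <= dl / 1" by (intro frac_le) auto
  then have "\<bar>?d n t - ?d n 0\<bar> / fact n*\<bar>x\<bar> ^ n <= dl * \<bar>x\<bar> ^ n" by (intro mult_right_mono) auto
  then show ?thesis unfolding e' by (simp add: abs_mult power_abs)
 qed
 then show ?thesis using r by blast
qed

lemma exp_quadratic_bound: assumes "\<bar>u::real\<bar> <= 1" shows "\<bar>exp (- u) - 1 + u\<bar> <= u^2"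
proof -
 have low: "0 <= exp (- u) - 1 + u" using exp_ge_add_one_self[of "- u"] by linarith
 have "exp (- u) <= 1 - u + u^2"
 proof (cases "u <= 0")
  case True
  then show ?thesis using exp_bound[of "- u"] assms by simp
 next
  case False
  then have "1 + u + u^2/2 <= exp u" by (intro exp_lower_Taylor_quadratic) simp
  moreover have p: "0 < 1 + u + u^2/2" using False by (simp add: add_pos_nonneg)
  ultimately have "exp (- u) <= 1/(1 + u + u^2/2)" unfolding exp_minus inverse_eq_divide by (intro divide_left_mono) auto
  also have "... <= 1 - u + u^2"
  proof -
   have "(1 - u + u^2)*(1 + u + u^2/2) = 1 + (u^2 + u^3 + u^4)/2" by (simp add: field_simps eval_nat_numeral)
   moreover have "0 <= (u^2 + u^3 + u^4)/2" using False by simp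
   ultimately show ?thesis using p by (simp add: pos_divide_le_eq)
  qed
  finally show ?thesis .
 qed
 then show ?thesis using low by simp
qed

text \<open>In the rescaled height \<open>t\<close> the metric deviates from its midplane value by
  \<open>a*h^n*t^n\<close> to leading order. The quadratic error of the exponential is of order
  \<open>h^(2*n)\<close> and is absorbed, with the Taylor error, in \<open>rh * h^n\<close> for
  small \<open>h\<close>.\<close>

lemma conformal_factor_expansion:
 fixes ph :: "real => real"
 assumes ph: "smooth_on {-1/2<..<1/2} ph" and n: "n > 2" and z: "\<forall>k\<in>{1..n-1}. (deriv ^^ k) ph 0 = 0" and rh: "rh > 0"
  and a: "a = (deriv ^^ n) ph 0/fact n"
 shows "\<exists>h0>0. h0 <= 1 \<and> (\<forall>h t. 0 < h --> h < h0 --> \<bar>t\<bar> <= 1/2 --> \<bar>exp (ph 0 - ph (h*t)) - 1 + a*h^n*t^n\<bar> <= rh * h^n)"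
proof -
 define dl where "dl = min 1 (rh / 2)"
 have dl: "dl > 0" "dl <= 1" "dl <= rh / 2" using rh by (auto simp: dl_def)
 obtain r where r: "r > 0" "!!x. \<bar>x\<bar> <= r ==> \<bar>ph x - ph 0 - a*x^n\<bar> <= dl * \<bar>x\<bar> ^ n"
  using flat_Taylor[OF ph n z dl(1)] unfolding a by blast
 define c where "c = \<bar>a\<bar> + 1"
 have c: "c \<ge> 1" by (simp add: c_def)
 define h0 where "h0 = min 1 (min r (min (1/c) (rh / (2*c^2))))"
 have h0: "h0 > 0" using r(1) c rh by (simp add: h0_def)
 have "\<bar>exp (ph 0 - ph (h*t)) - 1 + a*h^n*t^n\<bar> <= rh * h^n" if h: "0 < h" "h < h0" and t: "\<bar>t\<bar> <= 1/2" for h t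
 proof -
  have h': "h <= 1" "h <= r" "h <= 1/c" "h <= rh / (2*c^2)" using h(2) by (auto simp: h0_def)
  define eps where "eps = h^n"
  have eps: "0 < eps" "eps <= h" using h(1) h'(1) n power_decreasing[of 1 n h] by (auto simp: eps_def)
  have tn: "\<bar>t^n\<bar> <= 1" unfolding power_abs using t by (intro power_le_one) auto
  define u where "u = ph (h*t) - ph 0"
  have "\<bar>h*t\<bar> <= h*1" unfolding abs_mult using h(1) t by (intro mult_mono) auto
  then have "\<bar>h*t\<bar> <= r" using h'(2) by linarith
  from r(2)[OF this] have "\<bar>u - a*eps * t^n\<bar> <= dl * (eps * \<bar>t^n\<bar>)"
   using h(1) by (simp add: u_def eps_def power_mult_distrib abs_mult power_abs mult.assoc)
  also have "... <= dl * (eps * 1)" using dl(1) eps(1) tn by (intro mult_left_mono) auto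
  finally have u1: "\<bar>u - a*eps * t^n\<bar> <= dl * eps" by simp
  have "\<bar>a*eps * t^n\<bar> <= \<bar>a\<bar> * eps * 1" unfolding abs_mult using eps(1) tn by (intro mult_mono) auto
  moreover have "dl * eps <= 1*eps" using dl(2) eps(1) by (intro mult_right_mono) auto
  moreover have "c*eps = \<bar>a\<bar> * eps * 1 + 1*eps" by (simp add: c_def algebra_simps)
  ultimately have u2: "\<bar>u\<bar> <= c*eps" using u1 by linarith
  have "c*eps <= c*h" using c eps(2) by (intro mult_left_mono) auto
  also have "... <= 1" using h'(3) c by (simp add: field_simps)
  finally have "\<bar>u\<bar> <= 1" using u2 by linarith
  from exp_quadratic_bound[OF this] have e1: "\<bar>exp (- u) - 1 + u\<bar> <= u^2" .
  have "u^2 <= (c*eps)^2" using u2 by (intro sq_le_of_abs) linarith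
  also have "... = (c^2*eps)*eps" by (simp add: power2_eq_square mult_ac)
  also have "... <= (rh / 2)*eps"
  proof (rule mult_right_mono)
   have "c^2*eps <= c^2*(rh / (2*c^2))" using eps(2) h'(4) by (intro mult_left_mono) auto
   also have "... = rh / 2" using c by simp
   finally show "c^2*eps <= rh / 2" .
  qed (use eps in simp)
  finally have e2: "u^2 <= (rh / 2)*eps" .
  have "dl * eps <= (rh / 2)*eps" using dl(3) eps(1) by (intro mult_right_mono) auto
  moreover have "rh * eps = (rh / 2)*eps + (rh / 2)*eps" by simp
  ultimately have "\<bar>exp (- u) - 1 + a*eps * t^n\<bar> <= rh * eps" using e1 e2 u1 by linarith
  then show ?thesis by (simp add: u_def eps_def)
 qed
 moreover have "h0 <= 1" by (simp add: h0_def)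
 ultimately show ?thesis using h0 by blast
qed

section \<open>The dilation as an admissible map\<close>

lemma test_fn_grad1:
 assumes "test_fn Om ps"
 shows "grad1 ps (%x. \<chi> j. frechet_derivative ps (at x) (axis j 1))"
  "x \<notin> Om ==> ps x = 0" "x \<notin> Om ==> frechet_derivative ps (at x) (axis j 1) = 0"
proof -
 have C: "Ck_on (Suc 0) UNIV ps" using assms by (simp add: test_fn_def smooth_on_def)
 then have d: "(ps has_derivative frechet_derivative ps (at x)) (at x)" for x
  by (simp add: frechet_derivative_works)
 have ax: "axis j (1::real) \<in> Basis" for j :: 3 by (simp add: axis_in_Basis_iff)
 have exp: "frechet_derivative ps (at x) h = (\<chi> j. frechet_derivative ps (at x) (axis j 1)) \<bullet> h" for x h
 proof -
  have l: "linear (frechet_derivative ps (at x))" by (rule has_derivative_linear[OF d])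
  have "h = (\<Sum>j\<in>UNIV. h $ j*\<^sub>R axis j 1)" using basis_expansion[of h] by (simp add: scalar_mult_eq_scaleR)
  then have "frechet_derivative ps (at x) h = frechet_derivative ps (at x) (\<Sum>j\<in>UNIV. h $ j*\<^sub>R axis j 1)" by simp
  also have "... = (\<Sum>j\<in>UNIV. h $ j*frechet_derivative ps (at x) (axis j 1))"
   by (simp add: linear_sum[OF l] linear_cmul[OF l])
  finally show ?thesis by (simp add: inner_vec_def mult.commute)
 qed
 have "continuous_on UNIV (%x. \<chi> j. frechet_derivative ps (at x) (axis j 1))"
  using C ax by (intro continuous_on_vec_lambda) simp
 moreover have "(ps has_derivative (%h. (\<chi> j. frechet_derivative ps (at x) (axis j 1)) \<bullet> h)) (at x)" for x
  by (rule has_derivative_eq_rhs[OF d]) (rule ext, rule exp)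
 ultimately show "grad1 ps (%x. \<chi> j. frechet_derivative ps (at x) (axis j 1))" by (simp add: grad1_def)
 let ?K = "closure {x. ps x \<noteq> 0}"
 have K: "?K \<subseteq> Om" using assms by (simp add: test_fn_def)
 have z: "ps x = 0" if "x \<notin> ?K" for x using that closure_subset[of "{x. ps x \<noteq> 0}"] by blast
 show "ps x = 0" if "x \<notin> Om" using z[of x] K that by blast
 show "frechet_derivative ps (at x) (axis j 1) = 0" if "x \<notin> Om"
 proof -
  have x: "x \<in> - ?K" using K that by blast
  have "(ps has_derivative (%h. 0)) (at x)"
  proof (rule has_derivative_transform_within_open[OF has_derivative_const[of 0] _ x])
   show "open (- ?K)" by (rule open_Compl[OF closed_closure])
   show "0 = ps y" if "y \<in> - ?K" for y by (rule sym, rule z) (use that in blast)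
  qed
  from has_derivative_unique[OF d this] show ?thesis by simp
 qed
qed

lemma integral_lebesgue_on_supported:
 fixes f :: "real^3 => real"
 assumes Om: "open Om" "Om \<subseteq> cbox a b" and f: "continuous_on UNIV f" "!!x. x \<notin> Om ==> f x = 0"
 shows "integral\<^sup>L (lebesgue_on Om) f = integral (cbox a b) f"
proof -
 have m: "Om \<in> sets lebesgue" using Om(1) by auto
 have "bounded Om" using Om(2) bounded_cbox bounded_subset by blast
 then have lm: "Om \<in> lmeasurable" using Om(1) by (simp add: lmeasurable_open)
 interpret finite_measure "lebesgue_on Om" by (rule finite_measure_lebesgue_on[OF lm])
 have "compact (f ` cbox a b)" by (intro compact_continuous_image cont_UNIV_sub[OF f(1)] compact_cbox)
 then obtain M where M: "!!x. x \<in> cbox a b ==> norm (f x) <= M" using compact_imp_bounded bounded_iff by (metis imageI)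
 have mf: "f \<in> borel_measurable (lebesgue_on Om)"
  using borel_measurable_continuous_onI[OF f(1)] by (intro measurable_restrict_space1) (auto intro: measurable_completion)
 have "integrable (lebesgue_on Om) f"
  by (rule integrable_const_bound[where B=M, OF _ mf]) (rule AE_I2, use M Om(2) in auto)
 then have "integral\<^sup>L (lebesgue_on Om) f = integral Om f" by (rule lebesgue_integral_eq_integral[OF _ m])
 also have "... = integral UNIV (%x. if x \<in> Om then f x else 0)"
  by (rule Henstock_Kurzweil_Integration.integral_restrict_UNIV[symmetric])
 also have "... = integral UNIV (%x. if x \<in> cbox a b then f x else 0)"
  by (rule arg_cong[where f="integral UNIV"], rule ext) (use f(2) Om(2) in auto)
 also have "... = integral (cbox a b) f" by (rule Henstock_Kurzweil_Integration.integral_restrict_UNIV)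
 finally show ?thesis .
qed

lemma sobolev12_dilation:
 assumes Om: "open Om" "bounded Om"
 shows "sobolev12 Om (%x. c*\<^sub>R x) (%x. c*\<^sub>R mat 1)"
proof -
 have m: "Om \<in> sets lebesgue" using Om(1) by auto
 have lm: "Om \<in> lmeasurable" using Om by (simp add: lmeasurable_open)
 interpret finite_measure "lebesgue_on Om" by (rule finite_measure_lebesgue_on[OF lm])
 obtain a b where ab: "Om \<subseteq> cbox a b" using bounded_subset_cbox_symmetric[OF Om(2)] by blast
 have mc: "f \<in> borel_measurable (lebesgue_on Om)" if "continuous_on UNIV f" for f :: "real^3 => 'b::euclidean_space"
  using borel_measurable_continuous_onI[OF that] by (intro measurable_restrict_space1) (auto intro: measurable_completion)
 have int: "integrable (lebesgue_on Om) f" if f: "continuous_on UNIV f" for f :: "real^3 => real"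
 proof -
  have "compact (f ` cbox a b)" by (intro compact_continuous_image cont_UNIV_sub[OF f] compact_cbox)
  then obtain M where M: "!!x. x \<in> cbox a b ==> norm (f x) <= M" using compact_imp_bounded bounded_iff by (metis imageI)
  show ?thesis by (rule integrable_const_bound[where B=M, OF _ mc[OF f]]) (rule AE_I2, use M ab in auto)
 qed
 have weak: "(\<integral>x. (c*\<^sub>R x) $ i*frechet_derivative ps (at x) (axis j 1) \<partial>(lebesgue_on Om))
    = - (\<integral>x. (c*\<^sub>R mat 1 :: real^3^3) $ i $ j*ps x \<partial>(lebesgue_on Om))" if t: "test_fn Om ps" for ps i j
 proof -
  note G = test_fn_grad1[OF t]
  have g: "grad1 (%x. c*x $ i) (%x. c*\<^sub>R axis i 1)" by (rule grad1_cmult[OF grad1_coord])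
  have cD: "continuous_on UNIV (%x. frechet_derivative ps (at x) (axis j 1))"
   using continuous_on_component[OF grad1_cont_grad[OF G(1)], of j] by simp
  have eq: "integral (cbox a b) (%x. (c*\<^sub>R axis i 1 :: real^3) $ j*ps x) = - integral (cbox a b) (%x. c*x $ i*frechet_derivative ps (at x) (axis j 1))"
   using integral_by_parts[OF g G(1), of a b j] G(2) ab by (auto simp: subset_iff)
  have "(\<integral>x. (c*\<^sub>R x) $ i*frechet_derivative ps (at x) (axis j 1) \<partial>(lebesgue_on Om)) = integral (cbox a b) (%x. (c*\<^sub>R x) $ i*frechet_derivative ps (at x) (axis j 1))"
   by (rule integral_lebesgue_on_supported[OF Om(1) ab]) (auto intro!: continuous_intros cD simp: G(3))
  also have "... = - integral (cbox a b) (%x. (c*\<^sub>R axis i 1 :: real^3) $ j*ps x)" using eq by simp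
  also have "(%x. (c*\<^sub>R axis i 1 :: real^3) $ j*ps x) = (%x. (c*\<^sub>R mat 1 :: real^3^3) $ i $ j*ps x)"
   by (auto simp: axis_def mat_def)
  also have "integral (cbox a b) (%x. (c*\<^sub>R mat 1 :: real^3^3) $ i $ j*ps x) = (\<integral>x. (c*\<^sub>R mat 1 :: real^3^3) $ i $ j*ps x \<partial>(lebesgue_on Om))"
   by (rule integral_lebesgue_on_supported[OF Om(1) ab, symmetric]) (auto intro!: continuous_intros grad1_cont[OF G(1)] simp: G(2))
  finally show ?thesis .
 qed
 show ?thesis
  unfolding sobolev12_def
  by (intro conjI allI impI mc int weak continuous_intros)
qed

lemma Omega_open_bounded:
 assumes "open wm" "bounded wm"
 shows "open (Omega wm h)" "bounded (Omega wm h)"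
  "\<exists>C>0. \<forall>h>0. emeasure lebesgue (Omega wm h) <= ennreal (C*h)"
proof -
 have c: "continuous_on UNIV (%x::real^3. vector [x $ 1, x $ 2] :: real^2)"
 proof -
  have cc: "continuous_on UNIV (%x::real^3. \<chi> i::2. if i = 1 then x $ 1 else x $ 2)"
  proof (rule continuous_on_vec_lambda)
   show "continuous_on UNIV (%x::real^3. if i = 1 then x $ 1 else x $ 2)" for i :: 2 by (cases "i = 1") (auto intro!: continuous_intros)
  qed
  have e: "(%x::real^3. \<chi> i::2. if i = 1 then x $ 1 else x $ 2) = (%x. vector [x $ 1, x $ 2])"
   by (rule ext) (simp add: vec_eq_iff forall_2)
  show ?thesis using cc unfolding e .
 qed
 have "Omega wm h = ((%x. vector [x $ 1, x $ 2]) -` wm) \<inter> {x. \<bar>x $ 3\<bar> < h/2}" by (auto simp: Omega_def)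
 moreover have "open ((%x::real^3. vector [x $ 1, x $ 2] :: real^2) -` wm)" by (rule open_vimage[OF assms(1) c])
 moreover have "open {x::real^3. \<bar>x $ 3\<bar> < h/2}" by (intro open_Collect_less continuous_intros)
 ultimately show "open (Omega wm h)" by auto
 obtain r where r: "r > 0" "\<forall>q\<in>wm. norm q <= r" using assms(2) unfolding bounded_pos by (elim exE conjE) (rule that)
 have sub: "Omega wm h \<subseteq> cbox (- vector [r, r, h/2]) (vector [r, r, h/2])" for h
 proof
  fix x assume x: "x \<in> Omega wm h"
  have n: "norm (vector [x $ 1, x $ 2] :: real^2) <= r" using r(2) x by (simp add: Omega_def)
  have v: "(vector [x $ 1, x $ 2] :: real^2) $ 1 = x $ 1" "(vector [x $ 1, x $ 2] :: real^2) $ 2 = x $ 2" by simp_all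
  have "\<bar>x $ 1\<bar> <= r" using order_trans[OF component_le_norm_cart[of _ 1] n] unfolding v .
  moreover have "\<bar>x $ 2\<bar> <= r" using order_trans[OF component_le_norm_cart[of _ 2] n] unfolding v .
  moreover have "\<bar>x $ 3\<bar> <= h/2" using x by (simp add: Omega_def)
  ultimately show "x \<in> cbox (- vector [r, r, h/2]) (vector [r, r, h/2])"
   unfolding mem_box_cart forall_3 abs_le_iff by simp
 qed
 show "bounded (Omega wm h)" by (rule bounded_subset[OF bounded_cbox sub])
 have "emeasure lebesgue (Omega wm h) <= ennreal ((2*r)^2*h)" if h: "h > 0" for h
 proof -
  let ?b = "vector [r, r, h/2] :: real^3"
  have "0 \<in> cbox (- ?b) ?b" using r(1) h by (simp add: mem_box_cart forall_3)
  then have ne: "cbox (- ?b) ?b \<noteq> {}" by blast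
  have "emeasure lebesgue (Omega wm h) <= emeasure lebesgue (cbox (- ?b) ?b)" by (rule emeasure_mono[OF sub]) auto
  also have "... = emeasure lborel (cbox (- ?b) ?b)" by simp
  also have "... = ennreal (measure lborel (cbox (- ?b) ?b))"
   by (rule emeasure_eq_ennreal_measure) (use emeasure_lborel_cbox_finite in \<open>simp add: less_top\<close>)
  also have "measure lborel (cbox (- ?b) ?b) = (2*r)^2*h"
   using content_cbox_cart[OF ne] unfolding prod_UNIV_3 by (simp add: power2_eq_square)
  finally show ?thesis .
 qed
 moreover have "(2*r)^2 > 0" using r(1) by simp
 ultimately show "\<exists>C>0. \<forall>h>0. emeasure lebesgue (Omega wm h) <= ennreal (C*h)" by blast
qed

context admissible
begin

text \<open>For the dilation the argument of \<open>W\<close> is a scalar matrix within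
  \<open>O(h^n)\<close> of the identity, where the density is at most quadratic. The volume of the
  plate, at most \<open>C*h\<close>, cancels the normalization \<open>1/h\<close>.\<close>

lemma upper_bound:
 assumes wm: "open wm" "bounded wm" and ph: "smooth_on {-1/2<..<1/2} ph" and n: "n > 2" and z: "\<forall>k\<in>{1..n-1}. (deriv ^^ k) ph 0 = 0"
 shows "\<exists>C>0. \<exists>h0>0. h0 <= 1 \<and> (\<forall>h. 0 < h \<and> h < h0 --> inf_energy W ph wm h <= ennreal (C*h^(2*n)))"
proof -
 define a where "a = (deriv ^^ n) ph 0/fact n"
 obtain h1 where h1: "h1 > 0" "h1 <= 1" and ex: "\<forall>h t. 0 < h --> h < h1 --> \<bar>t\<bar> <= 1/2 --> \<bar>exp (ph 0 - ph (h*t)) - 1 + a*h^n*t^n\<bar> <= 1*h^n"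
  using conformal_factor_expansion[OF ph n z zero_less_one a_def] by (elim exE conjE) (rule that)
 obtain cka where cka: "cka > 0" and T: "\<forall>F. norm F < cka --> mat 1 + F \<in> U \<and> \<bar>Wr (mat 1 + F) - B F F/2\<bar> <= 1*(norm F)^2"
  using Taylor[OF zero_less_one] by (elim exE conjE) (rule that)
 obtain K where K: "K \<ge> 0" and KB: "\<forall>F. \<bar>B F F\<bar> <= K*(norm F)^2" using B_bound by (elim exE conjE) (rule that)
 obtain C where C: "C > 0" and CO: "\<forall>h>0. emeasure lebesgue (Omega wm h) <= ennreal (C*h)"
  using Omega_open_bounded(3)[OF wm] by (elim exE conjE) (rule that)
 define k where "k = \<bar>a\<bar> + 1"
 have k: "k \<ge> 1" by (simp add: k_def)
 define h0 where "h0 = min h1 (cka / (4 * k))"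
 have h0: "h0 > 0" "h0 <= 1" using h1 cka k by (auto simp: h0_def)
 define c where "c = (K/2 + 1)*(2 * k)^2"
 have c: "c > 0" using K k by (simp add: c_def)
 have "inf_energy W ph wm h <= ennreal (c*C*h^(2*n))" if h: "0 < h" "h < h0" for h
 proof -
  have h': "h < h1" "h < cka / (4 * k)" "h <= 1" using h h1 by (auto simp: h0_def)
  have hn: "h^n <= h" using power_decreasing[of 1 n h] h(1) h'(3) n by simp
  let ?Du = "%x::real^3. exp (ph 0)*\<^sub>R (mat 1 :: real^3^3)"
  have "sobolev12 (Omega wm h) (%x. exp (ph 0)*\<^sub>R x) ?Du"
   by (rule sobolev12_dilation[OF Omega_open_bounded(1,2)[OF wm]])
  then have "inf_energy W ph wm h <= energy W ph wm h ?Du"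
   unfolding inf_energy_def by (intro INF_lower2[of "(%x. exp (ph 0)*\<^sub>R x, ?Du)"]) auto
  also have "... <= ennreal (1/h)*(ennreal (c*h^(2*n))*ennreal (C*h))"
   unfolding energy_def
  proof (intro mult_left_mono)
   have pt: "W (?Du x ** inv_sqrt (metricG ph x)) <= ennreal (c*h^(2*n))" if x: "x \<in> Omega wm h" for x
   proof -
    define t where "t = x $ 3/h"
    have t: "\<bar>t\<bar> <= 1/2" "h*t = x $ 3" using x h(1) by (auto simp: Omega_def t_def field_simps)
    define s where "s = exp (ph 0 - ph (x $ 3)) - 1"
    have "\<bar>t^n\<bar> <= 1" unfolding power_abs using t by (intro power_le_one) auto
    then have "\<bar>a*h^n*t^n\<bar> <= \<bar>a\<bar> * h^n*1" unfolding abs_mult using h(1) by (intro mult_mono) auto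
    moreover have "k*h^n = \<bar>a\<bar> * h^n*1 + 1*h^n" by (simp add: k_def algebra_simps)
    ultimately have s: "\<bar>s\<bar> <= k*h^n" using ex[rule_format, OF h(1) h'(1) t(1)] unfolding t(2) s_def by linarith
    define F where "F = s*\<^sub>R (mat 1 :: real^3^3)"
    have "norm F = \<bar>s\<bar> * norm (mat 1 :: real^3^3)" by (simp add: F_def)
    also have "... <= (k*h^n)*2" using s k h(1) by (intro mult_mono norm_SO3(2) mat1_SO3) auto
    finally have nF: "norm F <= 2 * k*h^n" by simp
    have "2 * k*h^n <= 2 * k*h" using hn k by (intro mult_left_mono) auto
    also have "... < cka"
    proof -
     have "4 * k*h < cka" using h'(2) k by (simp add: field_simps)
     moreover have "0 < k*h" using k h(1) by simp
     ultimately show ?thesis by linarith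
    qed
    finally have Fcka: "norm F < cka" using nF by linarith
    note T1 = T[rule_format, OF Fcka]
    have "Wr (mat 1 + F) <= (K/2 + 1)*(norm F)^2"
    proof -
     have "Wr (mat 1 + F) - B F F/2 <= 1*(norm F)^2" by (rule order_trans[OF abs_ge_self conjunct2[OF T1]])
     moreover have "B F F <= K*(norm F)^2" by (rule order_trans[OF abs_ge_self KB[rule_format]])
     moreover have "(K/2 + 1)*(norm F)^2 = (K*(norm F)^2)/2 + 1*(norm F)^2" by (simp add: ring_distribs)
     ultimately show ?thesis by linarith
    qed
    also have "... <= (K/2 + 1)*(2 * k*h^n)^2" using nF K by (intro mult_left_mono power_mono) auto
    also have "... = c*h^(2*n)" by (simp add: c_def power_mult_distrib power_mult[symmetric] mult.commute)
    finally have Wle: "Wr (mat 1 + F) <= c*h^(2*n)" .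
    have "?Du x ** inv_sqrt (metricG ph x) = (exp (ph 0)*exp (- ph (x $ 3)))*\<^sub>R mat 1"
     unfolding inv_sqrt_metricG scaleR_mat_mult ..
    also have "exp (ph 0)*exp (- ph (x $ 3)) = 1 + s" by (simp add: s_def mult_exp_exp)
    also have "(1 + s)*\<^sub>R mat 1 = mat 1 + F" by (simp add: F_def algebra_simps)
    finally show ?thesis using W_Wr[of "mat 1 + F"] T1 Wle by (simp add: ennreal_leI)
   qed
   have "(\<integral>\<^sup>+x\<in>Omega wm h. W (?Du x ** inv_sqrt (metricG ph x)) \<partial>lebesgue) <= (\<integral>\<^sup>+x\<in>Omega wm h. ennreal (c*h^(2*n)) \<partial>lebesgue)"
    by (rule nn_integral_mono) (auto simp: indicator_def intro: pt)
   also have "... = ennreal (c*h^(2*n))*emeasure lebesgue (Omega wm h)"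
    by (rule nn_integral_cmult_indicator) (use Omega_open_bounded(1)[OF wm] in auto)
   also have "... <= ennreal (c*h^(2*n))*ennreal (C*h)" using CO h(1) by (intro mult_left_mono) auto
   finally show "(\<integral>\<^sup>+x\<in>Omega wm h. W (?Du x ** inv_sqrt (metricG ph x)) \<partial>lebesgue) <= ennreal (c*h^(2*n))*ennreal (C*h)" .
  qed simp
  also have "... = ennreal (1/h*(c*h^(2*n)*(C*h)))"
  proof -
   have "ennreal p*(ennreal q*ennreal r) = ennreal (p*(q*r))" if "0 <= p" "0 <= q" "0 <= r" for p q r
    using that by (simp add: ennreal_mult)
   from this[of "1/h" "c*h^(2*n)" "C*h"] show ?thesis using h(1) c C by simp
  qed
  also have "1/h*(c*h^(2*n)*(C*h)) = c*C*h^(2*n)" using h(1) by simp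
  finally show ?thesis .
 qed
 moreover have "c*C > 0" using c C by simp
 ultimately show ?thesis using h0 by blast
qed

end

section \<open>The lower bound\<close>

lemma nn_integral_lborel_affine:
 fixes f :: "real^3 => ennreal"
 assumes f[measurable]: "f \<in> borel_measurable borel" and h: "h > 0"
 shows "(nnI (%x. f x)) = ennreal (h^3)*(nnI (%y. f (p + h*\<^sub>R y)))"
proof -
 let ?M = "distr lborel borel (%x::real^3. p + h*\<^sub>R x)"
 have "(nnI (%x. f x)) = (\<integral>\<^sup>+x. f x \<partial>density ?M (%_. ennreal (\<bar>h\<bar> ^ DIM(real^3))))"
  by (rule arg_cong[where f="%M. \<integral>\<^sup>+x. f x \<partial>M"], rule lborel_affine) (use h in simp)
 also have "... = (\<integral>\<^sup>+x. ennreal (\<bar>h\<bar> ^ DIM(real^3))*f x \<partial>?M)" by (rule nn_integral_density) measurable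
 also have "... = (nnI (%y. ennreal (\<bar>h\<bar> ^ DIM(real^3))*f (p + h*\<^sub>R y)))" by (rule nn_integral_distr) measurable
 also have "... = ennreal (\<bar>h\<bar> ^ DIM(real^3))*(nnI (%y. f (p + h*\<^sub>R y)))" by (rule nn_integral_cmult) measurable
 finally show ?thesis using h by simp
qed

lemma gradM_rescale:
 assumes "gradM v V" "h \<noteq> 0"
 shows "gradM (%x. (c/h)*\<^sub>R v (p + h*\<^sub>R x)) (%x. c*\<^sub>R V (p + h*\<^sub>R x))"
 unfolding gradM_def
proof
 fix i
 have "grad1 (%x. c/h * v (p + h*\<^sub>R x) $ i) (%x. (c/h)*\<^sub>R (h*\<^sub>R V (p + h*\<^sub>R x) $ i))"
  by (rule grad1_cmult[OF grad1_affine[OF gradM_nth[OF assms(1)]]])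
 then show "grad1 (%x. ((c/h)*\<^sub>R v (p + h*\<^sub>R x)) $ i) (%x. (c*\<^sub>R V (p + h*\<^sub>R x)) $ i)"
  by (rule grad1_cong) (use assms(2) in auto)
qed

lemma matrix_mult_scaled_id: "A ** (c*\<^sub>R mat 1) = c*\<^sub>R (A :: real^3^3)"
 unfolding matrix_eq by (simp add: matrix_vector_mul_assoc[symmetric] scaleR_matrix_vector_assoc[symmetric] matrix_vector_mult_scaleR)

section \<open>Counting lattice squares inside the planar domain\<close>

lemma prod_UNIV_2: "(\<Prod>i\<in>UNIV. f (i::2)) = f 1*(f 2 :: real)"
proof -
 have "(\<Prod>i\<in>{1,2::2}. f i) = f 1*f 2" by simp
 then show ?thesis unfolding UNIV_2 .
qed

lemma emeasure_square:
 fixes s :: "real^2"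
 assumes "r > 0"
 shows "{q::real^2. \<bar>q $ 1 - s $ 1\<bar> <= r \<and> \<bar>q $ 2 - s $ 2\<bar> <= r} \<in> sets borel"
  "emeasure lborel {q::real^2. \<bar>q $ 1 - s $ 1\<bar> <= r \<and> \<bar>q $ 2 - s $ 2\<bar> <= r} = ennreal ((2*r)^2)"
proof -
 let ?a = "s - vec r" and ?b = "s + vec r"
 have e: "{q::real^2. \<bar>q $ 1 - s $ 1\<bar> <= r \<and> \<bar>q $ 2 - s $ 2\<bar> <= r} = cbox ?a ?b"
  by (auto simp: mem_box_cart forall_2 abs_le_iff)
 show "{q::real^2. \<bar>q $ 1 - s $ 1\<bar> <= r \<and> \<bar>q $ 2 - s $ 2\<bar> <= r} \<in> sets borel" unfolding e by simp
 have "s \<in> cbox ?a ?b" using assms by (simp add: mem_box_cart)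
 then have ne: "cbox ?a ?b \<noteq> {}" by blast
 have "emeasure lborel (cbox ?a ?b) = ennreal (measure lborel (cbox ?a ?b))"
  by (rule emeasure_eq_ennreal_measure) (use emeasure_lborel_cbox_finite in \<open>simp add: less_top\<close>)
 also have "measure lborel (cbox ?a ?b) = (2*r)^2"
  using content_cbox_cart[OF ne] unfolding prod_UNIV_2 by (simp add: power2_eq_square)
 finally show "emeasure lborel {q::real^2. \<bar>q $ 1 - s $ 1\<bar> <= r \<and> \<bar>q $ 2 - s $ 2\<bar> <= r} = ennreal ((2*r)^2)" unfolding e .
qed

text \<open>The squares that meet \<open>K\<close> cover it, which gives the count, and for
  \<open>4*L*h < d\<close> they are too small to reach the complement of \<open>wm\<close>.\<close>

lemma grid_cells:
 fixes wm K :: "(real^2) set"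
 assumes wm: "open wm" and K: "compact K" "K \<subseteq> wm" and L: "L > 0"
 shows "\<exists>h1>0. \<forall>h. 0 < h \<and> h < h1 --> (\<exists>I :: (int \<times> int) set. finite I \<and> measure lborel K <= real (card I)*(2*L*h)^2 \<and>
  (\<forall>z\<in>I. \<forall>q. \<bar>q $ 1 - 2*L*h * of_int (fst z)\<bar> <= L*h \<and> \<bar>q $ 2 - 2*L*h * of_int (snd z)\<bar> <= L*h --> q \<in> wm))"
proof -
 obtain d where d: "d > 0" "(\<Union>x\<in>K. ball x d) \<subseteq> wm"
  using compact_subset_open_imp_ball_epsilon_subset[OF K(1) wm K(2)] by blast
 obtain r where r: "\<forall>q\<in>K. norm q <= r" using compact_imp_bounded[OF K(1)] unfolding bounded_iff by (elim exE) (rule that)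
 have "\<exists>I :: (int \<times> int) set. finite I \<and> measure lborel K <= real (card I)*(2*L*h)^2 \<and>
  (\<forall>z\<in>I. \<forall>q. \<bar>q $ 1 - 2*L*h * of_int (fst z)\<bar> <= L*h \<and> \<bar>q $ 2 - 2*L*h * of_int (snd z)\<bar> <= L*h --> q \<in> wm)"
  if h: "0 < h" "h < d/(4*L)" for h
 proof -
  define S where "S z = {q::real^2. \<bar>q $ 1 - 2*L*h * of_int (fst z)\<bar> <= L*h \<and> \<bar>q $ 2 - 2*L*h * of_int (snd z)\<bar> <= L*h}" for z :: "int \<times> int"
  define I where "I = {z. S z \<inter> K \<noteq> {}}"
  have Lh: "L*h > 0" using L h(1) by simp
  have sub: "q \<in> wm" if z: "z \<in> I" and q: "q \<in> S z" for z q
  proof -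
   obtain k where k: "k \<in> S z" "k \<in> K" using z by (auto simp: I_def)
   have "\<bar>(k - q) $ 1\<bar> <= 2*(L*h)" "\<bar>(k - q) $ 2\<bar> <= 2*(L*h)" using k(1) q by (auto simp: S_def)
   moreover have "norm (k - q) <= \<bar>(k - q) $ 1\<bar> + \<bar>(k - q) $ 2\<bar>" using norm_le_l1_cart[of "k - q"] by (simp add: sum_2)
   moreover have "4*(L*h) < d" using h(2) L by (simp add: field_simps)
   ultimately have "dist k q < d" unfolding dist_norm by linarith
   then have "q \<in> ball k d" by simp
   then show ?thesis using d(2) k(2) by blast
  qed
  have fin: "finite I"
  proof -
   define m where "m = \<lceil>(\<bar>r\<bar> + L*h)/(2*L*h)\<rceil>"
   have bd: "i \<in> {-m..m}" if "\<bar>k - 2*L*h * of_int i\<bar> <= L*h" "\<bar>k\<bar> <= \<bar>r\<bar>" for k and i :: int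
   proof -
    have "2*L*h*\<bar>of_int i\<bar> = \<bar>2*L*h * of_int i\<bar>" using L h(1) by (simp add: abs_mult)
    also have "... <= \<bar>r\<bar> + L*h" using that by linarith
    finally have "\<bar>of_int i\<bar> <= (\<bar>r\<bar> + L*h)/(2*L*h)" using L h(1) by (simp add: pos_le_divide_eq mult.commute)
    then have "\<bar>real_of_int i\<bar> <= of_int m" unfolding m_def using le_of_int_ceiling order_trans by blast
    then show ?thesis by (simp add: abs_le_iff)
   qed
   have "I \<subseteq> {-m..m} \<times> {-m..m}"
   proof
    fix z assume "z \<in> I"
    then obtain k where k: "k \<in> S z" "k \<in> K" by (auto simp: I_def)
    have kc: "\<bar>k $ i\<bar> <= \<bar>r\<bar>" for i using component_le_norm_cart[of k i] r[rule_format, OF k(2)] by linarith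
    have "fst z \<in> {-m..m}" by (rule bd[OF _ kc[of 1]]) (use k(1) in \<open>simp add: S_def\<close>)
    moreover have "snd z \<in> {-m..m}" by (rule bd[OF _ kc[of 2]]) (use k(1) in \<open>simp add: S_def\<close>)
    ultimately show "z \<in> {-m..m} \<times> {-m..m}" by (simp add: mem_Times_iff)
   qed
   then show ?thesis by (rule finite_subset) simp
  qed
  have cover: "K \<subseteq> (\<Union>z\<in>I. S z)"
  proof
   fix k assume k: "k \<in> K"
   define z where "z = (round (k $ 1/(2*L*h)), round (k $ 2/(2*L*h)))"
   have rd: "\<bar>x - 2*L*h * of_int (round (x/(2*L*h)))\<bar> <= L*h" for x
   proof -
    have "x - 2*L*h * of_int (round (x/(2*L*h))) = - (2*L*h)*(of_int (round (x/(2*L*h))) - x/(2*L*h))"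
     using L h(1) by (simp add: right_diff_distrib)
    then have "\<bar>x - 2*L*h * of_int (round (x/(2*L*h)))\<bar> = (2*L*h)*\<bar>of_int (round (x/(2*L*h))) - x/(2*L*h)\<bar>"
     using L h(1) by (simp add: abs_mult)
    also have "... <= (2*L*h)*(1/2)" using L h(1) by (intro mult_left_mono of_int_round_abs_le) auto
    finally show ?thesis by simp
   qed
   have "k \<in> S z" using rd by (simp add: S_def z_def)
   moreover from this k have "z \<in> I" by (auto simp: I_def)
   ultimately show "k \<in> (\<Union>z\<in>I. S z)" by blast
  qed
  have SS: "S z \<in> sets borel" "emeasure lborel (S z) = ennreal ((2*(L*h))^2)" for z
  proof -
   let ?s = "vector [2*L*h * of_int (fst z), 2*L*h * of_int (snd z)] :: real^2"
   have v: "?s $ 1 = 2*L*h * of_int (fst z)" "?s $ 2 = 2*L*h * of_int (snd z)" by simp_all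
   show "S z \<in> sets borel" "emeasure lborel (S z) = ennreal ((2*(L*h))^2)"
    using emeasure_square[OF Lh, of ?s] unfolding S_def v by blast+
  qed
  have "ennreal (measure lborel K) = emeasure lborel K"
   by (rule emeasure_eq_ennreal_measure[symmetric]) (use emeasure_compact_finite[OF K(1)] in \<open>simp add: less_top\<close>)
  also have "... <= emeasure lborel (\<Union>z\<in>I. S z)" using SS(1) fin by (intro emeasure_mono cover) auto
  also have "... <= (\<Sum>z\<in>I. emeasure lborel (S z))" using SS(1) by (intro emeasure_subadditive_finite fin) auto
  also have "... = ennreal (real (card I)*(2*(L*h))^2)"
   unfolding SS(2) by (simp add: ennreal_mult ennreal_of_nat_eq_real_of_nat)
  finally have "measure lborel K <= real (card I)*(2*(L*h))^2" by (subst (asm) ennreal_le_iff) auto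
  then have "measure lborel K <= real (card I)*(2*L*h)^2" by (simp add: mult.assoc)
  moreover have "\<forall>z\<in>I. \<forall>q. \<bar>q $ 1 - 2*L*h * of_int (fst z)\<bar> <= L*h \<and> \<bar>q $ 2 - 2*L*h * of_int (snd z)\<bar> <= L*h --> q \<in> wm"
   using sub unfolding S_def by blast
  ultimately show ?thesis using fin by blast
 qed
 moreover have "d/(4*L) > 0" using d(1) L by simp
 ultimately show ?thesis by blast
qed

text \<open>Cells have to lie inside the domain, so part of its area is given up; one half is a
  fixed fraction that enters only the numerical constant.\<close>

lemma compact_half_measure:
 fixes wm :: "(real^2) set"
 assumes "open wm" "bounded wm" "wm \<noteq> {}"
 shows "measure lborel wm > 0" "\<exists>K. compact K \<and> K \<subseteq> wm \<and> measure lborel wm / 2 <= measure lborel K"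
proof -
 have fin: "emeasure lborel wm < \<infinity>" by (rule emeasure_bounded_finite[OF assms(2)])
 have "emeasure lborel wm \<noteq> 0"
 proof
  assume "emeasure lborel wm = 0"
  then have "negligible wm" using assms(1) by (simp add: negligible_iff_emeasure0)
  then show False using open_not_negligible[OF assms(1,3)] by simp
 qed
 then show pos: "measure lborel wm > 0" using fin unfolding measure_def by (simp add: enn2real_positive_iff zero_less_iff_neq_zero)
 have mwm: "wm \<in> sets lebesgue" using assms(1) by auto
 have p2: "measure lborel wm / 2 > 0" using pos by simp
 obtain T where T: "closed T" "T \<subseteq> wm" "wm - T \<in> lmeasurable" "emeasure lebesgue (wm - T) < ennreal (measure lborel wm / 2)"
  by (rule sets_lebesgue_inner_closed[OF mwm p2])
 have cT: "compact T" unfolding compact_eq_bounded_closed using bounded_subset[OF assms(2) T(2)] T(1) by simp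
 have [measurable]: "T \<in> sets borel" "wm \<in> sets borel" using T(1) assms(1) by auto
 have "ennreal (measure lborel wm) = emeasure lborel wm" by (rule emeasure_eq_ennreal_measure[symmetric]) (use fin in auto)
 also have "... <= emeasure lborel T + emeasure lborel (wm - T)"
 proof -
  have "wm = T \<union> (wm - T)" using T(2) by blast
  then have "emeasure lborel wm = emeasure lborel (T \<union> (wm - T))" by simp
  also have "... <= emeasure lborel T + emeasure lborel (wm - T)" by (rule emeasure_subadditive) auto
  finally show ?thesis .
 qed
 also have "... <= ennreal (measure lborel T) + ennreal (measure lborel wm / 2)"
 proof (rule add_mono)
  show "emeasure lborel T <= ennreal (measure lborel T)"
   using emeasure_compact_finite[OF cT] by (subst emeasure_eq_ennreal_measure) auto
  show "emeasure lborel (wm - T) <= ennreal (measure lborel wm / 2)" using less_imp_le[OF T(4)] by simp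
 qed
 also have "... = ennreal (measure lborel T + measure lborel wm / 2)" by simp
 finally have "measure lborel wm <= measure lborel T + measure lborel wm / 2" by (subst (asm) ennreal_le_iff) auto
 then have "measure lborel wm / 2 <= measure lborel T" by simp
 then show "\<exists>K. compact K \<and> K \<subseteq> wm \<and> measure lborel wm / 2 <= measure lborel K" using cT T(2) by blast
qed

lemma rescaled_approximation:
 fixes D :: "real^3 => real^3^3"
 assumes D[measurable]: "D \<in> borel_measurable borel" and V: "gradM v V" and h: "h > 0" and c: "c > 0"
  and Q: "compact Q"
  and ap: "(nnI (%x. ennreal ((norm (V x - D x))^2)*indicator ((%y. p + h*\<^sub>R y) ` Q) x)) <= ennreal (h^3*e/c^2)" and e: "e \<ge> 0"
 shows "(nnI (%y. ennreal ((norm (c*\<^sub>R V (p + h*\<^sub>R y) - c*\<^sub>R D (p + h*\<^sub>R y)))^2)*indicator Q y)) <= ennreal e"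
proof -
 let ?T = "%y::real^3. p + h*\<^sub>R y"
 have inj: "inj ?T" using h by (auto simp: inj_def)
 have ind: "indicator (?T ` Q) (?T y) = (indicator Q y :: ennreal)" for y
  using inj_image_mem_iff[OF inj] by (simp add: indicator_def)
 have cT: "compact (?T ` Q)" by (intro compact_continuous_image Q continuous_intros)
 have [measurable]: "?T ` Q \<in> sets borel" "Q \<in> sets borel" using cT Q by (auto intro: borel_compact)
 have [measurable]: "V \<in> borel_measurable borel" by (rule borel_measurable_continuous_onI[OF gradM_cont(1)[OF V]])
 define X where "X = (nnI (%y. ennreal ((norm (V (?T y) - D (?T y)))^2)*indicator Q y))"
 have "(nnI (%x. ennreal ((norm (V x - D x))^2)*indicator (?T ` Q) x)) = ennreal (h^3)*X"
  unfolding X_def using nn_integral_lborel_affine[of "%x. ennreal ((norm (V x - D x))^2)*indicator (?T ` Q) x" h p] h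
  by (simp add: ind)
 with ap have hX: "ennreal (h^3)*X <= ennreal (h^3*e/c^2)" by simp
 have "(nnI (%y. ennreal ((norm (c*\<^sub>R V (?T y) - c*\<^sub>R D (?T y)))^2)*indicator Q y))
  = (nnI (%y. ennreal (c^2)*(ennreal ((norm (V (?T y) - D (?T y)))^2)*indicator Q y)))"
 proof (rule nn_integral_cong)
  fix y
  have "norm (c*\<^sub>R V (?T y) - c*\<^sub>R D (?T y)) = c*norm (V (?T y) - D (?T y))"
   using c by (simp add: scaleR_diff_right[symmetric])
  then show "ennreal ((norm (c*\<^sub>R V (?T y) - c*\<^sub>R D (?T y)))^2)*indicator Q y
   = ennreal (c^2)*(ennreal ((norm (V (?T y) - D (?T y)))^2)*indicator Q y)"
   by (simp add: power_mult_distrib ennreal_mult mult.assoc)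
 qed
 also have "... = ennreal (c^2)*X" unfolding X_def by (rule nn_integral_cmult) measurable
 also have "... = ennreal (c^2/h^3)*(ennreal (h^3)*X)"
 proof -
  have "ennreal (c^2/h^3)*ennreal (h^3) = ennreal (c^2/h^3*h^3)" using h by (subst ennreal_mult) auto
  also have "c^2/h^3*h^3 = c^2" using h by simp
  finally show ?thesis by (simp add: mult.assoc[symmetric])
 qed
 also have "... <= ennreal (c^2/h^3)*ennreal (h^3*e/c^2)" by (intro mult_left_mono hX) simp
 also have "... = ennreal (c^2/h^3*(h^3*e/c^2))" using h c e by (subst ennreal_mult) auto
 also have "c^2/h^3*(h^3*e/c^2) = e" using h c by simp
 finally show ?thesis .
qed


context admissible
begin

text \<open>With \<open>eps = h^n\<close> each cell contributes \<open>h^3\<close> times the cell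
  bound, which is proportional to \<open>l^2\<close>; the number of cells is of the order of the
  area divided by \<open>(l*h)^2\<close>, and the energy carries \<open>1/h\<close>. So
  \<open>l\<close> cancels and \<open>h^(2*n)\<close> remains. The constant is
  \<open>768 = 24 * 32\<close>.\<close>

lemma lower_bound:
 assumes wm: "open wm" "bounded wm" "wm \<noteq> {}" and ph: "smooth_on {-1/2<..<1/2} ph" and n: "n > 2"
  and z: "\<forall>k\<in>{1..n-1}. (deriv ^^ k) ph 0 = 0" and a: "a = (deriv ^^ n) ph 0/fact n" "a \<noteq> 0"
 shows "\<exists>h0>0. h0 <= 1 \<and> (\<forall>h. 0 < h \<and> h < h0 -->
  ennreal ((jn n)^2/(768 * kb^2)*a^2*measure lborel wm * Q2 W (mat 1)*h^(2*n)) <= inf_energy W ph wm h)"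
proof -
 have n2: "n \<ge> 2" using n by simp
 define Q where "Q = Q2 W (mat 1)"
 have Qpos: "Q > 0" using stress_exists by (simp add: Q_def)
 obtain l rh eps0 where l: "l \<ge> 1" and rh: "rh > 0" and eps0: "eps0 > 0" and cell: "\<forall>eps f D v V. 0 < eps --> eps <= eps0 --> f \<in> borel_measurable borel --> D \<in> borel_measurable borel --> gradM v V -->
  (\<forall>t. \<bar>t\<bar> <= 1/2 --> \<bar>f t - 1 + a*eps * t^n\<bar> <= rh * eps) -->
  (nnI (%y. ennreal ((norm (V y - D y))^2)*indicator (Qb (cl l) (1/8)) y)) <= ennreal (eps ^ 4) -->
  ennreal ((jn n)^2/(24 * kb^2)*a^2*Q*l^2*eps^2)
   <= (nnI (%y. W (f (y $ 3)*\<^sub>R D y)*indicator (Qb (cl l) (1/8)) y))"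
  using cell_bound[OF n2 a(2)] unfolding Q_def[symmetric] by (elim exE conjE) (rule that)
 let ?Q = "Qb (cl l) (1/8)"
 \<comment> \<open>Slightly more than the half-width \<open>l + 1/8\<close> of the closed cells, so
   that cells at different lattice points are disjoint; \<open>L <= 2*l\<close> bounds the area
   wasted between them.\<close>
 define L where "L = l + 1/4"
 have L: "L > 0" "l + 1/8 < L" "L <= 2*l" using l by (simp_all add: L_def)
 obtain h1 where h1: "h1 > 0" "h1 <= 1" and ex: "\<forall>h t. 0 < h --> h < h1 --> \<bar>t\<bar> <= 1/2 --> \<bar>exp (ph 0 - ph (h*t)) - 1 + a*h^n*t^n\<bar> <= rh * h^n"
  using conformal_factor_expansion[OF ph n z rh a(1)] by (elim exE conjE) (rule that)
 obtain K where K: "compact K" "K \<subseteq> wm" "measure lborel wm / 2 <= measure lborel K"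
  using compact_half_measure(2)[OF wm] by (elim exE conjE) (rule that)
 obtain h2 where h2: "h2 > 0" and grid: "\<forall>h. 0 < h \<and> h < h2 --> (\<exists>I :: (int \<times> int) set. finite I \<and> measure lborel K <= real (card I)*(2*L*h)^2 \<and>
  (\<forall>z\<in>I. \<forall>q. \<bar>q $ 1 - 2*L*h * of_int (fst z)\<bar> <= L*h \<and> \<bar>q $ 2 - 2*L*h * of_int (snd z)\<bar> <= L*h --> q \<in> wm))"
  using grid_cells[OF wm(1) K(1,2) L(1)] by (elim exE conjE) (rule that)
 define h0 where "h0 = min h1 (min h2 eps0)"
 have h0: "h0 > 0" "h0 <= 1" using h1 h2 eps0 by (auto simp: h0_def)
 define T where "T = (jn n)^2/(24 * kb^2)*a^2*Q*l^2"
 have T: "T \<ge> 0" using Qpos by (simp add: T_def)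
 have "ennreal (T*(measure lborel wm / (32*l^2))*h^(2*n)) <= energy W ph wm h Du"
  if h: "0 < h" "h < h0" and S: "sobolev12 (Omega wm h) u Du" for h u Du
 proof -
  have h': "h < h1" "h < h2" "h <= eps0" "h <= 1" using h h1 by (auto simp: h0_def)
  define eps where "eps = h^n"
  have eps: "0 < eps" "eps <= eps0" using h(1) h' n power_decreasing[of 1 n h] by (auto simp: eps_def)
  obtain I :: "(int \<times> int) set" where I: "finite I" "measure lborel K <= real (card I)*(2*L*h)^2"
   and Iwm: "\<forall>z\<in>I. \<forall>q. \<bar>q $ 1 - 2*L*h * of_int (fst z)\<bar> <= L*h \<and> \<bar>q $ 2 - 2*L*h * of_int (snd z)\<bar> <= L*h --> q \<in> wm"
   using grid[rule_format, OF conjI[OF h(1) h'(2)]] by (elim exE conjE) (rule that)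
  obtain D where D[measurable]: "D \<in> borel_measurable borel" and AED: "AE x in lborel. x \<in> Omega wm h --> D x = Du x"
   and app: "\<forall>K e. compact K \<and> K \<subseteq> Omega wm h \<and> e > 0 --> (\<exists>v V. gradM v V \<and>
   (nnI (%x. ennreal ((norm (V x - D x))^2)*indicator K x)) <= ennreal e)"
   using Sobolev_smooth_approx[OF Omega_open_bounded(1,2)[OF wm(1,2)] S] by (elim bexE conjE) (rule that)
  \<comment> \<open>Beyond the thickness \<open>ph\<close> may be arbitrary; the value 1 there only
    serves to make \<open>f\<close> Borel measurable.\<close>
  define f where "f t = (if t \<in> {-1/2..1/2} then exp (ph 0 - ph (h*t)) else 1)" for t
  have f[measurable]: "f \<in> borel_measurable borel"
   unfolding f_def
  proof (rule borel_measurable_continuous_on_if)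
   have cph: "continuous_on {-1/2<..<1/2} ph" using ph[unfolded smooth_on_def, rule_format, of 0] by simp
   have img: "(%t. h*t) ` {-1/2..1/2} \<subseteq> {-1/2<..<1/2}"
   proof
    fix s assume "s \<in> (%t. h*t) ` {-1/2..1/2}"
    then obtain t where t1: "s = h*t" "t \<in> {-1/2..1/2}" by blast
    have "\<bar>t\<bar> <= 1/2" using t1(2) unfolding abs_le_iff by simp
    note t = t1(1) this
    have "\<bar>s\<bar> <= h*(1/2)" unfolding t(1) abs_mult using h(1) t(2) by (intro mult_mono) auto
    moreover have "h < 1" using h'(1) h1(2) by simp
    ultimately have "\<bar>s\<bar> < 1/2" by linarith
    then show "s \<in> {-1/2<..<1/2}" unfolding greaterThanLessThan_iff abs_less_iff by linarith
   qed
   have "continuous_on {-1/2..1/2} (%t. ph (h*t))"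
    by (rule continuous_on_compose2[OF cph _ img]) (intro continuous_intros)
   then show "continuous_on {-1/2..1/2} (%t. exp (ph 0 - ph (h*t)))" by (intro continuous_intros)
  qed auto
  have f_in: "f t = exp (ph 0 - ph (h*t))" if t: "\<bar>t\<bar> <= 1/2" for t
  proof -
   have "t \<in> {-1/2..1/2}" using t unfolding abs_le_iff atLeastAtMost_iff by linarith
   then show ?thesis unfolding f_def by (rule if_P)
  qed
  have fb: "\<bar>f t - 1 + a*eps * t^n\<bar> <= rh * eps" if t: "\<bar>t\<bar> <= 1/2" for t
   unfolding f_in[OF t] eps_def by (rule ex[rule_format, OF h(1) h'(1) t])
  \<comment> \<open>Scaling the gradient by this factor normalizes the metric on the midplane to the
    identity.\<close>
  define c where "c = exp (- ph 0)"
  have c: "c > 0" by (simp add: c_def)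
  define p :: "int \<times> int => real^3" where "p z = vector [2*L*h * of_int (fst z), 2*L*h * of_int (snd z), 0]" for z
  have pz: "p z $ 1 = 2*L*h * of_int (fst z)" "p z $ 2 = 2*L*h * of_int (snd z)" "p z $ 3 = 0" for z
   by (simp_all add: p_def)
  define C where "C z = (%y. p z + h*\<^sub>R y) ` ?Q" for z
  have cQ: "compact ?Q" unfolding Qb_def by (rule compact_cbox)
  have cC: "compact (C z)" for z unfolding C_def by (intro compact_continuous_image cQ continuous_intros)
  have [measurable]: "C z \<in> sets borel" for z using cC by (rule borel_compact)
  have memC: "\<bar>x $ 1 - 2*L*h * of_int (fst z)\<bar> <= (l + 1/8)*h" "\<bar>x $ 2 - 2*L*h * of_int (snd z)\<bar> <= (l + 1/8)*h"
   "\<bar>x $ 3\<bar> <= 3/8*h" if x: "x \<in> C z" for x z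
  proof -
   obtain y where y: "x = p z + h*\<^sub>R y" "y \<in> ?Q" using x unfolding C_def by blast
   have yb: "\<bar>y $ 1\<bar> <= l + 1/8" "\<bar>y $ 2\<bar> <= l + 1/8" "\<bar>y $ 3\<bar> <= 3/8"
    using y(2) unfolding mem_Qb forall_3 cl_nth by auto
   have e: "x $ 1 - 2*L*h * of_int (fst z) = y $ 1*h" "x $ 2 - 2*L*h * of_int (snd z) = y $ 2*h" "x $ 3 = y $ 3*h"
    unfolding y(1) by (simp_all add: pz)
   show "\<bar>x $ 1 - 2*L*h * of_int (fst z)\<bar> <= (l + 1/8)*h" "\<bar>x $ 2 - 2*L*h * of_int (snd z)\<bar> <= (l + 1/8)*h" "\<bar>x $ 3\<bar> <= 3/8*h"
    unfolding e abs_mult using h(1) yb by (auto intro!: mult_mono)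
  qed
  have Lh: "(l + 1/8)*h < L*h" using L(2) h(1) by (rule mult_strict_right_mono)
  have sub: "x \<in> Omega wm h" if z: "z \<in> I" and x: "x \<in> C z" for z x
  proof -
   note m = memC[OF x]
   have v: "(vector [x $ 1, x $ 2] :: real^2) $ 1 = x $ 1" "(vector [x $ 1, x $ 2] :: real^2) $ 2 = x $ 2" by simp_all
   have "vector [x $ 1, x $ 2] \<in> wm"
   proof (rule Iwm[rule_format, OF z])
    show "\<bar>(vector [x $ 1, x $ 2] :: real^2) $ 1 - 2*L*h * of_int (fst z)\<bar> <= L*h \<and> \<bar>(vector [x $ 1, x $ 2] :: real^2) $ 2 - 2*L*h * of_int (snd z)\<bar> <= L*h"
     unfolding v using order_trans[OF m(1) less_imp_le[OF Lh]] order_trans[OF m(2) less_imp_le[OF Lh]] by (rule conjI)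
   qed
   moreover have "\<bar>x $ 3\<bar> < h/2" using m(3) h(1) by simp
   ultimately show ?thesis by (simp add: Omega_def)
  qed
  have gap: "i = j" if "\<bar>s - 2*L*h * of_int i\<bar> <= (l + 1/8)*h" "\<bar>s - 2*L*h * of_int j\<bar> <= (l + 1/8)*h" for s and i j :: int
  proof (rule ccontr)
   assume "i \<noteq> j"
   then have "1 <= \<bar>i - j\<bar>" by simp
   then have "1 <= \<bar>real_of_int (i - j)\<bar>" by linarith
   then have "(2*L*h)*1 <= (2*L*h)*\<bar>real_of_int (i - j)\<bar>" using L(1) h(1) by (intro mult_left_mono) auto
   also have "... = \<bar>2*L*h * of_int i - 2*L*h * of_int j\<bar>"
    using L(1) h(1) by (simp add: right_diff_distrib[symmetric] abs_mult)
   finally show False using that Lh by (simp add: mult.assoc)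
  qed
  have disj: "disjoint_family_on C I"
   unfolding disjoint_family_on_def
  proof (intro ballI impI)
   fix z z' assume zz: "z \<in> I" "z' \<in> I" "z \<noteq> z'"
   have False if "x \<in> C z" "x \<in> C z'" for x
   proof -
    have "fst z = fst z'" by (rule gap[OF memC(1)[OF that(1)] memC(1)[OF that(2)]])
    moreover have "snd z = snd z'" by (rule gap[OF memC(2)[OF that(1)] memC(2)[OF that(2)]])
    ultimately show False using zz(3) by (simp add: prod_eq_iff)
   qed
   then show "C z \<inter> C z' = {}" by blast
  qed
  define H where "H x = W (f (x $ 3/h)*\<^sub>R (c*\<^sub>R D x))" for x
  have [measurable]: "(%y::real^3. y $ 3/h) \<in> borel_measurable borel"
   unfolding divide_inverse by (intro borel_measurable_continuous_onI continuous_intros)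
  have [measurable]: "(%y::real^3. f (y $ 3/h)) \<in> borel_measurable borel" by (rule measurable_compose[OF _ f]) measurable
  have H[measurable]: "H \<in> borel_measurable borel" unfolding H_def by measurable
  have one: "ennreal (h^3)*ennreal (T*eps^2) <= (nnI (%x. H x*indicator (C z) x))" if z: "z \<in> I" for z
  proof -
   \<comment> \<open>The accuracy that becomes \<open>eps ^ 4\<close> after passing to cell
     coordinates and multiplying the gradient by \<open>c\<close>.\<close>
   have e0: "h^3*eps ^ 4/c^2 > 0" using h(1) eps(1) c by simp
   have CO: "C z \<subseteq> Omega wm h" using sub[OF z] by blast
   obtain v V where V: "gradM v V" and ap: "(nnI (%x. ennreal ((norm (V x - D x))^2)*indicator (C z) x)) <= ennreal (h^3*eps ^ 4/c^2)"
    using app[rule_format, OF conjI[OF cC conjI[OF CO e0]]] by (elim exE conjE) (rule that)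
   let ?D = "%y. c*\<^sub>R D (p z + h*\<^sub>R y)" and ?V = "%y. c*\<^sub>R V (p z + h*\<^sub>R y)"
   have D': "?D \<in> borel_measurable borel" by measurable
   have hne: "h \<noteq> 0" using h(1) by simp
   have V': "gradM (%x. (c/h)*\<^sub>R v (p z + h*\<^sub>R x)) ?V" by (rule gradM_rescale[OF V hne])
   have e4: "eps ^ 4 \<ge> 0" using eps(1) by simp
   have ap': "(nnI (%y. ennreal ((norm (?V y - ?D y))^2)*indicator ?Q y)) <= ennreal (eps ^ 4)"
    by (rule rescaled_approximation[OF D V h(1) c cQ ap[unfolded C_def] e4])
   have "ennreal (T*eps^2) <= (nnI (%y. W (f (y $ 3)*\<^sub>R ?D y)*indicator ?Q y))"
    unfolding T_def by (rule cell[rule_format, OF eps f D' V' _ ap']) (rule fb)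
   also have "... = (nnI (%y. H (p z + h*\<^sub>R y)*indicator (C z) (p z + h*\<^sub>R y)))"
   proof (rule nn_integral_cong)
    fix y :: "real^3"
    have "inj (%y::real^3. p z + h*\<^sub>R y)" using h(1) by (auto simp: inj_def)
    from inj_image_mem_iff[OF this, of y ?Q] have "indicator (C z) (p z + h*\<^sub>R y) = (indicator ?Q y :: ennreal)"
     unfolding C_def by (simp add: indicator_def)
    moreover have "(p z + h*\<^sub>R y) $ 3/h = y $ 3" using h(1) by (simp add: pz)
    ultimately show "W (f (y $ 3)*\<^sub>R ?D y)*indicator ?Q y = H (p z + h*\<^sub>R y)*indicator (C z) (p z + h*\<^sub>R y)"
     unfolding H_def by simp
   qed
   finally have "ennreal (h^3)*ennreal (T*eps^2) <= ennreal (h^3)*(nnI (%y. H (p z + h*\<^sub>R y)*indicator (C z) (p z + h*\<^sub>R y)))"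
    by (intro mult_left_mono) auto
   also have "... = (nnI (%x. H x*indicator (C z) x))"
    by (rule nn_integral_lborel_affine[symmetric, OF _ h(1)]) measurable
   finally show ?thesis .
  qed
  have "ennreal (real (card I)*(h^3*(T*eps^2))) = (\<Sum>z\<in>I. ennreal (h^3)*ennreal (T*eps^2))"
   using h(1) T by (simp add: ennreal_mult ennreal_of_nat_eq_real_of_nat)
  also have "... <= (\<Sum>z\<in>I. \<integral>\<^sup>+x. H x*indicator (C z) x \<partial>lborel)" by (rule sum_mono) (rule one)
  also have "... = (nnI (%x. (\<Sum>z\<in>I. H x*indicator (C z) x)))" by (rule nn_integral_sum[symmetric]) measurable
  also have "... = (nnI (%x. H x*indicator (\<Union>z\<in>I. C z) x))"
   by (simp add: indicator_UN_disjoint[OF I(1) disj] sum_distrib_left)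
  also have "... <= (\<integral>\<^sup>+x\<in>Omega wm h. W (Du x ** inv_sqrt (metricG ph x)) \<partial>lborel)"
  proof (rule nn_integral_mono_AE, rule AE_mp[OF AED], rule AE_I2, rule impI)
   fix x assume x: "x \<in> Omega wm h --> D x = Du x"
   show "H x*indicator (\<Union>z\<in>I. C z) x <= W (Du x ** inv_sqrt (metricG ph x))*indicator (Omega wm h) x"
   proof (cases "x \<in> (\<Union>z\<in>I. C z)")
    case True
    then obtain z where z: "z \<in> I" "x \<in> C z" by blast
    have xO: "x \<in> Omega wm h" by (rule sub[OF z])
    have DD: "D x = Du x" using x xO by blast
    have "\<bar>x $ 3/h\<bar> <= 1/2" using memC(3)[OF z(2)] h(1) by (simp add: field_simps)
    from f_in[OF this] have "f (x $ 3/h) = exp (ph 0 - ph (x $ 3))" using h(1) by simp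
    then have "f (x $ 3/h)*c = exp (- ph (x $ 3))" by (simp add: c_def mult_exp_exp)
    then have "H x = W (Du x ** inv_sqrt (metricG ph x))"
     unfolding H_def inv_sqrt_metricG matrix_mult_scaled_id DD by simp
    then show ?thesis using True xO by simp
   qed simp
  qed
  also have "... = (\<integral>\<^sup>+x\<in>Omega wm h. W (Du x ** inv_sqrt (metricG ph x)) \<partial>lebesgue)"
   by (rule nn_integral_completion[symmetric])
  finally have low: "ennreal (real (card I)*(h^3*(T*eps^2))) <= (\<integral>\<^sup>+x\<in>Omega wm h. W (Du x ** inv_sqrt (metricG ph x)) \<partial>lebesgue)" .
  \<comment> \<open>\<open>32 = 2 * 16\<close>: half of the area is covered by \<open>K\<close>, and
    \<open>(2*L*h)^2\<close> is at most \<open>16*(l*h)^2\<close>.\<close>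
  have count: "measure lborel wm / (32*l^2) <= real (card I)*h^2"
  proof -
   have "(2*L*h)^2 <= (4*l*h)^2" using L h(1) by (intro power_mono mult_right_mono) auto
   then have "real (card I)*(2*L*h)^2 <= real (card I)*(4*l*h)^2" by (intro mult_left_mono) auto
   then have "measure lborel wm / 2 <= real (card I)*(4*l*h)^2" using I(2) K(3) by linarith
   then have "measure lborel wm <= (32*l^2)*(real (card I)*h^2)" by (simp add: power_mult_distrib mult_ac)
   then show ?thesis using l by (simp add: pos_divide_le_eq mult.commute)
  qed
  have "T*(measure lborel wm / (32*l^2))*h^(2*n) <= T*(real (card I)*h^2)*h^(2*n)"
   using h(1) T by (intro mult_right_mono mult_left_mono count) auto
  also have "... = 1/h*(real (card I)*(h^3*(T*eps^2)))"
  proof -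
   have "h^(2*n) = eps^2" by (simp add: eps_def power_mult[symmetric] mult.commute)
   then show ?thesis using h(1) by (simp add: power2_eq_square power3_eq_cube)
  qed
  finally have "ennreal (T*(measure lborel wm / (32*l^2))*h^(2*n)) <= ennreal (1/h*(real (card I)*(h^3*(T*eps^2))))"
   by (rule ennreal_leI)
  also have "... = ennreal (1/h)*ennreal (real (card I)*(h^3*(T*eps^2)))" by (rule ennreal_mult) (use h(1) T in auto)
  also have "... <= energy W ph wm h Du" unfolding energy_def by (intro mult_left_mono low) simp
  finally show ?thesis .
 qed
 note en = this
 have Teq: "T*(measure lborel wm / (32*l^2))*x = (jn n)^2/(768 * kb^2)*a^2*measure lborel wm * Q2 W (mat 1)*x" for x
  using l by (simp add: T_def Q_def)
 have "ennreal ((jn n)^2/(768 * kb^2)*a^2*measure lborel wm * Q2 W (mat 1)*h^(2*n)) <= inf_energy W ph wm h"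
  if h: "0 < h" "h < h0" for h
  unfolding inf_energy_def Teq[symmetric]
 proof (rule INF_greatest, clarify)
  fix u Du assume "sobolev12 (Omega wm h) u Du"
  then show "ennreal (T*(measure lborel wm / (32*l^2))*h^(2*n)) <= energy W ph wm h Du" by (rule en[OF h])
 qed
 then show ?thesis using h0 by blast
qed

end

text \<open>The square of \<open>fact n\<close> converts the Taylor coefficient into the derivative
  of order \<open>n\<close>. The value 1 for small \<open>n\<close> is a filler, since the constants
  are required to be positive for every index.\<close>

definition rigidity_const :: "nat => real" where
 "rigidity_const n = (if n > 2 then (jn n)\<^sup>2/(768 * kb^2)/(fact n)^2 else 1)"

lemma rigidity_const_pos: "rigidity_const n > 0"
proof (cases "n > 2")
 case True
 then have "jn n > 0" by (simp add: jn_def)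
 moreover have "kb > 0" by (simp add: kb_def)
 ultimately show ?thesis using True by (simp add: rigidity_const_def)
qed (simp add: rigidity_const_def)

theorem theorem9p1:
  shows "\<exists>cn :: nat \<Rightarrow> real. (\<forall>n. cn n > 0) \<and>
    (\<forall>(\<omega> :: (real^2) set) (W :: real^3^3 \<Rightarrow> ennreal) (\<phi> :: real \<Rightarrow> real) (n :: nat).
       lipschitz_domain \<omega> \<and> admissible_density W \<and> smooth_on {-1/2<..<1/2} \<phi> \<and>
       n > 2 \<and> (\<forall>k\<in>{1..n-1}. (deriv ^^ k) \<phi> 0 = 0) \<longrightarrow>
       (\<exists>C>0. \<exists>h0>0. h0 \<le> 1 \<and>
          (\<forall>h. 0 < h \<and> h < h0 \<longrightarrow> inf_energy W \<phi> \<omega> h \<le> ennreal (C * h ^ (2 * n)))) \<and>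
       Liminf (at_right 0) (\<lambda>h. inf_energy W \<phi> \<omega> h / ennreal (h ^ (2 * n)))
         \<ge> ennreal (cn n * ((deriv ^^ n) \<phi> 0)\<^sup>2 * measure lborel \<omega> * Q2 W (mat 1)) \<and>
       ((deriv ^^ n) \<phi> 0 \<noteq> 0 \<longrightarrow>
          (\<exists>c>0. \<exists>C>0. \<exists>h0>0. h0 \<le> 1 \<and> (\<forall>h. 0 < h \<and> h < h0 \<longrightarrow>
             ennreal (c * h ^ (2 * n)) \<le> inf_energy W \<phi> \<omega> h \<and>
             inf_energy W \<phi> \<omega> h \<le> ennreal (C * h ^ (2 * n))))))"
proof (intro exI[of _ rigidity_const] conjI allI impI)
  show "rigidity_const n > 0" for n by (rule rigidity_const_pos)
  fix \<omega> :: "(real^2) set" and W :: "real^3^3 \<Rightarrow> ennreal" and \<phi> :: "real \<Rightarrow> real" and n :: nat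
  assume as: "lipschitz_domain \<omega> \<and> admissible_density W \<and> smooth_on {-1/2<..<1/2} \<phi> \<and>
       n > 2 \<and> (\<forall>k\<in>{1..n-1}. (deriv ^^ k) \<phi> 0 = 0)"
  then interpret admissible W by (intro admissible.intro) blast
  have \<omega>: "open \<omega>" "bounded \<omega>" "\<omega> \<noteq> {}" using as unfolding lipschitz_domain_def by blast+
  have \<phi>: "smooth_on {-1/2<..<1/2} \<phi>" and n: "n > 2" and z: "\<forall>k\<in>{1..n-1}. (deriv ^^ k) \<phi> 0 = 0" using as by blast+
  show upper: "\<exists>C>0. \<exists>h0>0. h0 \<le> 1 \<and> (\<forall>h. 0 < h \<and> h < h0 \<longrightarrow> inf_energy W \<phi> \<omega> h \<le> ennreal (C * h ^ (2 * n)))"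
    by (rule upper_bound[OF \<omega>(1,2) \<phi> n z])
  let ?d = "(deriv ^^ n) \<phi> 0"
  define c where "c = rigidity_const n * ?d\<^sup>2 * measure lborel \<omega> * Q2 W (mat 1)"
  have lower: "\<exists>h0>0. h0 \<le> 1 \<and> (\<forall>h. 0 < h \<and> h < h0 \<longrightarrow> ennreal (c * h ^ (2 * n)) \<le> inf_energy W \<phi> \<omega> h)" if d: "?d \<noteq> 0"
  proof -
    have "c = (jn n)\<^sup>2 / (768 * kb\<^sup>2) * (?d / fact n)\<^sup>2 * measure lborel \<omega> * Q2 W (mat 1)"
      using n by (simp add: c_def rigidity_const_def power_divide)
    then show ?thesis using lower_bound[OF \<omega> \<phi> n z refl] d by simp
  qed
  have "ennreal c \<le> Liminf (at_right 0) (\<lambda>h. inf_energy W \<phi> \<omega> h / ennreal (h ^ (2 * n)))"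
  \<comment> \<open>The cell bound divides the cases: it needs a nonzero coefficient, and for a
    vanishing derivative of order \<open>n\<close> the claimed bound is zero.\<close>
  proof (cases "?d = 0")
    case True
    then show ?thesis by (simp add: c_def)
  next
    case False
    obtain h0 where h0: "h0 > 0" "\<forall>h. 0 < h \<and> h < h0 \<longrightarrow> ennreal (c * h ^ (2 * n)) \<le> inf_energy W \<phi> \<omega> h"
      using lower[OF False] by (elim exE conjE) (rule that)
    show ?thesis
    proof (rule Liminf_bounded)
      have c0: "c \<ge> 0" using rigidity_const_pos[of n] stress_exists by (simp add: c_def)
      have "ennreal c \<le> inf_energy W \<phi> \<omega> h / ennreal (h ^ (2 * n))" if h: "0 < h" "h < h0" for h
      proof -
        have "ennreal c = ennreal (c * h ^ (2 * n)) / ennreal (h ^ (2 * n))"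
          using h(1) c0 by (subst divide_ennreal) auto
        also have "\<dots> \<le> inf_energy W \<phi> \<omega> h / ennreal (h ^ (2 * n))"
          using h0(2) h by (intro divide_right_mono_ennreal) blast
        finally show ?thesis .
      qed
      then show "\<forall>\<^sub>F h in at_right 0. ennreal c \<le> inf_energy W \<phi> \<omega> h / ennreal (h ^ (2 * n))"
        unfolding eventually_at_right_field using h0(1) by blast
    qed
  qed
  then show "ennreal (rigidity_const n * ?d\<^sup>2 * measure lborel \<omega> * Q2 W (mat 1))
      \<le> Liminf (at_right 0) (\<lambda>h. inf_energy W \<phi> \<omega> h / ennreal (h ^ (2 * n)))" unfolding c_def .
  show "\<exists>c>0. \<exists>C>0. \<exists>h0>0. h0 \<le> 1 \<and> (\<forall>h. 0 < h \<and> h < h0 \<longrightarrow>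
             ennreal (c * h ^ (2 * n)) \<le> inf_energy W \<phi> \<omega> h \<and>
             inf_energy W \<phi> \<omega> h \<le> ennreal (C * h ^ (2 * n)))" if d: "?d \<noteq> 0"
  proof -
    \<comment> \<open>Positivity of \<open>Q2\<close> comes from coercivity, that of the area from
      the domain being open and nonempty.\<close>
    have cpos: "c > 0" using rigidity_const_pos[of n] stress_exists compact_half_measure(1)[OF \<omega>] d by (simp add: c_def)
    obtain h1 where h1: "h1 > 0" "h1 \<le> 1" "\<forall>h. 0 < h \<and> h < h1 \<longrightarrow> ennreal (c * h ^ (2 * n)) \<le> inf_energy W \<phi> \<omega> h"
      using lower[OF d] by (elim exE conjE) (rule that)
    obtain C h2 where h2: "C > 0" "h2 > 0" "h2 \<le> 1" "\<forall>h. 0 < h \<and> h < h2 \<longrightarrow> inf_energy W \<phi> \<omega> h \<le> ennreal (C * h ^ (2 * n))"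
      using upper by (elim exE conjE) (rule that)
    show ?thesis
    proof (rule exI[of _ c], rule conjI[OF cpos], rule exI[of _ C], rule conjI[OF h2(1)], rule exI[of _ "min h1 h2"], intro conjI allI impI)
      show "0 < min h1 h2" "min h1 h2 \<le> 1" using h1 h2 by auto
      fix h assume h: "0 < h \<and> h < min h1 h2"
      show "ennreal (c * h ^ (2 * n)) \<le> inf_energy W \<phi> \<omega> h" using h1(3) h by simp
      show "inf_energy W \<phi> \<omega> h \<le> ennreal (C * h ^ (2 * n))" using h2(4) h by simp
    qed
  qed
qed

end
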